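(* Let $X$ and $A$ be finite sets and let $\Gamma:M_{XX}\to M_{AA}$ be a QNS correlation. (i) If $\Gamma$ is tracial then $\Gamma(\Upsilon(X))\subseteq\Upsilon(A)$; (ii) if $\Gamma$ is quantum tracial then $\Gamma(\Upsilon_{\mathrm q}(X))\subseteq\Upsilon_{\mathrm q}(A)$; (iii) if $\Gamma$ is locally tracial then $\Gamma(\Upsilon_{\mathrm{loc}}(X))\subseteq\Upsilon_{\mathrm{loc}}(A)$.
   Context: Notation: $M_X=\mathcal L(\mathbb C^X)$, $M_{XX}=M_X\otimes M_X$, $(e_x)$ is the canonical basis, $\xi\eta^*$ is the rank one operator $\zeta\mapsto\langle\zeta,\eta\rangle\xi$. A QNS correlation is a completely positive trace preserving map $\Gamma:M_{XX}\to M_{AA}$ with $\mathrm{Tr}_1\Gamma(\rho_1\otimes\rho_2)=0$ whenever $\mathrm{Tr}\rho_1=0$ and $\mathrm{Tr}_2\Gamma(\rho_1\otimes\rho_2)=0$ whenever $\mathrm{Tr}\rho_2=0$ ($\mathrm{Tr}_i$ is the partial trace over the $i$-th tensor factor of $M_A\otimes M_A$). Throughout, "trace" on a unital C*-algebra means tracial state and *-homomorphisms are unital. C*-reciprocal states: for a finite set $Z$, a unital C*-algebra $\mathcal A$, a trace $\tau$ on $\mathcal A$, and a positive element $E=(g_{z,z'})_{z,z'}\in M_Z\otimes\mathcal A$ with $\sum_zg_{z,z}=1$ (a stochastic $\mathcal A$-matrix), let $\omega^{E,\tau}=\sum_{z,z',u,u'}\tau(g_{z,z'}g_{u',u})\,e_ze_{z'}^*\otimes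 e_ue_{u'}^*\in M_{ZZ}$. This is a state (density matrix). $\Upsilon(Z)$ is the set of all states of the form $\omega^{E,\tau}$ (C*-reciprocal states); $\Upsilon_{\mathrm q}(Z)$ (quantum reciprocal) and $\Upsilon_{\mathrm{loc}}(Z)$ (locally reciprocal) are the sets of those for which $\mathcal A$ can be chosen finite dimensional, respectively abelian. Definition of $\mathcal C_{X,A}$. Let $\mathcal V^0_{X,A}$ be the ternary ring (complex vector space with a ternary product $[\cdot,\cdot,\cdot]$, linear in the outer variables, conjugate linear in the middle one, with $[s,t,[u,v,w]]=[s,[v,u,t],w]=[[s,t,u],v,w]$) generated by elements $v_{a,x}$, $x\in X$, $a\in A$, subject to $\sum_{a\in A}[v_{a'',x''},v_{a,x},v_{a,x'}]=\delta_{x,x'}v_{a'',x''}$ for all $x,x',x''\in X$, $a''\in A$. A representation of these relations is a family $V=(V_{a,x})_{a,x}\subseteq\mathcal B(H_V,K_V)$ with $\sum_aV_{a,x}^*V_{a,x'}=\delta_{x,x'}I_{H_V}$; it induces a ternary representation $\theta_V$ of $\mathcal V^0_{X,A}$ (i.e. $\theta_V([u,v,w])=\theta_V(u)\theta_V(v)^*\theta_V(w)$) with $\theta_V(v_{a,x})=V_{a,x}$. Let $\mathcal V_{X,A}$ be the completion of the quotient of $\mathcal V^0_{X,A}$ by the null space of the seminorm $\|u\|=\sup_V\|\theta_V(u)\|$ over all representations $V$; it is a ternary ring of operators (TRO), faithfully represented by the direct sum of the $\theta_V$ over equivalence classes of representations. $\mathcal C_{X,A}$ is its right C*-algebra: when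 $\mathcal V_{X,A}$ is faithfully represented as a concrete TRO, $\mathcal C_{X,A}=\overline{\mathrm{span}}\{S^*T:S,T\in\mathcal V_{X,A}\}$; it is a unital C*-algebra. Put $e_{x,x',a,a'}=v_{a,x}^*v_{a',x'}\in\mathcal C_{X,A}$. For a trace $\tau$ on $\mathcal C_{X,A}$ let $\Gamma_\tau:M_{XX}\to M_{AA}$ be the QNS correlation $$\Gamma_\tau(e_xe_{x'}^*\otimes e_ye_{y'}^* )=\sum_{a,a',b,b'\in A}\tau(e_{x,x',a,a'}e_{y',y,b',b})\,e_ae_{a'}^*\otimes e_be_{b'}^*.$$ A QNS correlation $\Gamma$ is: tracial if $\Gamma=\Gamma_\tau$ for a trace $\tau$ on $\mathcal C_{X,A}$; quantum tracial if $\Gamma=\Gamma_{\tau_{\mathcal A}\circ\pi}$ for a finite dimensional C*-algebra $\mathcal A$, a trace $\tau_{\mathcal A}$ on $\mathcal A$ and a *-homomorphism $\pi:\mathcal C_{X,A}\to\mathcal A$; locally tracial if $\Gamma=\Gamma_{\tau_{\mathcal A}\circ\pi}$ for an abelian C*-algebra $\mathcal A$, a state $\tau_{\mathcal A}$ on $\mathcal A$ and a *-homomorphism $\pi:\mathcal C_{X,A}\to\mathcal A$. *)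

theory Defs
  imports "HOL-Analysis.Analysis" "HOL-Algebra.Algebraic_Closure_Type"
begin

section \<open>C*-algebras, states, traces\<close>

abbreviation complex_ring :: "complex ring"
  where "complex_ring \<equiv> ring_of_type_algebra"

record 'a star_algebra = "(complex, 'a) module" +
  invol :: "'a \<Rightarrow> 'a"

record 'a normed_star_algebra = "'a star_algebra" +
  cnorm :: "'a \<Rightarrow> real"

definition norm_complete :: "('a, 'm) ring_scheme \<Rightarrow> ('a \<Rightarrow> real) \<Rightarrow> bool" where
  "norm_complete M N \<longleftrightarrow>
     (\<forall>\<sigma> :: nat \<Rightarrow> 'a. range \<sigma> \<subseteq> carrier M \<longrightarrow>
        (\<forall>\<epsilon>>0. \<exists>n0. \<forall>m\<ge>n0. \<forall>n\<ge>n0. N (\<sigma> m \<ominus>\<^bsub>M\<^esub> \<sigma> n) < \<epsilon>) \<longrightarrow>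
        (\<exists>a\<in>carrier M. (\<lambda>n. N (\<sigma> n \<ominus>\<^bsub>M\<^esub> a)) \<longlonglongrightarrow> 0))"

locale cstar_algebra = module complex_ring A + ring A
  for A :: "('a, 'm) normed_star_algebra_scheme" (structure) +
  assumes smult_mult_left:
      "\<lbrakk>a \<in> carrier A; b \<in> carrier A\<rbrakk> \<Longrightarrow> (c \<odot> a) \<otimes> b = c \<odot> (a \<otimes> b)"
    and smult_mult_right:
      "\<lbrakk>a \<in> carrier A; b \<in> carrier A\<rbrakk> \<Longrightarrow> a \<otimes> (c \<odot> b) = c \<odot> (a \<otimes> b)"
    and invol_closed: "a \<in> carrier A \<Longrightarrow> invol A a \<in> carrier A"
    and invol_invol: "a \<in> carrier A \<Longrightarrow> invol A (invol A a) = a"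
    and invol_add:
      "\<lbrakk>a \<in> carrier A; b \<in> carrier A\<rbrakk> \<Longrightarrow> invol A (a \<oplus> b) = invol A a \<oplus> invol A b"
    and invol_smult: "a \<in> carrier A \<Longrightarrow> invol A (c \<odot> a) = cnj c \<odot> invol A a"
    and invol_mult:
      "\<lbrakk>a \<in> carrier A; b \<in> carrier A\<rbrakk> \<Longrightarrow> invol A (a \<otimes> b) = invol A b \<otimes> invol A a"
    and cnorm_nonneg: "a \<in> carrier A \<Longrightarrow> 0 \<le> cnorm A a"
    and cnorm_eq_zero: "a \<in> carrier A \<Longrightarrow> cnorm A a = 0 \<longleftrightarrow> a = \<zero>"
    and cnorm_smult: "a \<in> carrier A \<Longrightarrow> cnorm A (c \<odot> a) = cmod c * cnorm A a"
    and cnorm_triangle: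
      "\<lbrakk>a \<in> carrier A; b \<in> carrier A\<rbrakk> \<Longrightarrow> cnorm A (a \<oplus> b) \<le> cnorm A a + cnorm A b"
    and cnorm_submult:
      "\<lbrakk>a \<in> carrier A; b \<in> carrier A\<rbrakk> \<Longrightarrow> cnorm A (a \<otimes> b) \<le> cnorm A a * cnorm A b"
    and cstar_identity: "a \<in> carrier A \<Longrightarrow> cnorm A (invol A a \<otimes> a) = (cnorm A a)\<^sup>2"
    and cnorm_complete: "norm_complete A (cnorm A)"

definition lin_span :: "(complex, 'a, 'm) module_scheme \<Rightarrow> 'a set \<Rightarrow> 'a set" where
  "lin_span M S = {\<Oplus>\<^bsub>M\<^esub>i\<in>{..<n}. c i \<odot>\<^bsub>M\<^esub> s i | (n::nat) c s. \<forall>i<n. s i \<in> S}"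

definition norm_closure :: "('a, 'm) normed_star_algebra_scheme \<Rightarrow> 'a set \<Rightarrow> 'a set" where
  "norm_closure A S = {a \<in> carrier A. \<forall>\<epsilon>>0. \<exists>s\<in>S. cnorm A (a \<ominus>\<^bsub>A\<^esub> s) < \<epsilon>}"

definition abelian_alg :: "('a, 'm) ring_scheme \<Rightarrow> bool" where
  "abelian_alg A \<longleftrightarrow> (\<forall>a\<in>carrier A. \<forall>b\<in>carrier A. a \<otimes>\<^bsub>A\<^esub> b = b \<otimes>\<^bsub>A\<^esub> a)"

definition finite_dim_alg :: "(complex, 'a, 'm) module_scheme \<Rightarrow> bool" where
  "finite_dim_alg A \<longleftrightarrow> (\<exists>B. finite B \<and> B \<subseteq> carrier A \<and> carrier A = lin_span A B)"

definition star_hom ::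
  "('a, 'm) star_algebra_scheme \<Rightarrow> ('b, 'n) star_algebra_scheme \<Rightarrow> ('a \<Rightarrow> 'b) \<Rightarrow> bool" where
  "star_hom A B f \<longleftrightarrow>
     f \<in> ring_hom A B \<and>
     (\<forall>c. \<forall>a\<in>carrier A. f (c \<odot>\<^bsub>A\<^esub> a) = c \<odot>\<^bsub>B\<^esub> f a) \<and>
     (\<forall>a\<in>carrier A. f (invol A a) = invol B (f a))"

definition positive_elem :: "('a, 'm) star_algebra_scheme \<Rightarrow> 'a \<Rightarrow> bool" where
  "positive_elem A a \<longleftrightarrow> a \<in> carrier A \<and> (\<exists>b\<in>carrier A. a = invol A b \<otimes>\<^bsub>A\<^esub> b)"

definition alg_state :: "('a, 'm) star_algebra_scheme \<Rightarrow> ('a \<Rightarrow> complex) \<Rightarrow> bool" where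
  "alg_state A \<phi> \<longleftrightarrow>
     (\<forall>a\<in>carrier A. \<forall>b\<in>carrier A. \<phi> (a \<oplus>\<^bsub>A\<^esub> b) = \<phi> a + \<phi> b) \<and>
     (\<forall>c. \<forall>a\<in>carrier A. \<phi> (c \<odot>\<^bsub>A\<^esub> a) = c * \<phi> a) \<and>
     (\<forall>a. positive_elem A a \<longrightarrow> \<phi> a \<in> \<real>\<^sub>\<ge>\<^sub>0) \<and>
     \<phi> \<one>\<^bsub>A\<^esub> = 1"

definition tracial_state :: "('a, 'm) star_algebra_scheme \<Rightarrow> ('a \<Rightarrow> complex) \<Rightarrow> bool" where
  "tracial_state A \<phi> \<longleftrightarrow> alg_state A \<phi> \<and>
     (\<forall>a\<in>carrier A. \<forall>b\<in>carrier A. \<phi> (a \<otimes>\<^bsub>A\<^esub> b) = \<phi> (b \<otimes>\<^bsub>A\<^esub> a))"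

section \<open>C*-reciprocal states\<close>

text \<open>The *-algebra of matrices over \<open>A\<close>, i.e. the tensor product of the full matrix algebra
  with \<open>A\<close>.\<close>

definition mat_alg ::
  "('a, 'm) star_algebra_scheme \<Rightarrow> ('z::finite \<Rightarrow> 'z \<Rightarrow> 'a) star_algebra" where
  "mat_alg A = \<lparr>
     carrier = {E. \<forall>z z'. E z z' \<in> carrier A},
     mult = (\<lambda>E F z z'. \<Oplus>\<^bsub>A\<^esub>w\<in>UNIV. E z w \<otimes>\<^bsub>A\<^esub> F w z'),
     one = (\<lambda>z z'. if z = z' then \<one>\<^bsub>A\<^esub> else \<zero>\<^bsub>A\<^esub>),
     zero = (\<lambda>z z'. \<zero>\<^bsub>A\<^esub>),
     add = (\<lambda>E F z z'. E z z' \<oplus>\<^bsub>A\<^esub> F z z'),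
     smult = (\<lambda>c E z z'. c \<odot>\<^bsub>A\<^esub> E z z'),
     invol = (\<lambda>E z z'. invol A (E z' z)) \<rparr>"

definition stochastic_matrix ::
  "('a, 'm) star_algebra_scheme \<Rightarrow> ('z::finite \<Rightarrow> 'z \<Rightarrow> 'a) \<Rightarrow> bool" where
  "stochastic_matrix A E \<longleftrightarrow>
     positive_elem (mat_alg A) E \<and> (\<Oplus>\<^bsub>A\<^esub>z\<in>UNIV. E z z) = \<one>\<^bsub>A\<^esub>"

text \<open>Elements of \<open>M\<^sub>Z \<otimes> M\<^sub>Z\<close> are matrices indexed by \<open>Z \<times> Z\<close>: the coefficient of
  \<open>e\<^sub>z e\<^sub>z\<^sub>'* \<otimes> e\<^sub>u e\<^sub>u\<^sub>'*\<close> is the entry in row \<open>(z, u)\<close> and column \<open>(z', u')\<close>.\<close>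

definition reciprocal_state ::
  "('a, 'm) star_algebra_scheme \<Rightarrow> ('a \<Rightarrow> complex) \<Rightarrow> ('z::finite \<Rightarrow> 'z \<Rightarrow> 'a) \<Rightarrow>
     complex^('z \<times> 'z)^('z \<times> 'z)" where
  "reciprocal_state A \<tau> E =
     (\<chi> p q. \<tau> (E (fst p) (fst q) \<otimes>\<^bsub>A\<^esub> E (snd q) (snd p)))"

text \<open>HOL cannot quantify over types inside a definition, so the sets of reciprocal states carry
  a universe \<open>'u\<close> from which the elements of the C*-algebras are taken.  Restricting to the
  unital C*-subalgebra generated by the entries of \<open>E\<close>, which is separable, shows that every type
  \<open>'u\<close> with at least continuum many elements yields all reciprocal states; over a smaller type
  only the zero algebra exists, which has no state, and the sets are empty.\<close>

definition Upsilon :: "'u itself \<Rightarrow> (complex^('z::finite \<times> 'z)^('z \<times> 'z)) set" where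
  "Upsilon _ = {reciprocal_state A \<tau> E | (A :: 'u normed_star_algebra) \<tau> E.
     cstar_algebra A \<and> tracial_state A \<tau> \<and> stochastic_matrix A E}"

definition Upsilon_q :: "'u itself \<Rightarrow> (complex^('z::finite \<times> 'z)^('z \<times> 'z)) set" where
  "Upsilon_q _ = {reciprocal_state A \<tau> E | (A :: 'u normed_star_algebra) \<tau> E.
     cstar_algebra A \<and> finite_dim_alg A \<and> tracial_state A \<tau> \<and> stochastic_matrix A E}"

definition Upsilon_loc :: "'u itself \<Rightarrow> (complex^('z::finite \<times> 'z)^('z \<times> 'z)) set" where
  "Upsilon_loc _ = {reciprocal_state A \<tau> E | (A :: 'u normed_star_algebra) \<tau> E.
     cstar_algebra A \<and> abelian_alg A \<and> tracial_state A \<tau> \<and> stochastic_matrix A E}"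

section \<open>Quantum no-signalling correlations\<close>

definition mat_scale :: "complex \<Rightarrow> complex^'n^'m \<Rightarrow> complex^'n^'m" where
  "mat_scale c M = (\<chi> i j. c * M $ i $ j)"

definition kron :: "complex^'m^'m \<Rightarrow> complex^'n^'n \<Rightarrow> complex^('m \<times> 'n)^('m \<times> 'n)" where
  "kron R S = (\<chi> p q. R $ fst p $ fst q * S $ snd p $ snd q)"

definition partial_trace1 :: "complex^('m::finite \<times> 'n)^('m \<times> 'n) \<Rightarrow> complex^'n^'n" where
  "partial_trace1 M = (\<chi> b b'. \<Sum>a\<in>UNIV. M $ (a, b) $ (a, b'))"

definition partial_trace2 :: "complex^('m \<times> 'n::finite)^('m \<times> 'n) \<Rightarrow> complex^'m^'m" where
  "partial_trace2 M = (\<chi> a a'. \<Sum>b\<in>UNIV. M $ (a, b) $ (a', b))"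

text \<open>Positive semidefiniteness of the block matrix \<open>(P i j)\<close>, \<open>i, j < k\<close>, as an element of
  \<open>M\<^sub>k(M\<^sub>n)\<close>.\<close>

definition block_psd :: "nat \<Rightarrow> (nat \<Rightarrow> nat \<Rightarrow> complex^'n::finite^'n) \<Rightarrow> bool" where
  "block_psd k P \<longleftrightarrow> (\<forall>v :: nat \<Rightarrow> complex^'n.
     (\<Sum>i<k. \<Sum>j<k. \<Sum>p\<in>UNIV. \<Sum>q\<in>UNIV. cnj (v i $ p) * P i j $ p $ q * v j $ q) \<in> \<real>\<^sub>\<ge>\<^sub>0)"

definition completely_positive ::
  "(complex^'m::finite^'m \<Rightarrow> complex^'n::finite^'n) \<Rightarrow> bool" where
  "completely_positive \<Gamma> \<longleftrightarrow> Vector_Spaces.linear mat_scale mat_scale \<Gamma> \<and>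
     (\<forall>k P. block_psd k P \<longrightarrow> block_psd k (\<lambda>i j. \<Gamma> (P i j)))"

definition QNS ::
  "(complex^('x::finite \<times> 'x)^('x \<times> 'x) \<Rightarrow> complex^('a::finite \<times> 'a)^('a \<times> 'a)) \<Rightarrow> bool" where
  "QNS \<Gamma> \<longleftrightarrow> completely_positive \<Gamma> \<and> (\<forall>M. trace (\<Gamma> M) = trace M) \<and>
     (\<forall>R S. trace R = 0 \<longrightarrow> partial_trace1 (\<Gamma> (kron R S)) = 0) \<and>
     (\<forall>R S. trace S = 0 \<longrightarrow> partial_trace2 (\<Gamma> (kron R S)) = 0)"

section \<open>Hilbert spaces and bounded operators\<close>

text \<open>The multiplicative fields of a \<open>hilbert\<close> record, inherited from \<open>module\<close>, play no role.\<close>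

record 'h hilbert = "(complex, 'h) module" +
  hinner :: "'h \<Rightarrow> 'h \<Rightarrow> complex"

definition hnorm :: "('h, 'm) hilbert_scheme \<Rightarrow> 'h \<Rightarrow> real" where
  "hnorm H \<xi> = sqrt (Re (hinner H \<xi> \<xi>))"

locale hilbert_space = module complex_ring H
  for H :: "('h, 'm) hilbert_scheme" (structure) +
  assumes hinner_add_left:
      "\<lbrakk>\<xi> \<in> carrier H; \<eta> \<in> carrier H; \<zeta> \<in> carrier H\<rbrakk> \<Longrightarrow>
        hinner H (\<xi> \<oplus> \<eta>) \<zeta> = hinner H \<xi> \<zeta> + hinner H \<eta> \<zeta>"
    and hinner_smult_left:
      "\<lbrakk>\<xi> \<in> carrier H; \<eta> \<in> carrier H\<rbrakk> \<Longrightarrow> hinner H (c \<odot> \<xi>) \<eta> = c * hinner H \<xi> \<eta>"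
    and hinner_commute:
      "\<lbrakk>\<xi> \<in> carrier H; \<eta> \<in> carrier H\<rbrakk> \<Longrightarrow> hinner H \<eta> \<xi> = cnj (hinner H \<xi> \<eta>)"
    and hinner_nonneg: "\<xi> \<in> carrier H \<Longrightarrow> hinner H \<xi> \<xi> \<in> \<real>\<^sub>\<ge>\<^sub>0"
    and hinner_eq_zero: "\<xi> \<in> carrier H \<Longrightarrow> hinner H \<xi> \<xi> = 0 \<longleftrightarrow> \<xi> = \<zero>"
    and hnorm_complete: "norm_complete H (hnorm H)"

definition bounded_ops :: "'h hilbert \<Rightarrow> 'k hilbert \<Rightarrow> ('h \<Rightarrow> 'k) set" where
  "bounded_ops H K = {T \<in> carrier H \<rightarrow>\<^sub>E carrier K.
     (\<forall>\<xi>\<in>carrier H. \<forall>\<eta>\<in>carrier H. T (\<xi> \<oplus>\<^bsub>H\<^esub> \<eta>) = T \<xi> \<oplus>\<^bsub>K\<^esub> T \<eta>) \<and>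
     (\<forall>c. \<forall>\<xi>\<in>carrier H. T (c \<odot>\<^bsub>H\<^esub> \<xi>) = c \<odot>\<^bsub>K\<^esub> T \<xi>) \<and>
     (\<exists>B. \<forall>\<xi>\<in>carrier H. hnorm K (T \<xi>) \<le> B * hnorm H \<xi>)}"

definition op_norm :: "'h hilbert \<Rightarrow> 'k hilbert \<Rightarrow> ('h \<Rightarrow> 'k) \<Rightarrow> real" where
  "op_norm H K T = Sup {hnorm K (T \<xi>) | \<xi>. \<xi> \<in> carrier H \<and> hnorm H \<xi> \<le> 1}"

definition adjoint_op :: "'h hilbert \<Rightarrow> 'k hilbert \<Rightarrow> ('h \<Rightarrow> 'k) \<Rightarrow> 'k \<Rightarrow> 'h" where
  "adjoint_op H K T = (THE S. S \<in> bounded_ops K H \<and>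
     (\<forall>\<xi>\<in>carrier H. \<forall>\<eta>\<in>carrier K. hinner K (T \<xi>) \<eta> = hinner H \<xi> (S \<eta>)))"

definition op_zero :: "'h hilbert \<Rightarrow> 'k hilbert \<Rightarrow> 'h \<Rightarrow> 'k" where
  "op_zero H K = (\<lambda>\<xi>\<in>carrier H. \<zero>\<^bsub>K\<^esub>)"

definition op_add :: "'h hilbert \<Rightarrow> 'k hilbert \<Rightarrow> ('h \<Rightarrow> 'k) \<Rightarrow> ('h \<Rightarrow> 'k) \<Rightarrow> 'h \<Rightarrow> 'k" where
  "op_add H K S T = (\<lambda>\<xi>\<in>carrier H. S \<xi> \<oplus>\<^bsub>K\<^esub> T \<xi>)"

definition op_smult :: "'h hilbert \<Rightarrow> 'k hilbert \<Rightarrow> complex \<Rightarrow> ('h \<Rightarrow> 'k) \<Rightarrow> 'h \<Rightarrow> 'k" where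
  "op_smult H K c T = (\<lambda>\<xi>\<in>carrier H. c \<odot>\<^bsub>K\<^esub> T \<xi>)"

definition op_families ::
  "'i set \<Rightarrow> ('i \<Rightarrow> 'h hilbert) \<Rightarrow> ('i \<Rightarrow> 'h hilbert) \<Rightarrow> ('i \<Rightarrow> 'h \<Rightarrow> 'h) normed_star_algebra" where
  \<comment> \<open>The bounded families of operators \<open>f i : H i \<rightarrow> K i\<close>, that is, the block diagonal operators
    between the Hilbert space direct sums.  The fields \<open>mult\<close>, \<open>one\<close>, \<open>invol\<close> are meaningful only
    for \<open>H = K\<close>, in which case this is a unital C*-algebra.\<close>
  "op_families I H K = \<lparr>
     carrier = {f \<in> \<Pi>\<^sub>E i\<in>I. bounded_ops (H i) (K i).
                  bdd_above ((\<lambda>i. op_norm (H i) (K i) (f i)) ` I)},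
     mult = (\<lambda>f g. \<lambda>i\<in>I. compose (carrier (H i)) (f i) (g i)),
     one = (\<lambda>i\<in>I. \<lambda>\<xi>\<in>carrier (H i). \<xi>),
     zero = (\<lambda>i\<in>I. op_zero (H i) (K i)),
     add = (\<lambda>f g. \<lambda>i\<in>I. op_add (H i) (K i) (f i) (g i)),
     smult = (\<lambda>c f. \<lambda>i\<in>I. op_smult (H i) (K i) c (f i)),
     invol = (\<lambda>f. \<lambda>i\<in>I. adjoint_op (H i) (K i) (f i)),
     cnorm = (\<lambda>f. SUP i\<in>I. op_norm (H i) (K i) (f i)) \<rparr>"

section \<open>The ternary ring \<open>\<V>\<^sup>0\<close>\<close>

text \<open>\<open>\<V>\<^sup>0\<close> is presented as the algebra of formal terms modulo the smallest congruence containing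
  the axioms of a complex vector space and of a ternary ring, and the defining relations.\<close>

datatype ('x, 'a) tterm =
    Gen 'a 'x
  | TZero
  | TAdd "('x, 'a) tterm" "('x, 'a) tterm"
  | TScale complex "('x, 'a) tterm"
  | Tern "('x, 'a) tterm" "('x, 'a) tterm" "('x, 'a) tterm"

definition tsum :: "('x, 'a) tterm list \<Rightarrow> ('x, 'a) tterm" where
  "tsum ts = foldr TAdd ts TZero"

inductive teq :: "('x, 'a) tterm \<Rightarrow> ('x, 'a) tterm \<Rightarrow> bool" where
  teq_refl: "teq s s"
| teq_sym: "teq s t \<Longrightarrow> teq t s"
| teq_trans: "teq s t \<Longrightarrow> teq t u \<Longrightarrow> teq s u"
| cong_add: "teq s s' \<Longrightarrow> teq t t' \<Longrightarrow> teq (TAdd s t) (TAdd s' t')"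
| cong_scale: "teq s s' \<Longrightarrow> teq (TScale c s) (TScale c s')"
| cong_tern: "teq s s' \<Longrightarrow> teq t t' \<Longrightarrow> teq u u' \<Longrightarrow> teq (Tern s t u) (Tern s' t' u')"
| add_assoc: "teq (TAdd (TAdd s t) u) (TAdd s (TAdd t u))"
| add_comm: "teq (TAdd s t) (TAdd t s)"
| add_zero: "teq (TAdd s TZero) s"
| add_neg: "teq (TAdd s (TScale (- 1) s)) TZero"
| scale_add: "teq (TScale c (TAdd s t)) (TAdd (TScale c s) (TScale c t))"
| add_scale: "teq (TScale (c + d) s) (TAdd (TScale c s) (TScale d s))"
| scale_scale: "teq (TScale c (TScale d s)) (TScale (c * d) s)"
| scale_one: "teq (TScale 1 s) s"
| tern_add1: "teq (Tern (TAdd s s') t u) (TAdd (Tern s t u) (Tern s' t u))"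
| tern_add2: "teq (Tern s (TAdd t t') u) (TAdd (Tern s t u) (Tern s t' u))"
| tern_add3: "teq (Tern s t (TAdd u u')) (TAdd (Tern s t u) (Tern s t u'))"
| tern_scale1: "teq (Tern (TScale c s) t u) (TScale c (Tern s t u))"
| tern_scale2: "teq (Tern s (TScale c t) u) (TScale (cnj c) (Tern s t u))"
| tern_scale3: "teq (Tern s t (TScale c u)) (TScale c (Tern s t u))"
| tern_assoc1: "teq (Tern s t (Tern u v w)) (Tern s (Tern v u t) w)"
| tern_assoc2: "teq (Tern s t (Tern u v w)) (Tern (Tern s t u) v w)"
| relation: "distinct as \<Longrightarrow> set as = UNIV \<Longrightarrow>
    teq (tsum (map (\<lambda>a. Tern (Gen a'' x'') (Gen a x) (Gen a x')) as))
        (if x = x' then Gen a'' x'' else TZero)"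

quotient_type ('x, 'a) ternary_V0 = "('x, 'a) tterm" / teq
proof (rule equivpI)
  show "reflp (teq :: ('x, 'a) tterm \<Rightarrow> _)" by (rule reflpI) (rule teq_refl)
  show "symp (teq :: ('x, 'a) tterm \<Rightarrow> _)" by (rule sympI) (rule teq_sym)
  show "transp (teq :: ('x, 'a) tterm \<Rightarrow> _)" by (rule transpI) (rule teq_trans)
qed

lift_definition gen_v :: "'a \<Rightarrow> 'x \<Rightarrow> ('x, 'a) ternary_V0" is Gen .

section \<open>The universal TRO and its right C*-algebra\<close>

type_synonym ('h, 'x, 'a) rep = "'h hilbert \<times> 'h hilbert \<times> ('a \<Rightarrow> 'x \<Rightarrow> 'h \<Rightarrow> 'h)"

abbreviation rep_dom :: "('h, 'x, 'a) rep \<Rightarrow> 'h hilbert" where "rep_dom \<equiv> fst"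

abbreviation rep_cod :: "('h, 'x, 'a) rep \<Rightarrow> 'h hilbert" where "rep_cod r \<equiv> fst (snd r)"

text \<open>The representations of the relations on Hilbert spaces with vectors in \<open>'h\<close>.  As for
  \<open>Upsilon\<close>, the choice of the universe \<open>'h\<close> is immaterial: the seminorm on \<open>\<V>\<^sup>0\<close> is
  determined by the representations on separable Hilbert spaces, and these are all available
  (up to unitary equivalence) if \<open>'h\<close> has at least continuum many elements; over smaller types
  there is only the zero Hilbert space, and \<open>C_alg\<close> below is the zero algebra, without states.\<close>

definition reps :: "('h, 'x, 'a::finite) rep set" where
  "reps = {(H, K, V). hilbert_space H \<and> hilbert_space K \<and>
     (\<forall>a x. V a x \<in> bounded_ops H K) \<and>
     (\<forall>x x'. \<forall>\<xi>\<in>carrier H.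
        (\<Oplus>\<^bsub>H\<^esub>a\<in>UNIV. adjoint_op H K (V a x) (V a x' \<xi>)) = (if x = x' then \<xi> else \<zero>\<^bsub>H\<^esub>))}"

primrec theta_term :: "('h, 'x, 'a) rep \<Rightarrow> ('x, 'a) tterm \<Rightarrow> 'h \<Rightarrow> 'h" where
  "theta_term r (Gen a x) = snd (snd r) a x"
| "theta_term r TZero = op_zero (rep_dom r) (rep_cod r)"
| "theta_term r (TAdd s t) = op_add (rep_dom r) (rep_cod r) (theta_term r s) (theta_term r t)"
| "theta_term r (TScale c s) = op_smult (rep_dom r) (rep_cod r) c (theta_term r s)"
| "theta_term r (Tern s t u) =
     compose (carrier (rep_dom r)) (theta_term r s)
       (compose (carrier (rep_dom r))
         (adjoint_op (rep_dom r) (rep_cod r) (theta_term r t)) (theta_term r u))"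

text \<open>For \<open>r \<in> reps\<close> the value of \<open>theta_term r\<close> depends only on the class of the term
  modulo \<open>teq\<close>.\<close>

definition theta :: "('h, 'x, 'a) rep \<Rightarrow> ('x, 'a) ternary_V0 \<Rightarrow> 'h \<Rightarrow> 'h" where
  "theta r u = theta_term r (rep_ternary_V0 u)"

text \<open>The direct sum of all \<open>theta r\<close>.  As \<open>cnorm\<close> of \<open>op_families\<close> is the supremum of the operator
  norms, the pullback of \<open>cnorm\<close> along \<open>theta_sum\<close> is the seminorm on \<open>\<V>\<^sup>0\<close>; hence the range of
  \<open>theta_sum\<close> is the quotient of \<open>\<V>\<^sup>0\<close> by the null space, and its closure is the completion.\<close>

definition theta_sum :: "('x, 'a) ternary_V0 \<Rightarrow> ('h, 'x, 'a::finite) rep \<Rightarrow> 'h \<Rightarrow> 'h" where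
  "theta_sum u = (\<lambda>r\<in>reps. theta r u)"

definition V_tro :: "(('h, 'x, 'a::finite) rep \<Rightarrow> 'h \<Rightarrow> 'h) set" where
  "V_tro = norm_closure (op_families reps rep_dom rep_cod) (range theta_sum)"

definition tro_product :: "(('h, 'x, 'a::finite) rep \<Rightarrow> 'h \<Rightarrow> 'h) \<Rightarrow>
    (('h, 'x, 'a) rep \<Rightarrow> 'h \<Rightarrow> 'h) \<Rightarrow> ('h, 'x, 'a) rep \<Rightarrow> 'h \<Rightarrow> 'h" where
  \<comment> \<open>\<open>S*T\<close>\<close>
  "tro_product S T = (\<lambda>r\<in>reps. compose (carrier (rep_dom r))
     (adjoint_op (rep_dom r) (rep_cod r) (S r)) (T r))"

definition C_alg :: "(('h, 'x, 'a::finite) rep \<Rightarrow> 'h \<Rightarrow> 'h) normed_star_algebra" where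
  "C_alg = (let D = op_families reps rep_dom rep_dom in
     D\<lparr>carrier := norm_closure D (lin_span D {tro_product S T | S T. S \<in> V_tro \<and> T \<in> V_tro})\<rparr>)"

definition e_elem :: "'x \<Rightarrow> 'x \<Rightarrow> 'a::finite \<Rightarrow> 'a \<Rightarrow> ('h, 'x, 'a) rep \<Rightarrow> 'h \<Rightarrow> 'h" where
  "e_elem x x' a a' = tro_product (theta_sum (gen_v a x)) (theta_sum (gen_v a' x'))"

section \<open>Tracial correlations\<close>

text \<open>The linear extension of the defining formula of \<open>\<Gamma>\<^sub>\<tau>\<close> on matrix units: the entry of the input
  in row \<open>(x, y)\<close> and column \<open>(x', y')\<close> is the coefficient of \<open>e\<^sub>x e\<^sub>x\<^sub>'* \<otimes> e\<^sub>y e\<^sub>y\<^sub>'*\<close>, and the row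
  \<open>p\<close> and column \<open>q\<close> of the output stand for \<open>(a, b)\<close> and \<open>(a', b')\<close>.\<close>

definition Gamma_of :: "((('h, 'x::finite, 'a::finite) rep \<Rightarrow> 'h \<Rightarrow> 'h) \<Rightarrow> complex) \<Rightarrow>
    complex^('x \<times> 'x)^('x \<times> 'x) \<Rightarrow> complex^('a \<times> 'a)^('a \<times> 'a)" where
  "Gamma_of \<tau> M = (\<chi> p q. \<Sum>x\<in>UNIV. \<Sum>x'\<in>UNIV. \<Sum>y\<in>UNIV. \<Sum>y'\<in>UNIV.
     M $ (x, y) $ (x', y') *
       \<tau> (e_elem x x' (fst p) (fst q) \<otimes>\<^bsub>C_alg\<^esub> e_elem y' y (snd q) (snd p)))"

definition tracial_corr :: "'h itself \<Rightarrow>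
    (complex^('x::finite \<times> 'x)^('x \<times> 'x) \<Rightarrow> complex^('a::finite \<times> 'a)^('a \<times> 'a)) \<Rightarrow> bool" where
  "tracial_corr _ \<Gamma> \<longleftrightarrow>
     (\<exists>\<tau> :: (('h, 'x, 'a) rep \<Rightarrow> 'h \<Rightarrow> 'h) \<Rightarrow> complex.
        tracial_state C_alg \<tau> \<and> \<Gamma> = Gamma_of \<tau>)"

definition quantum_tracial_corr :: "'h itself \<Rightarrow> 'b itself \<Rightarrow>
    (complex^('x::finite \<times> 'x)^('x \<times> 'x) \<Rightarrow> complex^('a::finite \<times> 'a)^('a \<times> 'a)) \<Rightarrow> bool" where
  "quantum_tracial_corr _ _ \<Gamma> \<longleftrightarrow>
     (\<exists>(B :: 'b normed_star_algebra) \<tau> (\<pi> :: (('h, 'x, 'a) rep \<Rightarrow> 'h \<Rightarrow> 'h) \<Rightarrow> 'b).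
        cstar_algebra B \<and> finite_dim_alg B \<and> tracial_state B \<tau> \<and> star_hom C_alg B \<pi> \<and>
        \<Gamma> = Gamma_of (\<tau> \<circ> \<pi>))"

definition locally_tracial_corr :: "'h itself \<Rightarrow> 'b itself \<Rightarrow>
    (complex^('x::finite \<times> 'x)^('x \<times> 'x) \<Rightarrow> complex^('a::finite \<times> 'a)^('a \<times> 'a)) \<Rightarrow> bool" where
  "locally_tracial_corr _ _ \<Gamma> \<longleftrightarrow>
     (\<exists>(B :: 'b normed_star_algebra) \<tau> (\<pi> :: (('h, 'x, 'a) rep \<Rightarrow> 'h \<Rightarrow> 'h) \<Rightarrow> 'b).
        cstar_algebra B \<and> abelian_alg B \<and> alg_state B \<tau> \<and> star_hom C_alg B \<pi> \<and>
        \<Gamma> = Gamma_of (\<tau> \<circ> \<pi>))"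

end

theory Submission
  imports Defs
begin

text \<open>Let \<open>E = h* h\<close> be a stochastic matrix over \<open>A\<close> with trace \<open>\<tau>\<close>, and let \<open>\<sigma>\<close> be a trace on \<open>C\<close>.  The
  state \<open>\<Gamma>(\<omega>)\<close> is the reciprocal state, over \<open>A \<otimes> C\<close> with the trace \<open>\<tau> \<otimes> \<sigma>\<close>, of the matrix with
  entries \<open>\<Sum> E\<^bsub>x,x'\<^esub> \<otimes> e\<^bsub>x,x',a,a'\<^esub>\<close>, which is stochastic because \<open>(e\<^bsub>x,x',a,a'\<^esub>)\<close> is positive and
  \<open>\<Sum>\<^sub>a e\<^bsub>x,x',a,a\<^esub> = \<delta>\<^bsub>x,x'\<^esub>\<close>.  Only the image of \<open>A \<otimes> C\<close> in the GNS representation of \<open>\<tau> \<otimes> \<sigma>\<close> is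
  needed, so that no C*-tensor norm has to be constructed: the kernel
  \<open>\<tau>(b* a) \<sigma>(d* c)\<close> on pairs is positive semidefinite by the Schur product theorem, and \<open>A\<close> and \<open>C\<close> act
  on its Hilbert space by commuting bounded operators.  Positivity of a matrix is an algebraic
  condition in the definitions; for matrices of the form \<open>\<Sum>\<^sub>n G\<^sub>n* G\<^sub>n\<close> with operators \<open>G\<^sub>n\<close> between
  different Hilbert spaces a square root is obtained from a convergent iteration.  Finally the algebra
  is cut down to the separable subalgebra generated by the matrix and transported to the universe of
  \<open>\<Upsilon>\<close>.\<close>

section \<open>Normed modules over the complex numbers\<close>

text \<open>Two kinds of operators occur: the generators v_(a,x) act between different spaces, while
  the GNS representation of \<tau> \<otimes> \<sigma> acts on a single one. Both are treated as
  bounded families over an index set, namely all representations in one case and one index in the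
  other, so that norms, adjoints and Gram positivity are proved once. The main obstacle is that a
  positive matrix must be b*b with b over the same algebra, whereas the natural factors are
  rectangular or leave the algebra; a root that is a norm limit of polynomials in the matrix itself
  stays inside every closed subalgebra. The value of \<Gamma>(\<omega>) is then found by expanding
  (\<tau> \<otimes> \<sigma>)(F_(a,a') F_(b',b)) into products of traces: the reversed indices of
  the second factor are those in the definitions of both \<omega> and \<Gamma>. That the universe of
  \<Upsilon> has continuum many elements is not assumed; a trace on one algebra over it separates
  the real multiples of the unit.\<close>

lemma complex_ring_simps [simp]:
  "carrier complex_ring = UNIV" "mult complex_ring = (*)" "add complex_ring = (+)"
  "one complex_ring = 1" "zero complex_ring = 0"
  by (simp_all add: ring_of_type_algebra_def fun_eq_iff)

text \<open>The additive inverse of x is (-1) x, because (-1 + 1) x = 0 x = 0. This suits records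
  that describe addition and scaling but not negation.\<close>

lemma cmoduleI:
  fixes M (structure)
  assumes "\<And>x y. \<lbrakk>x \<in> carrier M; y \<in> carrier M\<rbrakk> \<Longrightarrow> x \<oplus> y \<in> carrier M"
    and "\<zero> \<in> carrier M"
    and "\<And>x y z. \<lbrakk>x \<in> carrier M; y \<in> carrier M; z \<in> carrier M\<rbrakk> \<Longrightarrow> (x \<oplus> y) \<oplus> z = x \<oplus> (y \<oplus> z)"
    and "\<And>x y. \<lbrakk>x \<in> carrier M; y \<in> carrier M\<rbrakk> \<Longrightarrow> x \<oplus> y = y \<oplus> x"
    and "\<And>x. x \<in> carrier M \<Longrightarrow> \<zero> \<oplus> x = x"
    and smc: "\<And>c x. x \<in> carrier M \<Longrightarrow> c \<odot> x \<in> carrier M"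
    and ld: "\<And>c d x. x \<in> carrier M \<Longrightarrow> (c + d) \<odot> x = c \<odot> x \<oplus> d \<odot> x"
    and "\<And>c x y. \<lbrakk>x \<in> carrier M; y \<in> carrier M\<rbrakk> \<Longrightarrow> c \<odot> (x \<oplus> y) = c \<odot> x \<oplus> c \<odot> y"
    and "\<And>c d x. x \<in> carrier M \<Longrightarrow> (c * d) \<odot> x = c \<odot> (d \<odot> x)"
    and one: "\<And>x. x \<in> carrier M \<Longrightarrow> 1 \<odot> x = x"
    and zero: "\<And>x. x \<in> carrier M \<Longrightarrow> 0 \<odot> x = \<zero>"
  shows "module complex_ring M"
proof (rule moduleI)
  show "abelian_group M"
  proof (rule abelian_groupI)
    fix x assume x: "x \<in> carrier M"
    have "(- 1) \<odot> x \<oplus> 1 \<odot> x = \<zero>"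
      using ld[OF x, of "- 1" 1] zero[OF x] by simp
    thus "\<exists>y\<in>carrier M. y \<oplus> x = \<zero>" using smc one x by metis
  qed (use assms in auto)
qed (use assms in auto)

text \<open>Restates the module laws with the operations of \<open>complex_ring\<close> replaced by
  those of the type \<open>complex\<close>, so that simplification does not meet the selectors of
  the scalar ring.\<close>

locale cmodule = module complex_ring M for M (structure)
begin

lemma smult_closed' [simp, intro]: "x \<in> carrier M \<Longrightarrow> c \<odot>\<^bsub>M\<^esub> x \<in> carrier M"
  by simp

lemma smult_ldist: "x \<in> carrier M \<Longrightarrow> (c + d) \<odot>\<^bsub>M\<^esub> x = c \<odot>\<^bsub>M\<^esub> x \<oplus>\<^bsub>M\<^esub> d \<odot>\<^bsub>M\<^esub> x"
  using smult_l_distr[of c d x] by simp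

lemma smult_rdist:
  "x \<in> carrier M \<Longrightarrow> y \<in> carrier M \<Longrightarrow> c \<odot>\<^bsub>M\<^esub> (x \<oplus>\<^bsub>M\<^esub> y) = c \<odot>\<^bsub>M\<^esub> x \<oplus>\<^bsub>M\<^esub> c \<odot>\<^bsub>M\<^esub> y"
  using smult_r_distr[of c x y] by simp

lemma smult_smult: "x \<in> carrier M \<Longrightarrow> c \<odot>\<^bsub>M\<^esub> (d \<odot>\<^bsub>M\<^esub> x) = (c * d) \<odot>\<^bsub>M\<^esub> x"
  using smult_assoc1[of c d x] by simp

lemma smult_1 [simp]: "x \<in> carrier M \<Longrightarrow> 1 \<odot>\<^bsub>M\<^esub> x = x"
  using smult_one[of x] by simp

lemma smult_0 [simp]: "x \<in> carrier M \<Longrightarrow> 0 \<odot>\<^bsub>M\<^esub> x = \<zero>\<^bsub>M\<^esub>"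
  using smult_l_null[of x] by simp

lemma smult_neg: "x \<in> carrier M \<Longrightarrow> (- 1) \<odot>\<^bsub>M\<^esub> x = \<ominus>\<^bsub>M\<^esub> x"
proof -
  assume x: "x \<in> carrier M"
  have "(- 1) \<odot>\<^bsub>M\<^esub> x \<oplus>\<^bsub>M\<^esub> x = \<zero>\<^bsub>M\<^esub>"
    using smult_ldist[OF x, of "- 1" 1] x by simp
  thus ?thesis using M.minus_equality[of "(- 1) \<odot>\<^bsub>M\<^esub> x" x] x by simp
qed

lemma minus_conv: "x \<in> carrier M \<Longrightarrow> y \<in> carrier M \<Longrightarrow> x \<ominus>\<^bsub>M\<^esub> y = x \<oplus>\<^bsub>M\<^esub> (- 1) \<odot>\<^bsub>M\<^esub> y"
  by (simp add: smult_neg M.minus_eq)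

section \<open>Linear spans\<close>

lemma lin_span_zero: "\<zero>\<^bsub>M\<^esub> \<in> lin_span M S"
  unfolding lin_span_def by (auto intro!: exI[of _ "0::nat"])

text \<open>The representing sequences of length n are overwritten at index n, which leaves the
  earlier terms alone. Coefficients of repeated generators are never merged.\<close>

lemma lin_span_step:
  assumes S: "S \<subseteq> carrier M" and y: "y \<in> lin_span M S" and s: "s \<in> S"
  shows "y \<oplus>\<^bsub>M\<^esub> c \<odot>\<^bsub>M\<^esub> s \<in> lin_span M S"
proof -
  from y obtain n d t where y: "y = (\<Oplus>\<^bsub>M\<^esub>i\<in>{..<n::nat}. d i \<odot>\<^bsub>M\<^esub> t i)" and t: "\<forall>i<n. t i \<in> S"
    unfolding lin_span_def by auto
  let ?d = "d(n := c)" and ?t = "t(n := s)"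
  have "(\<Oplus>\<^bsub>M\<^esub>i\<in>{..<Suc n}. ?d i \<odot>\<^bsub>M\<^esub> ?t i)
      = c \<odot>\<^bsub>M\<^esub> s \<oplus>\<^bsub>M\<^esub> (\<Oplus>\<^bsub>M\<^esub>i\<in>{..<n}. ?d i \<odot>\<^bsub>M\<^esub> ?t i)"
    unfolding lessThan_Suc using t S s
    by (subst M.finsum_insert) (auto simp: Pi_def)
  also have "(\<Oplus>\<^bsub>M\<^esub>i\<in>{..<n}. ?d i \<odot>\<^bsub>M\<^esub> ?t i) = y"
    unfolding y using t S s by (intro M.finsum_cong') (auto simp: Pi_def)
  also have "c \<odot>\<^bsub>M\<^esub> s \<oplus>\<^bsub>M\<^esub> y = y \<oplus>\<^bsub>M\<^esub> c \<odot>\<^bsub>M\<^esub> s"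
    using s S t unfolding y by (intro M.a_comm M.finsum_closed) (auto simp: Pi_def)
  finally show ?thesis unfolding lin_span_def using t s
    by (intro CollectI exI[of _ "Suc n"] exI[of _ ?d] exI[of _ ?t]) (auto simp: less_Suc_eq)
qed

text \<open>Adding one scaled generator at a time turns statements on spans into a single additive
  step, so the finite sums of the definition need not be split again.\<close>

lemma lin_span_induct [consumes 2, case_names zero step]:
  assumes S: "S \<subseteq> carrier M" and x: "x \<in> lin_span M S"
    and zero: "P \<zero>\<^bsub>M\<^esub>"
    and step: "\<And>y c s. \<lbrakk>y \<in> lin_span M S; y \<in> carrier M; P y; s \<in> S\<rbrakk> \<Longrightarrow> P (y \<oplus>\<^bsub>M\<^esub> c \<odot>\<^bsub>M\<^esub> s)"
  shows "P x"
proof -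
  have "P (\<Oplus>\<^bsub>M\<^esub>i\<in>{..<n}. c i \<odot>\<^bsub>M\<^esub> s i)" if "\<forall>i<n. s i \<in> S" for n :: nat and c s
    using that
  proof (induction n)
    case 0 show ?case using zero by simp
  next
    case (Suc n)
    let ?y = "\<Oplus>\<^bsub>M\<^esub>i\<in>{..<n}. c i \<odot>\<^bsub>M\<^esub> s i"
    have sc: "s i \<in> carrier M" if "i < Suc n" for i using Suc.prems S that by auto
    have cl: "?y \<in> carrier M" using sc by (intro M.finsum_closed) (auto simp: Pi_def)
    have sn: "s n \<in> S" "s n \<in> carrier M" using Suc.prems S by auto
    have "(\<Oplus>\<^bsub>M\<^esub>i\<in>{..<Suc n}. c i \<odot>\<^bsub>M\<^esub> s i) = c n \<odot>\<^bsub>M\<^esub> s n \<oplus>\<^bsub>M\<^esub> ?y"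
      unfolding lessThan_Suc using sc
      by (subst M.finsum_insert) (auto simp: Pi_def)
    also have "\<dots> = ?y \<oplus>\<^bsub>M\<^esub> c n \<odot>\<^bsub>M\<^esub> s n" using cl sn by (intro M.a_comm) auto
    finally have "(\<Oplus>\<^bsub>M\<^esub>i\<in>{..<Suc n}. c i \<odot>\<^bsub>M\<^esub> s i) = ?y \<oplus>\<^bsub>M\<^esub> c n \<odot>\<^bsub>M\<^esub> s n" .
    moreover have "?y \<in> lin_span M S" using Suc.prems unfolding lin_span_def
      by (intro CollectI exI[of _ n] exI[of _ c] exI[of _ s]) auto
    ultimately show ?case using step[of ?y "s n" "c n"] cl sn Suc by auto
  qed
  thus ?thesis using x unfolding lin_span_def by auto
qed

lemma lin_span_carrier: "S \<subseteq> carrier M \<Longrightarrow> lin_span M S \<subseteq> carrier M"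
proof
  fix x assume S: "S \<subseteq> carrier M" and x: "x \<in> lin_span M S"
  show "x \<in> carrier M" by (rule lin_span_induct[OF S x]) (use S in auto)
qed

lemma lin_span_superset: "S \<subseteq> carrier M \<Longrightarrow> S \<subseteq> lin_span M S"
proof
  fix s assume S: "S \<subseteq> carrier M" and s: "s \<in> S"
  show "s \<in> lin_span M S"
    using lin_span_step[OF S lin_span_zero s, of 1] S s by auto
qed

lemma lin_span_add:
  assumes S: "S \<subseteq> carrier M" and x: "x \<in> lin_span M S" and y: "y \<in> lin_span M S"
  shows "x \<oplus>\<^bsub>M\<^esub> y \<in> lin_span M S"
  using S y
proof (induction rule: lin_span_induct)
  case zero thus ?case using x lin_span_carrier[OF S] by (auto simp: subsetD)
next
  case (step y c s)
  have "x \<oplus>\<^bsub>M\<^esub> (y \<oplus>\<^bsub>M\<^esub> c \<odot>\<^bsub>M\<^esub> s) = (x \<oplus>\<^bsub>M\<^esub> y) \<oplus>\<^bsub>M\<^esub> c \<odot>\<^bsub>M\<^esub> s"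
    using step x S lin_span_carrier[OF S] by (subst M.a_assoc) auto
  thus ?case using lin_span_step[OF S step.IH step.hyps(3)] by simp
qed

lemma lin_span_smult:
  assumes S: "S \<subseteq> carrier M" and x: "x \<in> lin_span M S"
  shows "c \<odot>\<^bsub>M\<^esub> x \<in> lin_span M S"
  using S x
proof (induction rule: lin_span_induct)
  case zero thus ?case by (simp add: lin_span_zero)
next
  case (step y d s)
  thus ?case using lin_span_step[OF S step.IH step.hyps(3), of "c * d"] S
    by (auto simp: smult_rdist smult_smult subsetD)
qed

lemma lin_span_minimal:
  assumes "S \<subseteq> T" "T \<subseteq> carrier M" "\<zero>\<^bsub>M\<^esub> \<in> T"
    "\<And>x y. x \<in> T \<Longrightarrow> y \<in> T \<Longrightarrow> x \<oplus>\<^bsub>M\<^esub> y \<in> T" "\<And>c x. x \<in> T \<Longrightarrow> c \<odot>\<^bsub>M\<^esub> x \<in> T"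
  shows "lin_span M S \<subseteq> T"
proof
  have S: "S \<subseteq> carrier M" using assms by auto
  fix x assume x: "x \<in> lin_span M S"
  show "x \<in> T" by (rule lin_span_induct[OF S x]) (use assms in auto)
qed

text \<open>Peels one generator off a spanning set; the inductive proof that finite dimensional
  subspaces are closed runs on this form.\<close>

lemma lin_span_insert:
  assumes S: "insert s S \<subseteq> carrier M"
  shows "lin_span M (insert s S) = {y \<oplus>\<^bsub>M\<^esub> c \<odot>\<^bsub>M\<^esub> s | y c. y \<in> lin_span M S}"
proof
  have S': "S \<subseteq> carrier M" "s \<in> carrier M" using S by auto
  show "lin_span M (insert s S) \<subseteq> {y \<oplus>\<^bsub>M\<^esub> c \<odot>\<^bsub>M\<^esub> s | y c. y \<in> lin_span M S}"
  proof (rule lin_span_minimal)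
    have "s = \<zero>\<^bsub>M\<^esub> \<oplus>\<^bsub>M\<^esub> 1 \<odot>\<^bsub>M\<^esub> s" using S' by simp
    moreover have "t = t \<oplus>\<^bsub>M\<^esub> 0 \<odot>\<^bsub>M\<^esub> s" if "t \<in> S" for t using S' that by (auto simp: subsetD)
    ultimately show "insert s S \<subseteq> {y \<oplus>\<^bsub>M\<^esub> c \<odot>\<^bsub>M\<^esub> s | y c. y \<in> lin_span M S}"
      using lin_span_zero lin_span_superset[OF S'(1)] by blast
    show "{y \<oplus>\<^bsub>M\<^esub> c \<odot>\<^bsub>M\<^esub> s | y c. y \<in> lin_span M S} \<subseteq> carrier M"
      using lin_span_carrier[OF S'(1)] S' by auto
    show "\<zero>\<^bsub>M\<^esub> \<in> {y \<oplus>\<^bsub>M\<^esub> c \<odot>\<^bsub>M\<^esub> s | y c. y \<in> lin_span M S}"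
      using S' lin_span_zero by (auto intro!: exI[of _ "\<zero>\<^bsub>M\<^esub>"] exI[of _ 0])
  next
    fix x y assume "x \<in> {y \<oplus>\<^bsub>M\<^esub> c \<odot>\<^bsub>M\<^esub> s | y c. y \<in> lin_span M S}" "y \<in> {y \<oplus>\<^bsub>M\<^esub> c \<odot>\<^bsub>M\<^esub> s | y c. y \<in> lin_span M S}"
    then obtain u c v d where *: "x = u \<oplus>\<^bsub>M\<^esub> c \<odot>\<^bsub>M\<^esub> s" "y = v \<oplus>\<^bsub>M\<^esub> d \<odot>\<^bsub>M\<^esub> s" "u \<in> lin_span M S" "v \<in> lin_span M S"
      by auto
    hence "u \<in> carrier M" "v \<in> carrier M" using lin_span_carrier[OF S'(1)] by auto
    hence "x \<oplus>\<^bsub>M\<^esub> y = (u \<oplus>\<^bsub>M\<^esub> v) \<oplus>\<^bsub>M\<^esub> (c + d) \<odot>\<^bsub>M\<^esub> s"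
      using S' unfolding * by (simp add: smult_ldist M.a_ac)
    thus "x \<oplus>\<^bsub>M\<^esub> y \<in> {y \<oplus>\<^bsub>M\<^esub> c \<odot>\<^bsub>M\<^esub> s | y c. y \<in> lin_span M S}"
      using lin_span_add[OF S'(1) *(3,4)] by auto
  next
    fix d x assume "x \<in> {y \<oplus>\<^bsub>M\<^esub> c \<odot>\<^bsub>M\<^esub> s | y c. y \<in> lin_span M S}"
    then obtain u c where *: "x = u \<oplus>\<^bsub>M\<^esub> c \<odot>\<^bsub>M\<^esub> s" "u \<in> lin_span M S" by auto
    hence "u \<in> carrier M" using lin_span_carrier[OF S'(1)] by auto
    hence "d \<odot>\<^bsub>M\<^esub> x = d \<odot>\<^bsub>M\<^esub> u \<oplus>\<^bsub>M\<^esub> (d * c) \<odot>\<^bsub>M\<^esub> s"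
      using S' unfolding * by (simp add: smult_rdist smult_smult)
    thus "d \<odot>\<^bsub>M\<^esub> x \<in> {y \<oplus>\<^bsub>M\<^esub> c \<odot>\<^bsub>M\<^esub> s | y c. y \<in> lin_span M S}"
      using lin_span_smult[OF S'(1) *(2)] by auto
  qed
  have "lin_span M S \<subseteq> lin_span M (insert s S)"
  proof (rule lin_span_minimal)
    show "S \<subseteq> lin_span M (insert s S)" using lin_span_superset[OF S] by auto
  qed (use lin_span_carrier[OF S] lin_span_zero lin_span_add[OF S] lin_span_smult[OF S] in auto)
  thus "{y \<oplus>\<^bsub>M\<^esub> c \<odot>\<^bsub>M\<^esub> s | y c. y \<in> lin_span M S} \<subseteq> lin_span M (insert s S)"
    using lin_span_step[OF S] by auto
qed

end

text \<open>The norm is a parameter because the notions below serve norms of different origin: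
  Hilbert norms, the supremum norm of operator families, \<open>cnorm\<close>, and the sum of entry
  norms on matrices.\<close>

locale normed_module = cmodule M for M :: "(complex, 'b, 'm) module_scheme" (structure) +
  fixes N :: "'b \<Rightarrow> real"
  assumes N_eq_zero: "a \<in> carrier M \<Longrightarrow> N a = 0 \<longleftrightarrow> a = \<zero>\<^bsub>M\<^esub>"
    and N_smult: "a \<in> carrier M \<Longrightarrow> N (c \<odot>\<^bsub>M\<^esub> a) = cmod c * N a"
    and N_triangle: "\<lbrakk>a \<in> carrier M; b \<in> carrier M\<rbrakk> \<Longrightarrow> N (a \<oplus>\<^bsub>M\<^esub> b) \<le> N a + N b"
begin

lemma N_zero [simp]: "N \<zero>\<^bsub>M\<^esub> = 0"
  using N_eq_zero by simp

text \<open>Follows from 0 = N (a - a) \<le> N a + N a.\<close>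

lemma N_nonneg [simp]:
  assumes a: "a \<in> carrier M" shows "0 \<le> N a"
proof -
  have "N (a \<oplus>\<^bsub>M\<^esub> (- 1) \<odot>\<^bsub>M\<^esub> a) \<le> N a + N a"
    using N_triangle[of a "(- 1) \<odot>\<^bsub>M\<^esub> a"] N_smult[OF a, of "- 1"] a by simp
  moreover have "a \<oplus>\<^bsub>M\<^esub> (- 1) \<odot>\<^bsub>M\<^esub> a = \<zero>\<^bsub>M\<^esub>"
    using smult_ldist[OF a, of 1 "- 1"] a by simp
  ultimately show ?thesis by simp
qed

lemma N_minus_commute:
  assumes "a \<in> carrier M" "b \<in> carrier M" shows "N (a \<ominus>\<^bsub>M\<^esub> b) = N (b \<ominus>\<^bsub>M\<^esub> a)"
proof -
  have "a \<ominus>\<^bsub>M\<^esub> b = (- 1) \<odot>\<^bsub>M\<^esub> (b \<ominus>\<^bsub>M\<^esub> a)"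
    using assms by (simp add: minus_conv smult_rdist smult_smult M.a_ac)
  thus ?thesis using N_smult[of "b \<ominus>\<^bsub>M\<^esub> a" "- 1"] assms by simp
qed

lemma minus_split:
  assumes "a \<in> carrier M" "b \<in> carrier M" "c \<in> carrier M"
  shows "a \<ominus>\<^bsub>M\<^esub> c = (a \<ominus>\<^bsub>M\<^esub> b) \<oplus>\<^bsub>M\<^esub> (b \<ominus>\<^bsub>M\<^esub> c)"
proof -
  have "(a \<ominus>\<^bsub>M\<^esub> b) \<oplus>\<^bsub>M\<^esub> (b \<ominus>\<^bsub>M\<^esub> c) = a \<oplus>\<^bsub>M\<^esub> ((\<ominus>\<^bsub>M\<^esub> b \<oplus>\<^bsub>M\<^esub> b) \<oplus>\<^bsub>M\<^esub> \<ominus>\<^bsub>M\<^esub> c)"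
    using assms by (simp add: M.minus_eq M.a_assoc del: M.add.l_inv M.add.inv_solve_left)
  thus ?thesis using assms by (simp add: M.l_neg M.minus_eq)
qed

lemma N_triangle_minus:
  assumes "a \<in> carrier M" "b \<in> carrier M" "c \<in> carrier M"
  shows "N (a \<ominus>\<^bsub>M\<^esub> c) \<le> N (a \<ominus>\<^bsub>M\<^esub> b) + N (b \<ominus>\<^bsub>M\<^esub> c)"
  using minus_split[OF assms] N_triangle[of "a \<ominus>\<^bsub>M\<^esub> b" "b \<ominus>\<^bsub>M\<^esub> c"] assms by simp

lemma minus_self [simp]: "a \<in> carrier M \<Longrightarrow> a \<ominus>\<^bsub>M\<^esub> a = \<zero>\<^bsub>M\<^esub>"
  by (simp add: M.minus_eq M.r_neg)

lemma minus_zero_iff: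
  assumes "a \<in> carrier M" "b \<in> carrier M"
  shows "N (a \<ominus>\<^bsub>M\<^esub> b) = 0 \<longleftrightarrow> a = b"
proof -
  have "a = b" if "a \<ominus>\<^bsub>M\<^esub> b = \<zero>\<^bsub>M\<^esub>"
    using minus_split[of a b "\<zero>\<^bsub>M\<^esub>"] that assms by (simp add: M.minus_eq)
  thus ?thesis using N_eq_zero[of "a \<ominus>\<^bsub>M\<^esub> b"] assms by auto
qed

lemma minus_zero [simp]: "a \<in> carrier M \<Longrightarrow> a \<ominus>\<^bsub>M\<^esub> \<zero>\<^bsub>M\<^esub> = a"
  by (simp add: minus_conv)

lemma N_diff_le:
  assumes "a \<in> carrier M" "b \<in> carrier M"
  shows "\<bar>N a - N b\<bar> \<le> N (a \<ominus>\<^bsub>M\<^esub> b)"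
  using N_triangle_minus[of a b "\<zero>\<^bsub>M\<^esub>"] N_triangle_minus[of b a "\<zero>\<^bsub>M\<^esub>"] assms
    N_minus_commute[OF assms] by auto

section \<open>Convergence of sequences in the carrier\<close>

definition tends :: "(nat \<Rightarrow> 'b) \<Rightarrow> 'b \<Rightarrow> bool" where
  "tends u a \<longleftrightarrow> (\<forall>n. u n \<in> carrier M) \<and> a \<in> carrier M \<and> (\<lambda>n. N (u n \<ominus>\<^bsub>M\<^esub> a)) \<longlonglongrightarrow> 0"

lemma tendsD:
  assumes "tends u a" shows "u n \<in> carrier M" "a \<in> carrier M"
  using assms by (auto simp: tends_def)

lemma tends_le:
  assumes "\<And>n. u n \<in> carrier M" "a \<in> carrier M" "\<And>n. N (u n \<ominus>\<^bsub>M\<^esub> a) \<le> f n" "f \<longlonglongrightarrow> 0"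
  shows "tends u a"
  unfolding tends_def using assms
  by (auto intro!: tendsto_sandwich[OF _ _ tendsto_const assms(4)] always_eventually)

lemma tends_const: "a \<in> carrier M \<Longrightarrow> tends (\<lambda>n. a) a"
  by (simp add: tends_def)

lemma tends_add:
  assumes "tends u a" "tends u' b"
  shows "tends (\<lambda>n. u n \<oplus>\<^bsub>M\<^esub> u' n) (a \<oplus>\<^bsub>M\<^esub> b)"
proof (rule tends_le)
  note [simp] = tendsD[OF assms(1)] tendsD[OF assms(2)]
  have "(u n \<oplus>\<^bsub>M\<^esub> u' n) \<ominus>\<^bsub>M\<^esub> (a \<oplus>\<^bsub>M\<^esub> b) = (u n \<ominus>\<^bsub>M\<^esub> a) \<oplus>\<^bsub>M\<^esub> (u' n \<ominus>\<^bsub>M\<^esub> b)" for n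
    by (simp add: minus_conv smult_rdist M.a_ac)
  thus "N ((u n \<oplus>\<^bsub>M\<^esub> u' n) \<ominus>\<^bsub>M\<^esub> (a \<oplus>\<^bsub>M\<^esub> b)) \<le> N (u n \<ominus>\<^bsub>M\<^esub> a) + N (u' n \<ominus>\<^bsub>M\<^esub> b)" for n
    using N_triangle[of "u n \<ominus>\<^bsub>M\<^esub> a" "u' n \<ominus>\<^bsub>M\<^esub> b"] by simp
  show "(\<lambda>n. N (u n \<ominus>\<^bsub>M\<^esub> a) + N (u' n \<ominus>\<^bsub>M\<^esub> b)) \<longlonglongrightarrow> 0"
    using assms tendsto_add[of "\<lambda>n. N (u n \<ominus>\<^bsub>M\<^esub> a)" 0 _ "\<lambda>n. N (u' n \<ominus>\<^bsub>M\<^esub> b)" 0] by (auto simp: tends_def)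
qed (use tendsD[OF assms(1)] tendsD[OF assms(2)] in auto)

text \<open>The scalars vary with n as well: convergent coefficients in a span and rational
  approximations of a complex scalar are both used this way below.\<close>

lemma tends_smult_seq:
  assumes "tends u a" "c \<longlonglongrightarrow> d"
  shows "tends (\<lambda>n. c n \<odot>\<^bsub>M\<^esub> u n) (d \<odot>\<^bsub>M\<^esub> a)"
proof (rule tends_le)
  note [simp] = tendsD[OF assms(1)]
  have "c n \<odot>\<^bsub>M\<^esub> u n \<ominus>\<^bsub>M\<^esub> d \<odot>\<^bsub>M\<^esub> a = c n \<odot>\<^bsub>M\<^esub> (u n \<ominus>\<^bsub>M\<^esub> a) \<oplus>\<^bsub>M\<^esub> (c n - d) \<odot>\<^bsub>M\<^esub> a" for n
  proof -
    have "(c n - d) \<odot>\<^bsub>M\<^esub> a = c n \<odot>\<^bsub>M\<^esub> a \<oplus>\<^bsub>M\<^esub> (- d) \<odot>\<^bsub>M\<^esub> a"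
      using smult_ldist[of a "c n" "- d"] by simp
    moreover have "(- c n) \<odot>\<^bsub>M\<^esub> a \<oplus>\<^bsub>M\<^esub> c n \<odot>\<^bsub>M\<^esub> a = \<zero>\<^bsub>M\<^esub>"
      using smult_ldist[of a "- c n" "c n"] by simp
    ultimately show ?thesis
      by (simp add: minus_conv smult_rdist smult_smult M.a_assoc)
        (simp flip: M.a_assoc)
  qed
  thus "N (c n \<odot>\<^bsub>M\<^esub> u n \<ominus>\<^bsub>M\<^esub> d \<odot>\<^bsub>M\<^esub> a) \<le> cmod (c n) * N (u n \<ominus>\<^bsub>M\<^esub> a) + cmod (c n - d) * N a" for n
    using N_triangle[of "c n \<odot>\<^bsub>M\<^esub> (u n \<ominus>\<^bsub>M\<^esub> a)" "(c n - d) \<odot>\<^bsub>M\<^esub> a"] by (simp add: N_smult)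
  have "(\<lambda>n. cmod (c n) * N (u n \<ominus>\<^bsub>M\<^esub> a) + cmod (c n - d) * N a) \<longlonglongrightarrow> cmod d * 0 + cmod (d - d) * N a"
    using assms by (intro tendsto_intros) (auto simp: tends_def)
  thus "(\<lambda>n. cmod (c n) * N (u n \<ominus>\<^bsub>M\<^esub> a) + cmod (c n - d) * N a) \<longlonglongrightarrow> 0" by simp
qed (use tendsD[OF assms(1)] in auto)

lemma tends_smult: "tends u a \<Longrightarrow> tends (\<lambda>n. c \<odot>\<^bsub>M\<^esub> u n) (c \<odot>\<^bsub>M\<^esub> a)"
  by (rule tends_smult_seq) auto

lemma tends_minus:
  assumes "tends u a" "tends u' b"
  shows "tends (\<lambda>n. u n \<ominus>\<^bsub>M\<^esub> u' n) (a \<ominus>\<^bsub>M\<^esub> b)"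
  using tends_add[OF assms(1) tends_smult[OF assms(2), of "- 1"]] tendsD[OF assms(1)] tendsD[OF assms(2)]
  by (simp add: minus_conv)

lemma tends_N: "tends u a \<Longrightarrow> (\<lambda>n. N (u n)) \<longlonglongrightarrow> N a"
proof -
  assume t: "tends u a"
  have "(\<lambda>n. N (u n) - N a) \<longlonglongrightarrow> 0"
  proof (rule Lim_null_comparison)
    show "\<forall>\<^sub>F n in sequentially. norm (N (u n) - N a) \<le> N (u n \<ominus>\<^bsub>M\<^esub> a)"
      using N_diff_le tendsD[OF t] by (auto intro!: always_eventually)
  qed (use t in \<open>auto simp: tends_def\<close>)
  thus ?thesis using LIM_zero_iff by blast
qed

lemma tends_bounded: "tends u a \<Longrightarrow> \<exists>B>0. \<forall>n. N (u n) \<le> B"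
proof -
  assume t: "tends u a"
  obtain B where "B > 0" "\<forall>n. norm (N (u n)) \<le> B"
    using convergent_imp_Bseq[OF convergentI[OF tends_N[OF t]]] unfolding Bseq_def by auto
  thus ?thesis using tendsD[OF t] by auto
qed

lemma tends_unique:
  assumes "tends u a" "tends u b" shows "a = b"
proof -
  have "(\<lambda>n. N (u n \<ominus>\<^bsub>M\<^esub> u n)) = (\<lambda>n. 0)" using tendsD(1)[OF assms(1)] by auto
  hence "N (a \<ominus>\<^bsub>M\<^esub> b) = 0"
    using tends_N[OF tends_minus[OF assms]] by (simp add: LIMSEQ_const_iff)
  thus ?thesis using minus_zero_iff tendsD[OF assms(1)] tendsD[OF assms(2)] by auto
qed

lemma tends_Cauchy:
  assumes t: "tends u a" and e: "\<epsilon> > 0"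
  shows "\<exists>n0. \<forall>m\<ge>n0. \<forall>n\<ge>n0. N (u m \<ominus>\<^bsub>M\<^esub> u n) < \<epsilon>"
proof -
  have "\<forall>\<^sub>F n in sequentially. N (u n \<ominus>\<^bsub>M\<^esub> a) < \<epsilon> / 2"
    using t e by (intro order_tendstoD) (auto simp: tends_def)
  then obtain n0 where n0: "\<And>n. n \<ge> n0 \<Longrightarrow> N (u n \<ominus>\<^bsub>M\<^esub> a) < \<epsilon> / 2"
    unfolding eventually_sequentially by auto
  have "N (u m \<ominus>\<^bsub>M\<^esub> u n) < \<epsilon>" if "m \<ge> n0" "n \<ge> n0" for m n
    using N_triangle_minus[of "u m" a "u n"] N_minus_commute[of "u n" a] tendsD[OF t] n0[OF that(1)] n0[OF that(2)]
    by auto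
  thus ?thesis by blast
qed

text \<open>For the C*-norm this is \<open>norm_closure\<close>. The version for an arbitrary norm
  also covers operators between two different spaces, which form no algebra.\<close>

definition ncl :: "'b set \<Rightarrow> 'b set" where
  "ncl S = {a \<in> carrier M. \<forall>\<epsilon>>0. \<exists>s\<in>S. N (a \<ominus>\<^bsub>M\<^esub> s) < \<epsilon>}"

lemma ncl_iff:
  assumes S: "S \<subseteq> carrier M"
  shows "a \<in> ncl S \<longleftrightarrow> (\<exists>u. (\<forall>n. u n \<in> S) \<and> tends u a)"
proof
  assume a: "a \<in> ncl S"
  hence "\<forall>n. \<exists>s\<in>S. N (a \<ominus>\<^bsub>M\<^esub> s) < 1 / real (Suc n)" unfolding ncl_def by simp
  then obtain u where u: "\<And>n. u n \<in> S" "\<And>n. N (a \<ominus>\<^bsub>M\<^esub> u n) < 1 / real (Suc n)" by metis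
  have "tends u a"
  proof (rule tends_le)
    show "(\<lambda>n. 1 / real (Suc n)) \<longlonglongrightarrow> 0" using LIMSEQ_inverse_real_of_nat by (simp add: inverse_eq_divide)
    show "N (u n \<ominus>\<^bsub>M\<^esub> a) \<le> 1 / real (Suc n)" for n
      using N_minus_commute[of "u n" a] u[of n] S a unfolding ncl_def by auto
  qed (use S u a in \<open>auto simp: ncl_def\<close>)
  thus "\<exists>u. (\<forall>n. u n \<in> S) \<and> tends u a" using u by blast
next
  assume "\<exists>u. (\<forall>n. u n \<in> S) \<and> tends u a"
  then obtain u where u: "\<And>n. u n \<in> S" "tends u a" by blast
  have "\<exists>s\<in>S. N (a \<ominus>\<^bsub>M\<^esub> s) < \<epsilon>" if "\<epsilon> > 0" for \<epsilon>
  proof -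
    have "\<forall>\<^sub>F n in sequentially. N (u n \<ominus>\<^bsub>M\<^esub> a) < \<epsilon>"
      using u that by (intro order_tendstoD) (auto simp: tends_def)
    then obtain n where "N (u n \<ominus>\<^bsub>M\<^esub> a) < \<epsilon>" unfolding eventually_sequentially by auto
    thus ?thesis using u N_minus_commute[of "u n" a] tendsD[OF u(2)] by auto
  qed
  thus "a \<in> ncl S" using tendsD[OF u(2)] by (auto simp: ncl_def)
qed

lemma ncl_carrier: "ncl S \<subseteq> carrier M"
  by (auto simp: ncl_def)

lemma ncl_superset: "S \<subseteq> carrier M \<Longrightarrow> S \<subseteq> ncl S"
  unfolding ncl_def by (auto intro!: bexI[rotated] simp: subsetD)

lemma ncl_closed:
  assumes S: "S \<subseteq> carrier M" and u: "\<And>n. u n \<in> ncl S" "tends u a"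
  shows "a \<in> ncl S"
proof -
  have "\<exists>s\<in>S. N (a \<ominus>\<^bsub>M\<^esub> s) < \<epsilon>" if "\<epsilon> > 0" for \<epsilon>
  proof -
    have "a \<in> ncl (ncl S)" using ncl_iff[OF ncl_carrier, of a S] u by blast
    moreover have e2: "\<epsilon> / 2 > 0" using that by simp
    ultimately obtain t where t: "t \<in> ncl S" "N (a \<ominus>\<^bsub>M\<^esub> t) < \<epsilon> / 2"
      unfolding ncl_def[of "ncl S"] by blast
    then obtain s where s: "s \<in> S" "N (t \<ominus>\<^bsub>M\<^esub> s) < \<epsilon> / 2" using e2 unfolding ncl_def by blast
    show ?thesis using s t N_triangle_minus[of a t s] tendsD[OF u(2)] S
      by (intro bexI[of _ s]) (auto simp: ncl_def)
  qed
  thus ?thesis using tendsD[OF u(2)] by (auto simp: ncl_def)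
qed

text \<open>The coefficient of \<open>s\<close> in a convergent sequence from \<open>Y + \<complex> s\<close> is Cauchy because \<open>s\<close> has
  positive distance from the closed subspace \<open>Y\<close>.\<close>

lemma lin_span_finite_closed:
  assumes "finite B" "B \<subseteq> carrier M"
  shows "ncl (lin_span M B) = lin_span M B"
  using assms
proof (induction B rule: finite_induct)
  case empty
  have "x = \<zero>\<^bsub>M\<^esub>" if "x \<in> lin_span M {}" for x
    by (rule lin_span_induct[of "{}" x "\<lambda>x. x = \<zero>\<^bsub>M\<^esub>"]) (use that in auto)
  hence e1: "lin_span M {} = {\<zero>\<^bsub>M\<^esub>}" using lin_span_zero[of "{}"] by blast
  have e2: "a = \<zero>\<^bsub>M\<^esub>" if "a \<in> ncl {\<zero>\<^bsub>M\<^esub>}" for a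
  proof -
    have a: "\<And>\<epsilon>. \<epsilon> > 0 \<Longrightarrow> N a < \<epsilon>" "a \<in> carrier M" using that by (auto simp: ncl_def)
    have "\<not> 0 < N a" using a(1)[of "N a"] by linarith
    hence "N a = 0" using N_nonneg[OF a(2)] by simp
    thus ?thesis using N_eq_zero[OF a(2)] by simp
  qed
  have "ncl {\<zero>\<^bsub>M\<^esub>} \<subseteq> {\<zero>\<^bsub>M\<^esub>}" by (rule subsetI, simp only: singleton_iff, erule e2)
  moreover have "{\<zero>\<^bsub>M\<^esub>} \<subseteq> ncl {\<zero>\<^bsub>M\<^esub>}" by (rule ncl_superset) auto
  ultimately show ?case unfolding e1 by (rule subset_antisym)
next
  case (insert s B)
  let ?Y = "lin_span M B"
  have B: "B \<subseteq> carrier M" "s \<in> carrier M" "insert s B \<subseteq> carrier M" using insert by auto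
  have Y: "?Y \<subseteq> carrier M" "ncl ?Y = ?Y" using lin_span_carrier[OF B(1)] insert by auto
  show ?case
  proof (cases "s \<in> ?Y")
    case True
    have "lin_span M (insert s B) = ?Y"
    proof
      have "y = y \<oplus>\<^bsub>M\<^esub> 0 \<odot>\<^bsub>M\<^esub> s" if "y \<in> ?Y" for y using B Y(1) that by (auto simp: subsetD)
      thus "?Y \<subseteq> lin_span M (insert s B)" unfolding lin_span_insert[OF B(3)] by blast
      show "lin_span M (insert s B) \<subseteq> ?Y" unfolding lin_span_insert[OF B(3)]
        using lin_span_add[OF B(1)] lin_span_smult[OF B(1)] True by auto
    qed
    thus ?thesis using Y by simp
  next
    case False
    hence "s \<notin> ncl ?Y" using Y by simp
    then obtain d where d: "d > 0" "\<And>y. y \<in> ?Y \<Longrightarrow> d \<le> N (s \<ominus>\<^bsub>M\<^esub> y)"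
      using B(2) unfolding ncl_def by (auto simp: not_less)
    \<comment> \<open>Write y + c s as c times s - (-1/c) y, where (-1/c) y is again in the span.
      The coefficient of s is thus controlled by the norm of the vector.\<close>
    have dc: "cmod c * d \<le> N (y \<oplus>\<^bsub>M\<^esub> c \<odot>\<^bsub>M\<^esub> s)" if y: "y \<in> ?Y" for y c
    proof (cases "c = 0")
      case True thus ?thesis using y Y B by (auto simp: subsetD)
    next
      case c: False
      have yc: "y \<in> carrier M" using y Y by auto
      have "y \<oplus>\<^bsub>M\<^esub> c \<odot>\<^bsub>M\<^esub> s = c \<odot>\<^bsub>M\<^esub> (s \<ominus>\<^bsub>M\<^esub> (- 1 / c) \<odot>\<^bsub>M\<^esub> y)"
        using c yc B by (simp add: minus_conv smult_rdist smult_smult M.a_comm)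
      thus ?thesis using d(2)[of "(- 1 / c) \<odot>\<^bsub>M\<^esub> y"] lin_span_smult[OF B(1) y] yc B
        by (simp add: N_smult mult_left_mono)
    qed
    have "a \<in> lin_span M (insert s B)" if a: "a \<in> ncl (lin_span M (insert s B))" for a
    proof -
      obtain u where u: "\<And>n. u n \<in> lin_span M (insert s B)" "tends u a"
        using a ncl_iff[OF lin_span_carrier[OF B(3)]] by blast
      then obtain y c where yc: "\<And>n. u n = y n \<oplus>\<^bsub>M\<^esub> c n \<odot>\<^bsub>M\<^esub> s" "\<And>n. y n \<in> ?Y"
        unfolding lin_span_insert[OF B(3)] by simp metis
      have y: "y n \<in> carrier M" for n using yc Y by auto
      have diff: "cmod (c m - c n) * d \<le> N (u m \<ominus>\<^bsub>M\<^esub> u n)" for m n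
      proof -
        have "u m \<ominus>\<^bsub>M\<^esub> u n = (y m \<ominus>\<^bsub>M\<^esub> y n) \<oplus>\<^bsub>M\<^esub> (c m - c n) \<odot>\<^bsub>M\<^esub> s"
          using B y smult_ldist[of s "c m" "- c n"]
          by (simp add: yc(1) minus_conv smult_rdist smult_smult M.a_ac)
        moreover have "y m \<ominus>\<^bsub>M\<^esub> y n \<in> ?Y"
          using lin_span_add[OF B(1) yc(2)[of m] lin_span_smult[OF B(1) yc(2)[of n]], of "- 1"] y
          by (simp add: minus_conv)
        ultimately show ?thesis using dc by simp
      qed
      have "Cauchy c"
      proof (rule metric_CauchyI)
        fix e :: real assume "e > 0"
        then obtain n0 where "\<forall>m\<ge>n0. \<forall>n\<ge>n0. N (u m \<ominus>\<^bsub>M\<^esub> u n) < e * d"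
          using tends_Cauchy[OF u(2), of "e * d"] d by auto
        hence "\<forall>m\<ge>n0. \<forall>n\<ge>n0. cmod (c m - c n) * d < e * d" using diff by (meson le_less_trans)
        thus "\<exists>M. \<forall>m\<ge>M. \<forall>n\<ge>M. dist (c m) (c n) < e" using d by (auto simp: dist_norm)
      qed
      then obtain c' where c': "c \<longlonglongrightarrow> c'" using Cauchy_convergent convergent_def by blast
      have "tends (\<lambda>n. u n \<ominus>\<^bsub>M\<^esub> c n \<odot>\<^bsub>M\<^esub> s) (a \<ominus>\<^bsub>M\<^esub> c' \<odot>\<^bsub>M\<^esub> s)"
        using u(2) tends_smult_seq[OF tends_const[OF B(2)] c'] by (rule tends_minus)
      moreover have "u n \<ominus>\<^bsub>M\<^esub> c n \<odot>\<^bsub>M\<^esub> s = y n" for n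
        unfolding yc(1) using y[of n] B smult_ldist[of s "c n" "- c n"]
        by (simp add: minus_conv smult_smult M.a_assoc)
      ultimately have "tends y (a \<ominus>\<^bsub>M\<^esub> c' \<odot>\<^bsub>M\<^esub> s)" by simp
      hence "a \<ominus>\<^bsub>M\<^esub> c' \<odot>\<^bsub>M\<^esub> s \<in> ?Y" using ncl_iff[OF Y(1)] yc(2) Y(2) by blast
      moreover have "a = (a \<ominus>\<^bsub>M\<^esub> c' \<odot>\<^bsub>M\<^esub> s) \<oplus>\<^bsub>M\<^esub> c' \<odot>\<^bsub>M\<^esub> s"
        using B tendsD[OF u(2)] smult_ldist[of s "- c'" c'] by (simp add: minus_conv smult_smult M.a_assoc)
      ultimately show ?thesis unfolding lin_span_insert[OF B(3)] by blast
    qed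
    thus ?thesis using ncl_superset[OF lin_span_carrier[OF B(3)]] by blast
  qed
qed

end

section \<open>Finite sums: interchange and additive maps\<close>

lemma (in abelian_monoid) finsum_swap:
  assumes "finite I" "finite J" "\<And>i j. i \<in> I \<Longrightarrow> j \<in> J \<Longrightarrow> f i j \<in> carrier G"
  shows "(\<Oplus>i\<in>I. \<Oplus>j\<in>J. f i j) = (\<Oplus>j\<in>J. \<Oplus>i\<in>I. f i j)"
  using assms(1,3)
proof (induction I rule: finite_induct)
  case empty
  show ?case using assms(2) by (simp add: finsum_zero)
next
  case (insert k I)
  have "(\<Oplus>i\<in>insert k I. \<Oplus>j\<in>J. f i j) = (\<Oplus>j\<in>J. f k j) \<oplus> (\<Oplus>i\<in>I. \<Oplus>j\<in>J. f i j)"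
    using insert by (intro finsum_insert) (auto intro!: finsum_closed)
  also have "\<dots> = (\<Oplus>j\<in>J. f k j) \<oplus> (\<Oplus>j\<in>J. \<Oplus>i\<in>I. f i j)" using insert by simp
  also have "\<dots> = (\<Oplus>j\<in>J. f k j \<oplus> (\<Oplus>i\<in>I. f i j))"
    using insert by (intro finsum_addf[symmetric]) (auto intro!: finsum_closed)
  also have "\<dots> = (\<Oplus>j\<in>J. \<Oplus>i\<in>insert k I. f i j)"
    using insert by (intro finsum_cong' refl) (auto intro!: finsum_closed finsum_insert[symmetric])
  finally show ?case .
qed

text \<open>Used with evaluation of an operator at a vector, with the involution, and with the
  identity map between a subalgebra and the whole algebra, whose sums are formed in different
  records.\<close>

lemma finsum_hom:
  assumes M: "abelian_monoid M" and L: "abelian_monoid L"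
    and f: "\<And>x. x \<in> carrier M \<Longrightarrow> f x \<in> carrier L" "f \<zero>\<^bsub>M\<^esub> = \<zero>\<^bsub>L\<^esub>"
      "\<And>x y. \<lbrakk>x \<in> carrier M; y \<in> carrier M\<rbrakk> \<Longrightarrow> f (x \<oplus>\<^bsub>M\<^esub> y) = f x \<oplus>\<^bsub>L\<^esub> f y"
    and g: "\<And>i. i \<in> I \<Longrightarrow> g i \<in> carrier M"
  shows "f (\<Oplus>\<^bsub>M\<^esub>i\<in>I. g i) = (\<Oplus>\<^bsub>L\<^esub>i\<in>I. f (g i))"
proof (cases "finite I")
  case False
  thus ?thesis using f by (simp add: abelian_monoid.finsum_infinite[OF M] abelian_monoid.finsum_infinite[OF L])
next
  case True
  thus ?thesis using g
  proof (induction I rule: finite_induct)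
    case empty
    show ?case using f by (simp add: abelian_monoid.finsum_empty[OF M] abelian_monoid.finsum_empty[OF L])
  next
    case (insert k I)
    have "f (finsum M g (insert k I)) = f (g k \<oplus>\<^bsub>M\<^esub> finsum M g I)"
      using insert by (subst abelian_monoid.finsum_insert[OF M]) auto
    also have "\<dots> = f (g k) \<oplus>\<^bsub>L\<^esub> (\<Oplus>\<^bsub>L\<^esub>i\<in>I. f (g i))"
      using insert by (subst f(3)) (auto intro!: abelian_monoid.finsum_closed[OF M])
    also have "\<dots> = (\<Oplus>\<^bsub>L\<^esub>i\<in>insert k I. f (g i))"
      using insert f(1) by (subst abelian_monoid.finsum_insert[OF L]) auto
    finally show ?case .
  qed
qed

text \<open>The variant for functionals, whose values are added by the type class; traces and inner
  products are instances. An infinite index set gives 0 on both sides.\<close>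

lemma finsum_hom_sum:
  fixes f :: "'a \<Rightarrow> 'c::comm_monoid_add"
  assumes M: "abelian_monoid M"
    and f: "f \<zero>\<^bsub>M\<^esub> = 0"
      "\<And>x y. \<lbrakk>x \<in> carrier M; y \<in> carrier M\<rbrakk> \<Longrightarrow> f (x \<oplus>\<^bsub>M\<^esub> y) = f x + f y"
    and g: "\<And>i. i \<in> I \<Longrightarrow> g i \<in> carrier M"
  shows "f (\<Oplus>\<^bsub>M\<^esub>i\<in>I. g i) = (\<Sum>i\<in>I. f (g i))"
proof (cases "finite I")
  case False
  thus ?thesis using f by (simp add: abelian_monoid.finsum_infinite[OF M])
next
  case True
  thus ?thesis using g
  proof (induction I rule: finite_induct)
    case empty
    show ?case using f by (simp add: abelian_monoid.finsum_empty[OF M])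
  next
    case (insert k I)
    have "f (finsum M g (insert k I)) = f (g k \<oplus>\<^bsub>M\<^esub> finsum M g I)"
      using insert by (subst abelian_monoid.finsum_insert[OF M]) auto
    thus ?case using insert by (simp add: f abelian_monoid.finsum_closed[OF M] Pi_def)
  qed
qed

lemma (in normed_module) N_finsum:
  assumes "finite I" "\<And>i. i \<in> I \<Longrightarrow> g i \<in> carrier M"
  shows "N (\<Oplus>\<^bsub>M\<^esub>i\<in>I. g i) \<le> (\<Sum>i\<in>I. N (g i))"
  using assms
proof (induction I rule: finite_induct)
  case (insert k I)
  have "N (finsum M g (insert k I)) = N (g k \<oplus>\<^bsub>M\<^esub> finsum M g I)"
    using insert by (subst M.finsum_insert) auto
  also have "\<dots> \<le> N (g k) + N (finsum M g I)" using insert by (intro N_triangle M.finsum_closed) auto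
  finally show ?case using insert by auto
qed simp

section \<open>Square roots in Banach *-algebras\<close>

text \<open>The C*-identity is absent on purpose: square roots are needed in matrix algebras over a
  C*-algebra, and these are normed by the sum of the entry norms.\<close>

locale banach_star = normed_module M N + ring M
  for M :: "('b, 'm) star_algebra_scheme" (structure) and N :: "'b \<Rightarrow> real" +
  assumes smult_mult_left:
      "\<lbrakk>a \<in> carrier M; b \<in> carrier M\<rbrakk> \<Longrightarrow> (c \<odot>\<^bsub>M\<^esub> a) \<otimes>\<^bsub>M\<^esub> b = c \<odot>\<^bsub>M\<^esub> (a \<otimes>\<^bsub>M\<^esub> b)"
    and smult_mult_right:
      "\<lbrakk>a \<in> carrier M; b \<in> carrier M\<rbrakk> \<Longrightarrow> a \<otimes>\<^bsub>M\<^esub> (c \<odot>\<^bsub>M\<^esub> b) = c \<odot>\<^bsub>M\<^esub> (a \<otimes>\<^bsub>M\<^esub> b)"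
    and invol_closed: "a \<in> carrier M \<Longrightarrow> invol M a \<in> carrier M"
    and invol_invol: "a \<in> carrier M \<Longrightarrow> invol M (invol M a) = a"
    and invol_add:
      "\<lbrakk>a \<in> carrier M; b \<in> carrier M\<rbrakk> \<Longrightarrow> invol M (a \<oplus>\<^bsub>M\<^esub> b) = invol M a \<oplus>\<^bsub>M\<^esub> invol M b"
    and invol_smult: "a \<in> carrier M \<Longrightarrow> invol M (c \<odot>\<^bsub>M\<^esub> a) = cnj c \<odot>\<^bsub>M\<^esub> invol M a"
    and invol_mult:
      "\<lbrakk>a \<in> carrier M; b \<in> carrier M\<rbrakk> \<Longrightarrow> invol M (a \<otimes>\<^bsub>M\<^esub> b) = invol M b \<otimes>\<^bsub>M\<^esub> invol M a"
    and N_submult: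
      "\<lbrakk>a \<in> carrier M; b \<in> carrier M\<rbrakk> \<Longrightarrow> N (a \<otimes>\<^bsub>M\<^esub> b) \<le> N a * N b"
    and N_invol_le: "a \<in> carrier M \<Longrightarrow> N (invol M a) \<le> N a"
    and N_complete: "norm_complete M N"
begin

lemma Cauchy_tends:
  assumes "\<And>n. u n \<in> carrier M"
    "\<And>\<epsilon>. \<epsilon> > 0 \<Longrightarrow> \<exists>n0. \<forall>m\<ge>n0. \<forall>n\<ge>n0. N (u m \<ominus>\<^bsub>M\<^esub> u n) < \<epsilon>"
  shows "\<exists>a. tends u a"
proof -
  have "range u \<subseteq> carrier M" using assms by auto
  then obtain a where "a \<in> carrier M" "(\<lambda>n. N (u n \<ominus>\<^bsub>M\<^esub> a)) \<longlonglongrightarrow> 0"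
    using N_complete assms(2) unfolding norm_complete_def by blast
  thus ?thesis using assms unfolding tends_def by blast
qed

text \<open>Changes one factor at a time. It gives continuity of the product and, for squares, the
  increments of the square root iteration.\<close>

lemma mult_minus_split:
  assumes "a \<in> carrier M" "b \<in> carrier M" "c \<in> carrier M" "d \<in> carrier M"
  shows "a \<otimes>\<^bsub>M\<^esub> b \<ominus>\<^bsub>M\<^esub> c \<otimes>\<^bsub>M\<^esub> d = a \<otimes>\<^bsub>M\<^esub> (b \<ominus>\<^bsub>M\<^esub> d) \<oplus>\<^bsub>M\<^esub> (a \<ominus>\<^bsub>M\<^esub> c) \<otimes>\<^bsub>M\<^esub> d"
proof -
  have "a \<otimes>\<^bsub>M\<^esub> (b \<ominus>\<^bsub>M\<^esub> d) = a \<otimes>\<^bsub>M\<^esub> b \<ominus>\<^bsub>M\<^esub> a \<otimes>\<^bsub>M\<^esub> d" "(a \<ominus>\<^bsub>M\<^esub> c) \<otimes>\<^bsub>M\<^esub> d = a \<otimes>\<^bsub>M\<^esub> d \<ominus>\<^bsub>M\<^esub> c \<otimes>\<^bsub>M\<^esub> d"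
    using assms by (simp_all add: minus_conv r_distr l_distr smult_mult_left smult_mult_right)
  thus ?thesis using minus_split[of "a \<otimes>\<^bsub>M\<^esub> b" "a \<otimes>\<^bsub>M\<^esub> d" "c \<otimes>\<^bsub>M\<^esub> d"] assms by simp
qed

lemma tends_mult:
  assumes "tends u a" "tends v b"
  shows "tends (\<lambda>n. u n \<otimes>\<^bsub>M\<^esub> v n) (a \<otimes>\<^bsub>M\<^esub> b)"
proof -
  note c = tendsD[OF assms(1)] tendsD[OF assms(2)]
  obtain B where B: "\<And>n. N (u n) \<le> B" using tends_bounded[OF assms(1)] by blast
  have "N (u n \<otimes>\<^bsub>M\<^esub> v n \<ominus>\<^bsub>M\<^esub> a \<otimes>\<^bsub>M\<^esub> b) \<le> B * N (v n \<ominus>\<^bsub>M\<^esub> b) + N (u n \<ominus>\<^bsub>M\<^esub> a) * N b" for n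
  proof -
    have "N (u n \<otimes>\<^bsub>M\<^esub> (v n \<ominus>\<^bsub>M\<^esub> b)) \<le> N (u n) * N (v n \<ominus>\<^bsub>M\<^esub> b)" using c by (intro N_submult) auto
    also have "\<dots> \<le> B * N (v n \<ominus>\<^bsub>M\<^esub> b)" using B c by (intro mult_right_mono) auto
    finally show ?thesis
      using mult_minus_split[of "u n" "v n" a b] N_submult[of "u n \<ominus>\<^bsub>M\<^esub> a" b]
        N_triangle[of "u n \<otimes>\<^bsub>M\<^esub> (v n \<ominus>\<^bsub>M\<^esub> b)" "(u n \<ominus>\<^bsub>M\<^esub> a) \<otimes>\<^bsub>M\<^esub> b"] c by auto
  qed
  moreover have "(\<lambda>n. B * N (v n \<ominus>\<^bsub>M\<^esub> b) + N (u n \<ominus>\<^bsub>M\<^esub> a) * N b) \<longlonglongrightarrow> B * 0 + 0 * N b"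
    using assms by (intro tendsto_intros) (auto simp: tends_def)
  hence "(\<lambda>n. B * N (v n \<ominus>\<^bsub>M\<^esub> b) + N (u n \<ominus>\<^bsub>M\<^esub> a) * N b) \<longlonglongrightarrow> 0" by simp
  ultimately show ?thesis using c by (intro tends_le) auto
qed

lemma invol_minus:
  "a \<in> carrier M \<Longrightarrow> b \<in> carrier M \<Longrightarrow> invol M (a \<ominus>\<^bsub>M\<^esub> b) = invol M a \<ominus>\<^bsub>M\<^esub> invol M b"
  by (simp add: minus_conv invol_add invol_smult invol_closed)

lemma tends_invol:
  assumes "tends u a" shows "tends (\<lambda>n. invol M (u n)) (invol M a)"
proof (rule tends_le)
  show "N (invol M (u n) \<ominus>\<^bsub>M\<^esub> invol M a) \<le> N (u n \<ominus>\<^bsub>M\<^esub> a)" for n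
    using N_invol_le[of "u n \<ominus>\<^bsub>M\<^esub> a"] tendsD[OF assms] by (simp add: invol_minus)
qed (use tendsD[OF assms] assms invol_closed in \<open>auto simp: tends_def\<close>)

lemma invol_one: "invol M \<one>\<^bsub>M\<^esub> = \<one>\<^bsub>M\<^esub>"
proof -
  have "invol M (invol M \<one>\<^bsub>M\<^esub>) = invol M (\<one>\<^bsub>M\<^esub> \<otimes>\<^bsub>M\<^esub> invol M \<one>\<^bsub>M\<^esub>)" by (simp add: invol_closed)
  also have "\<dots> = \<one>\<^bsub>M\<^esub> \<otimes>\<^bsub>M\<^esub> invol M \<one>\<^bsub>M\<^esub>" by (subst invol_mult) (auto simp: invol_closed invol_invol)
  finally show ?thesis by (simp add: invol_invol invol_closed)
qed

lemma invol_zero: "invol M \<zero>\<^bsub>M\<^esub> = \<zero>\<^bsub>M\<^esub>"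
  using invol_smult[of "\<zero>\<^bsub>M\<^esub>" 0] invol_closed[of "\<zero>\<^bsub>M\<^esub>"] by simp

lemma invol_pow: "x \<in> carrier M \<Longrightarrow> invol M (x [^]\<^bsub>M\<^esub> (n::nat)) = invol M x [^]\<^bsub>M\<^esub> n"
proof (induction n)
  case (Suc n)
  have "invol M (x [^]\<^bsub>M\<^esub> Suc n) = invol M x \<otimes>\<^bsub>M\<^esub> invol M x [^]\<^bsub>M\<^esub> n"
    using Suc by (simp add: invol_mult)
  also have "\<dots> = invol M x [^]\<^bsub>M\<^esub> Suc n"
    using Suc.prems invol_closed[of x] nat_pow_Suc2 by metis
  finally show ?case .
qed (simp add: invol_one)

end

text \<open>\<open>pcomb M x y t\<close>: \<open>y\<close> is a polynomial in \<open>x\<close> with nonnegative coefficients of sum \<open>t\<close>.\<close>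

inductive pcomb :: "('b, 'm) star_algebra_scheme \<Rightarrow> 'b \<Rightarrow> 'b \<Rightarrow> real \<Rightarrow> bool" for M x where
  pcomb_zero: "pcomb M x \<zero>\<^bsub>M\<^esub> 0"
| pcomb_step: "pcomb M x y t \<Longrightarrow> 0 \<le> r \<Longrightarrow>
    pcomb M x (y \<oplus>\<^bsub>M\<^esub> complex_of_real r \<odot>\<^bsub>M\<^esub> x [^]\<^bsub>M\<^esub> (k::nat)) (t + r)"

context banach_star
begin

context
  fixes x assumes x: "x \<in> carrier M"
begin

lemma pcomb_carrier: "pcomb M x y t \<Longrightarrow> y \<in> carrier M"
  by (induction rule: pcomb.induct) (use x in auto)

lemma pcomb_nonneg: "pcomb M x y t \<Longrightarrow> 0 \<le> t"
  by (induction rule: pcomb.induct) auto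

lemma pcomb_add: "pcomb M x z s \<Longrightarrow> pcomb M x y t \<Longrightarrow> pcomb M x (y \<oplus>\<^bsub>M\<^esub> z) (t + s)"
proof (induction rule: pcomb.induct)
  case pcomb_zero
  thus ?case using pcomb_carrier by simp
next
  case (pcomb_step z s r k)
  have "y \<oplus>\<^bsub>M\<^esub> (z \<oplus>\<^bsub>M\<^esub> complex_of_real r \<odot>\<^bsub>M\<^esub> x [^]\<^bsub>M\<^esub> k)
      = (y \<oplus>\<^bsub>M\<^esub> z) \<oplus>\<^bsub>M\<^esub> complex_of_real r \<odot>\<^bsub>M\<^esub> x [^]\<^bsub>M\<^esub> k"
    using pcomb_carrier[OF pcomb_step(1)] pcomb_carrier[OF pcomb_step(4)] x by (subst M.a_assoc) auto
  thus ?case using pcomb.pcomb_step[OF pcomb_step.IH[OF pcomb_step(4)] pcomb_step(2), of k]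
    by (simp add: add.assoc)
qed

lemma pcomb_smult: "pcomb M x y t \<Longrightarrow> 0 \<le> r \<Longrightarrow> pcomb M x (complex_of_real r \<odot>\<^bsub>M\<^esub> y) (r * t)"
proof (induction rule: pcomb.induct)
  case pcomb_zero
  show ?case using pcomb.pcomb_zero[of M x] by simp
next
  case (pcomb_step z s r' k)
  have "complex_of_real r \<odot>\<^bsub>M\<^esub> (z \<oplus>\<^bsub>M\<^esub> complex_of_real r' \<odot>\<^bsub>M\<^esub> x [^]\<^bsub>M\<^esub> k)
      = complex_of_real r \<odot>\<^bsub>M\<^esub> z \<oplus>\<^bsub>M\<^esub> complex_of_real (r * r') \<odot>\<^bsub>M\<^esub> x [^]\<^bsub>M\<^esub> k"
    using pcomb_carrier[OF pcomb_step(1)] x by (simp add: smult_rdist smult_smult)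
  thus ?case using pcomb.pcomb_step[OF pcomb_step.IH[OF pcomb_step(4)], of "r * r'" k] pcomb_step(2,4)
    by (simp add: distrib_left)
qed

lemma pcomb_mult_pow: "pcomb M x y t \<Longrightarrow> pcomb M x (y \<otimes>\<^bsub>M\<^esub> x [^]\<^bsub>M\<^esub> (j::nat)) t"
proof (induction rule: pcomb.induct)
  case pcomb_zero
  show ?case using pcomb.pcomb_zero[of M x] x by simp
next
  case (pcomb_step z s r k)
  have "(z \<oplus>\<^bsub>M\<^esub> complex_of_real r \<odot>\<^bsub>M\<^esub> x [^]\<^bsub>M\<^esub> k) \<otimes>\<^bsub>M\<^esub> x [^]\<^bsub>M\<^esub> j
      = z \<otimes>\<^bsub>M\<^esub> x [^]\<^bsub>M\<^esub> j \<oplus>\<^bsub>M\<^esub> complex_of_real r \<odot>\<^bsub>M\<^esub> x [^]\<^bsub>M\<^esub> (k + j)"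
    using pcomb_carrier[OF pcomb_step(1)] x by (simp add: l_distr smult_mult_left nat_pow_mult)
  thus ?case using pcomb.pcomb_step[OF pcomb_step.IH pcomb_step(2), of "k + j"] by simp
qed

text \<open>The real number is the value of the polynomial at 1, hence multiplicative.
  Multiplication by a single power is settled beforehand, so only distributivity over the terms of z
  remains.\<close>

lemma pcomb_mult: "pcomb M x z s \<Longrightarrow> pcomb M x y t \<Longrightarrow> pcomb M x (y \<otimes>\<^bsub>M\<^esub> z) (t * s)"
proof (induction rule: pcomb.induct)
  case pcomb_zero
  thus ?case using pcomb_carrier pcomb.pcomb_zero[of M x] by simp
next
  case (pcomb_step z s r k)
  have "y \<otimes>\<^bsub>M\<^esub> (z \<oplus>\<^bsub>M\<^esub> complex_of_real r \<odot>\<^bsub>M\<^esub> x [^]\<^bsub>M\<^esub> k)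
      = y \<otimes>\<^bsub>M\<^esub> z \<oplus>\<^bsub>M\<^esub> complex_of_real r \<odot>\<^bsub>M\<^esub> (y \<otimes>\<^bsub>M\<^esub> x [^]\<^bsub>M\<^esub> k)"
    using pcomb_carrier[OF pcomb_step(1)] pcomb_carrier[OF pcomb_step(4)] x
    by (simp add: r_distr smult_mult_right)
  thus ?case using pcomb_add[OF pcomb_smult[OF pcomb_mult_pow[OF pcomb_step(4)] pcomb_step(2)]
        pcomb_step.IH[OF pcomb_step(4)], of k] by (simp add: distrib_left mult.commute)
qed

lemma pcomb_invol:
  assumes "invol M x = x" shows "pcomb M x y t \<Longrightarrow> invol M y = y"
  by (induction rule: pcomb.induct)
    (use x assms pcomb_carrier in \<open>auto simp: invol_add invol_smult invol_pow invol_zero\<close>)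

text \<open>Only boundedness of the powers of x enters, not N x \<le> 1. The entry sum norm of a
  contractive matrix may exceed 1, while that of its powers stays bounded.\<close>

lemma pcomb_norm:
  assumes "\<And>n::nat. N (x [^]\<^bsub>M\<^esub> n) \<le> C" shows "pcomb M x y t \<Longrightarrow> N y \<le> C * t"
proof (induction rule: pcomb.induct)
  case (pcomb_step y t r k)
  have "N (y \<oplus>\<^bsub>M\<^esub> complex_of_real r \<odot>\<^bsub>M\<^esub> x [^]\<^bsub>M\<^esub> k) \<le> N y + r * N (x [^]\<^bsub>M\<^esub> k)"
    using N_triangle[of y "complex_of_real r \<odot>\<^bsub>M\<^esub> x [^]\<^bsub>M\<^esub> k"] N_smult[of "x [^]\<^bsub>M\<^esub> k" "complex_of_real r"]
      pcomb_carrier[OF pcomb_step(1)] pcomb_step(2) x by simp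
  also have "\<dots> \<le> C * t + r * C" using pcomb_step assms[of k] by (intro add_mono mult_left_mono) auto
  finally show ?case by (simp add: algebra_simps)
qed simp

end

text \<open>The iteration \<open>y \<mapsto> (x + y\<^sup>2) / 2\<close> converges to a fixed point \<open>y\<close>, and then
  \<open>(1 - y)\<^sup>2 = 1 - x\<close>.  Its increments are polynomials in \<open>x\<close> with nonnegative coefficients, so
  they are controlled by the increments of the same iteration for \<open>x = 1\<close>.\<close>

theorem ex_sqrt:
  assumes x: "x \<in> carrier M" "invol M x = x" and C: "\<And>n::nat. N (x [^]\<^bsub>M\<^esub> n) \<le> C"
  shows "\<exists>b\<in>carrier M. invol M b = b \<and> b \<otimes>\<^bsub>M\<^esub> b = \<one>\<^bsub>M\<^esub> \<ominus>\<^bsub>M\<^esub> x"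
proof -
  let ?h = "complex_of_real (1 / 2)"
  define y where "y = rec_nat \<zero>\<^bsub>M\<^esub> (\<lambda>_ y. ?h \<odot>\<^bsub>M\<^esub> (y \<otimes>\<^bsub>M\<^esub> y \<oplus>\<^bsub>M\<^esub> x))"
  define t where "t = rec_nat (0::real) (\<lambda>_ t. 1 / 2 * (t * t + 1))"
  have y0: "y 0 = \<zero>\<^bsub>M\<^esub>" and yS: "y (Suc n) = ?h \<odot>\<^bsub>M\<^esub> (y n \<otimes>\<^bsub>M\<^esub> y n \<oplus>\<^bsub>M\<^esub> x)" for n by (simp_all add: y_def)
  have t0: "t 0 = 0" and tS: "t (Suc n) = 1 / 2 * (t n * t n + 1)" for n by (simp_all add: t_def)
  have px: "pcomb M x x 1"
    using pcomb.pcomb_step[OF pcomb.pcomb_zero[of M x], of 1 1] x by simp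
  have py: "pcomb M x (y n) (t n)" for n
  proof (induction n)
    case 0 show ?case using pcomb.pcomb_zero[of M x] by (simp add: y0 t0)
  next
    case (Suc n)
    show ?case unfolding yS tS
      by (intro pcomb_smult pcomb_add pcomb_mult Suc px x) auto
  qed
  have yc: "y n \<in> carrier M" for n using pcomb_carrier[OF x(1) py] .
  \<comment> \<open>A new increment is half the difference of two squares, which
    \<open>mult_minus_split\<close> writes with products of earlier values and increments, all
    polynomials with nonnegative coefficients. The same expression in t gives the coefficient
    sum.\<close>
  have pd: "pcomb M x (y (Suc n) \<ominus>\<^bsub>M\<^esub> y n) (t (Suc n) - t n)" for n
  proof (induction n)
    case 0
    have "y (Suc 0) \<ominus>\<^bsub>M\<^esub> y 0 = y (Suc 0)" using yc[of "Suc 0"] by (simp add: y0)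
    thus ?case using py[of "Suc 0"] by (simp add: t0)
  next
    case (Suc n)
    have "y (Suc (Suc n)) \<ominus>\<^bsub>M\<^esub> y (Suc n)
        = ?h \<odot>\<^bsub>M\<^esub> (y (Suc n) \<otimes>\<^bsub>M\<^esub> y (Suc n) \<ominus>\<^bsub>M\<^esub> y n \<otimes>\<^bsub>M\<^esub> y n)"
    proof -
      have "y (Suc n) \<otimes>\<^bsub>M\<^esub> y (Suc n) \<oplus>\<^bsub>M\<^esub> x \<ominus>\<^bsub>M\<^esub> (y n \<otimes>\<^bsub>M\<^esub> y n \<oplus>\<^bsub>M\<^esub> x)
          = (y (Suc n) \<otimes>\<^bsub>M\<^esub> y (Suc n) \<ominus>\<^bsub>M\<^esub> y n \<otimes>\<^bsub>M\<^esub> y n) \<oplus>\<^bsub>M\<^esub> (x \<ominus>\<^bsub>M\<^esub> x)"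
        using yc x by (simp only: minus_conv smult_rdist smult_closed' M.a_ac M.a_closed m_closed)
      hence e: "y (Suc n) \<otimes>\<^bsub>M\<^esub> y (Suc n) \<oplus>\<^bsub>M\<^esub> x \<ominus>\<^bsub>M\<^esub> (y n \<otimes>\<^bsub>M\<^esub> y n \<oplus>\<^bsub>M\<^esub> x)
          = y (Suc n) \<otimes>\<^bsub>M\<^esub> y (Suc n) \<ominus>\<^bsub>M\<^esub> y n \<otimes>\<^bsub>M\<^esub> y n" using yc x by simp
      have sm: "c \<odot>\<^bsub>M\<^esub> a \<ominus>\<^bsub>M\<^esub> c \<odot>\<^bsub>M\<^esub> b = c \<odot>\<^bsub>M\<^esub> (a \<ominus>\<^bsub>M\<^esub> b)" if "a \<in> carrier M" "b \<in> carrier M" for a b c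
        using that by (simp add: minus_conv smult_rdist smult_smult)
      show ?thesis unfolding e[symmetric] yS[of "Suc n"] using yc x
        by (subst sm[symmetric]) (auto simp: yS[of n])
    qed
    also have "\<dots> = ?h \<odot>\<^bsub>M\<^esub> (y (Suc n) \<otimes>\<^bsub>M\<^esub> (y (Suc n) \<ominus>\<^bsub>M\<^esub> y n) \<oplus>\<^bsub>M\<^esub> (y (Suc n) \<ominus>\<^bsub>M\<^esub> y n) \<otimes>\<^bsub>M\<^esub> y n)"
      using yc by (simp add: mult_minus_split[of "y (Suc n)" "y (Suc n)" "y n" "y n"])
    finally have e: "y (Suc (Suc n)) \<ominus>\<^bsub>M\<^esub> y (Suc n) = \<dots>" .
    have "pcomb M x (y (Suc (Suc n)) \<ominus>\<^bsub>M\<^esub> y (Suc n))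
        (1 / 2 * (t (Suc n) * (t (Suc n) - t n) + (t (Suc n) - t n) * t n))"
      unfolding e by (intro pcomb_smult pcomb_add pcomb_mult Suc py x) auto
    moreover have "1 / 2 * (t (Suc n) * (t (Suc n) - t n) + (t (Suc n) - t n) * t n) = t (Suc (Suc n)) - t (Suc n)"
    proof -
      have "1 / 2 * (a * (a - b) + (a - b) * b) = 1 / 2 * (a * a + 1) - 1 / 2 * (b * b + 1)" for a b :: real
        by (simp add: field_simps)
      thus ?thesis unfolding tS[of "Suc n"] using tS[of n] by metis
    qed
    ultimately show ?case by simp
  qed
  have tmono: "t n \<le> t (Suc n)" for n using pcomb_nonneg[OF x(1) pd[of n]] by simp
  \<comment> \<open>The scalar iteration never passes its fixed point 1.\<close>
  have t1: "0 \<le> t n \<and> t n \<le> 1" for n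
  proof (induction n)
    case (Suc n)
    hence "t n * t n \<le> 1" by (simp add: mult_le_one)
    thus ?case using Suc by (simp add: tS)
  qed (simp add: t0)
  \<comment> \<open>Telescoping: each increment is bounded through its coefficient sum, so the
    scalar sequence dominates the iteration.\<close>
  have dist: "N (y (n + k) \<ominus>\<^bsub>M\<^esub> y n) \<le> C * (t (n + k) - t n)" for n k
  proof (induction k)
    case 0 thus ?case using yc by simp
  next
    case (Suc k)
    have "N (y (n + Suc k) \<ominus>\<^bsub>M\<^esub> y (n + k)) \<le> C * (t (n + Suc k) - t (n + k))"
      using pcomb_norm[OF x(1) C pd[of "n + k"]] by simp
    thus ?case using Suc N_triangle_minus[of "y (n + Suc k)" "y (n + k)" "y n"] yc
      by (simp add: algebra_simps)
  qed
  have "convergent t"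
    using t1 tmono by (intro Bseq_monoseq_convergent) (auto intro!: BseqI'[of _ 1] simp: monoseq_Suc)
  hence "Cauchy t" by (rule convergent_Cauchy)
  have "\<exists>a. tends y a"
  proof (rule Cauchy_tends)
    fix e :: real assume e: "e > 0"
    have C0: "0 \<le> C" using order_trans[OF N_nonneg C[of 0]] x by simp
    obtain n0 where n0: "\<forall>m\<ge>n0. \<forall>n\<ge>n0. dist (t m) (t n) < e / (C + 1)"
      using metric_CauchyD[OF \<open>Cauchy t\<close>, of "e / (C + 1)"] e C0 by auto
    have le: "N (y m \<ominus>\<^bsub>M\<^esub> y n) < e" if "n0 \<le> n" "n \<le> m" for m n
    proof -
      have tn: "dist (t m) (t n) < e / (C + 1)" using n0 that by auto
      have "N (y m \<ominus>\<^bsub>M\<^esub> y n) \<le> C * (t m - t n)" using dist[of n "m - n"] that by simp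
      also have "\<dots> \<le> C * (e / (C + 1))"
        using tn C0 by (intro mult_left_mono) (auto simp: dist_real_def)
      also have "\<dots> < e" using C0 e by (simp add: field_simps)
      finally show ?thesis .
    qed
    have "N (y m \<ominus>\<^bsub>M\<^esub> y n) < e" if "m \<ge> n0" "n \<ge> n0" for m n
      using le[of n m] le[of m n] that N_minus_commute[OF yc yc, of m n] by (cases "n \<le> m") auto
    thus "\<exists>n0. \<forall>m\<ge>n0. \<forall>n\<ge>n0. N (y m \<ominus>\<^bsub>M\<^esub> y n) < e" by blast
  qed (rule yc)
  then obtain a where a: "tends y a" by blast
  have ac: "a \<in> carrier M" using tendsD[OF a] by simp
  have "tends (\<lambda>n. y (Suc n)) a"
    using a LIMSEQ_Suc[of "\<lambda>n. N (y n \<ominus>\<^bsub>M\<^esub> a)" 0] unfolding tends_def by auto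
  moreover have "tends (\<lambda>n. y (Suc n)) (?h \<odot>\<^bsub>M\<^esub> (a \<otimes>\<^bsub>M\<^esub> a \<oplus>\<^bsub>M\<^esub> x))"
    unfolding yS by (intro tends_smult tends_add tends_mult a tends_const x)
  ultimately have fx: "a = ?h \<odot>\<^bsub>M\<^esub> (a \<otimes>\<^bsub>M\<^esub> a \<oplus>\<^bsub>M\<^esub> x)" by (rule tends_unique)
  have "2 \<odot>\<^bsub>M\<^esub> a = 2 \<odot>\<^bsub>M\<^esub> (?h \<odot>\<^bsub>M\<^esub> (a \<otimes>\<^bsub>M\<^esub> a \<oplus>\<^bsub>M\<^esub> x))" by (rule arg_cong[OF fx])
  also have "\<dots> = a \<otimes>\<^bsub>M\<^esub> a \<oplus>\<^bsub>M\<^esub> x" using ac x by (simp add: smult_smult)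
  finally have fix2: "2 \<odot>\<^bsub>M\<^esub> a = a \<otimes>\<^bsub>M\<^esub> a \<oplus>\<^bsub>M\<^esub> x" .
  have "(\<lambda>n. invol M (y n)) = y" using pcomb_invol[OF x(1,2) py] by blast
  hence ia: "invol M a = a" using tends_unique[OF tends_invol[OF a]] a by metis
  let ?b = "\<one>\<^bsub>M\<^esub> \<ominus>\<^bsub>M\<^esub> a"
  have "?b \<otimes>\<^bsub>M\<^esub> ?b = (\<one>\<^bsub>M\<^esub> \<ominus>\<^bsub>M\<^esub> 2 \<odot>\<^bsub>M\<^esub> a) \<oplus>\<^bsub>M\<^esub> a \<otimes>\<^bsub>M\<^esub> a"
  proof -
    have "(-2) \<odot>\<^bsub>M\<^esub> a = (-1) \<odot>\<^bsub>M\<^esub> a \<oplus>\<^bsub>M\<^esub> (-1) \<odot>\<^bsub>M\<^esub> a" using smult_ldist[OF ac, of "-1" "-1"] by simp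
    thus ?thesis using ac
      by (simp add: minus_conv l_distr r_distr smult_mult_left smult_mult_right smult_smult smult_rdist M.a_ac)
  qed
  also have "\<dots> = \<one>\<^bsub>M\<^esub> \<ominus>\<^bsub>M\<^esub> x"
  proof -
    let ?s = "a \<otimes>\<^bsub>M\<^esub> a"
    have "(\<one>\<^bsub>M\<^esub> \<ominus>\<^bsub>M\<^esub> (?s \<oplus>\<^bsub>M\<^esub> x)) \<oplus>\<^bsub>M\<^esub> ?s = (\<one>\<^bsub>M\<^esub> \<ominus>\<^bsub>M\<^esub> x) \<oplus>\<^bsub>M\<^esub> (?s \<ominus>\<^bsub>M\<^esub> ?s)"
      using ac x by (simp only: minus_conv smult_rdist smult_closed' M.a_ac M.a_closed m_closed one_closed)
    thus ?thesis unfolding fix2 using ac x by simp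
  qed
  finally have "?b \<otimes>\<^bsub>M\<^esub> ?b = \<one>\<^bsub>M\<^esub> \<ominus>\<^bsub>M\<^esub> x" .
  moreover have "invol M ?b = ?b" using ac by (simp add: invol_minus invol_one ia)
  ultimately show ?thesis using ac by (intro bexI[of _ ?b]) auto
qed

end

section \<open>Hilbert spaces\<close>

text \<open>The discriminant argument behind the Cauchy-Schwarz inequalities below: test with c = -t
  times the conjugate of z and take t = 1/b; for b = 0 and z \<noteq> 0 a large t violates the
  hypothesis. It serves Hilbert spaces, kernels, positive matrices and the first variation in
  \<open>riesz\<close>.\<close>

lemma cs_scalar:
  fixes z :: complex
  assumes "\<And>c. 0 \<le> a + 2 * Re (c * z) + (cmod c)\<^sup>2 * b" "0 \<le> b"
  shows "(cmod z)\<^sup>2 \<le> a * b"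
proof (cases "z = 0")
  case True
  have "0 \<le> a" using assms(1)[of 0] by simp
  thus ?thesis using True assms(2) by simp
next
  case False
  hence z: "(cmod z)\<^sup>2 > 0" by simp
  have a: "0 \<le> a" using assms(1)[of 0] by simp
  have t: "0 \<le> a - 2 * t * (cmod z)\<^sup>2 + t\<^sup>2 * (cmod z)\<^sup>2 * b" for t :: real
  proof -
    have "complex_of_real (- t) * cnj z * z = complex_of_real (- t) * complex_of_real ((cmod z)\<^sup>2)"
      unfolding complex_norm_square by simp
    also have "\<dots> = complex_of_real (- t * (cmod z)\<^sup>2)" by (rule of_real_mult[symmetric])
    finally have "complex_of_real (- t) * cnj z * z = complex_of_real (- t * (cmod z)\<^sup>2)" .
    hence "Re (complex_of_real (- t) * cnj z * z) = - t * (cmod z)\<^sup>2"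
      by (simp only: Re_complex_of_real)
    moreover have "(cmod (complex_of_real (- t) * cnj z))\<^sup>2 = t\<^sup>2 * (cmod z)\<^sup>2"
      by (simp add: norm_mult power_mult_distrib)
    ultimately show ?thesis using assms(1)[of "complex_of_real (- t) * cnj z"] by simp
  qed
  show ?thesis
  proof (cases "b = 0")
    case True
    thus ?thesis using t[of "(a + 1) / (cmod z)\<^sup>2"] a z by (simp add: field_simps)
  next
    case b: False
    hence "b > 0" using assms(2) by simp
    thus ?thesis using t[of "1 / b"] by (simp add: field_simps power2_eq_square)
  qed
qed

context hilbert_space
begin

lemma hinner_add_right:
  "\<lbrakk>\<xi> \<in> carrier H; \<eta> \<in> carrier H; \<zeta> \<in> carrier H\<rbrakk> \<Longrightarrow> hinner H \<xi> (\<eta> \<oplus>\<^bsub>H\<^esub> \<zeta>) = hinner H \<xi> \<eta> + hinner H \<xi> \<zeta>"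
  using hinner_commute[of \<xi> "\<eta> \<oplus>\<^bsub>H\<^esub> \<zeta>"] hinner_commute[of \<xi> \<eta>] hinner_commute[of \<xi> \<zeta>] hinner_add_left[of \<eta> \<zeta> \<xi>]
  by (metis M.a_closed complex_cnj_add complex_cnj_cnj)

lemma smult_cl [simp]: "\<xi> \<in> carrier H \<Longrightarrow> c \<odot>\<^bsub>H\<^esub> \<xi> \<in> carrier H"
  by simp

lemma hinner_smult_right:
  "\<lbrakk>\<xi> \<in> carrier H; \<eta> \<in> carrier H\<rbrakk> \<Longrightarrow> hinner H \<xi> (c \<odot>\<^bsub>H\<^esub> \<eta>) = cnj c * hinner H \<xi> \<eta>"
  using hinner_commute[of \<xi> "c \<odot>\<^bsub>H\<^esub> \<eta>"] hinner_commute[of \<xi> \<eta>] hinner_smult_left[of \<eta> \<xi> c]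
  by (metis smult_cl complex_cnj_mult complex_cnj_cnj)

lemma hinner_zero_left: "\<eta> \<in> carrier H \<Longrightarrow> hinner H \<zero>\<^bsub>H\<^esub> \<eta> = 0"
  using hinner_add_left[of "\<zero>\<^bsub>H\<^esub>" "\<zero>\<^bsub>H\<^esub>" \<eta>] by simp

lemma hinner_zero_right: "\<eta> \<in> carrier H \<Longrightarrow> hinner H \<eta> \<zero>\<^bsub>H\<^esub> = 0"
  using hinner_add_right[of \<eta> "\<zero>\<^bsub>H\<^esub>" "\<zero>\<^bsub>H\<^esub>"] by simp

lemma hinner_self: "\<xi> \<in> carrier H \<Longrightarrow> hinner H \<xi> \<xi> = complex_of_real ((hnorm H \<xi>)\<^sup>2)"
  using hinner_nonneg[of \<xi>] unfolding hnorm_def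
  by (auto simp: complex_eq_iff complex_nonneg_Reals_iff)

lemma hnorm_sq: "\<xi> \<in> carrier H \<Longrightarrow> (hnorm H \<xi>)\<^sup>2 = Re (hinner H \<xi> \<xi>)"
  by (simp add: hinner_self)

lemma hnorm_ge0 [simp]: "\<xi> \<in> carrier H \<Longrightarrow> 0 \<le> hnorm H \<xi>"
  using hinner_nonneg[of \<xi>] by (simp add: hnorm_def complex_nonneg_Reals_iff)

lemma hinner_expand:
  assumes "\<xi> \<in> carrier H" "\<eta> \<in> carrier H"
  shows "(hnorm H (\<xi> \<oplus>\<^bsub>H\<^esub> c \<odot>\<^bsub>H\<^esub> \<eta>))\<^sup>2
    = (hnorm H \<xi>)\<^sup>2 + 2 * Re (c * hinner H \<eta> \<xi>) + (cmod c)\<^sup>2 * (hnorm H \<eta>)\<^sup>2"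
proof -
  have "hinner H (\<xi> \<oplus>\<^bsub>H\<^esub> c \<odot>\<^bsub>H\<^esub> \<eta>) (\<xi> \<oplus>\<^bsub>H\<^esub> c \<odot>\<^bsub>H\<^esub> \<eta>)
      = hinner H \<xi> \<xi> + c * hinner H \<eta> \<xi> + cnj (c * hinner H \<eta> \<xi>) + c * cnj c * hinner H \<eta> \<eta>"
    using assms hinner_commute[of \<eta> \<xi>]
    by (simp add: hinner_add_left hinner_add_right hinner_smult_left hinner_smult_right algebra_simps)
  moreover have "c * cnj c = complex_of_real ((cmod c)\<^sup>2)" by (rule complex_norm_square[symmetric])
  ultimately have "hinner H (\<xi> \<oplus>\<^bsub>H\<^esub> c \<odot>\<^bsub>H\<^esub> \<eta>) (\<xi> \<oplus>\<^bsub>H\<^esub> c \<odot>\<^bsub>H\<^esub> \<eta>)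
      = hinner H \<xi> \<xi> + c * hinner H \<eta> \<xi> + cnj (c * hinner H \<eta> \<xi>) + complex_of_real ((cmod c)\<^sup>2) * hinner H \<eta> \<eta>"
    by (simp only:)
  hence "Re (hinner H (\<xi> \<oplus>\<^bsub>H\<^esub> c \<odot>\<^bsub>H\<^esub> \<eta>) (\<xi> \<oplus>\<^bsub>H\<^esub> c \<odot>\<^bsub>H\<^esub> \<eta>))
      = Re (hinner H \<xi> \<xi>) + 2 * Re (c * hinner H \<eta> \<xi>) + (cmod c)\<^sup>2 * Re (hinner H \<eta> \<eta>)"
    by (simp only: plus_complex.sel complex_cnj Re_complex_of_real times_complex.sel Im_complex_of_real) (simp add: cnj.sel)
  thus ?thesis using assms by (simp only: hnorm_sq M.a_closed smult_cl)
qed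

lemma cauchy_schwarz:
  assumes "\<xi> \<in> carrier H" "\<eta> \<in> carrier H"
  shows "cmod (hinner H \<xi> \<eta>) \<le> hnorm H \<xi> * hnorm H \<eta>"
proof (rule power2_le_imp_le)
  show "(cmod (hinner H \<xi> \<eta>))\<^sup>2 \<le> (hnorm H \<xi> * hnorm H \<eta>)\<^sup>2"
  proof -
    have "(cmod (hinner H \<xi> \<eta>))\<^sup>2 \<le> (hnorm H \<eta>)\<^sup>2 * (hnorm H \<xi>)\<^sup>2"
    proof (rule cs_scalar)
      show "0 \<le> (hnorm H \<eta>)\<^sup>2 + 2 * Re (c * hinner H \<xi> \<eta>) + (cmod c)\<^sup>2 * (hnorm H \<xi>)\<^sup>2" for c
        using hinner_expand[OF assms(2,1), of c] zero_le_power2[of "hnorm H (\<eta> \<oplus>\<^bsub>H\<^esub> c \<odot>\<^bsub>H\<^esub> \<xi>)"]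
        by linarith
    qed simp
    thus ?thesis by (simp add: power_mult_distrib mult.commute)
  qed
qed (use assms in auto)

sublocale normed_module H "hnorm H"
proof unfold_locales
  fix a assume a: "a \<in> carrier H"
  show "(hnorm H a = 0) = (a = \<zero>\<^bsub>H\<^esub>)"
    using hinner_eq_zero[OF a] hinner_self[OF a] by auto
  fix c show "hnorm H (c \<odot>\<^bsub>H\<^esub> a) = cmod c * hnorm H a"
  proof -
    have "(hnorm H (c \<odot>\<^bsub>H\<^esub> a))\<^sup>2 = (cmod c * hnorm H a)\<^sup>2"
      using hinner_expand[of "\<zero>\<^bsub>H\<^esub>" a c] a
      by (simp add: hinner_zero_right power_mult_distrib hnorm_sq[of "\<zero>\<^bsub>H\<^esub>"] hinner_zero_left)
    thus ?thesis using a by simp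
  qed
next
  fix a b assume ab: "a \<in> carrier H" "b \<in> carrier H"
  have "(hnorm H (a \<oplus>\<^bsub>H\<^esub> b))\<^sup>2 = (hnorm H a)\<^sup>2 + 2 * Re (hinner H b a) + (hnorm H b)\<^sup>2"
    using hinner_expand[of a b 1] smult_one[of b] ab by simp
  also have "\<dots> \<le> (hnorm H a)\<^sup>2 + 2 * (hnorm H b * hnorm H a) + (hnorm H b)\<^sup>2"
    using cauchy_schwarz[of b a] complex_Re_le_cmod[of "hinner H b a"] ab by simp
  finally have "(hnorm H (a \<oplus>\<^bsub>H\<^esub> b))\<^sup>2 \<le> (hnorm H a + hnorm H b)\<^sup>2" by (simp add: power2_sum algebra_simps)
  thus "hnorm H (a \<oplus>\<^bsub>H\<^esub> b) \<le> hnorm H a + hnorm H b"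
    by (rule power2_le_imp_le) (use ab in auto)
qed

lemma hinner_minus_left:
  "\<lbrakk>\<xi> \<in> carrier H; \<eta> \<in> carrier H; \<zeta> \<in> carrier H\<rbrakk> \<Longrightarrow> hinner H (\<xi> \<ominus>\<^bsub>H\<^esub> \<eta>) \<zeta> = hinner H \<xi> \<zeta> - hinner H \<eta> \<zeta>"
  by (simp add: minus_conv hinner_add_left hinner_smult_left)

lemma hinner_eqI:
  assumes "\<xi> \<in> carrier H" "\<eta> \<in> carrier H" "\<And>\<zeta>. \<zeta> \<in> carrier H \<Longrightarrow> hinner H \<xi> \<zeta> = hinner H \<eta> \<zeta>"
  shows "\<xi> = \<eta>"
proof -
  have "hinner H (\<xi> \<ominus>\<^bsub>H\<^esub> \<eta>) (\<xi> \<ominus>\<^bsub>H\<^esub> \<eta>) = 0"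
    using assms by (subst hinner_minus_left) auto
  thus ?thesis using hinner_self[of "\<xi> \<ominus>\<^bsub>H\<^esub> \<eta>"] minus_zero_iff assms by auto
qed

lemma hinner_eqI_right:
  assumes "\<xi> \<in> carrier H" "\<eta> \<in> carrier H" "\<And>\<zeta>. \<zeta> \<in> carrier H \<Longrightarrow> hinner H \<zeta> \<xi> = hinner H \<zeta> \<eta>"
  shows "\<xi> = \<eta>"
  using hinner_eqI[OF assms(1,2)] assms hinner_commute by metis

lemma Cauchy_tends:
  assumes "\<And>n. u n \<in> carrier H"
    "\<And>\<epsilon>. \<epsilon> > 0 \<Longrightarrow> \<exists>n0. \<forall>m\<ge>n0. \<forall>n\<ge>n0. hnorm H (u m \<ominus>\<^bsub>H\<^esub> u n) < \<epsilon>"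
  shows "\<exists>a. tends u a"
proof -
  have "range u \<subseteq> carrier H" using assms(1) by blast
  moreover have "\<forall>\<epsilon>>0. \<exists>n0. \<forall>m\<ge>n0. \<forall>n\<ge>n0. hnorm H (u m \<ominus>\<^bsub>H\<^esub> u n) < \<epsilon>" using assms(2) by blast
  ultimately obtain a where "a \<in> carrier H" "(\<lambda>n. hnorm H (u n \<ominus>\<^bsub>H\<^esub> a)) \<longlonglongrightarrow> 0"
    using hnorm_complete[unfolded norm_complete_def, rule_format, of u] by blast
  thus ?thesis using assms(1) unfolding tends_def by blast
qed

text \<open>The representing vector minimises \<open>\<parallel>\<xi>\<parallel>\<^sup>2 - 2 Re (f \<xi>)\<close>.\<close>

theorem riesz:
  assumes add: "\<And>\<xi> \<eta>. \<lbrakk>\<xi> \<in> carrier H; \<eta> \<in> carrier H\<rbrakk> \<Longrightarrow> f (\<xi> \<oplus>\<^bsub>H\<^esub> \<eta>) = f \<xi> + f \<eta>"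
    and smult: "\<And>c \<xi>. \<xi> \<in> carrier H \<Longrightarrow> f (c \<odot>\<^bsub>H\<^esub> \<xi>) = c * f \<xi>"
    and bound: "\<And>\<xi>. \<xi> \<in> carrier H \<Longrightarrow> cmod (f \<xi>) \<le> B * hnorm H \<xi>"
  shows "\<exists>\<eta>\<in>carrier H. \<forall>\<xi>\<in>carrier H. f \<xi> = hinner H \<xi> \<eta>"
proof -
  define J where "J \<xi> = (hnorm H \<xi>)\<^sup>2 - 2 * Re (f \<xi>)" for \<xi>
  \<comment> \<open>From Re (f \<xi>) \<le> B |\<xi>| and 0 \<le> (|\<xi>| - B)^2.\<close>
  have "- (B\<^sup>2) \<le> J \<xi>" if "\<xi> \<in> carrier H" for \<xi>
  proof -
    have "Re (f \<xi>) \<le> B * hnorm H \<xi>" using bound[OF that] complex_Re_le_cmod[of "f \<xi>"] by linarith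
    moreover have "0 \<le> (hnorm H \<xi> - B)\<^sup>2" by simp
    ultimately show ?thesis by (simp add: J_def power2_diff algebra_simps)
  qed
  hence bdd: "bdd_below (J ` carrier H)" by (intro bdd_belowI2[of _ "- (B\<^sup>2)"])
  define m where "m = Inf (J ` carrier H)"
  have m: "m \<le> J \<xi>" if "\<xi> \<in> carrier H" for \<xi>
    unfolding m_def using that bdd by (intro cInf_lower imageI)
  have "\<exists>\<xi>\<in>carrier H. J \<xi> < m + 1 / real (Suc n)" for n
  proof -
    have "carrier H \<noteq> {}" using M.zero_closed by (rule ex_in_conv[THEN iffD1, OF exI])
    hence "J ` carrier H \<noteq> {}" by (simp only: image_is_empty not_False_eq_True)
    moreover have "Inf (J ` carrier H) < m + 1 / real (Suc n)" unfolding m_def by simp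
    ultimately obtain s where "s \<in> J ` carrier H" "s < m + 1 / real (Suc n)" by (rule cInf_lessD[THEN bexE])
    thus ?thesis by (elim imageE) (rule bexI, simp_all only:)
  qed
  then obtain u where u: "\<And>n. u n \<in> carrier H" "\<And>n. J (u n) < m + 1 / real (Suc n)" by metis
  \<comment> \<open>Parallelogram law with the midpoint, where J is at least m: two vectors that
    nearly minimise J are close, so a minimising sequence is Cauchy.\<close>
  have dist: "(hnorm H (\<xi> \<ominus>\<^bsub>H\<^esub> \<eta>))\<^sup>2 \<le> 2 * J \<xi> + 2 * J \<eta> - 4 * m" if c: "\<xi> \<in> carrier H" "\<eta> \<in> carrier H" for \<xi> \<eta>
  proof -
    let ?mid = "complex_of_real (1/2) \<odot>\<^bsub>H\<^esub> (\<xi> \<oplus>\<^bsub>H\<^esub> \<eta>)"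
    have 1: "(hnorm H (\<xi> \<oplus>\<^bsub>H\<^esub> 1 \<odot>\<^bsub>H\<^esub> \<eta>))\<^sup>2 = (hnorm H \<xi>)\<^sup>2 + 2 * Re (hinner H \<eta> \<xi>) + (hnorm H \<eta>)\<^sup>2"
      using hinner_expand[OF c, of 1] by simp
    have 2: "(hnorm H (\<xi> \<ominus>\<^bsub>H\<^esub> \<eta>))\<^sup>2 = (hnorm H \<xi>)\<^sup>2 - 2 * Re (hinner H \<eta> \<xi>) + (hnorm H \<eta>)\<^sup>2"
      using hinner_expand[OF c, of "- 1"] c by (simp add: minus_conv)
    have "hnorm H ?mid = 1 / 2 * hnorm H (\<xi> \<oplus>\<^bsub>H\<^esub> 1 \<odot>\<^bsub>H\<^esub> \<eta>)"
      using c N_smult[of "\<xi> \<oplus>\<^bsub>H\<^esub> \<eta>" "complex_of_real (1/2)"] by simp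
    hence "(hnorm H ?mid)\<^sup>2 = (1 / 2 * hnorm H (\<xi> \<oplus>\<^bsub>H\<^esub> 1 \<odot>\<^bsub>H\<^esub> \<eta>))\<^sup>2" by (rule arg_cong)
    also have "\<dots> = 1 / 4 * (hnorm H (\<xi> \<oplus>\<^bsub>H\<^esub> 1 \<odot>\<^bsub>H\<^esub> \<eta>))\<^sup>2"
      by (simp only: power_mult_distrib) (simp add: power2_eq_square)
    finally have sq: "(hnorm H ?mid)\<^sup>2 = \<dots>" .
    have fm: "f ?mid = complex_of_real (1/2) * (f \<xi> + f \<eta>)" using c by (simp only: smult add M.a_closed)
    have "2 * Re (f ?mid) = Re (f \<xi>) + Re (f \<eta>)" unfolding fm by simp
    hence "J ?mid = 1 / 4 * (hnorm H (\<xi> \<oplus>\<^bsub>H\<^esub> 1 \<odot>\<^bsub>H\<^esub> \<eta>))\<^sup>2 - Re (f \<xi>) - Re (f \<eta>)"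
      unfolding J_def sq by simp
    moreover have "m \<le> J ?mid" using c by (intro m) auto
    ultimately have "m \<le> 1 / 4 * ((hnorm H \<xi>)\<^sup>2 + 2 * Re (hinner H \<eta> \<xi>) + (hnorm H \<eta>)\<^sup>2) - Re (f \<xi>) - Re (f \<eta>)"
      unfolding 1 by linarith
    moreover have "m \<le> 1 / 4 * (a + 2 * r + b) - p - q \<Longrightarrow> a - 2 * r + b \<le> 2 * (a - 2 * p) + 2 * (b - 2 * q) - 4 * m"
      for a r b p q m :: real by (simp add: field_simps)
    ultimately show ?thesis unfolding 2 J_def by blast
  qed
  have "\<exists>\<eta>. tends u \<eta>"
  proof (rule Cauchy_tends)
    fix e :: real assume e: "e > 0"
    \<comment> \<open>The quarter compensates that \<open>dist\<close> bounds the squared distance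
      by four times 1 / (n0 + 1).\<close>
    obtain n0 where n0: "1 / real (Suc n0) < e\<^sup>2 / 4" using e nat_approx_posE[of "e\<^sup>2 / 4"] by auto
    have "hnorm H (u k \<ominus>\<^bsub>H\<^esub> u n) < e" if "k \<ge> n0" "n \<ge> n0" for k n
    proof (rule power2_less_imp_less)
      have le: "1 / real (Suc j) \<le> 1 / real (Suc n0)" if "j \<ge> n0" for j using that by (simp add: field_simps)
      show "(hnorm H (u k \<ominus>\<^bsub>H\<^esub> u n))\<^sup>2 < e\<^sup>2"
        using dist[OF u(1) u(1), of k n] u(2)[of k] u(2)[of n] le[OF that(1)] le[OF that(2)] n0
        by linarith
    qed (use e in simp)
    thus "\<exists>n0. \<forall>m\<ge>n0. \<forall>n\<ge>n0. hnorm H (u m \<ominus>\<^bsub>H\<^esub> u n) < e" by blast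
  qed (rule u)
  then obtain \<eta> where \<eta>: "tends u \<eta>" by blast
  have \<eta>c: "\<eta> \<in> carrier H" using tendsD[OF \<eta>] by simp
  have "(\<lambda>n. f (u n) - f \<eta>) \<longlonglongrightarrow> 0"
  proof (rule Lim_null_comparison)
    have "f (u n \<ominus>\<^bsub>H\<^esub> \<eta>) = f (u n) - f \<eta>" for n using u(1) \<eta>c by (simp add: minus_conv add smult)
    hence "norm (f (u n) - f \<eta>) \<le> B * hnorm H (u n \<ominus>\<^bsub>H\<^esub> \<eta>)" for n
      using bound[of "u n \<ominus>\<^bsub>H\<^esub> \<eta>"] M.minus_closed[OF u(1) \<eta>c, of n] by simp
    thus "\<forall>\<^sub>F n in sequentially. norm (f (u n) - f \<eta>) \<le> B * hnorm H (u n \<ominus>\<^bsub>H\<^esub> \<eta>)"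
      by (intro always_eventually allI)
    show "(\<lambda>n. B * hnorm H (u n \<ominus>\<^bsub>H\<^esub> \<eta>)) \<longlonglongrightarrow> 0"
      using \<eta> by (intro tendsto_mult_right_zero) (auto simp: tends_def)
  qed
  hence "(\<lambda>n. f (u n)) \<longlonglongrightarrow> f \<eta>" using LIM_zero_iff by blast
  hence "(\<lambda>n. J (u n)) \<longlonglongrightarrow> J \<eta>" unfolding J_def by (intro tendsto_intros tends_N \<eta>)
  moreover have "(\<lambda>n. m + 1 / real (Suc n)) \<longlonglongrightarrow> m + 0"
    by (intro tendsto_intros) (use LIMSEQ_inverse_real_of_nat in \<open>simp add: inverse_eq_divide\<close>)
  ultimately have J\<eta>: "J \<eta> \<le> m" using u(2)
    by (intro LIMSEQ_le[of "\<lambda>n. J (u n)"]) (auto simp: less_imp_le)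
  \<comment> \<open>First variation at the minimiser: J does not fall below its value at \<eta> when
    c \<zeta> is added, for any complex c, and \<open>cs_scalar\<close> with a = 0 makes the linear
    term vanish.\<close>
  have "f \<zeta> = hinner H \<zeta> \<eta>" if \<zeta>: "\<zeta> \<in> carrier H" for \<zeta>
  proof -
    have "0 \<le> 0 + 2 * Re (c * (hinner H \<zeta> \<eta> - f \<zeta>)) + (cmod c)\<^sup>2 * (hnorm H \<zeta>)\<^sup>2" for c
      using m[of "\<eta> \<oplus>\<^bsub>H\<^esub> c \<odot>\<^bsub>H\<^esub> \<zeta>"] J\<eta> \<eta>c \<zeta> by (simp add: J_def hinner_expand add smult algebra_simps)
    hence "(cmod (hinner H \<zeta> \<eta> - f \<zeta>))\<^sup>2 \<le> 0 * (hnorm H \<zeta>)\<^sup>2" by (rule cs_scalar) simp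
    thus ?thesis by simp
  qed
  thus ?thesis using \<eta>c by blast
qed

end

section \<open>Bounded families of operators\<close>

lemma bounded_opsD:
  assumes "T \<in> bounded_ops H K"
  shows "T \<in> extensional (carrier H)" "\<xi> \<in> carrier H \<Longrightarrow> T \<xi> \<in> carrier K"
    "\<lbrakk>\<xi> \<in> carrier H; \<eta> \<in> carrier H\<rbrakk> \<Longrightarrow> T (\<xi> \<oplus>\<^bsub>H\<^esub> \<eta>) = T \<xi> \<oplus>\<^bsub>K\<^esub> T \<eta>"
    "\<xi> \<in> carrier H \<Longrightarrow> T (c \<odot>\<^bsub>H\<^esub> \<xi>) = c \<odot>\<^bsub>K\<^esub> T \<xi>"
    "\<exists>B. \<forall>\<xi>\<in>carrier H. hnorm K (T \<xi>) \<le> B * hnorm H \<xi>"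
  using assms by (auto simp: bounded_ops_def PiE_def)

text \<open>\<open>op_norm\<close> is a supremum over the closed unit ball. The zero vector keeps
  the set nonempty on every space and boundedness of T keeps it bounded; normalising a nonzero
  vector then gives the usual estimate.\<close>

lemma op_norm_props:
  assumes H: "hilbert_space H" and K: "hilbert_space K" and T: "T \<in> bounded_ops H K"
  shows op_norm_bound: "\<xi> \<in> carrier H \<Longrightarrow> hnorm K (T \<xi>) \<le> op_norm H K T * hnorm H \<xi>"
    and op_norm_nonneg: "0 \<le> op_norm H K T"
    and op_norm_le: "\<lbrakk>0 \<le> B; \<And>\<xi>. \<xi> \<in> carrier H \<Longrightarrow> hnorm K (T \<xi>) \<le> B * hnorm H \<xi>\<rbrakk> \<Longrightarrow> op_norm H K T \<le> B"
proof -
  interpret H: hilbert_space H by fact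
  interpret K: hilbert_space K by fact
  note T = bounded_opsD[OF T]
  define S where "S = {hnorm K (T \<xi>) | \<xi>. \<xi> \<in> carrier H \<and> hnorm H \<xi> \<le> 1}"
  have SS: "op_norm H K T = Sup S" by (simp add: op_norm_def S_def)
  have T0: "T \<zero>\<^bsub>H\<^esub> = \<zero>\<^bsub>K\<^esub>" using T(4)[of "\<zero>\<^bsub>H\<^esub>" 0] T(2)[of "\<zero>\<^bsub>H\<^esub>"] by simp
  have S0: "0 \<in> S" unfolding S_def using T0 by (auto intro!: exI[of _ "\<zero>\<^bsub>H\<^esub>"])
  obtain C where C: "\<And>\<xi>. \<xi> \<in> carrier H \<Longrightarrow> hnorm K (T \<xi>) \<le> C * hnorm H \<xi>" using T(5) by blast
  have upper: "s \<le> B" if sS: "s \<in> S" "0 \<le> B" "\<And>\<xi>. \<xi> \<in> carrier H \<Longrightarrow> hnorm K (T \<xi>) \<le> B * hnorm H \<xi>" for s B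
  proof -
    obtain \<xi> where \<xi>: "s = hnorm K (T \<xi>)" "\<xi> \<in> carrier H" "hnorm H \<xi> \<le> 1" using sS(1) unfolding S_def by blast
    have "B * hnorm H \<xi> \<le> B * 1" using \<xi> sS(2) by (intro mult_left_mono) auto
    thus ?thesis using \<xi>(1) sS(3)[OF \<xi>(2)] by simp
  qed
  have "C * hnorm H \<xi> \<le> \<bar>C\<bar> * hnorm H \<xi>" if "\<xi> \<in> carrier H" for \<xi> using that by (intro mult_right_mono) auto
  hence bdd: "bdd_above S" using upper[of _ "\<bar>C\<bar>"] C by (intro bdd_aboveI[of _ "\<bar>C\<bar>"]) (meson abs_ge_zero order_trans)
  show nn: "0 \<le> op_norm H K T" unfolding SS using S0 bdd by (rule cSup_upper)
  show "op_norm H K T \<le> B" if "0 \<le> B" "\<And>\<xi>. \<xi> \<in> carrier H \<Longrightarrow> hnorm K (T \<xi>) \<le> B * hnorm H \<xi>" for B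
    unfolding SS using S0 upper[OF _ that] by (intro cSup_least) auto
  show "hnorm K (T \<xi>) \<le> op_norm H K T * hnorm H \<xi>" if \<xi>: "\<xi> \<in> carrier H"
  proof (cases "hnorm H \<xi> = 0")
    case True
    hence "\<xi> = \<zero>\<^bsub>H\<^esub>" using H.N_eq_zero \<xi> by blast
    thus ?thesis using T0 by simp
  next
    case False
    hence pos: "hnorm H \<xi> > 0" using H.N_nonneg[OF \<xi>] by simp
    define c where "c = complex_of_real (1 / hnorm H \<xi>)"
    have c: "cmod c = 1 / hnorm H \<xi>" using pos by (simp add: c_def norm_divide)
    have "hnorm H (c \<odot>\<^bsub>H\<^esub> \<xi>) = 1" using pos \<xi> by (simp add: H.N_smult c)
    hence "hnorm K (T (c \<odot>\<^bsub>H\<^esub> \<xi>)) \<in> S" unfolding S_def using \<xi> by (auto intro!: exI[of _ "c \<odot>\<^bsub>H\<^esub> \<xi>"])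
    hence "hnorm K (T (c \<odot>\<^bsub>H\<^esub> \<xi>)) \<le> op_norm H K T" unfolding SS using bdd by (rule cSup_upper)
    hence "1 / hnorm H \<xi> * hnorm K (T \<xi>) \<le> op_norm H K T" using \<xi> T by (simp add: K.N_smult c)
    thus ?thesis using pos by (simp add: field_simps)
  qed
qed

text \<open>\<open>riesz\<close>, applied to the functional \<xi> \<mapsto> <T \<xi>, \<eta>>,
  yields the value at \<eta>; linearity and uniqueness hold since vectors are determined by inner
  products. This gives meaning to the definite description in \<open>adjoint_op\<close>.\<close>

lemma adjoint_exists:
  assumes H: "hilbert_space H" and K: "hilbert_space K" and T: "T \<in> bounded_ops H K"
  shows adjoint_op_bounded: "adjoint_op H K T \<in> bounded_ops K H"
    and adjoint_op_inner: "\<lbrakk>\<xi> \<in> carrier H; \<eta> \<in> carrier K\<rbrakk> \<Longrightarrow>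
      hinner K (T \<xi>) \<eta> = hinner H \<xi> (adjoint_op H K T \<eta>)"
    and adjoint_op_norm: "\<eta> \<in> carrier K \<Longrightarrow> hnorm H (adjoint_op H K T \<eta>) \<le> op_norm H K T * hnorm K \<eta>"
proof -
  interpret H: hilbert_space H by fact
  interpret K: hilbert_space K by fact
  note Tb = op_norm_props[OF H K T]
  note T = bounded_opsD[OF T]
  let ?B = "op_norm H K T"
  have "\<exists>\<zeta>\<in>carrier H. \<forall>\<xi>\<in>carrier H. hinner K (T \<xi>) \<eta> = hinner H \<xi> \<zeta>" if \<eta>: "\<eta> \<in> carrier K" for \<eta>
  proof (rule H.riesz)
    fix \<xi> assume \<xi>: "\<xi> \<in> carrier H"
    have "cmod (hinner K (T \<xi>) \<eta>) \<le> hnorm K (T \<xi>) * hnorm K \<eta>" using \<xi> \<eta> T by (intro K.cauchy_schwarz) auto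
    also have "\<dots> \<le> (?B * hnorm H \<xi>) * hnorm K \<eta>" using \<xi> \<eta> Tb by (intro mult_right_mono) auto
    finally show "cmod (hinner K (T \<xi>) \<eta>) \<le> (?B * hnorm K \<eta>) * hnorm H \<xi>" by (simp add: algebra_simps)
  qed (use T \<eta> in \<open>auto simp: K.hinner_add_left K.hinner_smult_left\<close>)
  then obtain S0 where S0: "\<And>\<eta>. \<eta> \<in> carrier K \<Longrightarrow> S0 \<eta> \<in> carrier H"
    "\<And>\<xi> \<eta>. \<eta> \<in> carrier K \<Longrightarrow> \<xi> \<in> carrier H \<Longrightarrow> hinner K (T \<xi>) \<eta> = hinner H \<xi> (S0 \<eta>)" by metis
  define S where "S = restrict S0 (carrier K)"
  have S: "S \<eta> \<in> carrier H" "\<And>\<xi>. \<xi> \<in> carrier H \<Longrightarrow> hinner K (T \<xi>) \<eta> = hinner H \<xi> (S \<eta>)"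
    if "\<eta> \<in> carrier K" for \<eta> using S0 that by (auto simp: S_def)
  \<comment> \<open>Write |S \<eta>|^2 as <T (S \<eta>), \<eta>> and divide by |S \<eta>|.\<close>
  have Sn: "hnorm H (S \<eta>) \<le> ?B * hnorm K \<eta>" if \<eta>: "\<eta> \<in> carrier K" for \<eta>
  proof -
    have "(hnorm H (S \<eta>))\<^sup>2 = Re (hinner K (T (S \<eta>)) \<eta>)" using S \<eta> by (simp add: H.hnorm_sq)
    also have "\<dots> \<le> hnorm K (T (S \<eta>)) * hnorm K \<eta>"
      by (rule order_trans[OF complex_Re_le_cmod K.cauchy_schwarz]) (use S T \<eta> in auto)
    also have "\<dots> \<le> ?B * hnorm H (S \<eta>) * hnorm K \<eta>" using S \<eta> Tb by (intro mult_right_mono) auto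
    finally have "hnorm H (S \<eta>) * hnorm H (S \<eta>) \<le> hnorm H (S \<eta>) * (?B * hnorm K \<eta>)"
      by (simp add: power2_eq_square algebra_simps)
    moreover have "0 \<le> ?B * hnorm K \<eta>" using Tb(2) \<eta> by simp
    ultimately show ?thesis using H.N_nonneg[OF S(1)[OF \<eta>]]
      by (cases "hnorm H (S \<eta>) = 0") (auto simp: mult_le_cancel_left)
  qed
  have SB: "S \<in> bounded_ops K H"
    unfolding bounded_ops_def
  proof (intro CollectI conjI ballI allI)
    show "S \<in> carrier K \<rightarrow>\<^sub>E carrier H" using S by (auto simp: S_def)
    show "\<exists>B. \<forall>\<xi>\<in>carrier K. hnorm H (S \<xi>) \<le> B * hnorm K \<xi>" using Sn by blast
  next
    fix \<eta> \<zeta> assume c: "\<eta> \<in> carrier K" "\<zeta> \<in> carrier K"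
    show "S (\<eta> \<oplus>\<^bsub>K\<^esub> \<zeta>) = S \<eta> \<oplus>\<^bsub>H\<^esub> S \<zeta>"
      using c S by (intro H.hinner_eqI_right) (auto simp: H.hinner_add_right K.hinner_add_right T S(2)[symmetric])
  next
    fix c \<eta> assume c: "\<eta> \<in> carrier K"
    show "S (c \<odot>\<^bsub>K\<^esub> \<eta>) = c \<odot>\<^bsub>H\<^esub> S \<eta>"
      using c S by (intro H.hinner_eqI_right) (auto simp: H.hinner_smult_right K.hinner_smult_right T S(2)[symmetric])
  qed
  have "adjoint_op H K T = S"
    unfolding adjoint_op_def
  proof (rule the_equality)
    show "S \<in> bounded_ops K H \<and> (\<forall>\<xi>\<in>carrier H. \<forall>\<eta>\<in>carrier K. hinner K (T \<xi>) \<eta> = hinner H \<xi> (S \<eta>))"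
      using SB S by auto
  next
    fix R assume R: "R \<in> bounded_ops K H \<and> (\<forall>\<xi>\<in>carrier H. \<forall>\<eta>\<in>carrier K. hinner K (T \<xi>) \<eta> = hinner H \<xi> (R \<eta>))"
    show "R = S"
    proof (rule extensionalityI)
      show "R \<in> extensional (carrier K)" using R bounded_opsD(1) by blast
      show "S \<in> extensional (carrier K)" using SB bounded_opsD(1) by blast
      fix \<eta> assume "\<eta> \<in> carrier K"
      thus "R \<eta> = S \<eta>" using R S bounded_opsD(2)[of R K H] by (intro H.hinner_eqI_right) auto
    qed
  qed
  thus "adjoint_op H K T \<in> bounded_ops K H"
    "\<lbrakk>\<xi> \<in> carrier H; \<eta> \<in> carrier K\<rbrakk> \<Longrightarrow> hinner K (T \<xi>) \<eta> = hinner H \<xi> (adjoint_op H K T \<eta>)"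
    "\<eta> \<in> carrier K \<Longrightarrow> hnorm H (adjoint_op H K T \<eta>) \<le> op_norm H K T * hnorm K \<eta>"
    using SB S Sn by auto
qed

text \<open>An index must exist because the norm of a family is a supremum over \<open>I\<close>,
  which carries no information for the empty set.\<close>

definition hfam :: "'i set \<Rightarrow> ('i \<Rightarrow> 'h hilbert) \<Rightarrow> bool" where
  "hfam I H \<longleftrightarrow> I \<noteq> {} \<and> (\<forall>i\<in>I. hilbert_space (H i))"

abbreviation ops :: "'i set \<Rightarrow> ('i \<Rightarrow> 'h hilbert) \<Rightarrow> ('i \<Rightarrow> 'h hilbert) \<Rightarrow> ('i \<Rightarrow> 'h \<Rightarrow> 'h) set" where
  "ops I H K \<equiv> carrier (op_families I H K)"

abbreviation fnorm :: "'i set \<Rightarrow> ('i \<Rightarrow> 'h hilbert) \<Rightarrow> ('i \<Rightarrow> 'h hilbert) \<Rightarrow> ('i \<Rightarrow> 'h \<Rightarrow> 'h) \<Rightarrow> real" where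
  "fnorm I H K \<equiv> cnorm (op_families I H K)"

text \<open>The product in \<open>op_families I H K\<close> mentions only the domain H. Under its
  own name it also composes operators between three different families of spaces.\<close>

definition opcomp :: "'i set \<Rightarrow> ('i \<Rightarrow> 'h hilbert) \<Rightarrow> ('i \<Rightarrow> 'h \<Rightarrow> 'h) \<Rightarrow> ('i \<Rightarrow> 'h \<Rightarrow> 'h) \<Rightarrow> 'i \<Rightarrow> 'h \<Rightarrow> 'h" where
  "opcomp I H f g = (\<lambda>i\<in>I. compose (carrier (H i)) (f i) (g i))"

definition fadj :: "'i set \<Rightarrow> ('i \<Rightarrow> 'h hilbert) \<Rightarrow> ('i \<Rightarrow> 'h hilbert) \<Rightarrow> ('i \<Rightarrow> 'h \<Rightarrow> 'h) \<Rightarrow> 'i \<Rightarrow> 'h \<Rightarrow> 'h" where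
  "fadj I H K f = (\<lambda>i\<in>I. adjoint_op (H i) (K i) (f i))"

lemma op_families_mult: "mult (op_families I H K) = opcomp I H"
  by (simp add: op_families_def opcomp_def fun_eq_iff)

lemma op_families_invol: "invol (op_families I H K) = fadj I H K"
  by (simp add: op_families_def fadj_def fun_eq_iff)

lemma op_families_vals:
  assumes "i \<in> I" "\<xi> \<in> carrier (H i)"
  shows "(f \<oplus>\<^bsub>op_families I H K\<^esub> g) i \<xi> = f i \<xi> \<oplus>\<^bsub>K i\<^esub> g i \<xi>"
    "(c \<odot>\<^bsub>op_families I H K\<^esub> f) i \<xi> = c \<odot>\<^bsub>K i\<^esub> f i \<xi>"
    "\<zero>\<^bsub>op_families I H K\<^esub> i \<xi> = \<zero>\<^bsub>K i\<^esub>"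
    "\<one>\<^bsub>op_families I H K\<^esub> i \<xi> = \<xi>"
    "opcomp I H f g i \<xi> = f i (g i \<xi>)"
  using assms by (simp_all add: op_families_def op_add_def op_smult_def op_zero_def opcomp_def compose_def)

lemma opsD:
  assumes f: "f \<in> ops I H K"
  shows "f \<in> extensional I" "i \<in> I \<Longrightarrow> f i \<in> bounded_ops (H i) (K i)"
    "i \<in> I \<Longrightarrow> f i \<in> extensional (carrier (H i))"
    "\<lbrakk>i \<in> I; \<xi> \<in> carrier (H i)\<rbrakk> \<Longrightarrow> f i \<xi> \<in> carrier (K i)"
    "\<lbrakk>i \<in> I; \<xi> \<in> carrier (H i); \<eta> \<in> carrier (H i)\<rbrakk> \<Longrightarrow> f i (\<xi> \<oplus>\<^bsub>H i\<^esub> \<eta>) = f i \<xi> \<oplus>\<^bsub>K i\<^esub> f i \<eta>"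
    "\<lbrakk>i \<in> I; \<xi> \<in> carrier (H i)\<rbrakk> \<Longrightarrow> f i (c \<odot>\<^bsub>H i\<^esub> \<xi>) = c \<odot>\<^bsub>K i\<^esub> f i \<xi>"
proof -
  show 1: "f \<in> extensional I" and 2: "i \<in> I \<Longrightarrow> f i \<in> bounded_ops (H i) (K i)" for i
    using f by (auto simp: op_families_def PiE_def)
  fix i
  show "i \<in> I \<Longrightarrow> f i \<in> extensional (carrier (H i))"
    "\<lbrakk>i \<in> I; \<xi> \<in> carrier (H i)\<rbrakk> \<Longrightarrow> f i \<xi> \<in> carrier (K i)"
    "\<lbrakk>i \<in> I; \<xi> \<in> carrier (H i); \<eta> \<in> carrier (H i)\<rbrakk> \<Longrightarrow> f i (\<xi> \<oplus>\<^bsub>H i\<^esub> \<eta>) = f i \<xi> \<oplus>\<^bsub>K i\<^esub> f i \<eta>"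
    "\<lbrakk>i \<in> I; \<xi> \<in> carrier (H i)\<rbrakk> \<Longrightarrow> f i (c \<odot>\<^bsub>H i\<^esub> \<xi>) = c \<odot>\<^bsub>K i\<^esub> f i \<xi>"
    using bounded_opsD[OF 2] by blast+
qed

lemma ops_eqI:
  assumes f: "f \<in> ops I H K" and g: "g \<in> ops I H K"
    and eq: "\<And>i \<xi>. i \<in> I \<Longrightarrow> \<xi> \<in> carrier (H i) \<Longrightarrow> f i \<xi> = g i \<xi>"
  shows "f = g"
proof (rule extensionalityI[OF opsD(1)[OF f] opsD(1)[OF g]])
  fix i assume i: "i \<in> I"
  show "f i = g i"
    by (rule extensionalityI[OF opsD(3)[OF f i] opsD(3)[OF g i]]) (rule eq[OF i])
qed

context
  fixes I :: "'i set" and H K :: "'i \<Rightarrow> 'h hilbert"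
  assumes H: "hfam I H" and K: "hfam I K"
begin

section \<open>Membership, norm and linear operations of operator families\<close>

lemma opsI:
  assumes "f \<in> extensional I" "\<And>i. i \<in> I \<Longrightarrow> f i \<in> extensional (carrier (H i))"
    "\<And>i \<xi>. \<lbrakk>i \<in> I; \<xi> \<in> carrier (H i)\<rbrakk> \<Longrightarrow> f i \<xi> \<in> carrier (K i)"
    "\<And>i \<xi> \<eta>. \<lbrakk>i \<in> I; \<xi> \<in> carrier (H i); \<eta> \<in> carrier (H i)\<rbrakk> \<Longrightarrow> f i (\<xi> \<oplus>\<^bsub>H i\<^esub> \<eta>) = f i \<xi> \<oplus>\<^bsub>K i\<^esub> f i \<eta>"
    "\<And>c i \<xi>. \<lbrakk>i \<in> I; \<xi> \<in> carrier (H i)\<rbrakk> \<Longrightarrow> f i (c \<odot>\<^bsub>H i\<^esub> \<xi>) = c \<odot>\<^bsub>K i\<^esub> f i \<xi>"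
    and B: "\<And>i \<xi>. \<lbrakk>i \<in> I; \<xi> \<in> carrier (H i)\<rbrakk> \<Longrightarrow> hnorm (K i) (f i \<xi>) \<le> B * hnorm (H i) \<xi>"
  shows "f \<in> ops I H K"
proof -
  have T: "f i \<in> bounded_ops (H i) (K i)" if "i \<in> I" for i
  proof -
    have "\<exists>B. \<forall>\<xi>\<in>carrier (H i). hnorm (K i) (f i \<xi>) \<le> B * hnorm (H i) \<xi>" using B[OF that] by blast
    thus ?thesis using assms that unfolding bounded_ops_def by (simp add: PiE_def Pi_def)
  qed
  \<comment> \<open>B may be negative when \<open>H i\<close> is the zero space, hence the absolute
    value.\<close>
  have "op_norm (H i) (K i) (f i) \<le> \<bar>B\<bar>" if i: "i \<in> I" for i
  proof -
    interpret Hi: hilbert_space "H i" using H i by (auto simp: hfam_def)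
    have "hnorm (K i) (f i \<xi>) \<le> \<bar>B\<bar> * hnorm (H i) \<xi>" if "\<xi> \<in> carrier (H i)" for \<xi>
      by (rule order_trans[OF B[OF i that] mult_right_mono]) (use Hi.N_nonneg[OF that] in auto)
    thus ?thesis using H K i T by (intro op_norm_le) (auto simp: hfam_def)
  qed
  hence "bdd_above ((\<lambda>i. op_norm (H i) (K i) (f i)) ` I)" by (auto intro!: bdd_aboveI2)
  thus ?thesis using T assms(1) by (auto simp: op_families_def PiE_def)
qed

lemma opsI_restrict:
  assumes "\<And>i \<xi>. \<lbrakk>i \<in> I; \<xi> \<in> carrier (H i)\<rbrakk> \<Longrightarrow> g i \<xi> \<in> carrier (K i)"
    "\<And>i \<xi> \<eta>. \<lbrakk>i \<in> I; \<xi> \<in> carrier (H i); \<eta> \<in> carrier (H i)\<rbrakk> \<Longrightarrow> g i (\<xi> \<oplus>\<^bsub>H i\<^esub> \<eta>) = g i \<xi> \<oplus>\<^bsub>K i\<^esub> g i \<eta>"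
    "\<And>c i \<xi>. \<lbrakk>i \<in> I; \<xi> \<in> carrier (H i)\<rbrakk> \<Longrightarrow> g i (c \<odot>\<^bsub>H i\<^esub> \<xi>) = c \<odot>\<^bsub>K i\<^esub> g i \<xi>"
    "\<And>i \<xi>. \<lbrakk>i \<in> I; \<xi> \<in> carrier (H i)\<rbrakk> \<Longrightarrow> hnorm (K i) (g i \<xi>) \<le> B * hnorm (H i) \<xi>"
  shows "(\<lambda>i\<in>I. \<lambda>\<xi>\<in>carrier (H i). g i \<xi>) \<in> ops I H K"
proof (rule opsI)
  fix i \<xi> \<eta> assume i: "i \<in> I" "\<xi> \<in> carrier (H i)" "\<eta> \<in> carrier (H i)"
  interpret Hi: hilbert_space "H i" using H i by (auto simp: hfam_def)
  show "(\<lambda>i\<in>I. \<lambda>\<xi>\<in>carrier (H i). g i \<xi>) i (\<xi> \<oplus>\<^bsub>H i\<^esub> \<eta>) =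
    (\<lambda>i\<in>I. \<lambda>\<xi>\<in>carrier (H i). g i \<xi>) i \<xi> \<oplus>\<^bsub>K i\<^esub> (\<lambda>i\<in>I. \<lambda>\<xi>\<in>carrier (H i). g i \<xi>) i \<eta>"
    using i assms by simp
next
  fix c i \<xi> assume i: "i \<in> I" "\<xi> \<in> carrier (H i)"
  interpret Hi: hilbert_space "H i" using H i by (auto simp: hfam_def)
  show "(\<lambda>i\<in>I. \<lambda>\<xi>\<in>carrier (H i). g i \<xi>) i (c \<odot>\<^bsub>H i\<^esub> \<xi>) =
    c \<odot>\<^bsub>K i\<^esub> (\<lambda>i\<in>I. \<lambda>\<xi>\<in>carrier (H i). g i \<xi>) i \<xi>"
    using i assms by simp
qed (use assms in auto)

lemma fnorm_bound:
  assumes f: "f \<in> ops I H K" and i: "i \<in> I" "\<xi> \<in> carrier (H i)"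
  shows "hnorm (K i) (f i \<xi>) \<le> fnorm I H K f * hnorm (H i) \<xi>"
proof -
  interpret Hi: hilbert_space "H i" using H i by (auto simp: hfam_def)
  have "op_norm (H i) (K i) (f i) \<le> fnorm I H K f"
    using f i by (auto simp: op_families_def intro!: cSUP_upper)
  hence "op_norm (H i) (K i) (f i) * hnorm (H i) \<xi> \<le> fnorm I H K f * hnorm (H i) \<xi>"
    using Hi.N_nonneg[OF i(2)] by (rule mult_right_mono)
  moreover have "hnorm (K i) (f i \<xi>) \<le> op_norm (H i) (K i) (f i) * hnorm (H i) \<xi>"
    using opsD(2)[OF f] i H K by (intro op_norm_bound) (auto simp: hfam_def)
  ultimately show ?thesis by simp
qed

lemma fnorm_le:
  assumes f: "f \<in> ops I H K" and "0 \<le> B"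
    "\<And>i \<xi>. \<lbrakk>i \<in> I; \<xi> \<in> carrier (H i)\<rbrakk> \<Longrightarrow> hnorm (K i) (f i \<xi>) \<le> B * hnorm (H i) \<xi>"
  shows "fnorm I H K f \<le> B"
proof -
  have "op_norm (H i) (K i) (f i) \<le> B" if "i \<in> I" for i
    using assms that H K opsD(2)[OF f] by (intro op_norm_le) (auto simp: hfam_def)
  thus ?thesis using H unfolding op_families_def by (auto simp: hfam_def intro!: cSUP_least)
qed

lemma fnorm_nonneg:
  assumes f: "f \<in> ops I H K" shows "0 \<le> fnorm I H K f"
proof -
  obtain i where i: "i \<in> I" using H by (auto simp: hfam_def)
  have "0 \<le> op_norm (H i) (K i) (f i)" using H K i by (intro op_norm_nonneg opsD(2)[OF f i]) (auto simp: hfam_def)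
  also have "\<dots> \<le> fnorm I H K f" using f i by (auto simp: op_families_def intro!: cSUP_upper)
  finally show ?thesis .
qed

lemma ops_zero: "\<zero>\<^bsub>op_families I H K\<^esub> \<in> ops I H K"
proof -
  have "(\<lambda>i\<in>I. \<lambda>\<xi>\<in>carrier (H i). \<zero>\<^bsub>K i\<^esub>) \<in> ops I H K"
  proof (rule opsI_restrict)
    fix c i \<xi> \<eta> assume i: "i \<in> I"
    interpret Ki: hilbert_space "K i" using K i by (auto simp: hfam_def)
    show "\<zero>\<^bsub>K i\<^esub> \<in> carrier (K i)" "\<zero>\<^bsub>K i\<^esub> = \<zero>\<^bsub>K i\<^esub> \<oplus>\<^bsub>K i\<^esub> \<zero>\<^bsub>K i\<^esub>" "\<zero>\<^bsub>K i\<^esub> = c \<odot>\<^bsub>K i\<^esub> \<zero>\<^bsub>K i\<^esub>"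
      "hnorm (K i) \<zero>\<^bsub>K i\<^esub> \<le> 0 * hnorm (H i) \<xi>" by simp_all
  qed
  thus ?thesis by (simp add: op_families_def op_zero_def)
qed

lemma ops_add:
  assumes f: "f \<in> ops I H K" and g: "g \<in> ops I H K"
  shows "f \<oplus>\<^bsub>op_families I H K\<^esub> g \<in> ops I H K"
proof -
  have "(\<lambda>i\<in>I. \<lambda>\<xi>\<in>carrier (H i). f i \<xi> \<oplus>\<^bsub>K i\<^esub> g i \<xi>) \<in> ops I H K"
  proof (rule opsI_restrict)
    fix c i \<xi> assume i: "i \<in> I" "\<xi> \<in> carrier (H i)"
    interpret Ki: hilbert_space "K i" using K i by (auto simp: hfam_def)
    note [simp] = opsD[OF f] opsD[OF g] i
    show "f i \<xi> \<oplus>\<^bsub>K i\<^esub> g i \<xi> \<in> carrier (K i)" by simp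
    show "f i (c \<odot>\<^bsub>H i\<^esub> \<xi>) \<oplus>\<^bsub>K i\<^esub> g i (c \<odot>\<^bsub>H i\<^esub> \<xi>) = c \<odot>\<^bsub>K i\<^esub> (f i \<xi> \<oplus>\<^bsub>K i\<^esub> g i \<xi>)"
      by (simp add: Ki.smult_rdist)
    show "hnorm (K i) (f i \<xi> \<oplus>\<^bsub>K i\<^esub> g i \<xi>) \<le> (fnorm I H K f + fnorm I H K g) * hnorm (H i) \<xi>"
      using Ki.N_triangle[of "f i \<xi>" "g i \<xi>"] fnorm_bound[OF f i] fnorm_bound[OF g i] by (simp add: distrib_right)
    fix \<eta> assume [simp]: "\<eta> \<in> carrier (H i)"
    show "f i (\<xi> \<oplus>\<^bsub>H i\<^esub> \<eta>) \<oplus>\<^bsub>K i\<^esub> g i (\<xi> \<oplus>\<^bsub>H i\<^esub> \<eta>) = (f i \<xi> \<oplus>\<^bsub>K i\<^esub> g i \<xi>) \<oplus>\<^bsub>K i\<^esub> (f i \<eta> \<oplus>\<^bsub>K i\<^esub> g i \<eta>)"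
      by (simp add: Ki.M.a_ac)
  qed
  thus ?thesis by (simp add: op_families_def op_add_def)
qed

lemma ops_smult:
  assumes f: "f \<in> ops I H K"
  shows "c \<odot>\<^bsub>op_families I H K\<^esub> f \<in> ops I H K"
proof -
  have "(\<lambda>i\<in>I. \<lambda>\<xi>\<in>carrier (H i). c \<odot>\<^bsub>K i\<^esub> f i \<xi>) \<in> ops I H K"
  proof (rule opsI_restrict)
    fix d i \<xi> assume i: "i \<in> I" "\<xi> \<in> carrier (H i)"
    interpret Ki: hilbert_space "K i" using K i by (auto simp: hfam_def)
    note [simp] = opsD[OF f] i
    show "c \<odot>\<^bsub>K i\<^esub> f i \<xi> \<in> carrier (K i)" by simp
    show "c \<odot>\<^bsub>K i\<^esub> f i (d \<odot>\<^bsub>H i\<^esub> \<xi>) = d \<odot>\<^bsub>K i\<^esub> (c \<odot>\<^bsub>K i\<^esub> f i \<xi>)"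
      by (simp add: Ki.smult_smult mult.commute)
    show "hnorm (K i) (c \<odot>\<^bsub>K i\<^esub> f i \<xi>) \<le> (cmod c * fnorm I H K f) * hnorm (H i) \<xi>"
      using fnorm_bound[OF f i] by (simp add: Ki.N_smult mult.assoc mult_left_mono)
    fix \<eta> assume [simp]: "\<eta> \<in> carrier (H i)"
    show "c \<odot>\<^bsub>K i\<^esub> f i (\<xi> \<oplus>\<^bsub>H i\<^esub> \<eta>) = c \<odot>\<^bsub>K i\<^esub> f i \<xi> \<oplus>\<^bsub>K i\<^esub> c \<odot>\<^bsub>K i\<^esub> f i \<eta>"
      by (simp add: Ki.smult_rdist)
  qed
  thus ?thesis by (simp add: op_families_def op_smult_def)
qed

lemma fadj_props:
  assumes f: "f \<in> ops I H K"
  shows fadj_closed: "fadj I H K f \<in> ops I K H"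
    and fadj_inner: "\<lbrakk>i \<in> I; \<xi> \<in> carrier (H i); \<eta> \<in> carrier (K i)\<rbrakk> \<Longrightarrow>
      hinner (K i) (f i \<xi>) \<eta> = hinner (H i) \<xi> (fadj I H K f i \<eta>)"
    and fadj_norm: "fnorm I K H (fadj I H K f) \<le> fnorm I H K f"
proof -
  have HK: "hilbert_space (H i)" "hilbert_space (K i)" if "i \<in> I" for i using H K that by (auto simp: hfam_def)
  show inn: "hinner (K i) (f i \<xi>) \<eta> = hinner (H i) \<xi> (fadj I H K f i \<eta>)"
    if "i \<in> I" "\<xi> \<in> carrier (H i)" "\<eta> \<in> carrier (K i)" for i \<xi> \<eta>
    using adjoint_op_inner[OF HK opsD(2)[OF f]] that by (simp add: fadj_def)
  have n: "op_norm (K i) (H i) (adjoint_op (H i) (K i) (f i)) \<le> fnorm I H K f" if i: "i \<in> I" for i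
  proof -
    have "op_norm (K i) (H i) (adjoint_op (H i) (K i) (f i)) \<le> op_norm (H i) (K i) (f i)"
      using adjoint_exists[OF HK[OF i] opsD(2)[OF f i]] op_norm_nonneg[OF HK[OF i] opsD(2)[OF f i]] HK[OF i]
      by (intro op_norm_le) auto
    also have "\<dots> \<le> fnorm I H K f" using f i by (auto simp: op_families_def intro!: cSUP_upper)
    finally show ?thesis .
  qed
  show "fadj I H K f \<in> ops I K H"
    using adjoint_op_bounded[OF HK opsD(2)[OF f]] n
    by (auto simp: op_families_def fadj_def PiE_def intro!: bdd_aboveI2)
  show "fnorm I K H (fadj I H K f) \<le> fnorm I H K f"
    using n H unfolding op_families_def fadj_def by (auto simp: hfam_def intro!: cSUP_least)
qed

lemma ops_eqI_inner:
  assumes f: "f \<in> ops I H K" and g: "g \<in> ops I H K"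
    and eq: "\<And>i \<xi> \<eta>. \<lbrakk>i \<in> I; \<xi> \<in> carrier (H i); \<eta> \<in> carrier (K i)\<rbrakk> \<Longrightarrow>
      hinner (K i) (f i \<xi>) \<eta> = hinner (K i) (g i \<xi>) \<eta>"
  shows "f = g"
proof (rule ops_eqI[OF f g])
  fix i \<xi> assume i: "i \<in> I" "\<xi> \<in> carrier (H i)"
  interpret Ki: hilbert_space "K i" using K i by (auto simp: hfam_def)
  show "f i \<xi> = g i \<xi>" using opsD(4)[OF f i] opsD(4)[OF g i] eq[OF i] by (rule Ki.hinner_eqI)
qed

end

context
  fixes I :: "'i set" and H K :: "'i \<Rightarrow> 'h hilbert"
  assumes H: "hfam I H" and K: "hfam I K"
begin

lemma fadj_inner':
  assumes f: "f \<in> ops I H K" and "i \<in> I" "\<xi> \<in> carrier (H i)" "\<eta> \<in> carrier (K i)"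
  shows "hinner (H i) (fadj I H K f i \<eta>) \<xi> = hinner (K i) \<eta> (f i \<xi>)"
proof -
  interpret Hi: hilbert_space "H i" using H assms by (auto simp: hfam_def)
  interpret Ki: hilbert_space "K i" using K assms by (auto simp: hfam_def)
  show ?thesis
    using fadj_inner[OF H K f assms(2-)] Hi.hinner_commute[of \<xi> "fadj I H K f i \<eta>"]
      Ki.hinner_commute[of "f i \<xi>" \<eta>] opsD(4)[OF f assms(2,3)] opsD(4)[OF fadj_closed[OF H K f] assms(2,4)] assms(3,4)
    by simp
qed

text \<open>The source of the algebraic rules for adjoints below: a candidate only has to satisfy
  the inner product identity, with no reference to \<open>adjoint_op\<close>.\<close>

lemma fadj_unique:
  assumes f: "f \<in> ops I H K" and g: "g \<in> ops I K H"
    and eq: "\<And>i \<xi> \<eta>. \<lbrakk>i \<in> I; \<xi> \<in> carrier (H i); \<eta> \<in> carrier (K i)\<rbrakk> \<Longrightarrow>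
      hinner (H i) (g i \<eta>) \<xi> = hinner (K i) \<eta> (f i \<xi>)"
  shows "fadj I H K f = g"
  by (rule ops_eqI_inner[OF K H fadj_closed[OF H K f] g]) (simp add: fadj_inner'[OF f] eq)

end

lemma fadj_fadj:
  assumes H: "hfam I H" and K: "hfam I K" and f: "f \<in> ops I H K"
  shows "fadj I K H (fadj I H K f) = f"
proof (rule fadj_unique[OF K H fadj_closed[OF H K f] f])
  fix i \<xi> \<eta> assume "i \<in> I" "\<xi> \<in> carrier (K i)" "\<eta> \<in> carrier (H i)"
  thus "hinner (K i) (f i \<eta>) \<xi> = hinner (H i) \<eta> (fadj I H K f i \<xi>)"
    using fadj_inner[OF H K f] by simp
qed

lemma hfamD: "hfam I H \<Longrightarrow> i \<in> I \<Longrightarrow> hilbert_space (H i)"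
  by (simp add: hfam_def)

lemma hilbert_space_cmodule: "hilbert_space H \<Longrightarrow> cmodule H"
  by (simp add: hilbert_space_def cmodule_def)

lemma opcomp_props:
  assumes H: "hfam I H" and K: "hfam I K" and L: "hfam I L"
    and f: "f \<in> ops I K L" and g: "g \<in> ops I H K"
  shows opcomp_closed: "opcomp I H f g \<in> ops I H L"
    and opcomp_norm: "fnorm I H L (opcomp I H f g) \<le> fnorm I K L f * fnorm I H K g"
proof -
  have b: "hnorm (L i) (f i (g i \<xi>)) \<le> (fnorm I K L f * fnorm I H K g) * hnorm (H i) \<xi>"
    if i: "i \<in> I" "\<xi> \<in> carrier (H i)" for i \<xi>
  proof -
    have "hnorm (L i) (f i (g i \<xi>)) \<le> fnorm I K L f * hnorm (K i) (g i \<xi>)"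
      using fnorm_bound[OF K L f i(1) opsD(4)[OF g i]] .
    also have "\<dots> \<le> fnorm I K L f * (fnorm I H K g * hnorm (H i) \<xi>)"
      using fnorm_bound[OF H K g i] fnorm_nonneg[OF K L f] by (rule mult_left_mono)
    finally show ?thesis by (simp only: mult.assoc)
  qed
  have "(\<lambda>i\<in>I. \<lambda>\<xi>\<in>carrier (H i). f i (g i \<xi>)) \<in> ops I H L"
    by (rule opsI_restrict[OF H L _ _ _ b]) (simp_all add: opsD[OF f] opsD[OF g])
  thus m: "opcomp I H f g \<in> ops I H L" by (simp add: opcomp_def compose_def)
  show "fnorm I H L (opcomp I H f g) \<le> fnorm I K L f * fnorm I H K g"
    using fnorm_nonneg[OF K L f] fnorm_nonneg[OF H K g] b
    by (intro fnorm_le[OF H L m]) (simp_all add: op_families_vals)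
qed

text \<open>The laws hold vector by vector. Only homogeneity of the norm needs more, since
  estimating vectors gives just one inequality.\<close>

lemma ops_normed_module:
  assumes H: "hfam I H" and K: "hfam I K"
  shows "normed_module (op_families I H K) (fnorm I H K)"
proof -
  let ?M = "op_families I H K"
  note HK = H K
  note v = op_families_vals
  have Ki: "cmodule (K i)" "hilbert_space (K i)" if "i \<in> I" for i
    using hfamD[OF K that] by (auto intro: hilbert_space_cmodule)
  have Ka: "abelian_group (K i)" if "i \<in> I" for i
    using Ki(1)[OF that] by (simp add: cmodule_def module_def)
  have mod: "module complex_ring ?M"
  proof (rule cmoduleI)
    fix x y z assume x: "x \<in> ops I H K" and y: "y \<in> ops I H K" and z: "z \<in> ops I H K"
    show "x \<oplus>\<^bsub>?M\<^esub> y \<oplus>\<^bsub>?M\<^esub> z = x \<oplus>\<^bsub>?M\<^esub> (y \<oplus>\<^bsub>?M\<^esub> z)"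
      by (rule ops_eqI[of _ I H K]) (simp_all add: ops_add[OF HK] x y z v opsD(4)[OF x] opsD(4)[OF y] opsD(4)[OF z]
        abelian_groupE(3)[OF Ka])
  next
    fix x y assume x: "x \<in> ops I H K" and y: "y \<in> ops I H K"
    show "x \<oplus>\<^bsub>?M\<^esub> y \<in> ops I H K" using ops_add[OF HK x y] .
    show "x \<oplus>\<^bsub>?M\<^esub> y = y \<oplus>\<^bsub>?M\<^esub> x"
      by (rule ops_eqI[of _ I H K]) (simp_all add: ops_add[OF HK] x y v, metis opsD(4)[OF x] opsD(4)[OF y] abelian_groupE(4)[OF Ka])
    show "c \<odot>\<^bsub>?M\<^esub> (x \<oplus>\<^bsub>?M\<^esub> y) = c \<odot>\<^bsub>?M\<^esub> x \<oplus>\<^bsub>?M\<^esub> c \<odot>\<^bsub>?M\<^esub> y" for c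
      by (rule ops_eqI[of _ I H K]) (simp_all add: ops_add[OF HK] ops_smult[OF HK] x y v opsD(4)[OF x] opsD(4)[OF y]
        cmodule.smult_rdist[OF Ki(1)])
  next
    fix x assume x: "x \<in> ops I H K"
    show "\<zero>\<^bsub>?M\<^esub> \<oplus>\<^bsub>?M\<^esub> x = x"
      by (rule ops_eqI[of _ I H K]) (simp_all add: ops_add[OF HK] ops_zero[OF HK] x v opsD(4)[OF x] abelian_groupE(5)[OF Ka])
    show "c \<odot>\<^bsub>?M\<^esub> x \<in> ops I H K" for c using ops_smult[OF HK x] .
    show "(c + d) \<odot>\<^bsub>?M\<^esub> x = c \<odot>\<^bsub>?M\<^esub> x \<oplus>\<^bsub>?M\<^esub> d \<odot>\<^bsub>?M\<^esub> x" for c d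
      by (rule ops_eqI[of _ I H K]) (simp_all add: ops_add[OF HK] ops_smult[OF HK] x v opsD(4)[OF x] cmodule.smult_ldist[OF Ki(1)])
    show "(c * d) \<odot>\<^bsub>?M\<^esub> x = c \<odot>\<^bsub>?M\<^esub> (d \<odot>\<^bsub>?M\<^esub> x)" for c d
      by (rule ops_eqI[of _ I H K]) (simp_all add: ops_smult[OF HK] x v opsD(4)[OF x] cmodule.smult_smult[OF Ki(1)])
    show "1 \<odot>\<^bsub>?M\<^esub> x = x"
      by (rule ops_eqI[of _ I H K]) (simp_all add: ops_smult[OF HK] x v opsD(4)[OF x] cmodule.smult_1[OF Ki(1)])
    show "0 \<odot>\<^bsub>?M\<^esub> x = \<zero>\<^bsub>?M\<^esub>"
      by (rule ops_eqI[of _ I H K]) (simp_all add: ops_smult[OF HK] ops_zero[OF HK] x v opsD(4)[OF x] cmodule.smult_0[OF Ki(1)])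
  qed (rule ops_zero[OF HK])
  interpret M: cmodule ?M using mod by (simp add: cmodule_def)
  have sm: "fnorm I H K (c \<odot>\<^bsub>?M\<^esub> a) \<le> cmod c * fnorm I H K a" if a: "a \<in> ops I H K" for c a
  proof (rule fnorm_le[OF HK ops_smult[OF HK a]])
    fix i \<xi> assume i: "i \<in> I" "\<xi> \<in> carrier (H i)"
    interpret Ki: hilbert_space "K i" using Ki i by blast
    show "hnorm (K i) ((c \<odot>\<^bsub>?M\<^esub> a) i \<xi>) \<le> cmod c * fnorm I H K a * hnorm (H i) \<xi>"
      using fnorm_bound[OF HK a i] opsD(4)[OF a i] i by (simp add: v Ki.N_smult mult_left_mono mult.assoc)
  qed (use fnorm_nonneg[OF HK a] in simp)
  show ?thesis
  proof unfold_locales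
    fix a assume a: "a \<in> ops I H K"
    show "(fnorm I H K a = 0) = (a = \<zero>\<^bsub>?M\<^esub>)"
    proof
      assume n0: "fnorm I H K a = 0"
      show "a = \<zero>\<^bsub>?M\<^esub>"
      proof (rule ops_eqI[OF a ops_zero[OF HK]])
        fix i \<xi> assume i: "i \<in> I" "\<xi> \<in> carrier (H i)"
        interpret Ki: hilbert_space "K i" using Ki i by blast
        have "hnorm (K i) (a i \<xi>) = 0"
          using fnorm_bound[OF HK a i] n0 Ki.N_nonneg[OF opsD(4)[OF a i]] by simp
        thus "a i \<xi> = \<zero>\<^bsub>?M\<^esub> i \<xi>" using Ki.N_eq_zero[OF opsD(4)[OF a i]] i by (simp add: v)
      qed
    next
      assume "a = \<zero>\<^bsub>?M\<^esub>"
      hence "a = 0 \<odot>\<^bsub>?M\<^esub> a" using a by simp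
      hence "fnorm I H K a \<le> cmod 0 * fnorm I H K a" using sm[OF a, of 0] by simp
      thus "fnorm I H K a = 0" using fnorm_nonneg[OF HK a] by simp
    qed
    fix c show "fnorm I H K (c \<odot>\<^bsub>?M\<^esub> a) = cmod c * fnorm I H K a"
    proof (cases "c = 0")
      case True
      thus ?thesis using sm[OF a, of 0] fnorm_nonneg[OF HK ops_smult[OF HK a]] by (metis dual_order.antisym mult_zero_left norm_zero)
    next
      case False
      \<comment> \<open>The reverse inequality is the first one for the scalar 1/c.\<close>
      have "fnorm I H K ((1 / c) \<odot>\<^bsub>?M\<^esub> (c \<odot>\<^bsub>?M\<^esub> a)) \<le> cmod (1 / c) * fnorm I H K (c \<odot>\<^bsub>?M\<^esub> a)"
        using a by (intro sm) simp
      hence "cmod c * fnorm I H K a \<le> fnorm I H K (c \<odot>\<^bsub>?M\<^esub> a)"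
        using a False by (simp add: M.smult_smult norm_divide field_simps)
      thus ?thesis using sm[OF a, of c] by simp
    qed
  next
    fix a b assume a: "a \<in> ops I H K" and b: "b \<in> ops I H K"
    show "fnorm I H K (a \<oplus>\<^bsub>?M\<^esub> b) \<le> fnorm I H K a + fnorm I H K b"
    proof (rule fnorm_le[OF HK ops_add[OF HK a b]])
      fix i \<xi> assume i: "i \<in> I" "\<xi> \<in> carrier (H i)"
      interpret Ki: hilbert_space "K i" using Ki i by blast
      show "hnorm (K i) ((a \<oplus>\<^bsub>?M\<^esub> b) i \<xi>) \<le> (fnorm I H K a + fnorm I H K b) * hnorm (H i) \<xi>"
        using fnorm_bound[OF HK a i] fnorm_bound[OF HK b i] Ki.N_triangle[OF opsD(4)[OF a i] opsD(4)[OF b i]] i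
        by (simp add: v distrib_right)
    qed (use fnorm_nonneg[OF HK a] fnorm_nonneg[OF HK b] in simp)
  qed
qed

lemma op_families_minus:
  assumes H: "hfam I H" and K: "hfam I K" and f: "f \<in> ops I H K" and g: "g \<in> ops I H K"
    and i: "i \<in> I" "\<xi> \<in> carrier (H i)"
  shows "(f \<ominus>\<^bsub>op_families I H K\<^esub> g) i \<xi> = f i \<xi> \<ominus>\<^bsub>K i\<^esub> g i \<xi>"
proof -
  interpret M: normed_module "op_families I H K" "fnorm I H K" using ops_normed_module[OF H K] .
  interpret Ki: hilbert_space "K i" using hfamD[OF K i(1)] .
  show ?thesis using f g i by (simp add: M.minus_conv Ki.minus_conv opsD[OF f] opsD[OF g] op_families_vals)
qed

lemma op_families_finsum:
  assumes H: "hfam I H" and K: "hfam I K" and f: "\<And>j. j \<in> J \<Longrightarrow> f j \<in> ops I H K"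
    and i: "i \<in> I" "\<xi> \<in> carrier (H i)"
  shows "(\<Oplus>\<^bsub>op_families I H K\<^esub>j\<in>J. f j) i \<xi> = (\<Oplus>\<^bsub>K i\<^esub>j\<in>J. f j i \<xi>)"
proof -
  interpret M: normed_module "op_families I H K" "fnorm I H K" using ops_normed_module[OF H K] .
  interpret Ki: hilbert_space "K i" using hfamD[OF K i(1)] .
  show ?thesis
    by (rule finsum_hom[where f = "\<lambda>f. f i \<xi>", OF M.M.abelian_monoid_axioms Ki.M.abelian_monoid_axioms])
      (simp_all add: op_families_vals i opsD(4) f)
qed

text \<open>The Cauchy condition is uniform over all indices and unit balls. Pointwise limits
  therefore form a bounded family and are approached in the supremum norm.\<close>

lemma ops_complete:
  assumes H: "hfam I H" and K: "hfam I K"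
  shows "norm_complete (op_families I H K) (fnorm I H K)"
  unfolding norm_complete_def
proof (intro allI impI)
  let ?M = "op_families I H K" and ?N = "fnorm I H K"
  fix u :: "nat \<Rightarrow> 'a \<Rightarrow> 'b \<Rightarrow> 'b"
  assume "range u \<subseteq> ops I H K"
    and Cau: "\<forall>\<epsilon>>0. \<exists>n0. \<forall>m\<ge>n0. \<forall>n\<ge>n0. ?N (u m \<ominus>\<^bsub>?M\<^esub> u n) < \<epsilon>"
  hence u: "u n \<in> ops I H K" for n by auto
  interpret M: normed_module ?M ?N using ops_normed_module[OF H K] .
  have diff: "hnorm (K i) (u m i \<xi> \<ominus>\<^bsub>K i\<^esub> u n i \<xi>) \<le> ?N (u m \<ominus>\<^bsub>?M\<^esub> u n) * hnorm (H i) \<xi>"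
    if "i \<in> I" "\<xi> \<in> carrier (H i)" for i \<xi> m n
    using fnorm_bound[OF H K M.M.minus_closed[OF u u] that, of m n] op_families_minus[OF H K u u that] by simp
  have "\<exists>a. normed_module.tends (K i) (hnorm (K i)) (\<lambda>n. u n i \<xi>) a" if i: "i \<in> I" "\<xi> \<in> carrier (H i)" for i \<xi>
  proof -
    interpret Hi: hilbert_space "H i" using hfamD[OF H i(1)] .
    interpret Ki: hilbert_space "K i" using hfamD[OF K i(1)] .
    show ?thesis
    proof (rule Ki.Cauchy_tends)
      show "u n i \<xi> \<in> carrier (K i)" for n using opsD(4)[OF u i] .
      fix e :: real assume e: "e > 0"
      have nn: "0 \<le> hnorm (H i) \<xi>" using i by simp
      hence "e / (hnorm (H i) \<xi> + 1) > 0" using e by simp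
      then obtain n0 where n0: "\<forall>m\<ge>n0. \<forall>n\<ge>n0. ?N (u m \<ominus>\<^bsub>?M\<^esub> u n) < e / (hnorm (H i) \<xi> + 1)" using Cau by blast
      have "hnorm (K i) (u m i \<xi> \<ominus>\<^bsub>K i\<^esub> u n i \<xi>) < e" if "m \<ge> n0" "n \<ge> n0" for m n
      proof -
        have "hnorm (K i) (u m i \<xi> \<ominus>\<^bsub>K i\<^esub> u n i \<xi>) \<le> ?N (u m \<ominus>\<^bsub>?M\<^esub> u n) * hnorm (H i) \<xi>" by (rule diff[OF i])
        also have "\<dots> \<le> e / (hnorm (H i) \<xi> + 1) * hnorm (H i) \<xi>" using n0 that nn by (intro mult_right_mono) (auto simp: less_imp_le)
        also have "\<dots> < e" using e nn by (simp add: field_simps)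
        finally show ?thesis .
      qed
      thus "\<exists>n0. \<forall>m\<ge>n0. \<forall>n\<ge>n0. hnorm (K i) (u m i \<xi> \<ominus>\<^bsub>K i\<^esub> u n i \<xi>) < e" by blast
    qed
  qed
  then obtain g where g: "\<And>i \<xi>. i \<in> I \<Longrightarrow> \<xi> \<in> carrier (H i) \<Longrightarrow>
      normed_module.tends (K i) (hnorm (K i)) (\<lambda>n. u n i \<xi>) (g i \<xi>)" by metis
  \<comment> \<open>Let m tend to infinity in the estimate for u n - u m at a fixed vector; the
    factor e depends on neither the index nor the vector.\<close>
  have close: "hnorm (K i) (u n i \<xi> \<ominus>\<^bsub>K i\<^esub> g i \<xi>) \<le> e * hnorm (H i) \<xi>"
    if i: "i \<in> I" "\<xi> \<in> carrier (H i)" and n: "\<And>m. m \<ge> n0 \<Longrightarrow> ?N (u n \<ominus>\<^bsub>?M\<^esub> u m) < e" for i \<xi> n n0 e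
  proof -
    interpret Hi: hilbert_space "H i" using hfamD[OF H i(1)] .
    interpret Ki: hilbert_space "K i" using hfamD[OF K i(1)] .
    have "(\<lambda>m. hnorm (K i) (u n i \<xi> \<ominus>\<^bsub>K i\<^esub> u m i \<xi>)) \<longlonglongrightarrow> hnorm (K i) (u n i \<xi> \<ominus>\<^bsub>K i\<^esub> g i \<xi>)"
      by (intro Ki.tends_N Ki.tends_minus Ki.tends_const opsD(4)[OF u i] g[OF i])
    moreover have "hnorm (K i) (u n i \<xi> \<ominus>\<^bsub>K i\<^esub> u m i \<xi>) \<le> e * hnorm (H i) \<xi>" if "m \<ge> n0" for m
      using diff[OF i, of n m] n[OF that] Hi.N_nonneg[OF i(2)] by (meson less_imp_le mult_right_mono order_trans)
    ultimately show ?thesis by (intro LIMSEQ_le_const2) auto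
  qed
  let ?g = "\<lambda>i\<in>I. \<lambda>\<xi>\<in>carrier (H i). g i \<xi>"
  obtain n1 where n1: "\<And>m n. m \<ge> n1 \<Longrightarrow> n \<ge> n1 \<Longrightarrow> ?N (u m \<ominus>\<^bsub>?M\<^esub> u n) < 1" using Cau[rule_format, of 1] by auto
  have G: "?g \<in> ops I H K"
  proof (rule opsI_restrict[OF H K])
    fix i \<xi> assume i: "i \<in> I" "\<xi> \<in> carrier (H i)"
    interpret Hi: hilbert_space "H i" using hfamD[OF H i(1)] .
    interpret Ki: hilbert_space "K i" using hfamD[OF K i(1)] .
    show gc: "g i \<xi> \<in> carrier (K i)" using Ki.tendsD(2)[OF g[OF i]] .
    show "g i (c \<odot>\<^bsub>H i\<^esub> \<xi>) = c \<odot>\<^bsub>K i\<^esub> g i \<xi>" for c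
      using g[OF i(1) Hi.smult_cl[OF i(2)], of c] Ki.tends_smult[OF g[OF i], of c]
      by (intro Ki.tends_unique) (simp_all add: opsD(6)[OF u i])
    show "g i (\<xi> \<oplus>\<^bsub>H i\<^esub> \<eta>) = g i \<xi> \<oplus>\<^bsub>K i\<^esub> g i \<eta>" if e: "\<eta> \<in> carrier (H i)" for \<eta>
      using g[OF i(1) Hi.M.a_closed[OF i(2) e]] Ki.tends_add[OF g[OF i] g[OF i(1) e]]
      by (intro Ki.tends_unique) (simp_all add: opsD(5)[OF u i e])
    have "hnorm (K i) (g i \<xi>) \<le> hnorm (K i) (u n1 i \<xi>) + hnorm (K i) (u n1 i \<xi> \<ominus>\<^bsub>K i\<^esub> g i \<xi>)"
      using Ki.N_diff_le[OF opsD(4)[OF u i] gc, of n1] by simp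
    also have "\<dots> \<le> ?N (u n1) * hnorm (H i) \<xi> + 1 * hnorm (H i) \<xi>"
      using fnorm_bound[OF H K u i] close[OF i n1] by (intro add_mono) auto
    finally show "hnorm (K i) (g i \<xi>) \<le> (?N (u n1) + 1) * hnorm (H i) \<xi>" by (simp add: algebra_simps)
  qed
  have "(\<lambda>n. ?N (u n \<ominus>\<^bsub>?M\<^esub> ?g)) \<longlonglongrightarrow> 0"
  proof (rule LIMSEQ_I)
    fix e :: real assume e: "e > 0"
    then obtain n0 where n0: "\<And>m n. m \<ge> n0 \<Longrightarrow> n \<ge> n0 \<Longrightarrow> ?N (u m \<ominus>\<^bsub>?M\<^esub> u n) < e / 2" using Cau[rule_format, of "e / 2"] by auto
    have "?N (u n \<ominus>\<^bsub>?M\<^esub> ?g) \<le> e / 2" if "n \<ge> n0" for n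
    proof (rule fnorm_le[OF H K M.M.minus_closed[OF u G]])
      fix i \<xi> assume i: "i \<in> I" "\<xi> \<in> carrier (H i)"
      show "hnorm (K i) ((u n \<ominus>\<^bsub>?M\<^esub> ?g) i \<xi>) \<le> e / 2 * hnorm (H i) \<xi>"
        using close[OF i n0[OF that]] i by (simp add: op_families_minus[OF H K u G i])
    qed (use e in simp)
    thus "\<exists>n0. \<forall>n\<ge>n0. norm (?N (u n \<ominus>\<^bsub>?M\<^esub> ?g) - 0) < e"
      using e M.N_nonneg[OF M.M.minus_closed[OF u G]] by (intro exI[of _ n0]) (force intro: le_less_trans)
  qed
  thus "\<exists>a\<in>ops I H K. (\<lambda>n. ?N (u n \<ominus>\<^bsub>?M\<^esub> a)) \<longlonglongrightarrow> 0" using G by blast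
qed

lemma fadj_opcomp:
  assumes H: "hfam I H" and K: "hfam I K" and L: "hfam I L"
    and f: "f \<in> ops I K L" and g: "g \<in> ops I H K"
  shows "fadj I H L (opcomp I H f g) = opcomp I L (fadj I H K g) (fadj I K L f)"
  by (rule fadj_unique[OF H L opcomp_closed(1)[OF H K L f g]
        opcomp_closed(1)[OF L K H fadj_closed[OF H K g] fadj_closed[OF K L f]]])
    (simp add: op_families_vals opsD(4)[OF g] opsD(4)[OF fadj_closed[OF K L f]] opsD(4)[OF fadj_closed[OF H K g]]
      fadj_inner'[OF H K g] fadj_inner'[OF K L f])

lemma fadj_add:
  assumes H: "hfam I H" and K: "hfam I K" and f: "f \<in> ops I H K" and g: "g \<in> ops I H K"
  shows "fadj I H K (f \<oplus>\<^bsub>op_families I H K\<^esub> g) = fadj I H K f \<oplus>\<^bsub>op_families I K H\<^esub> fadj I H K g"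
proof (rule fadj_unique[OF H K ops_add[OF H K f g] ops_add[OF K H fadj_closed[OF H K f] fadj_closed[OF H K g]]])
  fix i \<xi> \<eta> assume i: "i \<in> I" "\<xi> \<in> carrier (H i)" "\<eta> \<in> carrier (K i)"
  interpret Hi: hilbert_space "H i" using hfamD[OF H i(1)] .
  interpret Ki: hilbert_space "K i" using hfamD[OF K i(1)] .
  show "hinner (H i) ((fadj I H K f \<oplus>\<^bsub>op_families I K H\<^esub> fadj I H K g) i \<eta>) \<xi> =
      hinner (K i) \<eta> ((f \<oplus>\<^bsub>op_families I H K\<^esub> g) i \<xi>)"
    using i by (simp add: op_families_vals opsD(4)[OF f] opsD(4)[OF g] opsD(4)[OF fadj_closed[OF H K f]]
      opsD(4)[OF fadj_closed[OF H K g]] Hi.hinner_add_left Ki.hinner_add_right fadj_inner'[OF H K f] fadj_inner'[OF H K g])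
qed

lemma fadj_smult:
  assumes H: "hfam I H" and K: "hfam I K" and f: "f \<in> ops I H K"
  shows "fadj I H K (c \<odot>\<^bsub>op_families I H K\<^esub> f) = cnj c \<odot>\<^bsub>op_families I K H\<^esub> fadj I H K f"
proof (rule fadj_unique[OF H K ops_smult[OF H K f] ops_smult[OF K H fadj_closed[OF H K f]]])
  fix i \<xi> \<eta> assume i: "i \<in> I" "\<xi> \<in> carrier (H i)" "\<eta> \<in> carrier (K i)"
  interpret Hi: hilbert_space "H i" using hfamD[OF H i(1)] .
  interpret Ki: hilbert_space "K i" using hfamD[OF K i(1)] .
  show "hinner (H i) ((cnj c \<odot>\<^bsub>op_families I K H\<^esub> fadj I H K f) i \<eta>) \<xi> =
      hinner (K i) \<eta> ((c \<odot>\<^bsub>op_families I H K\<^esub> f) i \<xi>)"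
    using i by (simp add: op_families_vals opsD(4)[OF f] opsD(4)[OF fadj_closed[OF H K f]]
      Hi.hinner_smult_left Ki.hinner_smult_right fadj_inner'[OF H K f])
qed

lemma ops_one:
  assumes H: "hfam I H" shows "\<one>\<^bsub>op_families I H H\<^esub> \<in> ops I H H"
proof -
  have "(\<lambda>i\<in>I. \<lambda>\<xi>\<in>carrier (H i). \<xi>) \<in> ops I H H" by (rule opsI_restrict[OF H H, of _ 1]) auto
  thus ?thesis by (simp add: op_families_def)
qed

theorem ops_cstar:
  assumes H: "hfam I H" shows "cstar_algebra (op_families I H H)"
proof -
  let ?M = "op_families I H H"
  note HH = H H
  interpret M: normed_module ?M "fnorm I H H" using ops_normed_module[OF HH] .
  note c = opcomp_closed(1)[OF H H H] ops_one[OF H] M.M.a_closed M.smult_closed'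
  have Hi: "hilbert_space (H i)" if "i \<in> I" for i using hfamD[OF H that] .
  have ring: "ring ?M"
  proof (rule ringI)
    show "abelian_group ?M" by (rule M.M.abelian_group_axioms)
    show "monoid ?M"
      by (rule monoidI, unfold op_families_mult)
        (auto intro!: c ops_eqI[of _ I H H] simp: op_families_vals opsD(4))
  next
    fix x y z assume x: "x \<in> ops I H H" and y: "y \<in> ops I H H" and z: "z \<in> ops I H H"
    show "(x \<oplus>\<^bsub>?M\<^esub> y) \<otimes>\<^bsub>?M\<^esub> z = x \<otimes>\<^bsub>?M\<^esub> z \<oplus>\<^bsub>?M\<^esub> y \<otimes>\<^bsub>?M\<^esub> z"
      unfolding op_families_mult by (rule ops_eqI[of _ I H H]) (simp_all add: c x y z op_families_vals opsD(4)[OF z])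
    show "z \<otimes>\<^bsub>?M\<^esub> (x \<oplus>\<^bsub>?M\<^esub> y) = z \<otimes>\<^bsub>?M\<^esub> x \<oplus>\<^bsub>?M\<^esub> z \<otimes>\<^bsub>?M\<^esub> y"
      unfolding op_families_mult by (rule ops_eqI[of _ I H H]) (simp_all add: c x y z op_families_vals opsD[OF z] opsD(4)[OF x] opsD(4)[OF y])
  qed
  interpret R: ring ?M by (rule ring)
  show ?thesis
  proof unfold_locales
    fix a b c assume a: "a \<in> ops I H H" and b: "b \<in> ops I H H"
    show "(c \<odot>\<^bsub>?M\<^esub> a) \<otimes>\<^bsub>?M\<^esub> b = c \<odot>\<^bsub>?M\<^esub> (a \<otimes>\<^bsub>?M\<^esub> b)"
      unfolding op_families_mult by (rule ops_eqI[of _ I H H]) (simp_all add: opcomp_closed(1)[OF H H H] a b op_families_vals opsD(4)[OF b])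
    show "a \<otimes>\<^bsub>?M\<^esub> (c \<odot>\<^bsub>?M\<^esub> b) = c \<odot>\<^bsub>?M\<^esub> (a \<otimes>\<^bsub>?M\<^esub> b)"
      unfolding op_families_mult by (rule ops_eqI[of _ I H H]) (simp_all add: opcomp_closed(1)[OF H H H] a b op_families_vals opsD(4)[OF b] opsD(6)[OF a])
    show "invol ?M (a \<oplus>\<^bsub>?M\<^esub> b) = invol ?M a \<oplus>\<^bsub>?M\<^esub> invol ?M b"
      unfolding op_families_invol by (rule fadj_add[OF H H a b])
    show "invol ?M (a \<otimes>\<^bsub>?M\<^esub> b) = invol ?M b \<otimes>\<^bsub>?M\<^esub> invol ?M a"
      unfolding op_families_invol op_families_mult by (rule fadj_opcomp[OF H H H a b])
    show "fnorm I H H (a \<oplus>\<^bsub>?M\<^esub> b) \<le> fnorm I H H a + fnorm I H H b" using a b by (rule M.N_triangle)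
    show "fnorm I H H (a \<otimes>\<^bsub>?M\<^esub> b) \<le> fnorm I H H a * fnorm I H H b"
      unfolding op_families_mult by (rule opcomp_norm[OF H H H a b])
  next
    fix a c assume a: "a \<in> ops I H H"
    note ad = fadj_props[OF H H a]
    show "invol ?M a \<in> ops I H H" unfolding op_families_invol by (rule ad(1))
    show "invol ?M (invol ?M a) = a" unfolding op_families_invol by (rule fadj_fadj[OF H H a])
    show "invol ?M (c \<odot>\<^bsub>?M\<^esub> a) = cnj c \<odot>\<^bsub>?M\<^esub> invol ?M a" unfolding op_families_invol by (rule fadj_smult[OF H H a])
    show "0 \<le> fnorm I H H a" using a by (rule M.N_nonneg)
    show "(fnorm I H H a = 0) = (a = \<zero>\<^bsub>?M\<^esub>)" using a by (rule M.N_eq_zero)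
    show "fnorm I H H (c \<odot>\<^bsub>?M\<^esub> a) = cmod c * fnorm I H H a" using a by (rule M.N_smult)
    let ?aa = "opcomp I H (fadj I H H a) a"
    have aa: "?aa \<in> ops I H H" using opcomp_closed(1)[OF H H H ad(1) a] .
    \<comment> \<open>The essential half of the C*-identity: |a \<xi>|^2 = <a*a \<xi>, \<xi>> \<le>
      |a*a| |\<xi>|^2. The other half is submultiplicativity together with |a*| \<le> |a|.\<close>
    have "fnorm I H H a \<le> sqrt (fnorm I H H ?aa)"
    proof (rule fnorm_le[OF H H a])
      fix i \<xi> assume i: "i \<in> I" "\<xi> \<in> carrier (H i)"
      interpret Hi: hilbert_space "H i" using Hi i by blast
      have x: "a i \<xi> \<in> carrier (H i)" "?aa i \<xi> \<in> carrier (H i)" using opsD(4)[OF a i] opsD(4)[OF aa i] .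
      have "(hnorm (H i) (a i \<xi>))\<^sup>2 = Re (hinner (H i) (?aa i \<xi>) \<xi>)"
        using i x fadj_inner'[OF H H a i x(1)] by (simp add: Hi.hnorm_sq op_families_vals)
      also have "\<dots> \<le> hnorm (H i) (?aa i \<xi>) * hnorm (H i) \<xi>"
        using complex_Re_le_cmod Hi.cauchy_schwarz[OF x(2) i(2)] by (rule order_trans)
      also have "\<dots> \<le> (fnorm I H H ?aa * hnorm (H i) \<xi>) * hnorm (H i) \<xi>"
        using fnorm_bound[OF H H aa i] i by (intro mult_right_mono) auto
      also have "\<dots> = (sqrt (fnorm I H H ?aa) * hnorm (H i) \<xi>)\<^sup>2"
        using fnorm_nonneg[OF H H aa] by (simp add: power_mult_distrib power2_eq_square)
      finally show "hnorm (H i) (a i \<xi>) \<le> sqrt (fnorm I H H ?aa) * hnorm (H i) \<xi>"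
        by (rule power2_le_imp_le) (use fnorm_nonneg[OF H H aa] i in simp)
    qed (use fnorm_nonneg[OF H H aa] in simp)
    hence 1: "(fnorm I H H a)\<^sup>2 \<le> fnorm I H H ?aa"
      using fnorm_nonneg[OF H H a] by (simp add: real_le_rsqrt sqrt_ge_absD)
    have "fnorm I H H ?aa \<le> fnorm I H H (fadj I H H a) * fnorm I H H a" by (rule opcomp_norm[OF H H H ad(1) a])
    also have "\<dots> \<le> fnorm I H H a * fnorm I H H a"
      using ad(3) fnorm_nonneg[OF H H a] by (rule mult_right_mono)
    finally show "fnorm I H H (invol ?M a \<otimes>\<^bsub>?M\<^esub> a) = (fnorm I H H a)\<^sup>2"
      unfolding op_families_mult op_families_invol using 1 by (simp add: power2_eq_square)
  next
    show "norm_complete ?M (fnorm I H H)" by (rule ops_complete[OF H H])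
  qed
qed

section \<open>Matrices over C*-algebras\<close>

lemma (in cstar_algebra) normed: "normed_module A (cnorm A)"
  by unfold_locales (use cnorm_eq_zero cnorm_smult cnorm_triangle in auto)

text \<open>The involution is contractive because |a*|^2 = |a a*| \<le> |a| |a*|.\<close>

sublocale cstar_algebra \<subseteq> B: banach_star A "cnorm A"
proof -
  interpret N: normed_module A "cnorm A" by (rule normed)
  show "banach_star A (cnorm A)"
  proof unfold_locales
    fix a assume a: "a \<in> carrier A"
    have a': "invol A a \<in> carrier A" using a by (rule invol_closed)
    have "(cnorm A (invol A a))\<^sup>2 \<le> cnorm A a * cnorm A (invol A a)"
      using cstar_identity[OF a'] cnorm_submult[OF a a'] by (simp add: invol_invol a)
    thus "cnorm A (invol A a) \<le> cnorm A a"
      using cnorm_nonneg[OF a'] cnorm_nonneg[OF a]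
      by (cases "cnorm A (invol A a) = 0") (auto simp: power2_eq_square)
  qed (use smult_mult_left smult_mult_right invol_closed invol_invol invol_add invol_smult invol_mult
      cnorm_submult cnorm_complete in auto)
qed

lemma (in cstar_algebra) norm_closure_eq: "norm_closure A S = B.ncl S"
  unfolding norm_closure_def B.ncl_def by (rule refl)

lemma mat_alg_simps [simp]:
  "carrier (mat_alg A) = {E. \<forall>z z'. E z z' \<in> carrier A}"
  "mult (mat_alg A) = (\<lambda>E F z z'. \<Oplus>\<^bsub>A\<^esub>w\<in>UNIV. E z w \<otimes>\<^bsub>A\<^esub> F w z')"
  "one (mat_alg A) = (\<lambda>z z'. if z = z' then \<one>\<^bsub>A\<^esub> else \<zero>\<^bsub>A\<^esub>)"
  "zero (mat_alg A) = (\<lambda>z z'. \<zero>\<^bsub>A\<^esub>)"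
  "add (mat_alg A) = (\<lambda>E F z z'. E z z' \<oplus>\<^bsub>A\<^esub> F z z')"
  "smult (mat_alg A) = (\<lambda>c E z z'. c \<odot>\<^bsub>A\<^esub> E z z')"
  "invol (mat_alg A) = (\<lambda>E z z'. invol A (E z' z))"
  by (simp_all add: mat_alg_def)

lemma (in cstar_algebra) invol_finsum:
  assumes "\<And>i. i \<in> I \<Longrightarrow> g i \<in> carrier A"
  shows "invol A (\<Oplus>\<^bsub>A\<^esub>i\<in>I. g i) = (\<Oplus>\<^bsub>A\<^esub>i\<in>I. invol A (g i))"
  by (rule finsum_hom[OF M.abelian_monoid_axioms M.abelian_monoid_axioms])
    (use assms invol_closed invol_add B.invol_zero in auto)

lemma (in cstar_algebra) smult_finsum:
  assumes "\<And>i. i \<in> I \<Longrightarrow> g i \<in> carrier A"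
  shows "c \<odot>\<^bsub>A\<^esub> (\<Oplus>\<^bsub>A\<^esub>i\<in>I. g i) = (\<Oplus>\<^bsub>A\<^esub>i\<in>I. c \<odot>\<^bsub>A\<^esub> g i)"
  by (rule finsum_hom[OF M.abelian_monoid_axioms M.abelian_monoid_axioms])
    (use assms B.smult_rdist in auto)

text \<open>The sum of the entry norms is in general no C*-norm, but it is submultiplicative and
  complete and requires no representation of A on a Hilbert space. This is enough for the square
  root iteration.\<close>

lemma (in cstar_algebra) mat_normed:
  "normed_module (mat_alg A :: ('z::finite \<Rightarrow> 'z \<Rightarrow> _) star_algebra)
     (\<lambda>E. \<Sum>z\<in>UNIV. \<Sum>z'\<in>UNIV. cnorm A (E z z'))" (is "normed_module ?M ?N")
proof -
  have "module complex_ring ?M"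
    by (rule cmoduleI) (auto simp: fun_eq_iff M.a_ac B.smult_ldist B.smult_rdist B.smult_smult)
  then interpret mm: cmodule ?M by (simp add: cmodule_def)
  show ?thesis
  proof unfold_locales
    fix E assume "E \<in> carrier ?M"
    hence E: "E z z' \<in> carrier A" for z z' by simp
    show "(?N E = 0) = (E = \<zero>\<^bsub>?M\<^esub>)"
      using E by (auto simp: sum_nonneg_eq_0_iff sum_nonneg cnorm_nonneg cnorm_eq_zero fun_eq_iff)
    show "?N (c \<odot>\<^bsub>?M\<^esub> E) = cmod c * ?N E" for c
      using E by (simp add: cnorm_smult sum_distrib_left)
  next
    fix E F assume "E \<in> carrier ?M" "F \<in> carrier ?M"
    thus "?N (E \<oplus>\<^bsub>?M\<^esub> F) \<le> ?N E + ?N F"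
      by (auto simp: sum.distrib[symmetric] intro!: sum_mono cnorm_triangle)
  qed
qed

theorem (in cstar_algebra) mat_banach:
  "banach_star (mat_alg A :: ('z::finite \<Rightarrow> 'z \<Rightarrow> _) star_algebra)
     (\<lambda>E. \<Sum>z\<in>UNIV. \<Sum>z'\<in>UNIV. cnorm A (E z z'))" (is "banach_star ?M ?N")
proof -
  interpret N: normed_module ?M ?N by (rule mat_normed)
  have fc: "(\<Oplus>\<^bsub>A\<^esub>w\<in>I. f w) \<in> carrier A" if "\<And>w. f w \<in> carrier A" for f :: "'z \<Rightarrow> _" and I
    using that by (intro M.finsum_closed) auto
  have ring: "ring ?M"
  proof (rule ringI)
    show "abelian_group ?M" by (rule N.M.abelian_group_axioms)
    show "monoid ?M"
    proof (rule monoidI)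
      fix E F G assume "E \<in> carrier ?M" "F \<in> carrier ?M" "G \<in> carrier ?M"
      hence c: "E z z' \<in> carrier A" "F z z' \<in> carrier A" "G z z' \<in> carrier A" for z z' by auto
      have "(\<Oplus>\<^bsub>A\<^esub>w\<in>UNIV. (\<Oplus>\<^bsub>A\<^esub>v\<in>UNIV. E z v \<otimes>\<^bsub>A\<^esub> F v w) \<otimes>\<^bsub>A\<^esub> G w z') =
        (\<Oplus>\<^bsub>A\<^esub>v\<in>UNIV. E z v \<otimes>\<^bsub>A\<^esub> (\<Oplus>\<^bsub>A\<^esub>w\<in>UNIV. F v w \<otimes>\<^bsub>A\<^esub> G w z'))" for z z'
      proof -
        have "(\<Oplus>\<^bsub>A\<^esub>w\<in>UNIV. (\<Oplus>\<^bsub>A\<^esub>v\<in>UNIV. E z v \<otimes>\<^bsub>A\<^esub> F v w) \<otimes>\<^bsub>A\<^esub> G w z') =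
          (\<Oplus>\<^bsub>A\<^esub>w\<in>UNIV. \<Oplus>\<^bsub>A\<^esub>v\<in>UNIV. E z v \<otimes>\<^bsub>A\<^esub> F v w \<otimes>\<^bsub>A\<^esub> G w z')"
          using c by (intro M.finsum_cong') (auto simp: finsum_ldistr intro!: fc)
        also have "\<dots> = (\<Oplus>\<^bsub>A\<^esub>v\<in>UNIV. \<Oplus>\<^bsub>A\<^esub>w\<in>UNIV. E z v \<otimes>\<^bsub>A\<^esub> F v w \<otimes>\<^bsub>A\<^esub> G w z')"
          using c by (intro M.finsum_swap) auto
        also have "\<dots> = (\<Oplus>\<^bsub>A\<^esub>v\<in>UNIV. E z v \<otimes>\<^bsub>A\<^esub> (\<Oplus>\<^bsub>A\<^esub>w\<in>UNIV. F v w \<otimes>\<^bsub>A\<^esub> G w z'))"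
          using c by (intro M.finsum_cong') (auto simp: finsum_rdistr m_assoc intro!: fc)
        finally show ?thesis .
      qed
      thus "E \<otimes>\<^bsub>?M\<^esub> F \<otimes>\<^bsub>?M\<^esub> G = E \<otimes>\<^bsub>?M\<^esub> (F \<otimes>\<^bsub>?M\<^esub> G)" by (simp add: fun_eq_iff)
      show "E \<otimes>\<^bsub>?M\<^esub> F \<in> carrier ?M" using c by (auto intro!: fc)
    next
      fix E assume "E \<in> carrier ?M"
      hence c: "E z z' \<in> carrier A" for z z' by auto
      have "(\<Oplus>\<^bsub>A\<^esub>w\<in>UNIV. (if z = w then \<one>\<^bsub>A\<^esub> else \<zero>\<^bsub>A\<^esub>) \<otimes>\<^bsub>A\<^esub> E w z') = E z z'" for z z'
      proof -
        have "(\<Oplus>\<^bsub>A\<^esub>w\<in>UNIV. (if z = w then \<one>\<^bsub>A\<^esub> else \<zero>\<^bsub>A\<^esub>) \<otimes>\<^bsub>A\<^esub> E w z') =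
            (\<Oplus>\<^bsub>A\<^esub>w\<in>UNIV. if z = w then E w z' else \<zero>\<^bsub>A\<^esub>)"
          using c by (intro M.finsum_cong') auto
        thus ?thesis using c by (simp add: M.finsum_singleton)
      qed
      thus "\<one>\<^bsub>?M\<^esub> \<otimes>\<^bsub>?M\<^esub> E = E" by (simp add: fun_eq_iff)
      have "(\<Oplus>\<^bsub>A\<^esub>w\<in>UNIV. E z w \<otimes>\<^bsub>A\<^esub> (if w = z' then \<one>\<^bsub>A\<^esub> else \<zero>\<^bsub>A\<^esub>)) = E z z'" for z z'
      proof -
        have "(\<Oplus>\<^bsub>A\<^esub>w\<in>UNIV. E z w \<otimes>\<^bsub>A\<^esub> (if w = z' then \<one>\<^bsub>A\<^esub> else \<zero>\<^bsub>A\<^esub>)) =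
            (\<Oplus>\<^bsub>A\<^esub>w\<in>UNIV. if z' = w then E z w else \<zero>\<^bsub>A\<^esub>)"
          using c by (intro M.finsum_cong') auto
        thus ?thesis using c by (simp add: M.finsum_singleton)
      qed
      thus "E \<otimes>\<^bsub>?M\<^esub> \<one>\<^bsub>?M\<^esub> = E" by (simp add: fun_eq_iff)
    qed simp
  next
    fix E F G assume "E \<in> carrier ?M" "F \<in> carrier ?M" "G \<in> carrier ?M"
    hence c: "E z z' \<in> carrier A" "F z z' \<in> carrier A" "G z z' \<in> carrier A" for z z' by auto
    show "(E \<oplus>\<^bsub>?M\<^esub> F) \<otimes>\<^bsub>?M\<^esub> G = E \<otimes>\<^bsub>?M\<^esub> G \<oplus>\<^bsub>?M\<^esub> F \<otimes>\<^bsub>?M\<^esub> G"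
      using c by (simp add: fun_eq_iff l_distr M.finsum_addf Pi_def)
    show "G \<otimes>\<^bsub>?M\<^esub> (E \<oplus>\<^bsub>?M\<^esub> F) = G \<otimes>\<^bsub>?M\<^esub> E \<oplus>\<^bsub>?M\<^esub> G \<otimes>\<^bsub>?M\<^esub> F"
      using c by (simp add: fun_eq_iff r_distr M.finsum_addf Pi_def)
  qed
  interpret rr: ring ?M by (rule ring)
  show ?thesis
  proof unfold_locales
    fix E F c assume "E \<in> carrier ?M" "F \<in> carrier ?M"
    hence ec: "E z z' \<in> carrier A" "F z z' \<in> carrier A" for z z' by auto
    show "(c \<odot>\<^bsub>?M\<^esub> E) \<otimes>\<^bsub>?M\<^esub> F = c \<odot>\<^bsub>?M\<^esub> (E \<otimes>\<^bsub>?M\<^esub> F)"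
      "E \<otimes>\<^bsub>?M\<^esub> (c \<odot>\<^bsub>?M\<^esub> F) = c \<odot>\<^bsub>?M\<^esub> (E \<otimes>\<^bsub>?M\<^esub> F)"
      using ec by (simp_all add: fun_eq_iff smult_finsum smult_mult_left smult_mult_right)
    show "invol ?M (E \<oplus>\<^bsub>?M\<^esub> F) = invol ?M E \<oplus>\<^bsub>?M\<^esub> invol ?M F"
      using ec by (simp add: fun_eq_iff invol_add)
    show "invol ?M (E \<otimes>\<^bsub>?M\<^esub> F) = invol ?M F \<otimes>\<^bsub>?M\<^esub> invol ?M E"
      using ec by (simp add: fun_eq_iff invol_finsum invol_mult)
    show "?N (E \<otimes>\<^bsub>?M\<^esub> F) \<le> ?N E * ?N F"
    proof -
      have "?N (E \<otimes>\<^bsub>?M\<^esub> F) \<le> (\<Sum>z\<in>UNIV. \<Sum>z'\<in>UNIV. \<Sum>w\<in>UNIV. cnorm A (E z w) * cnorm A (F w z'))"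
        using ec by (auto intro!: sum_mono order_trans[OF B.N_finsum] cnorm_submult)
      \<comment> \<open>Enlarging the factor from F to its whole column sum decouples the two
        summations.\<close>
      also have "\<dots> \<le> (\<Sum>z\<in>UNIV. \<Sum>z'\<in>UNIV. \<Sum>w\<in>UNIV. cnorm A (E z w) * (\<Sum>w'\<in>UNIV. cnorm A (F w' z')))"
        using ec by (intro sum_mono mult_left_mono member_le_sum) (auto intro!: cnorm_nonneg)
      also have "\<dots> = (\<Sum>z\<in>UNIV. \<Sum>z'\<in>UNIV. (\<Sum>w\<in>UNIV. cnorm A (E z w)) * (\<Sum>w'\<in>UNIV. cnorm A (F w' z')))"
        by (simp only: sum_distrib_right)
      also have "\<dots> = ?N E * (\<Sum>z'\<in>UNIV. \<Sum>w\<in>UNIV. cnorm A (F w z'))"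
        by (rule sum_product[symmetric])
      also have "(\<Sum>z'\<in>UNIV. \<Sum>w\<in>UNIV. cnorm A (F w z')) = ?N F" by (rule sum.swap)
      finally show ?thesis .
    qed
  next
    fix E assume "E \<in> carrier ?M"
    hence ec: "E z z' \<in> carrier A" for z z' by auto
    show "invol ?M E \<in> carrier ?M" using ec by (simp add: invol_closed)
    show "invol ?M (invol ?M E) = E" using ec by (simp add: fun_eq_iff invol_invol)
    show "invol ?M (c \<odot>\<^bsub>?M\<^esub> E) = cnj c \<odot>\<^bsub>?M\<^esub> invol ?M E" for c using ec by (simp add: fun_eq_iff invol_smult)
    have "?N (invol ?M E) \<le> (\<Sum>z\<in>UNIV. \<Sum>z'\<in>UNIV. cnorm A (E z' z))"
      using ec by (auto intro!: sum_mono B.N_invol_le)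
    also have "\<dots> = ?N E" by (rule sum.swap)
    finally show "?N (invol ?M E) \<le> ?N E" .
  next
    have minus: "(E \<ominus>\<^bsub>?M\<^esub> F) z z' = E z z' \<ominus>\<^bsub>A\<^esub> F z z'" if "E \<in> carrier ?M" "F \<in> carrier ?M" for E F z z'
      using that by (simp add: N.minus_conv B.minus_conv)
    show "norm_complete ?M ?N"
      unfolding norm_complete_def
    proof (intro allI impI)
      fix u :: "nat \<Rightarrow> 'z \<Rightarrow> 'z \<Rightarrow> 'a" assume "range u \<subseteq> carrier ?M"
        and Cau: "\<forall>\<epsilon>>0. \<exists>n0. \<forall>m\<ge>n0. \<forall>n\<ge>n0. ?N (u m \<ominus>\<^bsub>?M\<^esub> u n) < \<epsilon>"
      hence um: "u n \<in> carrier ?M" for n by blast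
      hence u: "u n z z' \<in> carrier A" for n z z' by simp
      have "\<exists>a. B.tends (\<lambda>n. u n z z') a" for z z'
      proof (rule B.Cauchy_tends)
        fix e :: real assume "e > 0"
        then obtain n0 where n0: "\<forall>m\<ge>n0. \<forall>n\<ge>n0. ?N (u m \<ominus>\<^bsub>?M\<^esub> u n) < e" using Cau by blast
        have "cnorm A (u m z z' \<ominus>\<^bsub>A\<^esub> u n z z') \<le> ?N (u m \<ominus>\<^bsub>?M\<^esub> u n)" for m n
        proof -
          let ?f = "\<lambda>z z'. cnorm A ((u m \<ominus>\<^bsub>?M\<^esub> u n) z z')"
          have nn: "0 \<le> ?f z z'" for z z' unfolding minus[OF um um] using u by (simp add: cnorm_nonneg)
          have "?f z z' \<le> (\<Sum>z'\<in>UNIV. ?f z z')" by (rule member_le_sum) (use nn in auto)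
          also have "\<dots> \<le> (\<Sum>z\<in>UNIV. \<Sum>z'\<in>UNIV. ?f z z')"
            by (rule member_le_sum[where f = "\<lambda>z. \<Sum>z'\<in>UNIV. ?f z z'"]) (use nn in \<open>auto intro: sum_nonneg\<close>)
          finally show ?thesis unfolding minus[OF um um] .
        qed
        thus "\<exists>n0. \<forall>m\<ge>n0. \<forall>n\<ge>n0. cnorm A (u m z z' \<ominus>\<^bsub>A\<^esub> u n z z') < e" using n0 by (meson le_less_trans)
      qed (rule u)
      then obtain a where a: "\<And>z z'. B.tends (\<lambda>n. u n z z') (a z z')" by metis
      have am: "a \<in> carrier ?M" using B.tendsD(2)[OF a] by simp
      have "(\<lambda>n. ?N (u n \<ominus>\<^bsub>?M\<^esub> a)) \<longlonglongrightarrow> (\<Sum>z\<in>(UNIV::'z set). \<Sum>z'\<in>(UNIV::'z set). 0)"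
        unfolding minus[OF um am] by (intro tendsto_sum) (use a in \<open>simp add: B.tends_def\<close>)
      thus "\<exists>a\<in>carrier ?M. (\<lambda>n. ?N (u n \<ominus>\<^bsub>?M\<^esub> a)) \<longlonglongrightarrow> 0" using am by auto
    qed
  qed
qed

section \<open>Closed *-subalgebras\<close>

text \<open>Besides closure under the operations only completeness has to be argued, and it follows
  from sequential closedness.\<close>

lemma (in cstar_algebra) subalgebra_cstar:
  assumes S: "S \<subseteq> carrier A" "\<zero>\<^bsub>A\<^esub> \<in> S" "\<one>\<^bsub>A\<^esub> \<in> S"
    and add: "\<And>a b. \<lbrakk>a \<in> S; b \<in> S\<rbrakk> \<Longrightarrow> a \<oplus>\<^bsub>A\<^esub> b \<in> S"
    and mult: "\<And>a b. \<lbrakk>a \<in> S; b \<in> S\<rbrakk> \<Longrightarrow> a \<otimes>\<^bsub>A\<^esub> b \<in> S"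
    and smult: "\<And>c a. a \<in> S \<Longrightarrow> c \<odot>\<^bsub>A\<^esub> a \<in> S"
    and invol: "\<And>a. a \<in> S \<Longrightarrow> invol A a \<in> S"
    and closed: "\<And>u a. (\<And>n::nat. u n \<in> S) \<Longrightarrow> B.tends u a \<Longrightarrow> a \<in> S"
  shows "cstar_algebra (A\<lparr>carrier := S\<rparr>)" (is "cstar_algebra ?S")
proof -
  have c: "a \<in> S \<Longrightarrow> a \<in> carrier A" for a using S by auto
  have mod: "module complex_ring ?S"
    by (rule cmoduleI) (auto simp: S add smult c M.a_ac B.smult_ldist B.smult_rdist B.smult_smult)
  then interpret sm: cmodule ?S by (simp add: cmodule_def)
  have "ring ?S"
    by (rule ringI[OF sm.M.abelian_group_axioms]) (auto intro!: monoidI simp: S mult c m_assoc l_distr r_distr)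
  then interpret sr: ring ?S .
  \<comment> \<open>Subtraction in the subalgebra refers to its own additive inverse; writing the
    inverse as (-1) b identifies it with the one of A.\<close>
  have minus: "a \<ominus>\<^bsub>?S\<^esub> b = a \<ominus>\<^bsub>A\<^esub> b" if "a \<in> S" "b \<in> S" for a b
    using that by (simp add: sm.minus_conv B.minus_conv c)
  show ?thesis
  proof unfold_locales
    show "norm_complete ?S (cnorm ?S)"
      unfolding norm_complete_def
    proof (intro allI impI)
      fix u :: "nat \<Rightarrow> 'a" assume "range u \<subseteq> carrier ?S"
        and Cau: "\<forall>\<epsilon>>0. \<exists>n0. \<forall>m\<ge>n0. \<forall>n\<ge>n0. cnorm ?S (u m \<ominus>\<^bsub>?S\<^esub> u n) < \<epsilon>"
      hence u: "u n \<in> S" for n by auto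
      have "\<exists>a. B.tends u a"
        by (rule B.Cauchy_tends) (use u Cau in \<open>auto simp: minus c\<close>)
      then obtain a where a: "B.tends u a" by blast
      hence "a \<in> S" using closed u by blast
      thus "\<exists>a\<in>carrier ?S. (\<lambda>n. cnorm ?S (u n \<ominus>\<^bsub>?S\<^esub> a)) \<longlonglongrightarrow> 0"
        using a u by (auto simp: minus B.tends_def)
    qed
  qed (auto simp: c S add mult smult invol smult_mult_left smult_mult_right invol_invol invol_add invol_smult
      invol_mult cnorm_nonneg cnorm_eq_zero cnorm_smult cnorm_triangle cnorm_submult cstar_identity)
qed

text \<open>Scalar multiples of elements of Q only have to lie in the closure. This weak form covers
  complex spans and also a countable subring with rational complex scalars.\<close>

lemma (in cstar_algebra) closure_cstar:
  assumes Q: "Q \<subseteq> carrier A" "Q \<noteq> {}" "\<one>\<^bsub>A\<^esub> \<in> norm_closure A Q"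
    and add: "\<And>a b. \<lbrakk>a \<in> Q; b \<in> Q\<rbrakk> \<Longrightarrow> a \<oplus>\<^bsub>A\<^esub> b \<in> Q"
    and mult: "\<And>a b. \<lbrakk>a \<in> Q; b \<in> Q\<rbrakk> \<Longrightarrow> a \<otimes>\<^bsub>A\<^esub> b \<in> Q"
    and smult: "\<And>c a. a \<in> Q \<Longrightarrow> c \<odot>\<^bsub>A\<^esub> a \<in> norm_closure A Q"
    and invol: "\<And>a. a \<in> Q \<Longrightarrow> invol A a \<in> Q"
  shows "cstar_algebra (A\<lparr>carrier := norm_closure A Q\<rparr>)"
proof -
  have D: "\<exists>u. (\<forall>n. u n \<in> Q) \<and> B.tends u a" if "a \<in> B.ncl Q" for a
    using B.ncl_iff[OF Q(1), THEN iffD1, OF that] .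
  have I: "a \<in> B.ncl Q" if "\<And>n. u n \<in> Q" "B.tends u a" for u a
    using B.ncl_iff[OF Q(1), THEN iffD2, OF exI[of _ u]] that by simp
  note smult = smult[unfolded norm_closure_eq]
  have smult': "c \<odot>\<^bsub>A\<^esub> a \<in> B.ncl Q" if aQ: "a \<in> B.ncl Q" for c a
  proof -
    obtain u where u: "\<forall>n. u n \<in> Q" "B.tends u a" using D[OF aQ] by (elim exE conjE)
    show ?thesis
      by (rule B.ncl_closed[OF Q(1) _ B.tends_smult[OF u(2)]]) (rule smult[OF u(1)[THEN spec]])
  qed
  show ?thesis unfolding norm_closure_eq
  proof (rule subalgebra_cstar)
    show "B.ncl Q \<subseteq> carrier A" by (rule B.ncl_carrier)
    show "\<one>\<^bsub>A\<^esub> \<in> B.ncl Q" using Q(3) unfolding norm_closure_eq .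
    obtain q where q: "q \<in> Q" using Q(2) by (elim ex_in_conv[THEN iffD2, THEN exE])
    have "q \<in> carrier A" using q Q(1) by (rule subsetD[rotated])
    thus "\<zero>\<^bsub>A\<^esub> \<in> B.ncl Q" using smult[OF q, of 0] by (simp only: B.smult_0)
    fix a b assume "a \<in> B.ncl Q" "b \<in> B.ncl Q"
    then obtain u v where uv: "\<forall>n. u n \<in> Q" "B.tends u a" "\<forall>n. v n \<in> Q" "B.tends v b" using D by meson
    show "a \<oplus>\<^bsub>A\<^esub> b \<in> B.ncl Q"
      by (rule I[OF _ B.tends_add[OF uv(2,4)]]) (rule add[OF uv(1,3)[THEN spec]])
    show "a \<otimes>\<^bsub>A\<^esub> b \<in> B.ncl Q"
      by (rule I[OF _ B.tends_mult[OF uv(2,4)]]) (rule mult[OF uv(1,3)[THEN spec]])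
  next
    fix a assume "a \<in> B.ncl Q"
    then obtain u where u: "\<forall>n. u n \<in> Q" "B.tends u a" using D by meson
    show "invol A a \<in> B.ncl Q"
      by (rule I[OF _ B.tends_invol[OF u(2)]]) (rule invol[OF u(1)[THEN spec]])
  next
    show "c \<odot>\<^bsub>A\<^esub> a \<in> B.ncl Q" if "a \<in> B.ncl Q" for c a using that by (rule smult')
    show "a \<in> B.ncl Q" if "\<And>n. u n \<in> B.ncl Q" "B.tends u a" for u a using Q(1) that by (rule B.ncl_closed)
  qed
qed

lemma (in cmodule) lin_span_finsum:
  assumes S: "S \<subseteq> carrier M" and f: "\<And>i. i \<in> I \<Longrightarrow> f i \<in> lin_span M S"
  shows "(\<Oplus>\<^bsub>M\<^esub>i\<in>I. f i) \<in> lin_span M S"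
  using f
proof (induction I rule: infinite_finite_induct)
  case (insert i I)
  have "f j \<in> carrier M" if "j \<in> insert i I" for j
    using subsetD[OF lin_span_carrier[OF S] insert.prems[OF that]] .
  hence "(\<Oplus>\<^bsub>M\<^esub>j\<in>insert i I. f j) = f i \<oplus>\<^bsub>M\<^esub> (\<Oplus>\<^bsub>M\<^esub>j\<in>I. f j)"
    using insert.hyps by (intro M.finsum_insert) auto
  thus ?case using lin_span_add[OF S insert.prems insert.IH] insert.prems by simp
qed (simp_all add: lin_span_zero)

context cstar_algebra
begin

lemma lin_span_mult:
  assumes S: "S \<subseteq> carrier A" and m: "\<And>a b. a \<in> S \<Longrightarrow> b \<in> S \<Longrightarrow> a \<otimes>\<^bsub>A\<^esub> b \<in> S"
    and a: "a \<in> lin_span A S" and b: "b \<in> lin_span A S"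
  shows "a \<otimes>\<^bsub>A\<^esub> b \<in> lin_span A S"
proof -
  note sc = subsetD[OF B.lin_span_carrier[OF S]] and Sc = subsetD[OF S]
  have 1: "s \<otimes>\<^bsub>A\<^esub> b \<in> lin_span A S" if s: "s \<in> S" for s
    using S b
  proof (induction rule: B.lin_span_induct)
    case zero
    show ?case using Sc[OF s] B.lin_span_zero by simp
  next
    case (step y c t)
    have "s \<otimes>\<^bsub>A\<^esub> (y \<oplus>\<^bsub>A\<^esub> c \<odot>\<^bsub>A\<^esub> t) = s \<otimes>\<^bsub>A\<^esub> y \<oplus>\<^bsub>A\<^esub> c \<odot>\<^bsub>A\<^esub> (s \<otimes>\<^bsub>A\<^esub> t)"
      using Sc[OF s] step.hyps(2) Sc[OF step.hyps(3)] by (simp add: r_distr smult_mult_right)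
    thus ?case using B.lin_span_step[OF S step.IH m[OF s step.hyps(3)], of c] by (simp only:)
  qed
  show ?thesis using S a
  proof (induction rule: B.lin_span_induct)
    case zero
    show ?case using sc[OF b] B.lin_span_zero by simp
  next
    case (step y c t)
    have "(y \<oplus>\<^bsub>A\<^esub> c \<odot>\<^bsub>A\<^esub> t) \<otimes>\<^bsub>A\<^esub> b = y \<otimes>\<^bsub>A\<^esub> b \<oplus>\<^bsub>A\<^esub> c \<odot>\<^bsub>A\<^esub> (t \<otimes>\<^bsub>A\<^esub> b)"
      using sc[OF b] step.hyps(2) Sc[OF step.hyps(3)] by (simp add: l_distr smult_mult_left)
    thus ?case using B.lin_span_add[OF S step.IH B.lin_span_smult[OF S 1[OF step.hyps(3)]], of c] by (simp only:)
  qed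
qed

lemma lin_span_invol:
  assumes S: "S \<subseteq> carrier A" and i: "\<And>a. a \<in> S \<Longrightarrow> invol A a \<in> S" and a: "a \<in> lin_span A S"
  shows "invol A a \<in> lin_span A S"
  using S a
proof (induction rule: B.lin_span_induct)
  case zero
  have "invol A (0 \<odot>\<^bsub>A\<^esub> \<zero>\<^bsub>A\<^esub>) = cnj 0 \<odot>\<^bsub>A\<^esub> invol A \<zero>\<^bsub>A\<^esub>" by (rule invol_smult) simp
  thus ?case using B.lin_span_zero by (simp add: invol_closed)
next
  case (step y c t)
  note Sc = subsetD[OF S step.hyps(3)]
  have "invol A (y \<oplus>\<^bsub>A\<^esub> c \<odot>\<^bsub>A\<^esub> t) = invol A y \<oplus>\<^bsub>A\<^esub> cnj c \<odot>\<^bsub>A\<^esub> invol A t"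
    using step.hyps(2) Sc by (simp add: invol_add invol_smult)
  thus ?case using B.lin_span_step[OF S step.IH i[OF step.hyps(3)], of "cnj c"] by (simp only:)
qed

text \<open>Used for the elementary tensors and for the products s* t of the universal
  representation: in both cases the generators themselves are closed under product and
  adjoint.\<close>

lemma span_closure_cstar:
  assumes S: "S \<subseteq> carrier A" and one: "\<one>\<^bsub>A\<^esub> \<in> lin_span A S"
    and m: "\<And>a b. a \<in> S \<Longrightarrow> b \<in> S \<Longrightarrow> a \<otimes>\<^bsub>A\<^esub> b \<in> S" and i: "\<And>a. a \<in> S \<Longrightarrow> invol A a \<in> S"
  shows "cstar_algebra (A\<lparr>carrier := norm_closure A (lin_span A S)\<rparr>)"
proof (rule closure_cstar)
  show sub: "lin_span A S \<subseteq> carrier A" by (rule B.lin_span_carrier[OF S])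
  note ncl = subsetD[OF B.ncl_superset[OF sub], folded norm_closure_eq]
  show "lin_span A S \<noteq> {}" using one by (rule ex_in_conv[THEN iffD1, OF exI])
  show "\<one>\<^bsub>A\<^esub> \<in> norm_closure A (lin_span A S)" by (rule ncl[OF one])
  show "c \<odot>\<^bsub>A\<^esub> a \<in> norm_closure A (lin_span A S)" if "a \<in> lin_span A S" for c a
    by (rule ncl[OF B.lin_span_smult[OF S that]])
  show "a \<oplus>\<^bsub>A\<^esub> b \<in> lin_span A S" if "a \<in> lin_span A S" "b \<in> lin_span A S" for a b
    by (rule B.lin_span_add[OF S that])
  show "a \<otimes>\<^bsub>A\<^esub> b \<in> lin_span A S" if "a \<in> lin_span A S" "b \<in> lin_span A S" for a b
    by (rule lin_span_mult[OF S m that])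
  show "invol A a \<in> lin_span A S" if "a \<in> lin_span A S" for a by (rule lin_span_invol[OF S i that])
qed

end

section \<open>Positivity of Gram matrices of operators\<close>

context
  fixes I :: "'i set" and H K :: "'i \<Rightarrow> 'h hilbert" and S :: "('i \<Rightarrow> 'h \<Rightarrow> 'h) set"
    and B :: "('i \<Rightarrow> 'h \<Rightarrow> 'h) normed_star_algebra"
  assumes H: "hfam I H" and K: "hfam I K"
    and B: "B = op_families I H H\<lparr>carrier := S\<rparr>" and S: "S \<subseteq> ops I H H" and cs: "cstar_algebra B"
begin

interpretation B: cstar_algebra B by (rule cs)

lemma sub_finsum:
  assumes f: "\<And>j. j \<in> J \<Longrightarrow> f j \<in> S" and i: "i \<in> I" "\<xi> \<in> carrier (H i)"
  shows "(\<Oplus>\<^bsub>B\<^esub>j\<in>J. f j) i \<xi> = (\<Oplus>\<^bsub>H i\<^esub>j\<in>J. f j i \<xi>)"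
proof -
  interpret Hi: hilbert_space "H i" using hfamD[OF H i(1)] .
  show ?thesis
    by (rule finsum_hom[where f = "\<lambda>f. f i \<xi>", OF B.M.abelian_monoid_axioms Hi.M.abelian_monoid_axioms])
      (simp_all add: B op_families_vals i f opsD(4)[OF subsetD[OF S] i])
qed

text \<open>The action of an operator matrix on columns of vectors, that is, on a direct sum of
  copies of \<open>H i\<close>. Contractivity is measured in this action, without forming the direct
  sum as a Hilbert space.\<close>

definition act :: "('z::finite \<Rightarrow> 'z \<Rightarrow> 'i \<Rightarrow> 'h \<Rightarrow> 'h) \<Rightarrow> 'i \<Rightarrow> ('z \<Rightarrow> 'h) \<Rightarrow> 'z \<Rightarrow> 'h" where
  "act E i \<xi> z = (\<Oplus>\<^bsub>H i\<^esub>w\<in>UNIV. E z w i (\<xi> w))"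

lemma act_closed:
  assumes i: "i \<in> I" and E: "\<And>z z'. E z z' \<in> S" and x: "\<And>z. \<xi> z \<in> carrier (H i)"
  shows "act E i \<xi> z \<in> carrier (H i)"
proof -
  interpret Hi: hilbert_space "H i" using hfamD[OF H i] .
  show ?thesis unfolding act_def
    by (intro Hi.M.finsum_closed) (use opsD(4)[OF subsetD[OF S E] i x] in auto)
qed

lemma act_mult:
  assumes i: "i \<in> I" and E: "\<And>z z'. E z z' \<in> S" and F: "\<And>z z'. F z z' \<in> S"
    and x: "\<And>z. \<xi> z \<in> carrier (H i)"
  shows "act (E \<otimes>\<^bsub>mat_alg B\<^esub> F) i \<xi> = act E i (act F i \<xi>)"
proof
  fix z
  interpret Hi: hilbert_space "H i" using hfamD[OF H i] .
  have EO: "E z z' \<in> ops I H H" and FO: "F z z' \<in> ops I H H" for z z' using E F S by auto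
  have EF: "E z v \<otimes>\<^bsub>B\<^esub> F v w \<in> S" for v w using B.m_closed[of "E z v" "F v w"] E F by (simp add: B)
  have Fx: "F v w i (\<xi> w) \<in> carrier (H i)" for v w using opsD(4)[OF FO i x] .
  have EFx: "E z v i (F v w i (\<xi> w)) \<in> carrier (H i)" for v w using opsD(4)[OF EO i Fx] .
  have "act (E \<otimes>\<^bsub>mat_alg B\<^esub> F) i \<xi> z = (\<Oplus>\<^bsub>H i\<^esub>w\<in>UNIV. \<Oplus>\<^bsub>H i\<^esub>v\<in>UNIV. (E z v \<otimes>\<^bsub>B\<^esub> F v w) i (\<xi> w))"
    unfolding act_def mat_alg_simps by (simp add: sub_finsum[OF EF i x])
  also have "\<dots> = (\<Oplus>\<^bsub>H i\<^esub>w\<in>UNIV. \<Oplus>\<^bsub>H i\<^esub>v\<in>UNIV. E z v i (F v w i (\<xi> w)))"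
    by (simp add: B op_families_mult op_families_vals i x)
  also have "\<dots> = (\<Oplus>\<^bsub>H i\<^esub>v\<in>UNIV. \<Oplus>\<^bsub>H i\<^esub>w\<in>UNIV. E z v i (F v w i (\<xi> w)))"
    by (rule Hi.M.finsum_swap) (use EFx in auto)
  also have "\<dots> = (\<Oplus>\<^bsub>H i\<^esub>v\<in>UNIV. E z v i (\<Oplus>\<^bsub>H i\<^esub>w\<in>UNIV. F v w i (\<xi> w)))"
  proof (rule Hi.M.finsum_cong'[OF refl])
    have Fs: "(\<Oplus>\<^bsub>H i\<^esub>w\<in>UNIV. F v w i (\<xi> w)) \<in> carrier (H i)" for v using Fx by (intro Hi.M.finsum_closed) auto
    thus "(\<lambda>v. E z v i (\<Oplus>\<^bsub>H i\<^esub>w\<in>UNIV. F v w i (\<xi> w))) \<in> UNIV \<rightarrow> carrier (H i)" using opsD(4)[OF EO i] by auto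
    have E0: "E z v i \<zero>\<^bsub>H i\<^esub> = \<zero>\<^bsub>H i\<^esub>" for v
      using opsD(6)[OF EO i Hi.M.zero_closed, of z v 0] opsD(4)[OF EO i Hi.M.zero_closed] by simp
    show "(\<Oplus>\<^bsub>H i\<^esub>w\<in>UNIV. E z v i (F v w i (\<xi> w))) = E z v i (\<Oplus>\<^bsub>H i\<^esub>w\<in>UNIV. F v w i (\<xi> w))" for v
      by (rule finsum_hom[symmetric, OF Hi.M.abelian_monoid_axioms Hi.M.abelian_monoid_axioms])
        (use opsD(4,5)[OF EO i] E0 Fx in auto)
  qed
  finally show "act (E \<otimes>\<^bsub>mat_alg B\<^esub> F) i \<xi> z = act E i (act F i \<xi>) z" by (simp only: act_def)
qed

text \<open>F is positive as an operator matrix, but \<open>positive_elem\<close> asks for a root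
  with entries in S. For large c the matrix x = 1 - F / c is a selfadjoint contraction on columns,
  so its powers have entries of norm at most 1 and \<open>ex_sqrt\<close> produces a root of F / c
  inside the matrix algebra over B. The factors G need not lie in S, nor map H to itself.\<close>

theorem gram_positive:
  fixes F :: "'z::finite \<Rightarrow> 'z \<Rightarrow> 'i \<Rightarrow> 'h \<Rightarrow> 'h" and G :: "'n \<Rightarrow> 'z \<Rightarrow> 'i \<Rightarrow> 'h \<Rightarrow> 'h"
  assumes N: "finite N" and G: "\<And>n z. n \<in> N \<Longrightarrow> G n z \<in> ops I H K" and F: "\<And>z z'. F z z' \<in> S"
    and FG: "\<And>i z z' \<xi>. i \<in> I \<Longrightarrow> \<xi> \<in> carrier (H i) \<Longrightarrow>
      F z z' i \<xi> = (\<Oplus>\<^bsub>H i\<^esub>n\<in>N. fadj I H K (G n z) i (G n z' i \<xi>))"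
    and FI: "\<And>z z'. invol B (F z z') = F z' z"
  shows "positive_elem (mat_alg B) F"
proof -
  let ?M = "mat_alg B :: ('z \<Rightarrow> 'z \<Rightarrow> 'i \<Rightarrow> 'h \<Rightarrow> 'h) star_algebra"
  let ?N = "\<lambda>E :: 'z \<Rightarrow> 'z \<Rightarrow> 'i \<Rightarrow> 'h \<Rightarrow> 'h. \<Sum>z\<in>UNIV. \<Sum>z'\<in>UNIV. cnorm B (E z z')"
  interpret M: banach_star ?M ?N by (rule B.mat_banach)
  have cB: "carrier B = S" by (simp add: B)
  have FM: "F \<in> carrier ?M" using F by (simp add: cB)
  define \<gamma> where "\<gamma> = (\<Sum>n\<in>N. \<Sum>z\<in>UNIV. fnorm I H K (G n z))"
  have \<gamma>0: "0 \<le> \<gamma>" unfolding \<gamma>_def using fnorm_nonneg[OF H K G] by (intro sum_nonneg) auto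
  have \<gamma>: "fnorm I H K (G n z) \<le> \<gamma>" if n: "n \<in> N" for n z
  proof -
    have "fnorm I H K (G n z) \<le> (\<Sum>z\<in>UNIV. fnorm I H K (G n z))"
      by (rule member_le_sum) (use fnorm_nonneg[OF H K G[OF n]] in auto)
    also have "\<dots> \<le> \<gamma>" unfolding \<gamma>_def
      by (rule member_le_sum[where f = "\<lambda>n. \<Sum>z\<in>UNIV. fnorm I H K (G n z)"]) (use fnorm_nonneg[OF H K G] n N in \<open>auto intro!: sum_nonneg\<close>)
    finally show ?thesis .
  qed
  \<comment> \<open>The product is the constant in |F \<xi>|^2 \<le> const <F \<xi>, \<xi>>,
    obtained by summing \<open>Fb\<close> over the rows; adding 1 keeps c positive when the product
    is 0.\<close>
  define c where "c = real CARD('z) * real (card N) * \<gamma>\<^sup>2 + 1"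
  have c: "c > 0" unfolding c_def by (intro add_nonneg_pos) auto
  define x where "x = \<one>\<^bsub>?M\<^esub> \<ominus>\<^bsub>?M\<^esub> complex_of_real (1 / c) \<odot>\<^bsub>?M\<^esub> F"
  have xM: "x \<in> carrier ?M" unfolding x_def by (intro M.M.minus_closed M.smult_closed' FM M.one_closed)
  hence xS: "x z z' \<in> S" for z z' by (simp add: cB)
  have invF: "invol ?M F = F" by (simp add: fun_eq_iff FI)
  have xI: "invol ?M x = x"
    unfolding x_def by (subst M.invol_minus) (use FM in \<open>simp_all only: M.invol_one M.invol_smult invF M.smult_closed' M.one_closed complex_cnj_complex_of_real\<close>)
  define nsq where "nsq i \<xi> = (\<Sum>z\<in>UNIV. (hnorm (H i) (\<xi> z))\<^sup>2)" for i and \<xi> :: "'z \<Rightarrow> 'h"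
  \<comment> \<open>Expand |\<xi> - F \<xi> / c|^2 as |\<xi>|^2 - (2/c) <F \<xi>, \<xi>> + |F
    \<xi>|^2 / c^2. With T n the n-th Gram factor applied to the column, <F \<xi>, \<xi>> is the sum
    \<tau> of the |T n|^2 and |F \<xi>|^2 \<le> c \<tau>, so the correction is at most -\<tau> /
    c.\<close>
  have contr: "nsq i (act x i \<xi>) \<le> nsq i \<xi>" if i: "i \<in> I" and \<xi>: "\<And>z. \<xi> z \<in> carrier (H i)" for i \<xi>
  proof -
    interpret Hi: hilbert_space "H i" using hfamD[OF H i] .
    interpret Ki: hilbert_space "K i" using hfamD[OF K i] .
    define T where "T n = (\<Oplus>\<^bsub>K i\<^esub>z\<in>UNIV. G n z i (\<xi> z))" for n
    have Gx: "G n z i (\<xi> z) \<in> carrier (K i)" if "n \<in> N" for n z using opsD(4)[OF G[OF that] i \<xi>] .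
    have T: "T n \<in> carrier (K i)" if "n \<in> N" for n
      unfolding T_def using Gx[OF that] by (intro Ki.M.finsum_closed) auto
    have Gs: "fadj I H K (G n z) \<in> ops I K H" if "n \<in> N" for n z using fadj_closed[OF H K G[OF that]] .
    have GT: "fadj I H K (G n z) i (T n) \<in> carrier (H i)" if "n \<in> N" for n z
      using opsD(4)[OF Gs[OF that] i T[OF that]] .
    have actF: "act F i \<xi> z = (\<Oplus>\<^bsub>H i\<^esub>n\<in>N. fadj I H K (G n z) i (T n))" for z
    proof -
      have GG: "fadj I H K (G n z) i (G n w i (\<xi> w)) \<in> carrier (H i)" if "n \<in> N" for n w
        using opsD(4)[OF Gs[OF that] i Gx[OF that]] .
      have "act F i \<xi> z = (\<Oplus>\<^bsub>H i\<^esub>w\<in>UNIV. \<Oplus>\<^bsub>H i\<^esub>n\<in>N. fadj I H K (G n z) i (G n w i (\<xi> w)))"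
        unfolding act_def by (simp add: FG[OF i \<xi>])
      also have "\<dots> = (\<Oplus>\<^bsub>H i\<^esub>n\<in>N. \<Oplus>\<^bsub>H i\<^esub>w\<in>UNIV. fadj I H K (G n z) i (G n w i (\<xi> w)))"
        by (rule Hi.M.finsum_swap) (use N GG in auto)
      also have "\<dots> = (\<Oplus>\<^bsub>H i\<^esub>n\<in>N. fadj I H K (G n z) i (T n))"
      proof (rule Hi.M.finsum_cong'[OF refl])
        show "(\<lambda>n. fadj I H K (G n z) i (T n)) \<in> N \<rightarrow> carrier (H i)" using GT by auto
        fix n assume n: "n \<in> N"
        have "fadj I H K (G n z) i \<zero>\<^bsub>K i\<^esub> = \<zero>\<^bsub>H i\<^esub>"
          using opsD(6)[OF Gs[OF n] i Ki.M.zero_closed, of z 0] opsD(4)[OF Gs[OF n] i Ki.M.zero_closed] by simp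
        thus "(\<Oplus>\<^bsub>H i\<^esub>w\<in>UNIV. fadj I H K (G n z) i (G n w i (\<xi> w))) = fadj I H K (G n z) i (T n)"
          unfolding T_def
          by (intro finsum_hom[symmetric, OF Ki.M.abelian_monoid_axioms Hi.M.abelian_monoid_axioms])
            (use opsD(4,5)[OF Gs[OF n] i] Gx[OF n] in auto)
      qed
      finally show ?thesis .
    qed
    have actFc: "act F i \<xi> z \<in> carrier (H i)" for z unfolding actF using GT by (intro Hi.M.finsum_closed) auto
    define \<tau> where "\<tau> = (\<Sum>n\<in>N. (hnorm (K i) (T n))\<^sup>2)"
    have \<tau>0: "0 \<le> \<tau>" unfolding \<tau>_def by (intro sum_nonneg) auto
    have inner: "(\<Sum>z\<in>UNIV. hinner (H i) (act F i \<xi> z) (\<xi> z)) = complex_of_real \<tau>"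
    proof -
      have "hinner (H i) (act F i \<xi> z) (\<xi> z) = (\<Sum>n\<in>N. hinner (K i) (T n) (G n z i (\<xi> z)))" for z
      proof -
        have "hinner (H i) (act F i \<xi> z) (\<xi> z) = (\<Sum>n\<in>N. hinner (H i) (fadj I H K (G n z) i (T n)) (\<xi> z))"
          unfolding actF by (rule finsum_hom_sum[OF Hi.M.abelian_monoid_axioms])
            (use \<xi> GT Hi.hinner_zero_left Hi.hinner_add_left in auto)
        also have "\<dots> = (\<Sum>n\<in>N. hinner (K i) (T n) (G n z i (\<xi> z)))"
          by (rule sum.cong[OF refl]) (rule fadj_inner'[OF H K G i \<xi> T])
        finally show ?thesis .
      qed
      hence "(\<Sum>z\<in>UNIV. hinner (H i) (act F i \<xi> z) (\<xi> z)) = (\<Sum>n\<in>N. \<Sum>z\<in>UNIV. hinner (K i) (T n) (G n z i (\<xi> z)))"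
        by (simp add: sum.swap[of _ N])
      also have "\<dots> = (\<Sum>n\<in>N. hinner (K i) (T n) (T n))"
      proof (rule sum.cong[OF refl])
        fix n assume n: "n \<in> N"
        have "hinner (K i) (T n) (\<Oplus>\<^bsub>K i\<^esub>z\<in>UNIV. G n z i (\<xi> z)) = (\<Sum>z\<in>UNIV. hinner (K i) (T n) (G n z i (\<xi> z)))"
          by (rule finsum_hom_sum[OF Ki.M.abelian_monoid_axioms])
            (use T[OF n] Gx[OF n] Ki.hinner_zero_right Ki.hinner_add_right in auto)
        thus "(\<Sum>z\<in>UNIV. hinner (K i) (T n) (G n z i (\<xi> z))) = hinner (K i) (T n) (T n)" by (simp add: T_def)
      qed
      also have "\<dots> = complex_of_real \<tau>" unfolding \<tau>_def of_real_sum
        by (rule sum.cong[OF refl]) (rule Ki.hinner_self[OF T])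
      finally show ?thesis .
    qed
    have Fb: "(hnorm (H i) (act F i \<xi> z))\<^sup>2 \<le> real (card N) * \<gamma>\<^sup>2 * \<tau>" for z
    proof -
      have "hnorm (H i) (act F i \<xi> z) \<le> (\<Sum>n\<in>N. hnorm (H i) (fadj I H K (G n z) i (T n)))"
        unfolding actF using N GT by (rule Hi.N_finsum)
      also have "\<dots> \<le> (\<Sum>n\<in>N. \<gamma> * hnorm (K i) (T n))"
      proof (rule sum_mono)
        fix n assume n: "n \<in> N"
        have "hnorm (H i) (fadj I H K (G n z) i (T n)) \<le> fnorm I K H (fadj I H K (G n z)) * hnorm (K i) (T n)"
          by (rule fnorm_bound[OF K H Gs[OF n] i T[OF n]])
        also have "\<dots> \<le> \<gamma> * hnorm (K i) (T n)"
          using order_trans[OF fadj_norm[OF H K G[OF n]] \<gamma>[OF n]] T[OF n] by (intro mult_right_mono) auto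
        finally show "hnorm (H i) (fadj I H K (G n z) i (T n)) \<le> \<gamma> * hnorm (K i) (T n)" .
      qed
      finally have "(hnorm (H i) (act F i \<xi> z))\<^sup>2 \<le> (\<Sum>n\<in>N. \<gamma> * hnorm (K i) (T n))\<^sup>2"
        using actFc by (intro power_mono) auto
      also have "\<dots> \<le> (\<Sum>n\<in>N. (\<gamma> * hnorm (K i) (T n))\<^sup>2) * real (card N)"
        using sum_squared_le_sum_of_squares[of "\<lambda>n. \<gamma> * hnorm (K i) (T n)" N] by (simp add: mult.commute)
      also have "\<dots> = real (card N) * \<gamma>\<^sup>2 * \<tau>" by (simp add: \<tau>_def power_mult_distrib sum_distrib_left mult_ac)
      finally show ?thesis .
    qed
    have xz: "act x i \<xi> z = \<xi> z \<oplus>\<^bsub>H i\<^esub> complex_of_real (- 1 / c) \<odot>\<^bsub>H i\<^esub> act F i \<xi> z" for z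
    proof -
      have FO: "F z w \<in> ops I H H" for z w using F S by auto
      have Fx: "F z w i (\<xi> w) \<in> carrier (H i)" for w using opsD(4)[OF FO i \<xi>] .
      have "x z w i (\<xi> w) = (if z = w then \<xi> w else \<zero>\<^bsub>H i\<^esub>) \<oplus>\<^bsub>H i\<^esub> complex_of_real (- 1 / c) \<odot>\<^bsub>H i\<^esub> F z w i (\<xi> w)" for w
        unfolding x_def using FM i \<xi> Fx
        by (subst M.minus_conv[OF M.one_closed M.smult_closed'[OF FM]]) (simp add: B op_families_vals Hi.smult_smult)
      hence "act x i \<xi> z = (\<Oplus>\<^bsub>H i\<^esub>w\<in>UNIV. (if z = w then \<xi> w else \<zero>\<^bsub>H i\<^esub>) \<oplus>\<^bsub>H i\<^esub> complex_of_real (- 1 / c) \<odot>\<^bsub>H i\<^esub> F z w i (\<xi> w))"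
        by (simp add: act_def)
      also have "\<dots> = (\<Oplus>\<^bsub>H i\<^esub>w\<in>UNIV. (if z = w then \<xi> w else \<zero>\<^bsub>H i\<^esub>)) \<oplus>\<^bsub>H i\<^esub> (\<Oplus>\<^bsub>H i\<^esub>w\<in>UNIV. complex_of_real (- 1 / c) \<odot>\<^bsub>H i\<^esub> F z w i (\<xi> w))"
        using \<xi> Fx by (intro Hi.M.finsum_addf) auto
      also have "(\<Oplus>\<^bsub>H i\<^esub>w\<in>UNIV. (if z = w then \<xi> w else \<zero>\<^bsub>H i\<^esub>)) = \<xi> z" using \<xi> by (intro Hi.M.finsum_singleton) auto
      also have "(\<Oplus>\<^bsub>H i\<^esub>w\<in>UNIV. complex_of_real (- 1 / c) \<odot>\<^bsub>H i\<^esub> F z w i (\<xi> w)) = complex_of_real (- 1 / c) \<odot>\<^bsub>H i\<^esub> act F i \<xi> z"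
        unfolding act_def
        by (rule finsum_hom[symmetric, OF Hi.M.abelian_monoid_axioms Hi.M.abelian_monoid_axioms]) (use Fx Hi.smult_rdist in auto)
      finally show ?thesis .
    qed
    have e: "(hnorm (H i) (act x i \<xi> z))\<^sup>2 = (hnorm (H i) (\<xi> z))\<^sup>2
        - 2 / c * Re (hinner (H i) (act F i \<xi> z) (\<xi> z)) + 1 / c\<^sup>2 * (hnorm (H i) (act F i \<xi> z))\<^sup>2" for z
      unfolding xz Hi.hinner_expand[OF \<xi> actFc] using c by (simp add: power_divide norm_divide)
    have "nsq i (act x i \<xi>) = nsq i \<xi> - 2 / c * Re (\<Sum>z\<in>UNIV. hinner (H i) (act F i \<xi> z) (\<xi> z))
        + 1 / c\<^sup>2 * (\<Sum>z\<in>UNIV. (hnorm (H i) (act F i \<xi> z))\<^sup>2)"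
      unfolding nsq_def e by (simp add: sum.distrib sum_subtractf sum_distrib_left)
    also have "\<dots> = nsq i \<xi> - 2 / c * \<tau> + 1 / c\<^sup>2 * (\<Sum>z\<in>UNIV. (hnorm (H i) (act F i \<xi> z))\<^sup>2)"
      unfolding inner by simp
    also have "\<dots> \<le> nsq i \<xi> - 2 / c * \<tau> + 1 / c\<^sup>2 * (\<Sum>z\<in>(UNIV::'z set). real (card N) * \<gamma>\<^sup>2 * \<tau>)"
      using Fb by (intro add_left_mono mult_left_mono sum_mono) auto
    also have "\<dots> \<le> nsq i \<xi> - 2 / c * \<tau> + 1 / c\<^sup>2 * (c * \<tau>)"
      using \<tau>0 by (intro add_left_mono mult_left_mono) (auto simp: c_def algebra_simps)
    also have "\<dots> = nsq i \<xi> - \<tau> / c" using c by (simp add: power2_eq_square field_simps)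
    also have "\<dots> \<le> nsq i \<xi>" using \<tau>0 c by simp
    finally show ?thesis .
  qed
  have xnM: "x [^]\<^bsub>?M\<^esub> n \<in> carrier ?M" for n :: nat using xM by (rule M.nat_pow_closed)
  hence xnS: "(x [^]\<^bsub>?M\<^esub> n) z z' \<in> S" for n :: nat and z z' by (simp add: cB)
  have pow: "nsq i (act (x [^]\<^bsub>?M\<^esub> n) i \<xi>) \<le> nsq i \<xi>" if i: "i \<in> I" and \<xi>: "\<And>z. \<xi> z \<in> carrier (H i)" for i \<xi> and n :: nat
    using \<xi>
  proof (induction n arbitrary: \<xi>)
    case 0
    interpret Hi: hilbert_space "H i" using hfamD[OF H i] .
    have "act \<one>\<^bsub>?M\<^esub> i \<xi> z = \<xi> z" for z
    proof -
      have "act \<one>\<^bsub>?M\<^esub> i \<xi> z = (\<Oplus>\<^bsub>H i\<^esub>w\<in>UNIV. (if z = w then \<xi> w else \<zero>\<^bsub>H i\<^esub>))"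
        unfolding act_def using 0 i by (intro Hi.M.finsum_cong'[OF refl]) (auto simp: B op_families_vals)
      thus ?thesis using 0 by (subst Hi.M.finsum_singleton[symmetric, of z UNIV \<xi>]) auto
    qed
    thus ?case by (simp add: nsq_def del: mat_alg_simps)
  next
    case (Suc n)
    have "nsq i (act (x [^]\<^bsub>?M\<^esub> Suc n) i \<xi>) = nsq i (act (x [^]\<^bsub>?M\<^esub> n) i (act x i \<xi>))"
      unfolding nat_pow_Suc by (rule arg_cong[OF act_mult[OF i xnS xS Suc.prems]])
    also have "\<dots> \<le> nsq i (act x i \<xi>)" by (rule Suc.IH) (rule act_closed[OF i xS Suc.prems])
    also have "\<dots> \<le> nsq i \<xi>" by (rule contr[OF i Suc.prems])
    finally show ?case .
  qed
  \<comment> \<open>An entry of a power is recovered by letting the power act on the column that has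
    \<xi> in place z' and 0 elsewhere.\<close>
  have entry: "cnorm B ((x [^]\<^bsub>?M\<^esub> n) z z') \<le> 1" for n :: nat and z z'
  proof -
    let ?X = "x [^]\<^bsub>?M\<^esub> n"
    have XO: "?X z w \<in> ops I H H" for z w using xnS S by blast
    have "fnorm I H H (?X z z') \<le> 1"
    proof (rule fnorm_le[OF H H XO])
      fix i \<xi> assume i: "i \<in> I" and \<xi>: "\<xi> \<in> carrier (H i)"
      interpret Hi: hilbert_space "H i" using hfamD[OF H i] .
      let ?\<eta> = "\<lambda>w. if w = z' then \<xi> else \<zero>\<^bsub>H i\<^esub>"
      have \<eta>: "?\<eta> w \<in> carrier (H i)" for w using \<xi> by simp
      have X0: "?X z w i \<zero>\<^bsub>H i\<^esub> = \<zero>\<^bsub>H i\<^esub>" for w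
        using opsD(6)[OF XO i Hi.M.zero_closed, of z w 0] opsD(4)[OF XO i Hi.M.zero_closed, of z w] by simp
      have "act ?X i ?\<eta> z = (\<Oplus>\<^bsub>H i\<^esub>w\<in>UNIV. (if z' = w then ?X z w i \<xi> else \<zero>\<^bsub>H i\<^esub>))"
        unfolding act_def using opsD(4)[OF XO i \<xi>] X0 by (intro Hi.M.finsum_cong'[OF refl]) auto
      also have "\<dots> = ?X z z' i \<xi>" using opsD(4)[OF XO i \<xi>] by (intro Hi.M.finsum_singleton) auto
      finally have "(hnorm (H i) (?X z z' i \<xi>))\<^sup>2 \<le> nsq i (act ?X i ?\<eta>)"
        unfolding nsq_def using member_le_sum[of z UNIV "\<lambda>z. (hnorm (H i) (act ?X i ?\<eta> z))\<^sup>2"] by simp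
      also have "\<dots> \<le> nsq i ?\<eta>" by (rule pow[OF i \<eta>])
      also have "\<dots> = (hnorm (H i) \<xi>)\<^sup>2"
      proof -
        have "nsq i ?\<eta> = (\<Sum>w\<in>UNIV. if w = z' then (hnorm (H i) \<xi>)\<^sup>2 else 0)"
          unfolding nsq_def by (intro sum.cong) auto
        thus ?thesis by simp
      qed
      finally have sq: "(hnorm (H i) (?X z z' i \<xi>))\<^sup>2 \<le> (hnorm (H i) \<xi>)\<^sup>2" .
      show "hnorm (H i) (?X z z' i \<xi>) \<le> 1 * hnorm (H i) \<xi>"
        using power2_le_imp_le[OF sq Hi.N_nonneg[OF \<xi>]] by (simp only: mult_1)
    qed simp
    thus ?thesis by (simp add: B)
  qed
  have "?N (x [^]\<^bsub>?M\<^esub> n) \<le> (\<Sum>z\<in>(UNIV::'z set). \<Sum>z'\<in>(UNIV::'z set). 1)" for n :: nat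
    by (intro sum_mono entry)
  from M.ex_sqrt[OF xM xI this] obtain b where b: "b \<in> carrier ?M" "invol ?M b = b" "b \<otimes>\<^bsub>?M\<^esub> b = \<one>\<^bsub>?M\<^esub> \<ominus>\<^bsub>?M\<^esub> x" by blast
  \<comment> \<open>Undo the normalisation: b b = F / c, so sqrt c times b is a root of F.\<close>
  let ?s = "complex_of_real (sqrt c)" and ?F = "complex_of_real (1 / c) \<odot>\<^bsub>?M\<^esub> F"
  have FcM: "?F \<in> carrier ?M" using FM by (rule M.smult_closed')
  have "\<one>\<^bsub>?M\<^esub> \<ominus>\<^bsub>?M\<^esub> x = \<one>\<^bsub>?M\<^esub> \<oplus>\<^bsub>?M\<^esub> ((- 1) \<odot>\<^bsub>?M\<^esub> \<one>\<^bsub>?M\<^esub> \<oplus>\<^bsub>?M\<^esub> ?F)"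
    unfolding x_def using FcM
    by (simp only: M.minus_conv M.smult_rdist M.smult_smult M.smult_closed' M.one_closed M.M.a_closed) (simp only: minus_mult_minus mult_1 M.smult_1)
  also have "\<dots> = (\<one>\<^bsub>?M\<^esub> \<oplus>\<^bsub>?M\<^esub> (- 1) \<odot>\<^bsub>?M\<^esub> \<one>\<^bsub>?M\<^esub>) \<oplus>\<^bsub>?M\<^esub> ?F"
    by (rule M.M.a_assoc[symmetric, OF M.one_closed M.smult_closed'[OF M.one_closed] FcM])
  also have "\<one>\<^bsub>?M\<^esub> \<oplus>\<^bsub>?M\<^esub> (- 1) \<odot>\<^bsub>?M\<^esub> \<one>\<^bsub>?M\<^esub> = \<zero>\<^bsub>?M\<^esub>"
    using M.smult_ldist[OF M.one_closed, of 1 "- 1", symmetric]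
    by (simp only: M.smult_1[OF M.one_closed] add.right_inverse M.smult_0[OF M.one_closed])
  also have "\<zero>\<^bsub>?M\<^esub> \<oplus>\<^bsub>?M\<^esub> ?F = ?F" by (rule M.M.l_zero[OF FcM])
  finally have bb: "b \<otimes>\<^bsub>?M\<^esub> b = ?F" unfolding b(3) .
  have "invol ?M (?s \<odot>\<^bsub>?M\<^esub> b) \<otimes>\<^bsub>?M\<^esub> (?s \<odot>\<^bsub>?M\<^esub> b) = (?s * ?s) \<odot>\<^bsub>?M\<^esub> (b \<otimes>\<^bsub>?M\<^esub> b)"
    by (simp only: M.invol_smult[OF b(1)] b(2) complex_cnj_complex_of_real M.smult_mult_left[OF b(1) M.smult_closed'[OF b(1)]]
      M.smult_mult_right[OF b(1) b(1)] M.smult_smult[OF M.m_closed[OF b(1) b(1)]])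
  also have "\<dots> = (?s * ?s * complex_of_real (1 / c)) \<odot>\<^bsub>?M\<^esub> F" unfolding bb by (rule M.smult_smult[OF FM])
  also have "?s * ?s * complex_of_real (1 / c) = 1"
  proof -
    have "?s * ?s * complex_of_real (1 / c) = complex_of_real (sqrt c * sqrt c * (1 / c))" by (simp only: of_real_mult)
    also have "sqrt c * sqrt c * (1 / c) = 1" using c by simp
    finally show ?thesis by simp
  qed
  finally have "F = invol ?M (?s \<odot>\<^bsub>?M\<^esub> b) \<otimes>\<^bsub>?M\<^esub> (?s \<odot>\<^bsub>?M\<^esub> b)" by (simp only: M.smult_1[OF FM])
  thus ?thesis unfolding positive_elem_def using FM M.smult_closed'[OF b(1)] by blast
qed

end

section \<open>The Hilbert space of a positive semidefinite kernel\<close>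

text \<open>A list of pairs \<open>(c, w)\<close> stands for the formal linear combination of the points \<open>w\<close>.  The
  completion of this pre-Hilbert space is realised inside its antidual, so that its elements are
  functions on the set of points.\<close>

definition lform :: "('w \<Rightarrow> 'w \<Rightarrow> complex) \<Rightarrow> (complex \<times> 'w) list \<Rightarrow> (complex \<times> 'w) list \<Rightarrow> complex" where
  "lform k p q = (\<Sum>x\<leftarrow>p. \<Sum>y\<leftarrow>q. fst x * cnj (fst y) * k (snd x) (snd y))"

text \<open>The antilinear extension of f from points to formal combinations.\<close>

definition lapp :: "('w \<Rightarrow> complex) \<Rightarrow> (complex \<times> 'w) list \<Rightarrow> complex" where
  "lapp f q = (\<Sum>y\<leftarrow>q. cnj (fst y) * f (snd y))"

definition lscale :: "complex \<Rightarrow> (complex \<times> 'w) list \<Rightarrow> (complex \<times> 'w) list" where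
  "lscale c p = map (\<lambda>x. (c * fst x, snd x)) p"

definition lmap :: "('w \<Rightarrow> 'w) \<Rightarrow> (complex \<times> 'w) list \<Rightarrow> (complex \<times> 'w) list" where
  "lmap m p = map (\<lambda>x. (fst x, m (snd x))) p"

section \<open>Formal linear combinations of points and the sesquilinear form\<close>

lemma lapp_simps [simp]:
  "lapp f [] = 0" "lapp f (y # q) = cnj (fst y) * f (snd y) + lapp f q"
  by (simp_all add: lapp_def)

lemma lapp_append [simp]: "lapp f (p @ q) = lapp f p + lapp f q"
  by (induction p) simp_all

lemma lapp_scale [simp]: "lapp f (lscale c q) = cnj c * lapp f q"
  by (induction q) (simp_all add: lscale_def algebra_simps)

lemma lapp_add: "lapp (\<lambda>w. f w + g w) q = lapp f q + lapp g q"
  by (induction q) (simp_all add: algebra_simps)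

lemma lapp_cmult: "lapp (\<lambda>w. c * f w) q = c * lapp f q"
  by (induction q) (simp_all add: algebra_simps)

lemma lapp_minus: "lapp (\<lambda>w. f w - g w) q = lapp f q - lapp g q"
  by (induction q) (simp_all add: algebra_simps)

lemma lapp_lmap: "lapp (\<lambda>w. f (m w)) q = lapp f (lmap m q)"
  by (induction q) (simp_all add: lmap_def)

text \<open>The image of a formal combination in the antidual, given by its values at points;
  \<open>lform\<close> is the antilinear extension of this function.\<close>

definition lvec :: "('w \<Rightarrow> 'w \<Rightarrow> complex) \<Rightarrow> (complex \<times> 'w) list \<Rightarrow> 'w \<Rightarrow> complex" where
  "lvec k p w = (\<Sum>x\<leftarrow>p. fst x * k (snd x) w)"

lemma lapp_zero [simp]: "lapp (\<lambda>w. 0) q = 0"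
  by (induction q) simp_all

lemma lvec_simps [simp]:
  "lvec k [] = (\<lambda>w. 0)" "lvec k (x # p) w = fst x * k (snd x) w + lvec k p w"
  by (simp_all add: lvec_def fun_eq_iff)

lemma lform_lapp: "lform k p q = lapp (lvec k p) q"
proof (induction p)
  case Nil
  show ?case by (simp add: lform_def)
next
  case (Cons x p)
  have "lform k (x # p) q = (\<Sum>y\<leftarrow>q. fst x * cnj (fst y) * k (snd x) (snd y)) + lform k p q" by (simp add: lform_def)
  also have "(\<Sum>y\<leftarrow>q. fst x * cnj (fst y) * k (snd x) (snd y)) = lapp (\<lambda>w. fst x * k (snd x) w) q"
    by (simp add: lapp_def mult_ac)
  also have "\<dots> + lform k p q = lapp (\<lambda>w. fst x * k (snd x) w + lvec k p w) q"
    by (simp add: lapp_add Cons.IH)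
  finally show ?case by (simp add: fun_eq_iff lapp_def)
qed

lemma lform_Cons: "lform k (x # p) q = fst x * lapp (k (snd x)) q + lform k p q"
proof -
  have "lvec k (x # p) = (\<lambda>w. fst x * k (snd x) w + lvec k p w)" by (simp add: fun_eq_iff)
  thus ?thesis unfolding lform_lapp by (simp add: lapp_add lapp_cmult)
qed

lemma lform_append_left [simp]: "lform k (p @ p') q = lform k p q + lform k p' q"
  by (simp add: lform_def)

lemma lform_append_right [simp]: "lform k p (q @ q') = lform k p q + lform k p q'"
  by (simp add: lform_lapp)

lemma lform_scale_left [simp]: "lform k (lscale c p) q = c * lform k p q"
proof (induction p)
  case (Cons x p)
  have "lscale c (x # p) = (c * fst x, snd x) # lscale c p" by (simp add: lscale_def)
  thus ?case using Cons by (simp add: lform_Cons algebra_simps)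
qed (simp add: lscale_def lform_def)

lemma lform_scale_right [simp]: "lform k p (lscale c q) = cnj c * lform k p q"
  by (simp add: lform_lapp)

locale psd_kernel =
  fixes k :: "'w \<Rightarrow> 'w \<Rightarrow> complex"
  assumes herm: "k w v = cnj (k v w)" and psd: "lform k p p \<in> \<real>\<^sub>\<ge>\<^sub>0"
begin

definition nrm :: "(complex \<times> 'w) list \<Rightarrow> real" where "nrm p = sqrt (Re (lform k p p))"

lemma nrm_nonneg [simp]: "0 \<le> nrm p"
  using psd[of p] by (simp add: nrm_def complex_nonneg_Reals_iff)

lemma nrm_sq: "(nrm p)\<^sup>2 = Re (lform k p p)"
  using psd[of p] by (simp add: nrm_def complex_nonneg_Reals_iff)

lemma lform_self: "lform k p p = complex_of_real ((nrm p)\<^sup>2)"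
  unfolding nrm_sq using psd[of p] by (auto simp: complex_eq_iff complex_nonneg_Reals_iff)

lemma lform_herm: "lform k q p = cnj (lform k p q)"
proof (induction p)
  case Nil show ?case by (simp add: lform_lapp lform_def)
next
  case (Cons x p)
  have "lvec k q v = cnj (lapp (k v) q)" for v
  proof (induction q)
    case (Cons y q)
    thus ?case using herm[of "snd y" v] by simp
  qed simp
  hence "lform k q (x # p) = cnj (fst x) * cnj (lapp (k (snd x)) q) + lform k q p" by (simp add: lform_lapp)
  thus ?case using Cons by (simp add: lform_Cons)
qed

lemma lform_cs: "cmod (lform k p q) \<le> nrm p * nrm q"
proof (rule power2_le_imp_le)
  have "(cmod (lform k p q))\<^sup>2 \<le> (nrm q)\<^sup>2 * (nrm p)\<^sup>2"
  proof (rule cs_scalar)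
    fix c
    have "lform k (q @ lscale c p) (q @ lscale c p)
        = lform k q q + c * lform k p q + cnj (c * lform k p q) + c * cnj c * lform k p p"
      using lform_herm[of q p] by (simp add: algebra_simps)
    also have "c * cnj c = complex_of_real ((cmod c)\<^sup>2)" by (rule complex_norm_square[symmetric])
    finally have "Re (lform k (q @ lscale c p) (q @ lscale c p))
        = Re (lform k q q) + 2 * Re (c * lform k p q) + (cmod c)\<^sup>2 * Re (lform k p p)"
      by (simp only: plus_complex.sel complex_cnj Re_complex_of_real times_complex.sel Im_complex_of_real) simp
    thus "0 \<le> (nrm q)\<^sup>2 + 2 * Re (c * lform k p q) + (cmod c)\<^sup>2 * (nrm p)\<^sup>2"
      using zero_le_power2[of "nrm (q @ lscale c p)"] unfolding nrm_sq by linarith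
  qed simp
  thus "(cmod (lform k p q))\<^sup>2 \<le> (nrm p * nrm q)\<^sup>2" by (simp add: power_mult_distrib mult.commute)
qed simp

text \<open>Convergence of formal combinations to f in the antidual norm: one null sequence must
  work for all q, relative to \<open>nrm q\<close>. Combinations with the same image define the same
  function, so no quotient by null vectors is formed.\<close>

definition apx :: "(nat \<Rightarrow> (complex \<times> 'w) list) \<Rightarrow> ('w \<Rightarrow> complex) \<Rightarrow> bool" where
  "apx u f \<longleftrightarrow> (\<exists>e. e \<longlonglongrightarrow> 0 \<and> (\<forall>n q. cmod (lapp f q - lform k (u n) q) \<le> e n * nrm q))"

definition Hset :: "('w \<Rightarrow> complex) set" where "Hset = {f. \<exists>u. apx u f}"

text \<open>The approximating combinations are automatically bounded: compare u n and u 0 through f,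
  test against u n itself and divide by \<open>nrm (u n)\<close>.\<close>

lemma apxE:
  assumes "apx u f"
  obtains e E where "e \<longlonglongrightarrow> (0::real)" "\<And>n. 0 \<le> e n" "\<And>n. e n \<le> E"
    "\<And>n q. cmod (lapp f q - lform k (u n) q) \<le> e n * nrm q" "\<And>n. nrm (u n) \<le> E"
proof -
  obtain d where d: "d \<longlonglongrightarrow> 0" "\<And>n q. cmod (lapp f q - lform k (u n) q) \<le> d n * nrm q"
    using assms unfolding apx_def by auto
  define e where "e n = \<bar>d n\<bar>" for n
  have "e = (\<lambda>n. \<bar>d n\<bar>)" by (simp add: e_def fun_eq_iff)
  hence e: "e \<longlonglongrightarrow> 0" using tendsto_rabs[OF d(1)] by simp
  have el: "cmod (lapp f q - lform k (u n) q) \<le> e n * nrm q" for n q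
    by (rule order_trans[OF d(2) mult_right_mono]) (auto simp: e_def)
  obtain B where B: "\<And>n. e n \<le> B" "B > 0"
    using convergent_imp_Bseq[OF convergentI[OF e]] unfolding Bseq_def by (auto simp: abs_le_iff)
  have "nrm (u n) \<le> 2 * B + nrm (u 0)" for n
  proof -
    have "(nrm (u n))\<^sup>2 = cmod (lform k (u n) (u n))" by (simp add: lform_self norm_power)
    also have "\<dots> \<le> cmod (lapp f (u n) - lform k (u n) (u n)) + cmod (lapp f (u n) - lform k (u 0) (u n)) + cmod (lform k (u 0) (u n))"
      by norm
    also have "\<dots> \<le> B * nrm (u n) + B * nrm (u n) + nrm (u 0) * nrm (u n)"
      using order_trans[OF el mult_right_mono[OF B(1) nrm_nonneg]] lform_cs by (intro add_mono) auto
    finally have "nrm (u n) * nrm (u n) \<le> (2 * B + nrm (u 0)) * nrm (u n)"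
      by (simp add: power2_eq_square algebra_simps)
    thus ?thesis using B(2) nrm_nonneg[of "u n"] nrm_nonneg[of "u 0"]
      by (cases "nrm (u n) = 0") (auto simp: mult_le_cancel_right)
  qed
  moreover have "e n \<le> 2 * B + nrm (u 0)" for n using B(1)[of n] B(2) nrm_nonneg[of "u 0"] by linarith
  ultimately show ?thesis using e el by (intro that[of e "2 * B + nrm (u 0)"]) (auto simp: e_def)
qed

text \<open>Replaces the left argument through f and the right one through g. For two indices of one
  pair of sequences it gives the Cauchy property of the forms, for two pairs of sequences the
  independence of the limit from the choice.\<close>

lemma lform_diff_bound:
  assumes "\<And>q. cmod (lapp f q - lform k u q) \<le> e * nrm q" "\<And>q. cmod (lapp f q - lform k u' q) \<le> e' * nrm q"
    and "\<And>q. cmod (lapp g q - lform k v q) \<le> h * nrm q" "\<And>q. cmod (lapp g q - lform k v' q) \<le> h' * nrm q"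
  shows "cmod (lform k u v - lform k u' v') \<le> (e + e') * nrm v + (h + h') * nrm u'"
proof -
  have "cmod (lform k u' v - lform k u' v') = cmod (lform k v u' - lform k v' u')"
    unfolding lform_herm[of u' v] lform_herm[of u' v'] by (metis complex_cnj_diff complex_mod_cnj)
  also have "\<dots> \<le> cmod (lapp g u' - lform k v u') + cmod (lapp g u' - lform k v' u')" by norm
  also have "\<dots> \<le> (h + h') * nrm u'" using assms(3,4)[of u'] by (simp add: distrib_right)
  finally have 1: "cmod (lform k u' v - lform k u' v') \<le> (h + h') * nrm u'" .
  have "cmod (lform k u v - lform k u' v) \<le> cmod (lapp f v - lform k u v) + cmod (lapp f v - lform k u' v)" by norm
  also have "\<dots> \<le> (e + e') * nrm v" using assms(1,2)[of v] by (simp add: distrib_right)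
  finally have "cmod (lform k u v - lform k u' v) \<le> (e + e') * nrm v" .
  moreover have "cmod (lform k u v - lform k u' v') \<le> cmod (lform k u v - lform k u' v) + cmod (lform k u' v - lform k u' v')" by norm
  ultimately show ?thesis using 1 by linarith
qed

definition hin :: "('w \<Rightarrow> complex) \<Rightarrow> ('w \<Rightarrow> complex) \<Rightarrow> complex" where
  "hin f g = lim (\<lambda>n. lform k ((SOME u. apx u f) n) ((SOME u. apx u g) n))"

text \<open>Frees \<open>hin\<close> from the choice operator in its definition: any approximating
  sequences compute it, so the laws of the form pass to the limit.\<close>

lemma hin_lim:
  assumes f: "apx u f" and g: "apx v g"
  shows "(\<lambda>n. lform k (u n) (v n)) \<longlonglongrightarrow> hin f g"
proof -
  define u' where "u' = (SOME u. apx u f)"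
  define v' where "v' = (SOME u. apx u g)"
  have f': "apx u' f" unfolding u'_def using f by (rule someI[of "\<lambda>u. apx u f"])
  have g': "apx v' g" unfolding v'_def using g by (rule someI[of "\<lambda>u. apx u g"])
  obtain e E where e: "e \<longlonglongrightarrow> (0::real)" "\<And>n. 0 \<le> e n" "\<And>n. e n \<le> E"
    "\<And>n q. cmod (lapp f q - lform k (u n) q) \<le> e n * nrm q" "\<And>n. nrm (u n) \<le> E" using apxE[OF f] by metis
  obtain e' E' where e': "e' \<longlonglongrightarrow> (0::real)" "\<And>n. 0 \<le> e' n" "\<And>n. e' n \<le> E'"
    "\<And>n q. cmod (lapp f q - lform k (u' n) q) \<le> e' n * nrm q" "\<And>n. nrm (u' n) \<le> E'" using apxE[OF f'] by metis
  obtain h E2 where h: "h \<longlonglongrightarrow> (0::real)" "\<And>n. 0 \<le> h n" "\<And>n. h n \<le> E2"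
    "\<And>n q. cmod (lapp g q - lform k (v n) q) \<le> h n * nrm q" "\<And>n. nrm (v n) \<le> E2" using apxE[OF g] by metis
  obtain h' E3 where h': "h' \<longlonglongrightarrow> (0::real)" "\<And>n. 0 \<le> h' n" "\<And>n. h' n \<le> E3"
    "\<And>n q. cmod (lapp g q - lform k (v' n) q) \<le> h' n * nrm q" "\<And>n. nrm (v' n) \<le> E3" using apxE[OF g'] by metis
  have "Cauchy (\<lambda>n. lform k (u' n) (v' n))"
  proof (rule metric_CauchyI)
    fix d :: real assume d: "d > 0"
    have "(\<lambda>n. e' n * E3 + h' n * E') \<longlonglongrightarrow> 0 * E3 + 0 * E'" by (intro tendsto_intros e' h')
    hence "\<forall>\<^sub>F n in sequentially. e' n * E3 + h' n * E' < d / 2" using d by (intro order_tendstoD) auto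
    then obtain n0 where n0: "\<And>n. n \<ge> n0 \<Longrightarrow> e' n * E3 + h' n * E' < d / 2" unfolding eventually_sequentially by auto
    have "dist (lform k (u' m) (v' m)) (lform k (u' n) (v' n)) < d" if "m \<ge> n0" "n \<ge> n0" for m n
    proof -
      have "cmod (lform k (u' m) (v' m) - lform k (u' n) (v' n)) \<le> (e' m + e' n) * nrm (v' m) + (h' m + h' n) * nrm (u' n)"
        by (rule lform_diff_bound[OF e'(4) e'(4) h'(4) h'(4)])
      also have "\<dots> \<le> (e' m + e' n) * E3 + (h' m + h' n) * E'"
        using e' h' by (intro add_mono mult_left_mono) (auto intro: add_nonneg_nonneg)
      also have "\<dots> < d" using n0[OF that(1)] n0[OF that(2)] by (simp add: algebra_simps)
      finally show ?thesis by (simp add: dist_norm)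
    qed
    thus "\<exists>M. \<forall>m\<ge>M. \<forall>n\<ge>M. dist (lform k (u' m) (v' m)) (lform k (u' n) (v' n)) < d" by blast
  qed
  hence "(\<lambda>n. lform k (u' n) (v' n)) \<longlonglongrightarrow> hin f g"
    unfolding hin_def u'_def[symmetric] v'_def[symmetric]
    using Cauchy_convergent convergent_LIMSEQ_iff by blast
  moreover have "(\<lambda>n. lform k (u n) (v n) - lform k (u' n) (v' n)) \<longlonglongrightarrow> 0"
  proof (rule Lim_null_comparison)
    show "\<forall>\<^sub>F n in sequentially. norm (lform k (u n) (v n) - lform k (u' n) (v' n)) \<le> (e n + e' n) * E2 + (h n + h' n) * E'"
    proof (intro always_eventually allI)
      fix n
      have "cmod (lform k (u n) (v n) - lform k (u' n) (v' n)) \<le> (e n + e' n) * nrm (v n) + (h n + h' n) * nrm (u' n)"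
        by (rule lform_diff_bound[OF e(4) e'(4) h(4) h'(4)])
      also have "\<dots> \<le> (e n + e' n) * E2 + (h n + h' n) * E'"
        using e e' h h' by (intro add_mono mult_left_mono) (auto intro: add_nonneg_nonneg)
      finally show "norm (lform k (u n) (v n) - lform k (u' n) (v' n)) \<le> (e n + e' n) * E2 + (h n + h' n) * E'" .
    qed
    have "(\<lambda>n. (e n + e' n) * E2 + (h n + h' n) * E') \<longlonglongrightarrow> (0 + 0) * E2 + (0 + 0) * E'" by (intro tendsto_intros e e' h h')
    thus "(\<lambda>n. (e n + e' n) * E2 + (h n + h' n) * E') \<longlonglongrightarrow> 0" by simp
  qed
  ultimately have "(\<lambda>n. (lform k (u n) (v n) - lform k (u' n) (v' n)) + lform k (u' n) (v' n)) \<longlonglongrightarrow> 0 + hin f g"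
    by (intro tendsto_add)
  thus ?thesis by simp
qed

lemma apx_add: assumes "apx u f" "apx v g" shows "apx (\<lambda>n. u n @ v n) (\<lambda>w. f w + g w)"
proof -
  obtain e where e: "e \<longlonglongrightarrow> 0" "\<And>n q. cmod (lapp f q - lform k (u n) q) \<le> e n * nrm q" using assms(1) unfolding apx_def by auto
  obtain h where h: "h \<longlonglongrightarrow> 0" "\<And>n q. cmod (lapp g q - lform k (v n) q) \<le> h n * nrm q" using assms(2) unfolding apx_def by auto
  have "cmod (lapp (\<lambda>w. f w + g w) q - lform k (u n @ v n) q) \<le> (e n + h n) * nrm q" for n q
  proof -
    have "lapp (\<lambda>w. f w + g w) q - lform k (u n @ v n) q = (lapp f q - lform k (u n) q) + (lapp g q - lform k (v n) q)"
      by (simp add: lapp_add)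
    also have "cmod \<dots> \<le> cmod (lapp f q - lform k (u n) q) + cmod (lapp g q - lform k (v n) q)" by (rule norm_triangle_ineq)
    finally show ?thesis using e(2)[of q n] h(2)[of q n] by (simp add: distrib_right)
  qed
  moreover have "(\<lambda>n. e n + h n) \<longlonglongrightarrow> 0" using tendsto_add[OF e(1) h(1)] by simp
  ultimately show ?thesis unfolding apx_def by blast
qed

lemma apx_scale: assumes "apx u f" shows "apx (\<lambda>n. lscale c (u n)) (\<lambda>w. c * f w)"
proof -
  obtain e where e: "e \<longlonglongrightarrow> 0" "\<And>n q. cmod (lapp f q - lform k (u n) q) \<le> e n * nrm q" using assms(1) unfolding apx_def by auto
  have "cmod (lapp (\<lambda>w. c * f w) q - lform k (lscale c (u n)) q) \<le> (cmod c * e n) * nrm q" for n q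
  proof -
    have "lapp (\<lambda>w. c * f w) q - lform k (lscale c (u n)) q = c * (lapp f q - lform k (u n) q)"
      by (simp add: lapp_cmult algebra_simps)
    thus ?thesis using mult_left_mono[OF e(2)[of q n], of "cmod c"] by (simp add: norm_mult mult.assoc)
  qed
  moreover have "(\<lambda>n. cmod c * e n) \<longlonglongrightarrow> 0" using tendsto_mult_left[OF e(1)] by simp
  ultimately show ?thesis unfolding apx_def by blast
qed

lemma apx_vec: "apx (\<lambda>n. p) (lvec k p)"
  unfolding apx_def by (intro exI[of _ "\<lambda>_. 0"]) (simp add: lform_lapp)

section \<open>The completion as a Hilbert space\<close>

definition HK :: "('w \<Rightarrow> complex) hilbert" where
  "HK = \<lparr>carrier = Hset, mult = (\<lambda>f g. f), one = (\<lambda>w. 0), zero = (\<lambda>w. 0),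
     add = (\<lambda>f g w. f w + g w), smult = (\<lambda>c f w. c * f w), hinner = hin\<rparr>"

lemma HK_simps [simp]:
  "carrier HK = Hset" "zero HK = (\<lambda>w. 0)" "add HK = (\<lambda>f g w. f w + g w)"
  "smult HK = (\<lambda>c f w. c * f w)" "hinner HK = hin"
  by (simp_all add: HK_def)

lemma HsetE: assumes "f \<in> Hset" obtains u where "apx u f" using assms unfolding Hset_def by auto

lemma HsetI: "apx u f \<Longrightarrow> f \<in> Hset" unfolding Hset_def by auto

lemma HK_module: "module complex_ring HK"
proof (rule cmoduleI)
  show "\<zero>\<^bsub>HK\<^esub> \<in> carrier HK" using HsetI[OF apx_vec[of "[]"]] by simp
  fix f g assume "f \<in> carrier HK" "g \<in> carrier HK"
  thus "f \<oplus>\<^bsub>HK\<^esub> g \<in> carrier HK" by (auto elim!: HsetE intro: HsetI[OF apx_add])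
next
  fix c f assume "f \<in> carrier HK"
  thus "c \<odot>\<^bsub>HK\<^esub> f \<in> carrier HK" by (auto elim!: HsetE intro: HsetI[OF apx_scale])
qed (auto simp: algebra_simps)

lemma hnorm_HK: "hnorm HK f = sqrt (Re (hin f f))"
  by (simp add: hnorm_def)

lemma nrm_lim: "apx u f \<Longrightarrow> (\<lambda>n. nrm (u n)) \<longlonglongrightarrow> hnorm HK f"
  unfolding nrm_def hnorm_HK by (intro tendsto_intros hin_lim)

lemma lapp_lim: assumes "apx u f" shows "(\<lambda>n. lform k (u n) q) \<longlonglongrightarrow> lapp f q"
proof -
  obtain e where e: "e \<longlonglongrightarrow> 0" "\<And>n q. cmod (lapp f q - lform k (u n) q) \<le> e n * nrm q" using assms(1) unfolding apx_def by auto
  have "(\<lambda>n. lform k (u n) q - lapp f q) \<longlonglongrightarrow> 0"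
  proof (rule Lim_null_comparison)
    show "\<forall>\<^sub>F n in sequentially. norm (lform k (u n) q - lapp f q) \<le> e n * nrm q"
      using e(2) by (simp add: norm_minus_commute)
    show "(\<lambda>n. e n * nrm q) \<longlonglongrightarrow> 0" using tendsto_mult_right[OF e(1), of "nrm q"] by simp
  qed
  thus ?thesis using LIM_zero_iff by blast
qed

text \<open>The reproducing property of the kernel space.\<close>

lemma hin_vec: assumes "f \<in> Hset" shows "hin f (lvec k q) = lapp f q"
proof -
  obtain u where u: "apx u f" using HsetE[OF assms] .
  show ?thesis using hin_lim[OF u apx_vec[of q]] lapp_lim[OF u, of q] by (rule LIMSEQ_unique)
qed

lemma lapp_bound: assumes "f \<in> Hset" shows "cmod (lapp f q) \<le> hnorm HK f * nrm q"
proof -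
  obtain u where u: "apx u f" using HsetE[OF assms] .
  have "(\<lambda>n. cmod (lform k (u n) q)) \<longlonglongrightarrow> cmod (lapp f q)" by (intro tendsto_norm lapp_lim u)
  moreover have "(\<lambda>n. nrm (u n) * nrm q) \<longlonglongrightarrow> hnorm HK f * nrm q" by (intro tendsto_mult_right nrm_lim u)
  ultimately show ?thesis using lform_cs by (intro LIMSEQ_le[of "\<lambda>n. cmod (lform k (u n) q)"]) auto
qed

text \<open>Together with \<open>lapp_bound\<close> this identifies the Hilbert norm with the
  antidual norm, so that norm estimates in \<open>HK\<close> reduce to inequalities against formal
  combinations. The proof tests f against its own approximations.\<close>

lemma hnorm_HK_le:
  assumes f: "f \<in> Hset" and C: "0 \<le> C" "\<And>q. cmod (lapp f q) \<le> C * nrm q" shows "hnorm HK f \<le> C"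
proof -
  obtain u where u: "apx u f" using HsetE[OF f] .
  obtain e E where e: "e \<longlonglongrightarrow> (0::real)" "\<And>n. 0 \<le> e n" "\<And>n q. cmod (lapp f q - lform k (u n) q) \<le> e n * nrm q"
    using apxE[OF u] by metis
  have "nrm (u n) \<le> C + e n" for n
  proof -
    have "(nrm (u n))\<^sup>2 = cmod (lform k (u n) (u n))" by (simp add: lform_self norm_power)
    also have "\<dots> \<le> cmod (lapp f (u n)) + cmod (lapp f (u n) - lform k (u n) (u n))" by norm
    also have "\<dots> \<le> C * nrm (u n) + e n * nrm (u n)" by (intro add_mono C e)
    finally have "nrm (u n) * nrm (u n) \<le> (C + e n) * nrm (u n)" by (simp add: power2_eq_square algebra_simps)
    thus ?thesis using C(1) e(2)[of n] by (cases "nrm (u n) = 0") (auto simp: mult_le_cancel_right dest: antisym[OF nrm_nonneg])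
  qed
  moreover have "(\<lambda>n. C + e n) \<longlonglongrightarrow> C + 0" by (intro tendsto_intros e)
  ultimately show ?thesis using nrm_lim[OF u] by (intro LIMSEQ_le[of "\<lambda>n. nrm (u n)" _ "\<lambda>n. C + e n"]) auto
qed

theorem HK_hilbert: "hilbert_space HK"
proof -
  interpret mm: cmodule HK using HK_module by (simp add: cmodule_def)
  have nn: "hin f f \<in> \<real>\<^sub>\<ge>\<^sub>0" if f: "f \<in> Hset" for f
  proof -
    obtain u where u: "apx u f" using HsetE[OF f] .
    have c: "closed (\<real>\<^sub>\<ge>\<^sub>0 :: complex set)" by simp
    show ?thesis using psd by (intro Lim_in_closed_set[OF c _ _ hin_lim[OF u u]]) auto
  qed
  \<comment> \<open>A function of norm 0 vanishes at each point, as the combination of that single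
    point shows.\<close>
  have z: "f = (\<lambda>w. 0)" if f: "f \<in> Hset" and 0: "hin f f = 0" for f
  proof
    fix w
    have "hnorm HK f = 0" using 0 by (simp add: hnorm_HK)
    thus "f w = 0" using lapp_bound[OF f, of "[(1, w)]"] by simp
  qed
  have lin: "hin (\<lambda>w. f w + g w) h = hin f h + hin g h" if fgh: "f \<in> Hset" "g \<in> Hset" "h \<in> Hset" for f g h
  proof -
    obtain u v w where u: "apx u f" "apx v g" "apx w h" using fgh[unfolded Hset_def] by blast
    have "(\<lambda>n. lform k (u n @ v n) (w n)) \<longlonglongrightarrow> hin f h + hin g h"
      using tendsto_add[OF hin_lim[OF u(1,3)] hin_lim[OF u(2,3)]] by simp
    thus ?thesis using hin_lim[OF apx_add[OF u(1,2)] u(3)] LIMSEQ_unique by blast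
  qed
  have sm: "hin (\<lambda>w. c * f w) h = c * hin f h" if fgh: "f \<in> Hset" "h \<in> Hset" for f h c
  proof -
    obtain u w where u: "apx u f" "apx w h" using fgh[unfolded Hset_def] by blast
    have "(\<lambda>n. lform k (lscale c (u n)) (w n)) \<longlonglongrightarrow> c * hin f h"
      using tendsto_mult_left[OF hin_lim[OF u], of c] by simp
    thus ?thesis using hin_lim[OF apx_scale[OF u(1)] u(2)] LIMSEQ_unique by blast
  qed
  have hm: "hin g f = cnj (hin f g)" if fgh: "f \<in> Hset" "g \<in> Hset" for f g
  proof -
    obtain u w where u: "apx u f" "apx w g" using fgh[unfolded Hset_def] by blast
    have "(\<lambda>n. lform k (w n) (u n)) \<longlonglongrightarrow> cnj (hin f g)"
      using tendsto_cnj[OF hin_lim[OF u]] by (simp add: lform_herm[symmetric])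
    thus ?thesis using hin_lim[OF u(2,1)] LIMSEQ_unique by blast
  qed
  have mi: "(f \<ominus>\<^bsub>HK\<^esub> g) = (\<lambda>w. f w - g w)" if "f \<in> Hset" "g \<in> Hset" for f g
    using mm.minus_conv[of f g] that by simp
  have complete: "norm_complete HK (hnorm HK)"
    unfolding norm_complete_def
  proof (intro allI impI)
    fix s :: "nat \<Rightarrow> 'w \<Rightarrow> complex" assume "range s \<subseteq> carrier HK"
      and Cau: "\<forall>\<epsilon>>0. \<exists>n0. \<forall>m\<ge>n0. \<forall>n\<ge>n0. hnorm HK (s m \<ominus>\<^bsub>HK\<^esub> s n) < \<epsilon>"
    hence s: "s n \<in> Hset" for n by auto
    have dH: "(\<lambda>w. s m w - s n w) \<in> Hset" for m n using mm.M.minus_closed[of "s m" "s n"] s mi by simp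
    have db: "cmod (lapp (s m) q - lapp (s n) q) \<le> hnorm HK (s m \<ominus>\<^bsub>HK\<^esub> s n) * nrm q" for m n q
      using lapp_bound[OF dH, of m n q] by (simp add: lapp_minus mi[OF s s])
    have "Cauchy (\<lambda>n. lapp (s n) q)" for q
    proof (rule metric_CauchyI)
      fix d :: real assume "d > 0"
      hence "d / (nrm q + 1) > 0" using nrm_nonneg[of q] by (simp add: add_nonneg_pos)
      then obtain n0 where n0: "\<forall>m\<ge>n0. \<forall>n\<ge>n0. hnorm HK (s m \<ominus>\<^bsub>HK\<^esub> s n) < d / (nrm q + 1)" using Cau by blast
      have "dist (lapp (s m) q) (lapp (s n) q) < d" if "m \<ge> n0" "n \<ge> n0" for m n
      proof -
        have "cmod (lapp (s m) q - lapp (s n) q) \<le> d / (nrm q + 1) * nrm q"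
          by (rule order_trans[OF db mult_right_mono]) (use n0 that in \<open>auto simp: less_imp_le\<close>)
        also have "\<dots> < d"
        proof -
          have "0 < nrm q + 1" using nrm_nonneg[of q] by linarith
          thus ?thesis using \<open>d > 0\<close> by (simp add: pos_divide_less_eq)
        qed
        finally show ?thesis by (simp add: dist_norm)
      qed
      thus "\<exists>M. \<forall>m\<ge>M. \<forall>n\<ge>M. dist (lapp (s m) q) (lapp (s n) q) < d" by blast
    qed
    hence conv: "(\<lambda>n. lapp (s n) q) \<longlonglongrightarrow> lim (\<lambda>n. lapp (s n) q)" for q
      using Cauchy_convergent convergent_LIMSEQ_iff by blast
    \<comment> \<open>The limit is taken pointwise; the antilinear extensions converge with it
      because each is a finite sum.\<close>
    define f where "f w = lim (\<lambda>n. s n w)" for w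
    have fw: "(\<lambda>n. s n w) \<longlonglongrightarrow> f w" for w using conv[of "[(1, w)]"] by (simp add: f_def)
    have fq: "(\<lambda>n. lapp (s n) q) \<longlonglongrightarrow> lapp f q" for q
    proof (induction q)
      case (Cons y q)
      show ?case unfolding lapp_simps by (intro tendsto_intros fw Cons.IH)
    qed simp
    have close: "cmod (lapp (s n) q - lapp f q) \<le> d * nrm q"
      if n: "\<And>m. m \<ge> n0 \<Longrightarrow> hnorm HK (s n \<ominus>\<^bsub>HK\<^esub> s m) < d" for n n0 d q
    proof (rule LIMSEQ_le_const2)
      show "(\<lambda>m. cmod (lapp (s n) q - lapp (s m) q)) \<longlonglongrightarrow> cmod (lapp (s n) q - lapp f q)" by (intro tendsto_intros fq)
      have "cmod (lapp (s n) q - lapp (s m) q) \<le> d * nrm q" if "m \<ge> n0" for m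
        by (rule order_trans[OF db mult_right_mono]) (use n[OF that] in \<open>auto simp: less_imp_le\<close>)
      thus "\<exists>N. \<forall>m\<ge>N. cmod (lapp (s n) q - lapp (s m) q) \<le> d * nrm q" by blast
    qed
    \<comment> \<open>To approximate the limit, choose a late member of the sequence and then a
      combination close to it, each with error d / 2.\<close>
    have ex: "\<exists>p. \<forall>q. cmod (lapp f q - lform k p q) \<le> d * nrm q" if d: "d > 0" for d
    proof -
      have "d / 2 > 0" using d by simp
      then obtain n0 where n0: "\<forall>m\<ge>n0. \<forall>n\<ge>n0. hnorm HK (s m \<ominus>\<^bsub>HK\<^esub> s n) < d / 2" using Cau by blast
      obtain u where u: "apx u (s n0)" using HsetE[OF s] .
      obtain e E where e: "e \<longlonglongrightarrow> (0::real)" "\<And>n q. cmod (lapp (s n0) q - lform k (u n) q) \<le> e n * nrm q"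
        using apxE[OF u] by metis
      have "\<forall>\<^sub>F n in sequentially. e n < d / 2" using e(1) d by (intro order_tendstoD) auto
      then obtain n where n: "e n < d / 2" unfolding eventually_sequentially by auto
      have "cmod (lapp f q - lform k (u n) q) \<le> d * nrm q" for q
      proof -
        have 1: "cmod (lapp (s n0) q - lapp f q) \<le> d / 2 * nrm q" by (rule close[of n0]) (use n0 in auto)
        have 2: "cmod (lapp (s n0) q - lform k (u n) q) \<le> d / 2 * nrm q"
          by (rule order_trans[OF e(2) mult_right_mono]) (use n in auto)
        have "cmod (lapp f q - lform k (u n) q) \<le> cmod (lapp (s n0) q - lapp f q) + cmod (lapp (s n0) q - lform k (u n) q)" by norm
        thus ?thesis using 1 2 by simp
      qed
      thus ?thesis by blast
    qed
    have "\<forall>n. \<exists>p. \<forall>q. cmod (lapp f q - lform k p q) \<le> 1 / real (Suc n) * nrm q"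
      by (rule allI, rule ex) simp
    then obtain u where u: "\<And>n q. cmod (lapp f q - lform k (u n) q) \<le> 1 / real (Suc n) * nrm q" by metis
    have "(\<lambda>n. 1 / real (Suc n)) \<longlonglongrightarrow> 0" using LIMSEQ_inverse_real_of_nat by (simp add: inverse_eq_divide)
    hence "apx u f" unfolding apx_def using u by blast
    hence f: "f \<in> Hset" by (rule HsetI)
    have sfH: "(\<lambda>w. s n w - f w) \<in> Hset" for n using mm.M.minus_closed[of "s n" f] s f mi by simp
    have "(\<lambda>n. hnorm HK (s n \<ominus>\<^bsub>HK\<^esub> f)) \<longlonglongrightarrow> 0"
    proof (rule LIMSEQ_I)
      fix d :: real assume d: "d > 0"
      hence "d / 2 > 0" by simp
      then obtain n0 where n0: "\<forall>m\<ge>n0. \<forall>n\<ge>n0. hnorm HK (s m \<ominus>\<^bsub>HK\<^esub> s n) < d / 2" using Cau by blast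
      have "norm (hnorm HK (s n \<ominus>\<^bsub>HK\<^esub> f) - 0) < d" if "n \<ge> n0" for n
      proof -
        have "hnorm HK (s n \<ominus>\<^bsub>HK\<^esub> f) \<le> d / 2" unfolding mi[OF s f]
          by (rule hnorm_HK_le[OF sfH]) (use d close[of n0 n "d / 2"] n0 that in \<open>auto simp: lapp_minus\<close>)
        moreover have "0 \<le> hnorm HK (s n \<ominus>\<^bsub>HK\<^esub> f)" unfolding mi[OF s f] hnorm_HK
          using nn[OF sfH] by (simp add: complex_nonneg_Reals_iff)
        ultimately show ?thesis using d by simp
      qed
      thus "\<exists>n0. \<forall>n\<ge>n0. norm (hnorm HK (s n \<ominus>\<^bsub>HK\<^esub> f) - 0) < d" by blast
    qed
    thus "\<exists>a\<in>carrier HK. (\<lambda>n. hnorm HK (s n \<ominus>\<^bsub>HK\<^esub> a)) \<longlonglongrightarrow> 0" using f by (intro bexI[of _ f]) auto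
  qed
  have hin0: "hin (\<lambda>w. 0) (\<lambda>w. 0) = 0"
    using sm[of "\<lambda>w. 0" "\<lambda>w. 0" 0] mm.M.zero_closed by simp
  show ?thesis
  proof (intro hilbert_space.intro hilbert_space_axioms.intro HK_module)
    fix f g h assume "f \<in> carrier HK" "g \<in> carrier HK" "h \<in> carrier HK"
    thus "hinner HK (f \<oplus>\<^bsub>HK\<^esub> g) h = hinner HK f h + hinner HK g h" using lin[of f g h] by simp
  next
    fix f g c assume "f \<in> carrier HK" "g \<in> carrier HK"
    hence f: "f \<in> Hset" and g: "g \<in> Hset" by simp_all
    show "hinner HK (c \<odot>\<^bsub>HK\<^esub> f) g = c * hinner HK f g" using sm[OF f g, of c] by simp
    show "hinner HK g f = cnj (hinner HK f g)" unfolding HK_simps by (rule hm[OF f g])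
  next
    fix f assume "f \<in> carrier HK"
    hence f: "f \<in> Hset" by simp
    show "hinner HK f f \<in> \<real>\<^sub>\<ge>\<^sub>0" unfolding HK_simps by (rule nn[OF f])
    show "(hinner HK f f = 0) = (f = \<zero>\<^bsub>HK\<^esub>)" unfolding HK_simps using z[OF f] hin0 by metis
  qed (rule complete)
qed

text \<open>A map \<open>m\<close> of the points with adjoint \<open>m'\<close> acts on functions through \<open>m'\<close>.\<close>

definition kop :: "('w \<Rightarrow> 'w) \<Rightarrow> unit \<Rightarrow> ('w \<Rightarrow> complex) \<Rightarrow> 'w \<Rightarrow> complex" where
  "kop m' = (\<lambda>i\<in>{()}. \<lambda>f\<in>Hset. \<lambda>w. f (m' w))"

abbreviation HF :: "unit \<Rightarrow> ('w \<Rightarrow> complex) hilbert" where "HF \<equiv> (\<lambda>_. HK)"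

lemma hfam_HK: "hfam {()} HF"
  using HK_hilbert by (simp add: hfam_def)

lemma kop_app [simp]: "f \<in> Hset \<Longrightarrow> kop m' () f = (\<lambda>w. f (m' w))"
  by (simp add: kop_def)

context
  fixes m m' :: "'w \<Rightarrow> 'w" and b :: real
  assumes adj: "\<And>v w. k (m v) w = k v (m' w)" and b: "0 \<le> b" "\<And>p. nrm (lmap m' p) \<le> b * nrm p"
begin

lemma lform_lmap: "lform k (lmap m p) q = lform k p (lmap m' q)"
proof (induction p)
  case (Cons x p)
  have "lapp (k (m (snd x))) q = lapp (k (snd x)) (lmap m' q)"
    unfolding lapp_lmap[symmetric] adj ..
  thus ?case using Cons by (simp add: lmap_def lform_Cons)
qed (simp add: lmap_def lform_def)

text \<open>Moving the points of a combination by m amounts, under the kernel, to moving the test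
  combination by \<open>m'\<close>; the bound on \<open>lmap m'\<close> therefore controls the
  error.\<close>

lemma apx_lmap: assumes "apx u f" shows "apx (\<lambda>n. lmap m (u n)) (\<lambda>w. f (m' w))"
proof -
  obtain e E where e: "e \<longlonglongrightarrow> (0::real)" "\<And>n. 0 \<le> e n" "\<And>n q. cmod (lapp f q - lform k (u n) q) \<le> e n * nrm q"
    using apxE[OF assms] by metis
  have "cmod (lapp (\<lambda>w. f (m' w)) q - lform k (lmap m (u n)) q) \<le> (e n * b) * nrm q" for n q
    unfolding lapp_lmap lform_lmap mult.assoc
    by (rule order_trans[OF e(3) mult_left_mono[OF b(2) e(2)]])
  moreover have "(\<lambda>n. e n * b) \<longlonglongrightarrow> 0" using tendsto_mult_right[OF e(1), of b] by simp
  ultimately show ?thesis unfolding apx_def by blast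
qed

text \<open>The bound for \<open>lmap m'\<close> on combinations passes to functions by duality,
  since composing with \<open>m'\<close> moves the test combination.\<close>

lemma kop_ops: "kop m' \<in> ops {()} HF HF"
proof -
  have c: "(\<lambda>w. f (m' w)) \<in> Hset" if "f \<in> Hset" for f
    using HsetE[OF that] HsetI[OF apx_lmap] by metis
  have "hnorm HK (\<lambda>w. f (m' w)) \<le> b * hnorm HK f" if f: "f \<in> Hset" for f
  proof (rule hnorm_HK_le[OF c[OF f]])
    interpret HK: hilbert_space HK by (rule HK_hilbert)
    have n: "0 \<le> hnorm HK f" using HK.N_nonneg f by simp
    thus "0 \<le> b * hnorm HK f" using b by simp
    show "cmod (lapp (\<lambda>w. f (m' w)) q) \<le> b * hnorm HK f * nrm q" for q
      unfolding lapp_lmap using order_trans[OF lapp_bound[OF f] mult_left_mono[OF b(2) n], of q] by (simp add: mult_ac)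
  qed
  hence "(\<lambda>i\<in>{()}. \<lambda>f\<in>carrier (HF i). \<lambda>w. f (m' w)) \<in> ops {()} HF HF"
    using c by (intro opsI_restrict[OF hfam_HK hfam_HK, of _ b]) auto
  thus ?thesis by (simp add: kop_def)
qed

end

text \<open>By hermiticity of the kernel the roles of m and \<open>m'\<close> are symmetric. The two
  operators are compared along approximating combinations, where the identity is
  \<open>lform_lmap\<close>.\<close>

lemma kop_adj:
  assumes adj: "\<And>v w. k (m v) w = k v (m' w)" and b: "0 \<le> b" "\<And>p. nrm (lmap m' p) \<le> b * nrm p"
    and b': "0 \<le> b'" "\<And>p. nrm (lmap m p) \<le> b' * nrm p"
  shows "fadj {()} HF HF (kop m') = kop m"
proof -
  have adj': "k (m' v) w = k v (m w)" for v w using adj[of w v] herm[of "m' v" w] herm[of v "m w"] by simp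
  show ?thesis
  proof (rule fadj_unique[OF hfam_HK hfam_HK kop_ops[OF adj b] kop_ops[OF adj' b']])
    fix i f g assume "f \<in> carrier (HF i)" "g \<in> carrier (HF i)"
    hence f: "f \<in> Hset" and g: "g \<in> Hset" by simp_all
    obtain u where u: "apx u f" using HsetE[OF f] .
    obtain v where v: "apx v g" using HsetE[OF g] .
    have "(\<lambda>n. lform k (lmap m' (v n)) (u n)) \<longlonglongrightarrow> hin (\<lambda>w. g (m w)) f"
      by (rule hin_lim[OF apx_lmap[OF adj' b' v] u])
    moreover have "(\<lambda>n. lform k (v n) (lmap m (u n))) \<longlonglongrightarrow> hin g (\<lambda>w. f (m' w))"
      by (rule hin_lim[OF v apx_lmap[OF adj b u]])
    ultimately have "hin (\<lambda>w. g (m w)) f = hin g (\<lambda>w. f (m' w))"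
      unfolding lform_lmap[OF adj' b'] using LIMSEQ_unique by blast
    thus "hinner (HF i) (kop m i g) f = hinner (HF i) g (kop m' i f)" using f g by simp
  qed
qed

end

section \<open>The Schur product theorem\<close>

definition psd_on :: "'i set \<Rightarrow> ('i \<Rightarrow> 'i \<Rightarrow> complex) \<Rightarrow> bool" where
  "psd_on I M \<longleftrightarrow> (\<forall>c. (\<Sum>i\<in>I. \<Sum>j\<in>I. c i * cnj (c j) * M i j) \<in> \<real>\<^sub>\<ge>\<^sub>0)"

lemma nonneg_Reals_sum: "(\<And>i. i \<in> I \<Longrightarrow> f i \<in> \<real>\<^sub>\<ge>\<^sub>0) \<Longrightarrow> (\<Sum>i\<in>I. f i) \<in> (\<real>\<^sub>\<ge>\<^sub>0 :: complex set)"
  by (induction I rule: infinite_finite_induct) auto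

text \<open>The form at e_i + t e_j. The two contributions are added, so i = j is allowed. The value
  t = 0 gives the diagonal, t = 1 and the imaginary unit give hermiticity, and all t together give
  Cauchy-Schwarz.\<close>

lemma psd_on_two:
  assumes I: "finite I" "i \<in> I" "j \<in> I" and M: "psd_on I M"
  shows "M i i + cnj t * M i j + t * M j i + t * cnj t * M j j \<in> \<real>\<^sub>\<ge>\<^sub>0"
proof -
  let ?c = "\<lambda>k. (if k = i then 1 else 0) + (if k = j then t else 0)"
  have in_l: "(\<Sum>l\<in>I. cnj (?c l) * M k l) = M k i + cnj t * M k j" for k
  proof -
    have "(\<Sum>l\<in>I. cnj (?c l) * M k l) = (\<Sum>l\<in>I. (if l = i then M k l else 0) + (if l = j then cnj t * M k l else 0))"
      by (intro sum.cong) (auto simp: algebra_simps)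
    thus ?thesis using I by (simp add: sum.distrib)
  qed
  have "(\<Sum>k\<in>I. \<Sum>l\<in>I. ?c k * cnj (?c l) * M k l) = (\<Sum>k\<in>I. ?c k * (\<Sum>l\<in>I. cnj (?c l) * M k l))"
    by (simp only: sum_distrib_left mult.assoc)
  also have "\<dots> = (\<Sum>k\<in>I. ?c k * (M k i + cnj t * M k j))" by (simp only: in_l)
  also have "\<dots> = (\<Sum>k\<in>I. (if k = i then M k i + cnj t * M k j else 0) + (if k = j then t * (M k i + cnj t * M k j) else 0))"
    by (intro sum.cong) (auto simp: algebra_simps)
  also have "\<dots> = M i i + cnj t * M i j + t * M j i + t * cnj t * M j j"
    using I by (simp add: sum.distrib algebra_simps)
  finally show ?thesis using M[unfolded psd_on_def, rule_format, of ?c] by simp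
qed

lemma psd_on_diag:
  assumes "finite I" "i \<in> I" "psd_on I M" shows "M i i \<in> \<real>\<^sub>\<ge>\<^sub>0"
  using psd_on_two[OF assms(1,2,2,3), of 0] by simp

lemma psd_on_herm:
  assumes I: "finite I" "i \<in> I" "j \<in> I" and M: "psd_on I M"
  shows "M j i = cnj (M i j)"
proof -
  have d: "Im (M i i) = 0" "Im (M j j) = 0"
    using psd_on_diag[OF I(1,2) M] psd_on_diag[OF I(1,3) M] by (simp_all add: complex_nonneg_Reals_iff)
  have "Im (M i j) + Im (M j i) = 0"
    using psd_on_two[OF I M, of 1] d by (simp add: complex_nonneg_Reals_iff)
  moreover have "Re (M j i) - Re (M i j) = 0"
    using psd_on_two[OF I M, of \<i>] d by (simp add: complex_nonneg_Reals_iff)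
  ultimately show ?thesis by (simp add: complex_eq_iff)
qed

lemma psd_on_cs:
  assumes I: "finite I" "i \<in> I" "j \<in> I" and M: "psd_on I M"
  shows "(cmod (M j i))\<^sup>2 \<le> Re (M i i) * Re (M j j)"
proof (rule cs_scalar)
  show "0 \<le> Re (M j j)" using psd_on_diag[OF I(1,3) M] by (simp add: complex_nonneg_Reals_iff)
  fix t
  have "t * cnj t = complex_of_real ((cmod t)\<^sup>2)" by (rule complex_norm_square[symmetric])
  hence "Re (M i i + cnj t * M i j + t * M j i + t * cnj t * M j j) =
      Re (M i i) + 2 * Re (t * M j i) + (cmod t)\<^sup>2 * Re (M j j)"
    using psd_on_herm[OF I(1,3,2) M]
    by (simp only: plus_complex.sel Re_complex_of_real Im_complex_of_real times_complex.sel) simp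
  thus "0 \<le> Re (M i i) + 2 * Re (t * M j i) + (cmod t)\<^sup>2 * Re (M j j)"
    using psd_on_two[OF I M, of t] by (simp add: complex_nonneg_Reals_iff)
qed

text \<open>Cholesky decomposition, by elimination of one index at a time.\<close>

lemma psd_on_decompose:
  assumes "finite I" "psd_on I M"
  shows "\<exists>u :: 'i \<Rightarrow> 'i \<Rightarrow> complex. \<forall>i\<in>I. \<forall>j\<in>I. M i j = (\<Sum>k\<in>I. u k i * cnj (u k j))"
  using assms
proof (induction I arbitrary: M rule: finite_induct)
  case (insert a I)
  let ?J = "insert a I"
  have J: "finite ?J" "a \<in> ?J" using insert by auto
  note M = insert.prems
  define d where "d = Re (M a a)"
  have d: "d \<ge> 0" "M a a = complex_of_real d"
    using psd_on_diag[OF J M] by (auto simp: d_def complex_nonneg_Reals_iff complex_eq_iff)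
  \<comment> \<open>A vanishing pivot forces its whole column to vanish by \<open>psd_on_cs\<close>,
    so the value 0 is correct in that case.\<close>
  define v where "v i = (if d = 0 then 0 else M i a / complex_of_real (sqrt d))" for i
  have herm: "M a i = cnj (M i a)" if "i \<in> ?J" for i using psd_on_herm[OF J(1) that J(2) M] .
  have va: "M i a = v i * cnj (v a)" if "i \<in> ?J" for i
  proof (cases "d = 0")
    case True
    have "(cmod (M i a))\<^sup>2 \<le> 0" using psd_on_cs[OF J that M] d True by simp
    thus ?thesis using True by (simp add: v_def)
  next
    case False
    have "complex_of_real d = complex_of_real (sqrt d) * complex_of_real (sqrt d)"
      using d(1) by (simp flip: of_real_mult)
    thus ?thesis using False d by (simp add: v_def)
  qed
  define M' where "M' i j = M i j - v i * cnj (v j)" for i j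
  have "psd_on I M'"
    unfolding psd_on_def
  proof
    fix c :: "'i \<Rightarrow> complex"
    define S where "S = (\<Sum>i\<in>I. c i * M i a)"
    \<comment> \<open>The coefficient at a that minimises the form; completing the square leaves the
      form of the Schur complement \<open>M'\<close>.\<close>
    define z where "z = (if d = 0 then 0 else - S / complex_of_real d)"
    let ?c = "c(a := z)"
    have "(\<Sum>i\<in>?J. \<Sum>j\<in>?J. ?c i * cnj (?c j) * M i j)
        = z * cnj z * M a a + (\<Sum>j\<in>I. z * cnj (c j) * M a j) + (\<Sum>i\<in>I. c i * cnj z * M i a)
          + (\<Sum>i\<in>I. \<Sum>j\<in>I. c i * cnj (c j) * M i j)"
    proof -
      have c': "?c i = c i" if "i \<in> I" for i using that insert.hyps by auto
      have "(\<Sum>j\<in>?J. ?c i * cnj (?c j) * M i j) = ?c i * cnj z * M i a + (\<Sum>j\<in>I. ?c i * cnj (c j) * M i j)" for i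
        using insert.hyps c' by (simp cong: sum.cong)
      hence "(\<Sum>i\<in>?J. \<Sum>j\<in>?J. ?c i * cnj (?c j) * M i j)
          = (\<Sum>i\<in>?J. ?c i * cnj z * M i a + (\<Sum>j\<in>I. ?c i * cnj (c j) * M i j))" by (simp only:)
      also have "\<dots> = (z * cnj z * M a a + (\<Sum>j\<in>I. z * cnj (c j) * M a j))
          + (\<Sum>i\<in>I. c i * cnj z * M i a + (\<Sum>j\<in>I. c i * cnj (c j) * M i j))"
        using insert.hyps c' by (simp cong: sum.cong)
      finally show ?thesis by (simp add: sum.distrib)
    qed
    also have "(\<Sum>j\<in>I. z * cnj (c j) * M a j) = z * cnj S"
      unfolding S_def cnj_sum sum_distrib_left using herm by (intro sum.cong) auto
    also have "(\<Sum>i\<in>I. c i * cnj z * M i a) = cnj z * S"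
      unfolding S_def sum_distrib_left by (intro sum.cong) auto
    also have "z * cnj z * M a a + z * cnj S + cnj z * S = - (\<Sum>i\<in>I. \<Sum>j\<in>I. c i * cnj (c j) * (v i * cnj (v j)))"
    proof -
      have "(\<Sum>i\<in>I. \<Sum>j\<in>I. c i * cnj (c j) * (v i * cnj (v j))) = (\<Sum>i\<in>I. c i * v i) * cnj (\<Sum>i\<in>I. c i * v i)"
        unfolding cnj_sum sum_product by (simp add: mult_ac)
      moreover have "z * cnj z * M a a + z * cnj S + cnj z * S = - ((\<Sum>i\<in>I. c i * v i) * cnj (\<Sum>i\<in>I. c i * v i))"
      proof (cases "d = 0")
        case True thus ?thesis by (simp add: z_def v_def)
      next
        case False
        have "(\<Sum>i\<in>I. c i * v i) = S / complex_of_real (sqrt d)"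
          using False unfolding S_def sum_divide_distrib by (intro sum.cong) (auto simp: v_def)
        moreover have "complex_of_real (sqrt d) * complex_of_real (sqrt d) = complex_of_real d"
          using d(1) by (simp flip: of_real_mult)
        ultimately show ?thesis using False by (simp add: z_def d(2))
      qed
      ultimately show ?thesis by simp
    qed
    also have "- (\<Sum>i\<in>I. \<Sum>j\<in>I. c i * cnj (c j) * (v i * cnj (v j))) + (\<Sum>i\<in>I. \<Sum>j\<in>I. c i * cnj (c j) * M i j)
        = (\<Sum>i\<in>I. \<Sum>j\<in>I. c i * cnj (c j) * M' i j)"
      by (simp add: M'_def sum_subtractf right_diff_distrib)
    finally show "(\<Sum>i\<in>I. \<Sum>j\<in>I. c i * cnj (c j) * M' i j) \<in> \<real>\<^sub>\<ge>\<^sub>0"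
      using M[unfolded psd_on_def, rule_format, of ?c] by (simp only:)
  qed
  then have "\<exists>u :: 'i \<Rightarrow> 'i \<Rightarrow> complex. \<forall>i\<in>I. \<forall>j\<in>I. M' i j = (\<Sum>k\<in>I. u k i * cnj (u k j))"
    by (rule insert.IH)
  then obtain u :: "'i \<Rightarrow> 'i \<Rightarrow> complex" where u: "\<forall>i\<in>I. \<forall>j\<in>I. M' i j = (\<Sum>k\<in>I. u k i * cnj (u k j))"
    by (elim exE)
  \<comment> \<open>The eliminated index contributes the factor v; the factors of the remaining
    indices are extended by 0 at a.\<close>
  define w where "w k i = (if k = a then v i else if i = a then 0 else u k i)" for k i
  have "M i j = (\<Sum>k\<in>?J. w k i * cnj (w k j))" if ij: "i \<in> ?J" "j \<in> ?J" for i j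
  proof -
    have s: "(\<Sum>k\<in>?J. w k i * cnj (w k j)) = v i * cnj (v j) + (\<Sum>k\<in>I. if i = a \<or> j = a then 0 else u k i * cnj (u k j))"
    proof -
      have "(\<Sum>k\<in>I. w k i * cnj (w k j)) = (\<Sum>k\<in>I. if i = a \<or> j = a then 0 else u k i * cnj (u k j))"
        using insert.hyps by (intro sum.cong) (auto simp: w_def)
      thus ?thesis using insert.hyps by (simp add: w_def)
    qed
    show ?thesis
    proof (cases "i = a \<or> j = a")
      case True
      have "M i j = v i * cnj (v j)"
      proof (cases "j = a")
        case True thus ?thesis using va[OF ij(1)] by simp
      next
        case False
        hence "i = a" using True by simp
        thus ?thesis using herm[OF ij(2)] va[OF ij(2)] by simp
      qed
      thus ?thesis unfolding s using True by simp
    next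
      case False
      hence "i \<in> I" "j \<in> I" using ij by auto
      thus ?thesis unfolding s using False u[rule_format, of i j] by (simp add: M'_def algebra_simps)
    qed
  qed
  thus ?case by (intro exI[of _ w]) auto
qed simp

text \<open>Decompose M into rank one matrices. Multiplying N entrywise by one of them only changes
  the test coefficients from c i to c i u k i, so the form is a sum of values of the form of
  N.\<close>

theorem schur_product:
  assumes I: "finite I" and M: "psd_on I M" and N: "psd_on I N"
  shows "psd_on I (\<lambda>i j. M i j * N i j)"
  unfolding psd_on_def
proof
  fix c :: "'a \<Rightarrow> complex"
  obtain u :: "'a \<Rightarrow> 'a \<Rightarrow> complex" where u: "\<forall>i\<in>I. \<forall>j\<in>I. M i j = (\<Sum>k\<in>I. u k i * cnj (u k j))"
    using psd_on_decompose[OF I M] by (elim exE)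
  have "(\<Sum>i\<in>I. \<Sum>j\<in>I. c i * cnj (c j) * (M i j * N i j))
      = (\<Sum>i\<in>I. \<Sum>j\<in>I. \<Sum>k\<in>I. (c i * u k i) * cnj (c j * u k j) * N i j)"
    using u by (intro sum.cong refl) (simp add: sum_distrib_left sum_distrib_right mult_ac)
  also have "\<dots> = (\<Sum>i\<in>I. \<Sum>k\<in>I. \<Sum>j\<in>I. (c i * u k i) * cnj (c j * u k j) * N i j)"
    by (intro sum.cong refl sum.swap)
  also have "\<dots> = (\<Sum>k\<in>I. \<Sum>i\<in>I. \<Sum>j\<in>I. (c i * u k i) * cnj (c j * u k j) * N i j)"
    by (rule sum.swap)
  also have "\<dots> \<in> \<real>\<^sub>\<ge>\<^sub>0"
    by (rule nonneg_Reals_sum) (rule N[unfolded psd_on_def, rule_format])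
  finally show "(\<Sum>i\<in>I. \<Sum>j\<in>I. c i * cnj (c j) * (M i j * N i j)) \<in> \<real>\<^sub>\<ge>\<^sub>0" .
qed

lemma psd_on_add:
  assumes "psd_on I M" "psd_on I N" shows "psd_on I (\<lambda>i j. M i j + N i j)"
  using assms unfolding psd_on_def by (simp add: distrib_left sum.distrib)

lemma psd_on_cmult:
  assumes M: "psd_on I M" and r: "0 \<le> r" shows "psd_on I (\<lambda>i j. complex_of_real r * M i j)"
  unfolding psd_on_def
proof
  fix c
  have "(\<Sum>i\<in>I. \<Sum>j\<in>I. c i * cnj (c j) * (complex_of_real r * M i j))
      = complex_of_real r * (\<Sum>i\<in>I. \<Sum>j\<in>I. c i * cnj (c j) * M i j)"
    unfolding sum_distrib_left by (intro sum.cong refl) simp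
  thus "(\<Sum>i\<in>I. \<Sum>j\<in>I. c i * cnj (c j) * (complex_of_real r * M i j)) \<in> \<real>\<^sub>\<ge>\<^sub>0"
    using M r by (simp add: psd_on_def)
qed

section \<open>Tracial states\<close>

locale ctrace = cstar_algebra A for A :: "('a, 'm) normed_star_algebra_scheme" (structure) +
  fixes \<tau> :: "'a \<Rightarrow> complex"
  assumes tr: "tracial_state A \<tau>"
begin

lemma tr_add: "\<lbrakk>a \<in> carrier A; b \<in> carrier A\<rbrakk> \<Longrightarrow> \<tau> (a \<oplus>\<^bsub>A\<^esub> b) = \<tau> a + \<tau> b"
  and tr_smult: "a \<in> carrier A \<Longrightarrow> \<tau> (c \<odot>\<^bsub>A\<^esub> a) = c * \<tau> a"
  and tr_one: "\<tau> \<one>\<^bsub>A\<^esub> = 1"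
  and tr_comm: "\<lbrakk>a \<in> carrier A; b \<in> carrier A\<rbrakk> \<Longrightarrow> \<tau> (a \<otimes>\<^bsub>A\<^esub> b) = \<tau> (b \<otimes>\<^bsub>A\<^esub> a)"
  using tr unfolding tracial_state_def alg_state_def by blast+

lemma tr_zero: "\<tau> \<zero>\<^bsub>A\<^esub> = 0"
  using tr_smult[of "\<zero>\<^bsub>A\<^esub>" 0] by simp

lemma tr_pos: "a \<in> carrier A \<Longrightarrow> \<tau> (invol A a \<otimes>\<^bsub>A\<^esub> a) \<in> \<real>\<^sub>\<ge>\<^sub>0"
proof -
  assume a: "a \<in> carrier A"
  have "positive_elem A (invol A a \<otimes>\<^bsub>A\<^esub> a)"
    unfolding positive_elem_def using a by (auto intro: invol_closed)
  thus ?thesis using tr unfolding tracial_state_def alg_state_def by blast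
qed

lemma tr_finsum: "(\<And>i. i \<in> I \<Longrightarrow> g i \<in> carrier A) \<Longrightarrow> \<tau> (\<Oplus>\<^bsub>A\<^esub>i\<in>I. g i) = (\<Sum>i\<in>I. \<tau> (g i))"
  by (rule finsum_hom_sum[OF M.abelian_monoid_axioms tr_zero tr_add])

text \<open>The form at c equals \<tau>(T* T), where T is the sum of the c i a i.\<close>

lemma psd_gram:
  assumes I: "finite I" and a: "\<And>i. i \<in> I \<Longrightarrow> a i \<in> carrier A"
  shows "psd_on I (\<lambda>i j. \<tau> (invol A (a j) \<otimes>\<^bsub>A\<^esub> a i))"
  unfolding psd_on_def
proof
  fix c
  let ?b = "\<lambda>i. c i \<odot>\<^bsub>A\<^esub> a i"
  have b: "?b i \<in> carrier A" if "i \<in> I" for i using a[OF that] by simp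
  have bi: "invol A (?b i) \<in> carrier A" if "i \<in> I" for i using b[OF that] by (rule invol_closed)
  let ?T = "\<Oplus>\<^bsub>A\<^esub>i\<in>I. ?b i"
  have T: "?T \<in> carrier A" using b by (intro M.finsum_closed) auto
  hence Ti: "invol A ?T \<in> carrier A" by (rule invol_closed)
  have "\<tau> (invol A ?T \<otimes>\<^bsub>A\<^esub> ?T) = \<tau> (\<Oplus>\<^bsub>A\<^esub>i\<in>I. invol A ?T \<otimes>\<^bsub>A\<^esub> ?b i)"
    using I b by (subst finsum_rdistr[OF _ Ti]) auto
  also have "\<dots> = (\<Sum>i\<in>I. \<tau> (invol A ?T \<otimes>\<^bsub>A\<^esub> ?b i))"
    by (intro tr_finsum m_closed[OF Ti b])
  also have "\<dots> = (\<Sum>i\<in>I. \<Sum>j\<in>I. c i * cnj (c j) * \<tau> (invol A (a j) \<otimes>\<^bsub>A\<^esub> a i))"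
  proof (rule sum.cong[OF refl])
    fix i assume i: "i \<in> I"
    have "invol A ?T \<otimes>\<^bsub>A\<^esub> ?b i = (\<Oplus>\<^bsub>A\<^esub>j\<in>I. invol A (?b j) \<otimes>\<^bsub>A\<^esub> ?b i)"
      using I b bi i by (subst invol_finsum) (auto simp: finsum_ldistr)
    also have "\<tau> \<dots> = (\<Sum>j\<in>I. \<tau> (invol A (?b j) \<otimes>\<^bsub>A\<^esub> ?b i))"
      using b bi i by (intro tr_finsum) auto
    also have "\<dots> = (\<Sum>j\<in>I. c i * cnj (c j) * \<tau> (invol A (a j) \<otimes>\<^bsub>A\<^esub> a i))"
      using a i by (intro sum.cong refl)
        (simp add: invol_smult invol_closed smult_mult_left smult_mult_right tr_smult B.smult_smult)
    finally show "\<tau> (invol A ?T \<otimes>\<^bsub>A\<^esub> ?b i) = \<dots>" .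
  qed
  finally show "(\<Sum>i\<in>I. \<Sum>j\<in>I. c i * cnj (c j) * \<tau> (invol A (a j) \<otimes>\<^bsub>A\<^esub> a i)) \<in> \<real>\<^sub>\<ge>\<^sub>0"
    using tr_pos[OF T] by simp
qed

text \<open>Read off from the two by two Gram matrix of a and b, which is positive and hence
  hermitian.\<close>

lemma tr_herm: assumes "a \<in> carrier A" "b \<in> carrier A"
  shows "\<tau> (invol A a \<otimes>\<^bsub>A\<^esub> b) = cnj (\<tau> (invol A b \<otimes>\<^bsub>A\<^esub> a))"
  using psd_on_herm[OF _ _ _ psd_gram[of "{True, False}" "\<lambda>i. if i then a else b"], of True False] assms by simp

lemma cnorm_one: "cnorm A \<one>\<^bsub>A\<^esub> \<le> 1"
  using cstar_identity[of "\<one>\<^bsub>A\<^esub>"] by (auto simp: B.invol_one power2_eq_square)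

text \<open>A root of 1 - x for x = b*b / |b|^2, whose powers have norm at most 1, scaled back by
  |b|. The case |b| = 0 is separated because of the division.\<close>

lemma ex_complement:
  assumes b: "b \<in> carrier A"
  shows "\<exists>d\<in>carrier A. invol A d \<otimes>\<^bsub>A\<^esub> d = complex_of_real ((cnorm A b)\<^sup>2) \<odot>\<^bsub>A\<^esub> \<one>\<^bsub>A\<^esub> \<ominus>\<^bsub>A\<^esub> invol A b \<otimes>\<^bsub>A\<^esub> b"
proof (cases "cnorm A b = 0")
  case True
  hence "b = \<zero>\<^bsub>A\<^esub>" using b cnorm_eq_zero by blast
  thus ?thesis using True by (intro bexI[of _ "\<zero>\<^bsub>A\<^esub>"]) (simp_all add: B.invol_zero)
next
  case False
  define s where "s = (cnorm A b)\<^sup>2"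
  have s: "s > 0" using False unfolding s_def by simp
  have bb: "invol A b \<otimes>\<^bsub>A\<^esub> b \<in> carrier A" using b invol_closed by simp
  define x where "x = complex_of_real (1 / s) \<odot>\<^bsub>A\<^esub> (invol A b \<otimes>\<^bsub>A\<^esub> b)"
  have x: "x \<in> carrier A" unfolding x_def using bb by simp
  have xi: "invol A x = x" unfolding x_def using b bb by (simp add: invol_smult invol_mult invol_invol invol_closed)
  have n1: "cmod (complex_of_real (1 / s)) = 1 / s" using s by (simp add: norm_divide)
  have n2: "cnorm A (invol A b \<otimes>\<^bsub>A\<^esub> b) = s" using cstar_identity[OF b] by (simp add: s_def)
  have "cnorm A x = 1" unfolding x_def cnorm_smult[OF bb] n1 n2 using s by simp
  hence "cnorm A (x [^]\<^bsub>A\<^esub> n) \<le> 1" for n :: nat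
  proof (induction n)
    case 0 show ?case using cnorm_one by simp
  next
    case (Suc n)
    have "cnorm A (x [^]\<^bsub>A\<^esub> Suc n) \<le> cnorm A (x [^]\<^bsub>A\<^esub> n) * cnorm A x"
      using x by (simp add: cnorm_submult)
    thus ?case using Suc by simp
  qed
  from B.ex_sqrt[OF x xi this] obtain r where r: "r \<in> carrier A" "invol A r = r" "r \<otimes>\<^bsub>A\<^esub> r = \<one>\<^bsub>A\<^esub> \<ominus>\<^bsub>A\<^esub> x" by blast
  let ?d = "complex_of_real (sqrt s) \<odot>\<^bsub>A\<^esub> r"
  have "complex_of_real (sqrt s) * complex_of_real (sqrt s) = complex_of_real s" using s by (simp flip: of_real_mult)
  hence "invol A ?d \<otimes>\<^bsub>A\<^esub> ?d = complex_of_real s \<odot>\<^bsub>A\<^esub> (\<one>\<^bsub>A\<^esub> \<ominus>\<^bsub>A\<^esub> x)"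
    using r x by (simp add: invol_smult smult_mult_left smult_mult_right B.smult_smult M.minus_closed)
  also have "\<dots> = complex_of_real s \<odot>\<^bsub>A\<^esub> \<one>\<^bsub>A\<^esub> \<ominus>\<^bsub>A\<^esub> invol A b \<otimes>\<^bsub>A\<^esub> b"
    using s x bb by (simp add: B.minus_conv B.smult_rdist B.smult_smult) (simp add: x_def B.smult_smult)
  finally show ?thesis using r s_def by auto
qed

text \<open>With d*d = |b|^2 1 - b*b the difference is the Gram matrix of the elements d a i. This
  is the boundedness of left multiplication in the GNS construction, in a matrix form that can enter
  Schur products.\<close>

lemma psd_bound:
  assumes I: "finite I" and a: "\<And>i. i \<in> I \<Longrightarrow> a i \<in> carrier A" and b: "b \<in> carrier A"
  shows "psd_on I (\<lambda>i j. complex_of_real ((cnorm A b)\<^sup>2) * \<tau> (invol A (a j) \<otimes>\<^bsub>A\<^esub> a i)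
    - \<tau> (invol A (b \<otimes>\<^bsub>A\<^esub> a j) \<otimes>\<^bsub>A\<^esub> (b \<otimes>\<^bsub>A\<^esub> a i)))"
proof -
  let ?s = "complex_of_real ((cnorm A b)\<^sup>2)"
  obtain d where d: "d \<in> carrier A" "invol A d \<otimes>\<^bsub>A\<^esub> d = ?s \<odot>\<^bsub>A\<^esub> \<one>\<^bsub>A\<^esub> \<ominus>\<^bsub>A\<^esub> invol A b \<otimes>\<^bsub>A\<^esub> b"
    using ex_complement[OF b] by (elim bexE)
  have "\<tau> (invol A (d \<otimes>\<^bsub>A\<^esub> y) \<otimes>\<^bsub>A\<^esub> (d \<otimes>\<^bsub>A\<^esub> z)) = ?s * \<tau> (invol A y \<otimes>\<^bsub>A\<^esub> z) - \<tau> (invol A (b \<otimes>\<^bsub>A\<^esub> y) \<otimes>\<^bsub>A\<^esub> (b \<otimes>\<^bsub>A\<^esub> z))"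
    if yz: "y \<in> carrier A" "z \<in> carrier A" for y z
  proof -
    note c = yz b d(1) invol_closed[OF yz(1)] invol_closed[OF b] invol_closed[OF d(1)]
    have "invol A (d \<otimes>\<^bsub>A\<^esub> y) \<otimes>\<^bsub>A\<^esub> (d \<otimes>\<^bsub>A\<^esub> z) = invol A y \<otimes>\<^bsub>A\<^esub> ((invol A d \<otimes>\<^bsub>A\<^esub> d) \<otimes>\<^bsub>A\<^esub> z)"
      using c by (simp add: invol_mult m_assoc)
    also have "\<dots> = ?s \<odot>\<^bsub>A\<^esub> (invol A y \<otimes>\<^bsub>A\<^esub> z) \<oplus>\<^bsub>A\<^esub> (- 1) \<odot>\<^bsub>A\<^esub> (invol A y \<otimes>\<^bsub>A\<^esub> (invol A b \<otimes>\<^bsub>A\<^esub> (b \<otimes>\<^bsub>A\<^esub> z)))"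
      unfolding d(2) using c by (simp add: B.minus_conv l_distr r_distr smult_mult_left smult_mult_right m_assoc)
    also have "invol A y \<otimes>\<^bsub>A\<^esub> (invol A b \<otimes>\<^bsub>A\<^esub> (b \<otimes>\<^bsub>A\<^esub> z)) = invol A (b \<otimes>\<^bsub>A\<^esub> y) \<otimes>\<^bsub>A\<^esub> (b \<otimes>\<^bsub>A\<^esub> z)"
      using c by (simp add: invol_mult m_assoc)
    finally show ?thesis using c by (simp add: tr_add tr_smult invol_closed)
  qed
  hence "(\<lambda>i j. if i \<in> I \<and> j \<in> I then \<tau> (invol A (d \<otimes>\<^bsub>A\<^esub> a j) \<otimes>\<^bsub>A\<^esub> (d \<otimes>\<^bsub>A\<^esub> a i)) else 0)
    = (\<lambda>i j. if i \<in> I \<and> j \<in> I then ?s * \<tau> (invol A (a j) \<otimes>\<^bsub>A\<^esub> a i) - \<tau> (invol A (b \<otimes>\<^bsub>A\<^esub> a j) \<otimes>\<^bsub>A\<^esub> (b \<otimes>\<^bsub>A\<^esub> a i)) else 0)"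
    using a by (auto simp: fun_eq_iff)
  note E = this
  \<comment> \<open>\<open>psd_on I\<close> sees only indices in I. The artificial 0 elsewhere
    permits rewriting under the binders although a is controlled on I alone.\<close>
  have cong: "psd_on I (\<lambda>i j. if i \<in> I \<and> j \<in> I then P i j else 0) = psd_on I P" for P
    unfolding psd_on_def by (simp cong: sum.cong)
  have "psd_on I (\<lambda>i j. \<tau> (invol A (d \<otimes>\<^bsub>A\<^esub> a j) \<otimes>\<^bsub>A\<^esub> (d \<otimes>\<^bsub>A\<^esub> a i)))"
    by (rule psd_gram[OF I]) (rule m_closed[OF d(1) a])
  hence "psd_on I (\<lambda>i j. if i \<in> I \<and> j \<in> I then \<tau> (invol A (d \<otimes>\<^bsub>A\<^esub> a j) \<otimes>\<^bsub>A\<^esub> (d \<otimes>\<^bsub>A\<^esub> a i)) else 0)"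
    unfolding cong .
  thus ?thesis unfolding E cong .
qed

end

section \<open>The tensor product of two traces\<close>

lemma lform_nth:
  "lform k p q = (\<Sum>i<length p. \<Sum>j<length q. fst (p ! i) * cnj (fst (q ! j)) * k (snd (p ! i)) (snd (q ! j)))"
  by (simp add: lform_def sum_list_sum_nth atLeast0LessThan)

text \<open>Points enter the space only through the kernel, so a formal relation that the kernel
  does not see holds for all its functions. Linearity of the tensor representation rests on
  this.\<close>

lemma (in psd_kernel) lapp_null:
  assumes f: "f \<in> Hset" and q: "\<And>v. lapp (k v) q = 0" shows "lapp f q = 0"
proof -
  have "lform k p q = 0" for p by (induction p) (simp_all add: lform_Cons q, simp add: lform_def)
  hence "nrm q = 0" by (simp add: nrm_def)
  thus ?thesis using lapp_bound[OF f, of q] by simp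
qed

locale two_traces = A: ctrace A \<tau> + C: ctrace C \<sigma>
  for A :: "('a, 'm) normed_star_algebra_scheme" and \<tau> :: "'a \<Rightarrow> complex"
    and C :: "('c, 'n) normed_star_algebra_scheme" and \<sigma> :: "'c \<Rightarrow> complex"
begin

text \<open>Points are pairs standing for elementary tensors; components outside the carriers count
  as \<open>0\<close>.\<close>

definition nA :: "'a \<times> 'c \<Rightarrow> 'a" where "nA w = (if fst w \<in> carrier A then fst w else \<zero>\<^bsub>A\<^esub>)"

definition nC :: "'a \<times> 'c \<Rightarrow> 'c" where "nC w = (if snd w \<in> carrier C then snd w else \<zero>\<^bsub>C\<^esub>)"

definition kk :: "'a \<times> 'c \<Rightarrow> 'a \<times> 'c \<Rightarrow> complex" where
  "kk p q = \<tau> (invol A (nA q) \<otimes>\<^bsub>A\<^esub> nA p) * \<sigma> (invol C (nC q) \<otimes>\<^bsub>C\<^esub> nC p)"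

definition ac :: "'a \<Rightarrow> 'c \<Rightarrow> 'a \<times> 'c \<Rightarrow> 'a \<times> 'c" where
  "ac a c w = (a \<otimes>\<^bsub>A\<^esub> nA w, c \<otimes>\<^bsub>C\<^esub> nC w)"

lemma nA_closed [simp]: "nA w \<in> carrier A" and nC_closed [simp]: "nC w \<in> carrier C"
  by (simp_all add: nA_def nC_def)

lemma nA_ac [simp]: "a \<in> carrier A \<Longrightarrow> nA (ac a c w) = a \<otimes>\<^bsub>A\<^esub> nA w"
  by (subst nA_def) (simp add: ac_def)

lemma nC_ac [simp]: "c \<in> carrier C \<Longrightarrow> nC (ac a c w) = c \<otimes>\<^bsub>C\<^esub> nC w"
  by (subst nC_def) (simp add: ac_def)

lemma kk_psd: "lform kk p p \<in> \<real>\<^sub>\<ge>\<^sub>0"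
proof -
  have "psd_on {..<length p} (\<lambda>i j. \<tau> (invol A (nA (snd (p ! j))) \<otimes>\<^bsub>A\<^esub> nA (snd (p ! i)))
      * \<sigma> (invol C (nC (snd (p ! j))) \<otimes>\<^bsub>C\<^esub> nC (snd (p ! i))))"
    by (intro schur_product A.psd_gram C.psd_gram) auto
  from this[unfolded psd_on_def, rule_format, of "\<lambda>i. fst (p ! i)"]
  show ?thesis unfolding lform_nth kk_def .
qed

sublocale K: psd_kernel kk
proof
  show "kk w v = cnj (kk v w)" for v w
    unfolding kk_def using A.tr_herm[of "nA v" "nA w"] C.tr_herm[of "nC v" "nC w"] by simp
qed (rule kk_psd)

lemma kk_adj:
  assumes "a \<in> carrier A" "c \<in> carrier C"
  shows "kk (ac a c v) w = kk v (ac (invol A a) (invol C c) w)"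
  unfolding kk_def using assms
  by (simp add: A.invol_closed C.invol_closed A.invol_mult C.invol_mult A.invol_invol C.invol_invol A.m_assoc C.m_assoc)

text \<open>Boundedness of a \<otimes> c for the product kernel. Let M1, M2 be the Gram matrices,
  N1, N2 those after multiplication, and s, t the squared norms. Then s t M1 M2 - N1 N2 = t (s M1 -
  N1) M2 + N1 (t M2 - N2), and both summands are built from Schur products of positive
  matrices.\<close>

lemma nrm_ac:
  assumes a: "a \<in> carrier A" and c: "c \<in> carrier C"
  shows "K.nrm (lmap (ac a c) p) \<le> (cnorm A a * cnorm C c) * K.nrm p"
proof (rule power2_le_imp_le)
  define I where "I = {..<length p}"
  define x where "x i = nA (snd (p ! i))" for i
  define y where "y i = nC (snd (p ! i))" for i
  define s where "s = (cnorm A a)\<^sup>2"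
  define t where "t = (cnorm C c)\<^sup>2"
  define M1 where "M1 i j = \<tau> (invol A (x j) \<otimes>\<^bsub>A\<^esub> x i)" for i j
  define M2 where "M2 i j = \<sigma> (invol C (y j) \<otimes>\<^bsub>C\<^esub> y i)" for i j
  define N1 where "N1 i j = \<tau> (invol A (a \<otimes>\<^bsub>A\<^esub> x j) \<otimes>\<^bsub>A\<^esub> (a \<otimes>\<^bsub>A\<^esub> x i))" for i j
  define N2 where "N2 i j = \<sigma> (invol C (c \<otimes>\<^bsub>C\<^esub> y j) \<otimes>\<^bsub>C\<^esub> (c \<otimes>\<^bsub>C\<^esub> y i))" for i j
  have I: "finite I" by (simp add: I_def)
  have xy: "x i \<in> carrier A" "y i \<in> carrier C" for i by (simp_all add: x_def y_def)
  have P: "psd_on I N1" "psd_on I M2"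
    "psd_on I (\<lambda>i j. complex_of_real s * M1 i j - N1 i j)" "psd_on I (\<lambda>i j. complex_of_real t * M2 i j - N2 i j)"
    unfolding N1_def M2_def M1_def N2_def s_def t_def
    by (intro A.psd_gram C.psd_gram A.psd_bound C.psd_bound I xy a c A.m_closed C.m_closed)+
  have "psd_on I (\<lambda>i j. complex_of_real t * ((complex_of_real s * M1 i j - N1 i j) * M2 i j)
      + N1 i j * (complex_of_real t * M2 i j - N2 i j))"
    by (intro psd_on_add psd_on_cmult schur_product I P) (simp add: t_def)
  also have "(\<lambda>i j. complex_of_real t * ((complex_of_real s * M1 i j - N1 i j) * M2 i j)
      + N1 i j * (complex_of_real t * M2 i j - N2 i j))
    = (\<lambda>i j. complex_of_real (s * t) * (M1 i j * M2 i j) - N1 i j * N2 i j)"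
    by (simp add: fun_eq_iff algebra_simps)
  finally have PP: "psd_on I (\<lambda>i j. complex_of_real (s * t) * (M1 i j * M2 i j) - N1 i j * N2 i j)" .
  have "(\<Sum>i\<in>I. \<Sum>j\<in>I. fst (p ! i) * cnj (fst (p ! j)) *
      (complex_of_real (s * t) * (M1 i j * M2 i j) - N1 i j * N2 i j)) \<in> \<real>\<^sub>\<ge>\<^sub>0"
    by (rule PP[unfolded psd_on_def, rule_format, of "\<lambda>i. fst (p ! i)"])
  also have "(\<Sum>i\<in>I. \<Sum>j\<in>I. fst (p ! i) * cnj (fst (p ! j)) *
      (complex_of_real (s * t) * (M1 i j * M2 i j) - N1 i j * N2 i j))
    = complex_of_real (s * t) * lform kk p p - lform kk (lmap (ac a c) p) (lmap (ac a c) p)"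
  proof -
    have 1: "lform kk p p = (\<Sum>i\<in>I. \<Sum>j\<in>I. fst (p ! i) * cnj (fst (p ! j)) * (M1 i j * M2 i j))"
      unfolding lform_nth kk_def I_def M1_def M2_def x_def y_def ..
    have 2: "lform kk (lmap (ac a c) p) (lmap (ac a c) p)
        = (\<Sum>i\<in>I. \<Sum>j\<in>I. fst (p ! i) * cnj (fst (p ! j)) * (N1 i j * N2 i j))"
      unfolding lform_nth kk_def I_def N1_def N2_def x_def y_def using a c
      by (intro sum.cong) (auto simp: lmap_def)
    show ?thesis unfolding 1 2 sum_distrib_left sum_subtractf[symmetric]
      by (intro sum.cong refl) (simp add: right_diff_distrib mult_ac)
  qed
  finally have nn: "complex_of_real (s * t) * lform kk p p - lform kk (lmap (ac a c) p) (lmap (ac a c) p) \<in> \<real>\<^sub>\<ge>\<^sub>0" .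
  hence "0 \<le> Re (complex_of_real (s * t) * lform kk p p - lform kk (lmap (ac a c) p) (lmap (ac a c) p))"
    unfolding complex_nonneg_Reals_iff by blast
  hence "(K.nrm (lmap (ac a c) p))\<^sup>2 \<le> (s * t) * (K.nrm p)\<^sup>2"
    unfolding K.lform_self by (simp only: of_real_mult[symmetric] of_real_diff[symmetric] Re_complex_of_real)
  thus "(K.nrm (lmap (ac a c) p))\<^sup>2 \<le> (cnorm A a * cnorm C c * K.nrm p)\<^sup>2"
    by (simp only: s_def t_def power_mult_distrib)
qed (use A.cnorm_nonneg[OF a] C.cnorm_nonneg[OF c] K.nrm_nonneg in simp)

text \<open>Left multiplication by a \<otimes> c. The adjoints occur because \<open>kop\<close>
  expects the adjoint of the map on points.\<close>

definition L :: "'a \<Rightarrow> 'c \<Rightarrow> unit \<Rightarrow> ('a \<times> 'c \<Rightarrow> complex) \<Rightarrow> 'a \<times> 'c \<Rightarrow> complex" where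
  "L a c = K.kop (ac (invol A a) (invol C c))"

abbreviation DD where "DD \<equiv> op_families {()} K.HF K.HF"

lemma L_app: "f \<in> K.Hset \<Longrightarrow> L a c () f = (\<lambda>w. f (ac (invol A a) (invol C c) w))"
  by (simp add: L_def)

lemma L_ops: assumes a: "a \<in> carrier A" and c: "c \<in> carrier C"
  shows "L a c \<in> ops {()} K.HF K.HF"
  unfolding L_def
  by (rule K.kop_ops[OF kk_adj[OF a c] _ nrm_ac[OF A.invol_closed[OF a] C.invol_closed[OF c]]])
    (use A.cnorm_nonneg[OF A.invol_closed[OF a]] C.cnorm_nonneg[OF C.invol_closed[OF c]] in simp)

lemma L_adj: assumes a: "a \<in> carrier A" and c: "c \<in> carrier C"
  shows "fadj {()} K.HF K.HF (L a c) = L (invol A a) (invol C c)"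
  unfolding L_def A.invol_invol[OF a] C.invol_invol[OF c]
  by (rule K.kop_adj[OF kk_adj[OF a c] _ nrm_ac[OF A.invol_closed[OF a] C.invol_closed[OF c]] _ nrm_ac[OF a c]])
    (use A.cnorm_nonneg[OF A.invol_closed[OF a]] C.cnorm_nonneg[OF C.invol_closed[OF c]]
      A.cnorm_nonneg[OF a] C.cnorm_nonneg[OF c] in simp_all)

lemma Hset_kk: "kk v \<in> K.Hset"
proof -
  have "lvec kk [(1, v)] = kk v" by (simp add: fun_eq_iff)
  thus ?thesis using K.HsetI[OF K.apx_vec[of "[(1, v)]"]] by (simp only:)
qed

lemma L_app_closed: "f \<in> K.Hset \<Longrightarrow> a \<in> carrier A \<Longrightarrow> c \<in> carrier C \<Longrightarrow> L a c () f \<in> K.Hset"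
  using opsD(4)[OF L_ops, of a c "()" f] by simp

lemma L_eqI:
  assumes "U \<in> ops {()} K.HF K.HF" "Y \<in> ops {()} K.HF K.HF" "\<And>f w. f \<in> K.Hset \<Longrightarrow> U () f w = Y () f w"
  shows "U = Y"
  using assms by (intro ops_eqI[of _ "{()}" K.HF K.HF]) (auto simp: fun_eq_iff)

lemma DD_cstar: "cstar_algebra DD"
  by (rule ops_cstar[OF K.hfam_HK])

sublocale DD: cstar_algebra DD by (rule DD_cstar)

lemma DD_vals:
  assumes f: "f \<in> K.Hset"
  shows "(U \<oplus>\<^bsub>DD\<^esub> Y) () f w = U () f w + Y () f w" "(c \<odot>\<^bsub>DD\<^esub> U) () f w = c * U () f w"
    "\<one>\<^bsub>DD\<^esub> () f w = f w" "\<zero>\<^bsub>DD\<^esub> () f w = 0" "(U \<otimes>\<^bsub>DD\<^esub> Y) () f w = U () (Y () f) w"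
  using op_families_vals[of "()" "{()}" f K.HF] f by (simp_all add: op_families_mult)

section \<open>Multiplicativity and bilinearity of the elementary tensors\<close>

lemma L_mult:
  assumes a: "a \<in> carrier A" "b \<in> carrier A" and c: "c \<in> carrier C" "d \<in> carrier C"
  shows "L a c \<otimes>\<^bsub>DD\<^esub> L b d = L (a \<otimes>\<^bsub>A\<^esub> b) (c \<otimes>\<^bsub>C\<^esub> d)"
proof (rule L_eqI)
  show "L a c \<otimes>\<^bsub>DD\<^esub> L b d \<in> ops {()} K.HF K.HF" using a c by (intro DD.m_closed L_ops)
  show "L (a \<otimes>\<^bsub>A\<^esub> b) (c \<otimes>\<^bsub>C\<^esub> d) \<in> ops {()} K.HF K.HF" using a c by (intro L_ops A.m_closed C.m_closed)
  fix f w assume f: "f \<in> K.Hset"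
  show "(L a c \<otimes>\<^bsub>DD\<^esub> L b d) () f w = L (a \<otimes>\<^bsub>A\<^esub> b) (c \<otimes>\<^bsub>C\<^esub> d) () f w"
  proof -
    have "(L a c \<otimes>\<^bsub>DD\<^esub> L b d) () f w = L a c () (L b d () f) w" by (rule DD_vals(5)[OF f])
    also have "\<dots> = L b d () f (ac (invol A a) (invol C c) w)"
      by (rule fun_cong[OF L_app[OF L_app_closed[OF f a(2) c(2)]]])
    also have "\<dots> = f (ac (invol A b) (invol C d) (ac (invol A a) (invol C c) w))" by (rule fun_cong[OF L_app[OF f]])
    also have "ac (invol A b) (invol C d) (ac (invol A a) (invol C c) w) = ac (invol A (a \<otimes>\<^bsub>A\<^esub> b)) (invol C (c \<otimes>\<^bsub>C\<^esub> d)) w"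
      unfolding ac_def[of "invol A b"] ac_def[of "invol A (a \<otimes>\<^bsub>A\<^esub> b)"] using a c
      by (simp add: A.invol_closed C.invol_closed A.invol_mult C.invol_mult A.m_assoc C.m_assoc)
    also have "f \<dots> = L (a \<otimes>\<^bsub>A\<^esub> b) (c \<otimes>\<^bsub>C\<^esub> d) () f w" by (rule fun_cong[OF L_app[OF f], symmetric])
    finally show ?thesis .
  qed
qed

text \<open>Multiplication by the units changes a point with a component outside its carrier, yet
  the old and the new point have the same kernel values.\<close>

lemma L_one: "L \<one>\<^bsub>A\<^esub> \<one>\<^bsub>C\<^esub> = \<one>\<^bsub>DD\<^esub>"
proof (rule L_eqI)
  fix f w assume f: "f \<in> K.Hset"
  have "lapp f [(1, ac \<one>\<^bsub>A\<^esub> \<one>\<^bsub>C\<^esub> w), (- 1, w)] = 0"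
    by (rule K.lapp_null[OF f]) (simp add: kk_def)
  thus "L \<one>\<^bsub>A\<^esub> \<one>\<^bsub>C\<^esub> () f w = \<one>\<^bsub>DD\<^esub> () f w"
    unfolding L_app[OF f] DD_vals[OF f] A.B.invol_one C.B.invol_one by simp
qed (auto intro: L_ops)

text \<open>The three points of the combination are unrelated as pairs; it is their kernel values
  that satisfy the relation, because \<tau> is additive. The next three lemmas use the same
  argument.\<close>

lemma L_add_left:
  assumes a: "a \<in> carrier A" "b \<in> carrier A" and c: "c \<in> carrier C"
  shows "L (a \<oplus>\<^bsub>A\<^esub> b) c = L a c \<oplus>\<^bsub>DD\<^esub> L b c"
proof (rule L_eqI)
  fix f w assume f: "f \<in> K.Hset"
  note ic = A.invol_closed[OF a(1)] A.invol_closed[OF a(2)] C.invol_closed[OF c]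
  have "lapp f [(1, ac (invol A a \<oplus>\<^bsub>A\<^esub> invol A b) (invol C c) w), (- 1, ac (invol A a) (invol C c) w), (- 1, ac (invol A b) (invol C c) w)] = 0"
    by (rule K.lapp_null[OF f])
      (use a c ic in \<open>simp add: kk_def A.l_distr A.invol_add A.invol_closed A.tr_add algebra_simps\<close>)
  thus "L (a \<oplus>\<^bsub>A\<^esub> b) c () f w = (L a c \<oplus>\<^bsub>DD\<^esub> L b c) () f w"
    unfolding L_app[OF f] DD_vals[OF f] A.invol_add[OF a] by (simp add: algebra_simps)
qed (use a c in \<open>auto intro!: L_ops DD.M.a_closed\<close>)

lemma L_add_right:
  assumes a: "a \<in> carrier A" and c: "c \<in> carrier C" "d \<in> carrier C"
  shows "L a (c \<oplus>\<^bsub>C\<^esub> d) = L a c \<oplus>\<^bsub>DD\<^esub> L a d"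
proof (rule L_eqI)
  fix f w assume f: "f \<in> K.Hset"
  note ic = C.invol_closed[OF c(1)] C.invol_closed[OF c(2)] A.invol_closed[OF a]
  have "lapp f [(1, ac (invol A a) (invol C c \<oplus>\<^bsub>C\<^esub> invol C d) w), (- 1, ac (invol A a) (invol C c) w), (- 1, ac (invol A a) (invol C d) w)] = 0"
    by (rule K.lapp_null[OF f])
      (use a c ic in \<open>simp add: kk_def C.l_distr C.invol_add C.invol_closed C.tr_add algebra_simps\<close>)
  thus "L a (c \<oplus>\<^bsub>C\<^esub> d) () f w = (L a c \<oplus>\<^bsub>DD\<^esub> L a d) () f w"
    unfolding L_app[OF f] DD_vals[OF f] C.invol_add[OF c] by (simp add: algebra_simps)
qed (use a c in \<open>auto intro!: L_ops DD.M.a_closed\<close>)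

lemma L_smult_left:
  assumes a: "a \<in> carrier A" and c: "c \<in> carrier C"
  shows "L (z \<odot>\<^bsub>A\<^esub> a) c = z \<odot>\<^bsub>DD\<^esub> L a c"
proof (rule L_eqI)
  fix f w assume f: "f \<in> K.Hset"
  note ic = A.invol_closed[OF a] C.invol_closed[OF c]
  have "lapp f [(1, ac (cnj z \<odot>\<^bsub>A\<^esub> invol A a) (invol C c) w), (- cnj z, ac (invol A a) (invol C c) w)] = 0"
    by (rule K.lapp_null[OF f])
      (use a c ic in \<open>simp add: kk_def A.smult_mult_left A.invol_smult A.invol_closed A.tr_smult\<close>)
  thus "L (z \<odot>\<^bsub>A\<^esub> a) c () f w = (z \<odot>\<^bsub>DD\<^esub> L a c) () f w"
    unfolding L_app[OF f] DD_vals[OF f] A.invol_smult[OF a] by simp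
qed (use a c in \<open>auto intro!: L_ops DD.B.smult_closed'\<close>)

lemma L_smult_right:
  assumes a: "a \<in> carrier A" and c: "c \<in> carrier C"
  shows "L a (z \<odot>\<^bsub>C\<^esub> c) = z \<odot>\<^bsub>DD\<^esub> L a c"
proof (rule L_eqI)
  fix f w assume f: "f \<in> K.Hset"
  note ic = A.invol_closed[OF a] C.invol_closed[OF c]
  have "lapp f [(1, ac (invol A a) (cnj z \<odot>\<^bsub>C\<^esub> invol C c) w), (- cnj z, ac (invol A a) (invol C c) w)] = 0"
    by (rule K.lapp_null[OF f])
      (use a c ic in \<open>simp add: kk_def C.smult_mult_left C.invol_smult C.invol_closed C.tr_smult\<close>)
  thus "L a (z \<odot>\<^bsub>C\<^esub> c) () f w = (z \<odot>\<^bsub>DD\<^esub> L a c) () f w"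
    unfolding L_app[OF f] DD_vals[OF f] C.invol_smult[OF c] by simp
qed (use a c in \<open>auto intro!: L_ops DD.B.smult_closed'\<close>)

definition LS :: "(unit \<Rightarrow> ('a \<times> 'c \<Rightarrow> complex) \<Rightarrow> 'a \<times> 'c \<Rightarrow> complex) set" where
  "LS = {L a c | a c. a \<in> carrier A \<and> c \<in> carrier C}"

definition TT where "TT = DD\<lparr>carrier := norm_closure DD (lin_span DD LS)\<rparr>"

lemma LS_ops: "LS \<subseteq> carrier DD" unfolding LS_def using L_ops by blast

lemma LSI: "a \<in> carrier A \<Longrightarrow> c \<in> carrier C \<Longrightarrow> L a c \<in> LS" unfolding LS_def by blast

lemma span_sub: "lin_span DD LS \<subseteq> carrier DD"
  by (rule DD.B.lin_span_carrier[OF LS_ops])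

lemma TT_cstar: "cstar_algebra TT"
  unfolding TT_def
proof (rule DD.span_closure_cstar[OF LS_ops])
  show "\<one>\<^bsub>DD\<^esub> \<in> lin_span DD LS"
    using subsetD[OF DD.B.lin_span_superset[OF LS_ops] LSI[OF A.one_closed C.one_closed]] by (simp add: L_one)
  show "U \<otimes>\<^bsub>DD\<^esub> Y \<in> LS" if UY: "U \<in> LS" "Y \<in> LS" for U Y
  proof -
    obtain a c b d where s: "U = L a c" "Y = L b d" "a \<in> carrier A" "c \<in> carrier C" "b \<in> carrier A" "d \<in> carrier C"
      using UY unfolding LS_def by blast
    show ?thesis unfolding s using s by (simp add: L_mult LSI)
  qed
  show "invol DD U \<in> LS" if U: "U \<in> LS" for U
  proof -
    obtain a c where s: "U = L a c" "a \<in> carrier A" "c \<in> carrier C" using U unfolding LS_def by blast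
    show ?thesis unfolding s(1) op_families_invol L_adj[OF s(2,3)]
      by (rule LSI[OF A.invol_closed[OF s(2)] C.invol_closed[OF s(3)]])
  qed
qed

lemma TT_simps [simp]:
  "carrier TT = DD.B.ncl (lin_span DD LS)" "mult TT = mult DD" "one TT = one DD" "zero TT = zero DD" "add TT = add DD"
  "smult TT = smult DD" "invol TT = invol DD" "cnorm TT = cnorm DD"
  by (simp_all add: TT_def DD.norm_closure_eq)

lemma L_TT: "a \<in> carrier A \<Longrightarrow> c \<in> carrier C \<Longrightarrow> L a c \<in> carrier TT"
  using subsetD[OF DD.B.ncl_superset[OF span_sub] subsetD[OF DD.B.lin_span_superset[OF LS_ops] LSI]] by simp

text \<open>The cyclic vector 1 \<otimes> 1 of the GNS space.\<close>

definition om where "om = kk (\<one>\<^bsub>A\<^esub>, \<one>\<^bsub>C\<^esub>)"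

definition \<phi> :: "(unit \<Rightarrow> ('a \<times> 'c \<Rightarrow> complex) \<Rightarrow> 'a \<times> 'c \<Rightarrow> complex) \<Rightarrow> complex" where
  "\<phi> U = K.hin (U () om) om"

lemma om_H: "om \<in> K.Hset" unfolding om_def by (rule Hset_kk)

lemma U_om: "U \<in> carrier DD \<Longrightarrow> U () om \<in> K.Hset"
  using opsD(4)[of U "{()}" K.HF K.HF "()" om] om_H by simp

text \<open>By the reproducing property the vector functional is an evaluation at the pair of units,
  which makes its linearity immediate.\<close>

lemma \<phi>_eval: assumes U: "U \<in> carrier DD" shows "\<phi> U = U () om (\<one>\<^bsub>A\<^esub>, \<one>\<^bsub>C\<^esub>)"
proof -
  have "lvec kk [(1, (\<one>\<^bsub>A\<^esub>, \<one>\<^bsub>C\<^esub>))] = om" by (simp add: fun_eq_iff om_def)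
  thus ?thesis using K.hin_vec[OF U_om[OF U], of "[(1, (\<one>\<^bsub>A\<^esub>, \<one>\<^bsub>C\<^esub>))]"] by (simp add: \<phi>_def)
qed

lemma \<phi>_L: assumes a: "a \<in> carrier A" and c: "c \<in> carrier C" shows "\<phi> (L a c) = \<tau> a * \<sigma> c"
  unfolding \<phi>_eval[OF L_ops[OF a c]] L_app[OF om_H] unfolding om_def kk_def
  using a c by (simp add: A.invol_closed C.invol_closed nA_def[of "(\<one>\<^bsub>A\<^esub>, \<one>\<^bsub>C\<^esub>)"] nC_def[of "(\<one>\<^bsub>A\<^esub>, \<one>\<^bsub>C\<^esub>)"] A.invol_invol C.invol_invol)

lemma \<phi>_add: "U \<in> carrier DD \<Longrightarrow> Y \<in> carrier DD \<Longrightarrow> \<phi> (U \<oplus>\<^bsub>DD\<^esub> Y) = \<phi> U + \<phi> Y"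
  by (simp add: \<phi>_eval DD_vals[OF om_H] DD.M.a_closed del: TT_simps)

lemma \<phi>_smult: "U \<in> carrier DD \<Longrightarrow> \<phi> (c \<odot>\<^bsub>DD\<^esub> U) = c * \<phi> U"
  by (simp add: \<phi>_eval DD_vals[OF om_H] DD.B.smult_closed')

text \<open>By Cauchy-Schwarz the functional is bounded by the operator norm times the squared norm
  of the cyclic vector; this is applied to the difference.\<close>

lemma \<phi>_tends: assumes u: "DD.B.tends u U" shows "(\<lambda>n. \<phi> (u n)) \<longlonglongrightarrow> \<phi> U"
proof -
  interpret HK: hilbert_space K.HK by (rule K.HK_hilbert)
  note uc = DD.B.tendsD[OF u]
  have "(\<lambda>n. \<phi> (u n) - \<phi> U) \<longlonglongrightarrow> 0"
  proof (rule Lim_null_comparison)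
    show "\<forall>\<^sub>F n in sequentially. norm (\<phi> (u n) - \<phi> U) \<le> cnorm DD (u n \<ominus>\<^bsub>DD\<^esub> U) * (hnorm K.HK om * hnorm K.HK om)"
    proof (intro always_eventually allI)
      fix n
      have d: "u n \<ominus>\<^bsub>DD\<^esub> U \<in> carrier DD" using uc by (intro DD.M.minus_closed)
      have e1: "\<phi> (u n) - \<phi> U = \<phi> (u n \<ominus>\<^bsub>DD\<^esub> U)"
        using uc DD.B.smult_closed'[OF uc(2)] by (simp add: DD.B.minus_conv \<phi>_add \<phi>_smult del: TT_simps)
      have "cmod (\<phi> (u n \<ominus>\<^bsub>DD\<^esub> U)) \<le> hnorm K.HK ((u n \<ominus>\<^bsub>DD\<^esub> U) () om) * hnorm K.HK om"
        unfolding \<phi>_def using HK.cauchy_schwarz[of "(u n \<ominus>\<^bsub>DD\<^esub> U) () om" om] U_om[OF d] om_H by simp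
      also have "\<dots> \<le> (cnorm DD (u n \<ominus>\<^bsub>DD\<^esub> U) * hnorm K.HK om) * hnorm K.HK om"
      proof (rule mult_right_mono)
        have om': "om \<in> carrier (K.HF ())" using om_H by simp
        show "hnorm K.HK ((u n \<ominus>\<^bsub>DD\<^esub> U) () om) \<le> cnorm DD (u n \<ominus>\<^bsub>DD\<^esub> U) * hnorm K.HK om"
          using fnorm_bound[where H = K.HF and K = K.HF and i = "()" and \<xi> = om, OF K.hfam_HK K.hfam_HK d insertI1 om'] .
        show "0 \<le> hnorm K.HK om" by (rule HK.N_nonneg) (use om_H in simp)
      qed
      finally show "norm (\<phi> (u n) - \<phi> U) \<le> cnorm DD (u n \<ominus>\<^bsub>DD\<^esub> U) * (hnorm K.HK om * hnorm K.HK om)"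
        unfolding e1 by (simp only: mult.assoc)
    qed
    show "(\<lambda>n. cnorm DD (u n \<ominus>\<^bsub>DD\<^esub> U) * (hnorm K.HK om * hnorm K.HK om)) \<longlonglongrightarrow> 0"
      using u by (intro tendsto_mult_left_zero) (auto simp: DD.B.tends_def)
  qed
  thus ?thesis using LIM_zero_iff by blast
qed

text \<open>On elementary tensors this is the trace property of both factors; it is extended
  linearly in one argument after the other.\<close>

lemma \<phi>_comm_span:
  assumes U: "U \<in> lin_span DD LS" and Y: "Y \<in> lin_span DD LS"
  shows "\<phi> (U \<otimes>\<^bsub>DD\<^esub> Y) = \<phi> (Y \<otimes>\<^bsub>DD\<^esub> U)"
proof -
  note lo = LS_ops
  note sc = subsetD[OF span_sub]
  have z: "\<phi> \<zero>\<^bsub>DD\<^esub> = 0" by (simp add: \<phi>_eval DD_vals[OF om_H])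
  have 1: "\<phi> (U \<otimes>\<^bsub>DD\<^esub> Y) = \<phi> (Y \<otimes>\<^bsub>DD\<^esub> U)" if Y: "Y \<in> LS" and U: "U \<in> lin_span DD LS" for U Y
    using lo U
  proof (induction rule: DD.B.lin_span_induct)
    case zero
    show ?case using subsetD[OF lo Y] by (simp add: z)
  next
    case (step U c s)
    obtain a c' b d where s: "s = L a c'" "Y = L b d" "a \<in> carrier A" "c' \<in> carrier C" "b \<in> carrier A" "d \<in> carrier C"
      using step.hyps(3) Y unfolding LS_def by blast
    have "\<phi> (s \<otimes>\<^bsub>DD\<^esub> Y) = \<phi> (Y \<otimes>\<^bsub>DD\<^esub> s)" unfolding s(1,2) using s(3-)
      by (simp add: L_mult \<phi>_L A.tr_comm[of a b] C.tr_comm[of c' d])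
    thus ?case
      using step.hyps(2) subsetD[OF lo step.hyps(3)] subsetD[OF lo Y] step.IH
      by (simp add: DD.l_distr DD.r_distr DD.smult_mult_left DD.smult_mult_right \<phi>_add \<phi>_smult)
  qed
  show ?thesis using lo Y
  proof (induction rule: DD.B.lin_span_induct)
    case zero
    show ?case using sc[OF U] by (simp add: z)
  next
    case (step Y c s)
    thus ?case using subsetD[OF lo step.hyps(3)] sc[OF U] 1[OF step.hyps(3) U]
      by (simp add: DD.l_distr DD.r_distr DD.smult_mult_left DD.smult_mult_right \<phi>_add \<phi>_smult)
  qed
qed

text \<open>Positivity holds because \<phi>(b*b) is the squared norm of b applied to the cyclic
  vector; the trace identity passes from the span to its closure by continuity of \<phi> and of the
  product.\<close>

lemma TT_trace: "tracial_state TT \<phi>"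
proof -
  interpret HK: hilbert_space K.HK by (rule K.HK_hilbert)
  have cc: "U \<in> carrier DD" if "U \<in> carrier TT" for U
    using that unfolding TT_simps by (rule subsetD[OF DD.B.ncl_carrier])
  have pos: "\<phi> a \<in> \<real>\<^sub>\<ge>\<^sub>0" if pe: "positive_elem TT a" for a
  proof -
    obtain b where b: "b \<in> carrier TT" "a = invol TT b \<otimes>\<^bsub>TT\<^esub> b"
      using pe[unfolded positive_elem_def, THEN conjunct2] by (elim bexE)
    note bD = cc[OF b(1)]
    have om': "om \<in> carrier (K.HF ())" using om_H by simp
    have bo: "b () om \<in> carrier (K.HF ())" using U_om[OF bD] by simp
    have "\<phi> a = K.hin (fadj {()} K.HF K.HF b () (b () om)) om"
      unfolding \<phi>_def b(2) TT_simps op_families_mult op_families_invol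
      by (simp only: op_families_vals(5)[of "()" "{()}" om K.HF, OF insertI1 om'])
    also have "\<dots> = K.hin (b () om) (b () om)"
      using fadj_inner'[where H = K.HF and K = K.HF and i = "()" and \<xi> = om and \<eta> = "b () om", OF K.hfam_HK K.hfam_HK bD insertI1 om' bo] by (simp only: K.HK_simps)
    finally show ?thesis using HK.hinner_nonneg[OF bo] by (simp only: K.HK_simps)
  qed
  have comm: "\<phi> (U \<otimes>\<^bsub>DD\<^esub> Y) = \<phi> (Y \<otimes>\<^bsub>DD\<^esub> U)" if UT: "U \<in> carrier TT" and YT: "Y \<in> carrier TT" for U Y
  proof -
    obtain u where u: "\<forall>n. u n \<in> lin_span DD LS" "DD.B.tends u U"
      using UT[unfolded TT_simps, THEN DD.B.ncl_iff[OF span_sub, THEN iffD1]] by (elim exE conjE)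
    obtain v where v: "\<forall>n. v n \<in> lin_span DD LS" "DD.B.tends v Y"
      using YT[unfolded TT_simps, THEN DD.B.ncl_iff[OF span_sub, THEN iffD1]] by (elim exE conjE)
    have eq: "(\<lambda>n. \<phi> (v n \<otimes>\<^bsub>DD\<^esub> u n)) = (\<lambda>n. \<phi> (u n \<otimes>\<^bsub>DD\<^esub> v n))"
      by (rule ext) (rule \<phi>_comm_span[OF v(1)[THEN spec] u(1)[THEN spec]])
    show ?thesis
      by (rule LIMSEQ_unique[OF \<phi>_tends[OF DD.B.tends_mult[OF u(2) v(2)]]
            \<phi>_tends[OF DD.B.tends_mult[OF v(2) u(2)], unfolded eq]])
  qed
  have one: "\<phi> \<one>\<^bsub>DD\<^esub> = 1"
    unfolding L_one[symmetric] \<phi>_L[OF A.one_closed C.one_closed] A.tr_one C.tr_one by simp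
  show ?thesis unfolding tracial_state_def alg_state_def
  proof (intro conjI ballI allI impI)
    show "\<phi> (a \<oplus>\<^bsub>TT\<^esub> b) = \<phi> a + \<phi> b" if "a \<in> carrier TT" "b \<in> carrier TT" for a b
      unfolding TT_simps by (rule \<phi>_add[OF cc[OF that(1)] cc[OF that(2)]])
    show "\<phi> (c \<odot>\<^bsub>TT\<^esub> a) = c * \<phi> a" if "a \<in> carrier TT" for c a
      unfolding TT_simps by (rule \<phi>_smult[OF cc[OF that]])
    show "\<phi> \<one>\<^bsub>TT\<^esub> = 1" unfolding TT_simps by (rule one)
    show "\<phi> (a \<otimes>\<^bsub>TT\<^esub> b) = \<phi> (b \<otimes>\<^bsub>TT\<^esub> a)" if "a \<in> carrier TT" "b \<in> carrier TT" for a b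
      unfolding TT_simps by (rule comm[OF that])
  qed (rule pos)
qed

end

lemma (in abelian_monoid) finsum_Times:
  assumes I: "finite I" and J: "finite J" and f: "\<And>i j. i \<in> I \<Longrightarrow> j \<in> J \<Longrightarrow> f (i, j) \<in> carrier G"
  shows "(\<Oplus>p\<in>I \<times> J. f p) = (\<Oplus>i\<in>I. \<Oplus>j\<in>J. f (i, j))"
  using I f
proof (induction I rule: finite_induct)
  case (insert i I)
  have "insert i I \<times> J = {i} \<times> J \<union> I \<times> J" by auto
  hence "(\<Oplus>p\<in>insert i I \<times> J. f p) = (\<Oplus>p\<in>{i} \<times> J \<union> I \<times> J. f p)" by simp
  also have "\<dots> = (\<Oplus>p\<in>{i} \<times> J. f p) \<oplus> (\<Oplus>p\<in>I \<times> J. f p)"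
    using insert J by (intro finsum_Un_disjoint) auto
  also have "(\<Oplus>p\<in>{i} \<times> J. f p) = (\<Oplus>j\<in>J. f (i, j))"
  proof -
    have "(\<Oplus>p\<in>Pair i ` J. f p) = (\<Oplus>j\<in>J. f (i, j))"
      using insert J by (intro finsum_reindex) (auto simp: inj_on_def)
    moreover have "Pair i ` J = {i} \<times> J" by auto
    ultimately show ?thesis by simp
  qed
  also have "(\<Oplus>p\<in>I \<times> J. f p) = (\<Oplus>i\<in>I. \<Oplus>j\<in>J. f (i, j))" using insert by simp
  also have "(\<Oplus>j\<in>J. f (i, j)) \<oplus> (\<Oplus>i\<in>I. \<Oplus>j\<in>J. f (i, j)) = (\<Oplus>i\<in>insert i I. \<Oplus>j\<in>J. f (i, j))"
    using insert J by (intro finsum_insert[symmetric]) (auto intro!: finsum_closed)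
  finally show ?case .
qed simp

context two_traces
begin

lemma L_zero_left: "c \<in> carrier C \<Longrightarrow> L \<zero>\<^bsub>A\<^esub> c = \<zero>\<^bsub>DD\<^esub>"
  using L_smult_left[of "\<zero>\<^bsub>A\<^esub>" c 0] DD.B.smult_0[OF L_ops[of "\<zero>\<^bsub>A\<^esub>" c]] by simp

lemma L_zero_right: "a \<in> carrier A \<Longrightarrow> L a \<zero>\<^bsub>C\<^esub> = \<zero>\<^bsub>DD\<^esub>"
  using L_smult_right[of a "\<zero>\<^bsub>C\<^esub>" 0] DD.B.smult_0[OF L_ops[of a "\<zero>\<^bsub>C\<^esub>"]] by simp

lemma L_finsum_left:
  assumes c: "c \<in> carrier C" and f: "\<And>i. i \<in> I \<Longrightarrow> f i \<in> carrier A"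
  shows "L (\<Oplus>\<^bsub>A\<^esub>i\<in>I. f i) c = (\<Oplus>\<^bsub>DD\<^esub>i\<in>I. L (f i) c)"
  by (rule finsum_hom[where f = "\<lambda>a. L a c", OF A.M.abelian_monoid_axioms DD.M.abelian_monoid_axioms])
    (use c f L_ops L_zero_left L_add_left in auto)

lemma L_finsum_right:
  assumes a: "a \<in> carrier A" and f: "\<And>i. i \<in> I \<Longrightarrow> f i \<in> carrier C"
  shows "L a (\<Oplus>\<^bsub>C\<^esub>i\<in>I. f i) = (\<Oplus>\<^bsub>DD\<^esub>i\<in>I. L a (f i))"
  by (rule finsum_hom[where f = "\<lambda>c. L a c", OF C.M.abelian_monoid_axioms DD.M.abelian_monoid_axioms])
    (use a f L_ops L_zero_right L_add_right in auto)

sublocale TT: cstar_algebra TT by (rule TT_cstar)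

lemma TT_DD: "U \<in> carrier TT \<Longrightarrow> U \<in> carrier DD"
  unfolding TT_simps by (rule subsetD[OF DD.B.ncl_carrier])

lemma TT_finsum: "(\<And>i. i \<in> I \<Longrightarrow> f i \<in> carrier TT) \<Longrightarrow> (\<Oplus>\<^bsub>TT\<^esub>i\<in>I. f i) = (\<Oplus>\<^bsub>DD\<^esub>i\<in>I. f i)"
  by (rule finsum_hom[where f = "\<lambda>x. x", OF TT.M.abelian_monoid_axioms DD.M.abelian_monoid_axioms])
    (auto simp del: TT_simps(1) intro: TT_DD)

lemma TT_finsum_closed: "(\<And>i. i \<in> I \<Longrightarrow> f i \<in> carrier TT) \<Longrightarrow> (\<Oplus>\<^bsub>DD\<^esub>i\<in>I. f i) \<in> carrier TT"
  using TT_finsum[of I f] TT.M.finsum_closed[of f I] by (auto simp del: TT_simps(1))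

lemma \<phi>_finsum: "(\<And>i. i \<in> I \<Longrightarrow> f i \<in> carrier DD) \<Longrightarrow> \<phi> (\<Oplus>\<^bsub>DD\<^esub>i\<in>I. f i) = (\<Sum>i\<in>I. \<phi> (f i))"
proof (rule finsum_hom_sum[OF DD.M.abelian_monoid_axioms])
  show "\<phi> \<zero>\<^bsub>DD\<^esub> = 0" using \<phi>_smult[OF DD.M.zero_closed, of 0] by simp
qed (rule \<phi>_add)

lemma DDsum: "(\<And>i. i \<in> I \<Longrightarrow> f i \<in> carrier DD) \<Longrightarrow> (\<Oplus>\<^bsub>DD\<^esub>i\<in>I. f i) \<in> carrier DD"
  by (intro DD.M.finsum_closed) auto

section \<open>The stochastic matrix over the tensor product\<close>

context
  fixes h :: "'x::finite \<Rightarrow> 'x \<Rightarrow> 'a" and s :: "'x \<times> 'y::finite \<Rightarrow> 'x \<times> 'y \<Rightarrow> 'c"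
  assumes h: "\<And>w x. h w x \<in> carrier A" and s: "\<And>m n. s m n \<in> carrier C"
begin

text \<open>In the application h is a root of E and s a root of the matrix of the e_(x,x',a,b), so
  that \<open>tg\<close> and \<open>te\<close> are the entries of these matrices. The roots are kept
  because they supply the Gram factors.\<close>

definition tg :: "'x \<Rightarrow> 'x \<Rightarrow> 'a" where
  "tg x x' = (\<Oplus>\<^bsub>A\<^esub>w\<in>UNIV. invol A (h w x) \<otimes>\<^bsub>A\<^esub> h w x')"

definition te :: "'x \<times> 'y \<Rightarrow> 'x \<times> 'y \<Rightarrow> 'c" where
  "te m n = (\<Oplus>\<^bsub>C\<^esub>k\<in>UNIV. invol C (s k m) \<otimes>\<^bsub>C\<^esub> s k n)"

definition tF :: "'y \<Rightarrow> 'y \<Rightarrow> unit \<Rightarrow> ('a \<times> 'c \<Rightarrow> complex) \<Rightarrow> 'a \<times> 'c \<Rightarrow> complex" where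
  "tF a b = (\<Oplus>\<^bsub>DD\<^esub>x\<in>UNIV. \<Oplus>\<^bsub>DD\<^esub>x'\<in>UNIV. L (tg x x') (te (x, a) (x', b)))"

lemma tg_closed: "tg x x' \<in> carrier A"
  unfolding tg_def by (intro A.M.finsum_closed) (use h A.invol_closed in auto)

lemma te_closed: "te m n \<in> carrier C"
  unfolding te_def by (intro C.M.finsum_closed) (use s C.invol_closed in auto)

lemma tF_TT: "tF a b \<in> carrier TT"
  unfolding tF_def by (intro TT_finsum_closed L_TT tg_closed te_closed)

lemma tg_invol: "invol A (tg x x') = tg x' x"
proof -
  have "invol A (tg x x') = (\<Oplus>\<^bsub>A\<^esub>w\<in>UNIV. invol A (invol A (h w x) \<otimes>\<^bsub>A\<^esub> h w x'))"
    unfolding tg_def by (rule A.invol_finsum) (use h A.invol_closed in auto)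
  also have "\<dots> = tg x' x" unfolding tg_def
    by (rule arg_cong[of _ _ "\<lambda>f. finsum A f UNIV"]) (simp add: fun_eq_iff h A.invol_closed A.invol_mult A.invol_invol)
  finally show ?thesis .
qed

lemma te_invol: "invol C (te m n) = te n m"
proof -
  have "invol C (te m n) = (\<Oplus>\<^bsub>C\<^esub>k\<in>UNIV. invol C (invol C (s k m) \<otimes>\<^bsub>C\<^esub> s k n))"
    unfolding te_def by (rule C.invol_finsum) (use s C.invol_closed in auto)
  also have "\<dots> = te n m" unfolding te_def
    by (rule arg_cong[of _ _ "\<lambda>f. finsum C f UNIV"]) (simp add: fun_eq_iff s C.invol_closed C.invol_mult C.invol_invol)
  finally show ?thesis .
qed

lemma tF_invol: "invol DD (tF a b) = tF b a"
proof -
  have Lc: "L (tg x x') (te m n) \<in> carrier DD" for x x' m n by (rule L_ops[OF tg_closed te_closed])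
  have "invol DD (tF a b) = (\<Oplus>\<^bsub>DD\<^esub>x\<in>UNIV. invol DD (\<Oplus>\<^bsub>DD\<^esub>x'\<in>UNIV. L (tg x x') (te (x, a) (x', b))))"
    unfolding tF_def by (rule DD.invol_finsum) (rule DDsum[OF Lc])
  also have "\<dots> = (\<Oplus>\<^bsub>DD\<^esub>x\<in>UNIV. \<Oplus>\<^bsub>DD\<^esub>x'\<in>UNIV. L (tg x' x) (te (x', b) (x, a)))"
  proof (rule arg_cong[of _ _ "\<lambda>f. finsum DD f UNIV"], rule ext)
    fix x
    have "invol DD (\<Oplus>\<^bsub>DD\<^esub>x'\<in>UNIV. L (tg x x') (te (x, a) (x', b))) = (\<Oplus>\<^bsub>DD\<^esub>x'\<in>UNIV. invol DD (L (tg x x') (te (x, a) (x', b))))"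
      by (rule DD.invol_finsum) (rule Lc)
    also have "\<dots> = (\<Oplus>\<^bsub>DD\<^esub>x'\<in>UNIV. L (tg x' x) (te (x', b) (x, a)))"
      by (rule arg_cong[of _ _ "\<lambda>f. finsum DD f UNIV"], rule ext)
        (simp only: op_families_invol L_adj[OF tg_closed te_closed] tg_invol te_invol)
    finally show "invol DD (\<Oplus>\<^bsub>DD\<^esub>x'\<in>UNIV. L (tg x x') (te (x, a) (x', b))) = \<dots>" .
  qed
  also have "\<dots> = tF b a" unfolding tF_def by (rule DD.M.finsum_swap) (use Lc in auto)
  finally show ?thesis .
qed

text \<open>One Gram factor for each pair of a row of h and a row of s, contracted over the shared
  index x. Together they form a matrix that is rectangular in general.\<close>

definition tG :: "'x \<times> 'x \<times> 'y \<Rightarrow> 'y \<Rightarrow> unit \<Rightarrow> ('a \<times> 'c \<Rightarrow> complex) \<Rightarrow> 'a \<times> 'c \<Rightarrow> complex" where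
  "tG n a = (\<Oplus>\<^bsub>DD\<^esub>x\<in>UNIV. L (h (fst n) x) (s (snd n) (x, a)))"

lemma tG_DD: "tG n a \<in> carrier DD"
  unfolding tG_def by (rule DDsum) (rule L_ops[OF h s])

text \<open>After expansion the sum over the pair n factorises: its first component rebuilds
  \<open>tg\<close> in the left leg, its second rebuilds \<open>te\<close> in the right leg.\<close>

lemma tF_gram: "tF a b = (\<Oplus>\<^bsub>DD\<^esub>n\<in>UNIV. invol DD (tG n a) \<otimes>\<^bsub>DD\<^esub> tG n b)"
proof -
  let ?P = "\<lambda>n x x'. L (invol A (h (fst n) x) \<otimes>\<^bsub>A\<^esub> h (fst n) x') (invol C (s (snd n) (x, a)) \<otimes>\<^bsub>C\<^esub> s (snd n) (x', b))"
  have hi: "invol A (h w x) \<in> carrier A" and si: "invol C (s m k) \<in> carrier C" for w x m k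
    using h s A.invol_closed C.invol_closed by auto
  have hh: "invol A (h w x) \<otimes>\<^bsub>A\<^esub> h w x' \<in> carrier A" and ss: "invol C (s m k) \<otimes>\<^bsub>C\<^esub> s m k' \<in> carrier C" for w x x' m k k'
    using A.m_closed[OF hi h] C.m_closed[OF si s] by auto
  have Pc: "?P n x x' \<in> carrier DD" for n x x' by (rule L_ops[OF hh ss])
  have prod: "invol DD (tG n a) \<otimes>\<^bsub>DD\<^esub> tG n b = (\<Oplus>\<^bsub>DD\<^esub>x\<in>UNIV. \<Oplus>\<^bsub>DD\<^esub>x'\<in>UNIV. ?P n x x')" for n
  proof -
    have Lh: "L (h (fst n) x) (s (snd n) (x, c)) \<in> carrier DD" for x c by (rule L_ops[OF h s])
    have Li: "L (invol A (h (fst n) x)) (invol C (s (snd n) (x, a))) \<in> carrier DD" for x by (rule L_ops[OF hi si])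
    have "invol DD (tG n a) = (\<Oplus>\<^bsub>DD\<^esub>x\<in>UNIV. invol DD (L (h (fst n) x) (s (snd n) (x, a))))"
      unfolding tG_def by (rule DD.invol_finsum) (rule Lh)
    also have "\<dots> = (\<Oplus>\<^bsub>DD\<^esub>x\<in>UNIV. L (invol A (h (fst n) x)) (invol C (s (snd n) (x, a))))"
      by (simp only: op_families_invol L_adj[OF h s])
    finally have i: "invol DD (tG n a) = (\<Oplus>\<^bsub>DD\<^esub>x\<in>UNIV. L (invol A (h (fst n) x)) (invol C (s (snd n) (x, a))))" .
    have "invol DD (tG n a) \<otimes>\<^bsub>DD\<^esub> tG n b = (\<Oplus>\<^bsub>DD\<^esub>x\<in>UNIV. L (invol A (h (fst n) x)) (invol C (s (snd n) (x, a))) \<otimes>\<^bsub>DD\<^esub> tG n b)"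
      unfolding i by (rule DD.finsum_ldistr) (use Li tG_DD in auto)
    also have "\<dots> = (\<Oplus>\<^bsub>DD\<^esub>x\<in>UNIV. \<Oplus>\<^bsub>DD\<^esub>x'\<in>UNIV. ?P n x x')"
    proof (rule arg_cong[of _ _ "\<lambda>f. finsum DD f UNIV"], rule ext)
      fix x
      have "L (invol A (h (fst n) x)) (invol C (s (snd n) (x, a))) \<otimes>\<^bsub>DD\<^esub> tG n b
          = (\<Oplus>\<^bsub>DD\<^esub>x'\<in>UNIV. L (invol A (h (fst n) x)) (invol C (s (snd n) (x, a))) \<otimes>\<^bsub>DD\<^esub> L (h (fst n) x') (s (snd n) (x', b)))"
        unfolding tG_def by (rule DD.finsum_rdistr) (use Li Lh in auto)
      also have "\<dots> = (\<Oplus>\<^bsub>DD\<^esub>x'\<in>UNIV. ?P n x x')" by (simp only: L_mult[OF hi h si s])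
      finally show "L (invol A (h (fst n) x)) (invol C (s (snd n) (x, a))) \<otimes>\<^bsub>DD\<^esub> tG n b = \<dots>" .
    qed
    finally show ?thesis .
  qed
  have sum: "(\<Oplus>\<^bsub>DD\<^esub>n\<in>UNIV. ?P n x x') = L (tg x x') (te (x, a) (x', b))" for x x'
  proof -
    have "(\<Oplus>\<^bsub>DD\<^esub>n\<in>UNIV \<times> UNIV. ?P n x x') = (\<Oplus>\<^bsub>DD\<^esub>w\<in>UNIV. \<Oplus>\<^bsub>DD\<^esub>m\<in>UNIV. ?P (w, m) x x')"
      by (rule DD.M.finsum_Times) (use Pc in auto)
    also have "\<dots> = (\<Oplus>\<^bsub>DD\<^esub>w\<in>UNIV. L (invol A (h w x) \<otimes>\<^bsub>A\<^esub> h w x') (te (x, a) (x', b)))"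
      unfolding te_def by (simp only: L_finsum_right[OF hh ss] fst_conv snd_conv)
    also have "\<dots> = L (tg x x') (te (x, a) (x', b))"
      unfolding tg_def by (rule L_finsum_left[symmetric, OF te_closed hh])
    finally show ?thesis by simp
  qed
  have "(\<Oplus>\<^bsub>DD\<^esub>n\<in>UNIV. invol DD (tG n a) \<otimes>\<^bsub>DD\<^esub> tG n b) = (\<Oplus>\<^bsub>DD\<^esub>n\<in>UNIV. \<Oplus>\<^bsub>DD\<^esub>x\<in>UNIV. \<Oplus>\<^bsub>DD\<^esub>x'\<in>UNIV. ?P n x x')"
    by (simp only: prod)
  also have "\<dots> = (\<Oplus>\<^bsub>DD\<^esub>x\<in>UNIV. \<Oplus>\<^bsub>DD\<^esub>n\<in>UNIV. \<Oplus>\<^bsub>DD\<^esub>x'\<in>UNIV. ?P n x x')"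
    by (rule DD.M.finsum_swap[OF finite finite]) (rule DDsum[OF Pc])
  also have "\<dots> = (\<Oplus>\<^bsub>DD\<^esub>x\<in>UNIV. \<Oplus>\<^bsub>DD\<^esub>x'\<in>UNIV. \<Oplus>\<^bsub>DD\<^esub>n\<in>UNIV. ?P n x x')"
    by (rule arg_cong[of _ _ "\<lambda>f. finsum DD f UNIV"], rule ext, rule DD.M.finsum_swap[OF finite finite]) (rule Pc)
  also have "\<dots> = tF a b" unfolding tF_def by (simp only: sum)
  finally show ?thesis by (rule sym)
qed

text \<open>The rectangular Gram factors are no witness for \<open>positive_elem\<close>;
  \<open>gram_positive\<close> with H = K replaces them by a square root over
  \<open>TT\<close>.\<close>

lemma tF_positive: "positive_elem (mat_alg TT) tF"
proof (rule gram_positive[where I = "{()}" and H = K.HF and K = K.HF and S = "carrier TT" and N = UNIV and G = tG])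
  show "TT = DD\<lparr>carrier := carrier TT\<rparr>" by (simp add: TT_def)
  show "carrier TT \<subseteq> ops {()} K.HF K.HF" by (rule subsetI) (rule TT_DD)
  show "cstar_algebra TT" by (rule TT_cstar)
  show "tF z z' \<in> carrier TT" for z z' by (rule tF_TT)
  show "invol TT (tF z z') = tF z' z" for z z' unfolding TT_simps by (rule tF_invol)
  fix i :: unit and z z' \<xi> assume i: "i \<in> {()}" and \<xi>: "\<xi> \<in> carrier (K.HF i)"
  have "tF z z' i \<xi> = (\<Oplus>\<^bsub>K.HF i\<^esub>n\<in>UNIV. (invol DD (tG n z) \<otimes>\<^bsub>DD\<^esub> tG n z') i \<xi>)"
    unfolding tF_gram
    by (rule op_families_finsum[OF K.hfam_HK K.hfam_HK _ i \<xi>]) (rule DD.m_closed[OF DD.invol_closed[OF tG_DD] tG_DD])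
  also have "\<dots> = (\<Oplus>\<^bsub>K.HF i\<^esub>n\<in>UNIV. fadj {()} K.HF K.HF (tG n z) i (tG n z' i \<xi>))"
    unfolding op_families_mult op_families_invol by (simp only: op_families_vals(5)[of i "{()}" \<xi> K.HF, OF i \<xi>])
  finally show "tF z z' i \<xi> = (\<Oplus>\<^bsub>K.HF i\<^esub>n\<in>UNIV. fadj {()} K.HF K.HF (tG n z) i (tG n z' i \<xi>))" .
qed (simp_all add: K.hfam_HK tG_DD del: TT_simps)

text \<open>Both legs multiply separately, so each pair of summands contributes a product of two
  traces. With the second pair of indices reversed, this is an entry of the image of the reciprocal
  state.\<close>

lemma tF_trace:
  "\<phi> (tF a b \<otimes>\<^bsub>DD\<^esub> tF c d) = (\<Sum>x\<in>UNIV. \<Sum>x'\<in>UNIV. \<Sum>y\<in>UNIV. \<Sum>y'\<in>UNIV.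
    \<tau> (tg x x' \<otimes>\<^bsub>A\<^esub> tg y y') * \<sigma> (te (x, a) (x', b) \<otimes>\<^bsub>C\<^esub> te (y, c) (y', d)))"
proof -
  let ?Q = "\<lambda>x x' a b. L (tg x x') (te (x, a) (x', b))"
  have Qc: "?Q x x' a b \<in> carrier DD" for x x' a b by (rule L_ops[OF tg_closed te_closed])
  have Fc: "tF a b \<in> carrier DD" for a b by (rule TT_DD[OF tF_TT])
  have 1: "\<phi> (U \<otimes>\<^bsub>DD\<^esub> tF c d) = (\<Sum>y\<in>UNIV. \<Sum>y'\<in>UNIV. \<phi> (U \<otimes>\<^bsub>DD\<^esub> ?Q y y' c d))" if U: "U \<in> carrier DD" for U
  proof -
    have "U \<otimes>\<^bsub>DD\<^esub> tF c d = (\<Oplus>\<^bsub>DD\<^esub>y\<in>UNIV. U \<otimes>\<^bsub>DD\<^esub> (\<Oplus>\<^bsub>DD\<^esub>y'\<in>UNIV. ?Q y y' c d))"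
      unfolding tF_def by (rule DD.finsum_rdistr) (use U DDsum[OF Qc] in auto)
    also have "\<dots> = (\<Oplus>\<^bsub>DD\<^esub>y\<in>UNIV. \<Oplus>\<^bsub>DD\<^esub>y'\<in>UNIV. U \<otimes>\<^bsub>DD\<^esub> ?Q y y' c d)"
      by (rule arg_cong[of _ _ "\<lambda>f. finsum DD f UNIV"], rule ext, rule DD.finsum_rdistr) (use U Qc in auto)
    finally show ?thesis
      by (simp only: \<phi>_finsum[OF DDsum[OF DD.m_closed[OF U Qc]]] \<phi>_finsum[OF DD.m_closed[OF U Qc]])
  qed
  have "tF a b \<otimes>\<^bsub>DD\<^esub> tF c d = (\<Oplus>\<^bsub>DD\<^esub>x\<in>UNIV. (\<Oplus>\<^bsub>DD\<^esub>x'\<in>UNIV. ?Q x x' a b) \<otimes>\<^bsub>DD\<^esub> tF c d)"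
    unfolding tF_def[of a b] by (rule DD.finsum_ldistr) (use Fc DDsum[OF Qc] in auto)
  also have "\<dots> = (\<Oplus>\<^bsub>DD\<^esub>x\<in>UNIV. \<Oplus>\<^bsub>DD\<^esub>x'\<in>UNIV. ?Q x x' a b \<otimes>\<^bsub>DD\<^esub> tF c d)"
    by (rule arg_cong[of _ _ "\<lambda>f. finsum DD f UNIV"], rule ext, rule DD.finsum_ldistr) (use Fc Qc in auto)
  finally have "\<phi> (tF a b \<otimes>\<^bsub>DD\<^esub> tF c d) = (\<Sum>x\<in>UNIV. \<Sum>x'\<in>UNIV. \<phi> (?Q x x' a b \<otimes>\<^bsub>DD\<^esub> tF c d))"
    by (simp only: \<phi>_finsum[OF DDsum[OF DD.m_closed[OF Qc Fc]]] \<phi>_finsum[OF DD.m_closed[OF Qc Fc]])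
  also have "\<dots> = (\<Sum>x\<in>UNIV. \<Sum>x'\<in>UNIV. \<Sum>y\<in>UNIV. \<Sum>y'\<in>UNIV.
      \<tau> (tg x x' \<otimes>\<^bsub>A\<^esub> tg y y') * \<sigma> (te (x, a) (x', b) \<otimes>\<^bsub>C\<^esub> te (y, c) (y', d)))"
    by (simp only: 1[OF Qc] L_mult[OF tg_closed tg_closed te_closed te_closed]
      \<phi>_L[OF A.m_closed[OF tg_closed tg_closed] C.m_closed[OF te_closed te_closed]])
  finally show ?thesis .
qed

text \<open>Summing over a first collapses the second leg to the unit for x = x' and to 0 otherwise;
  the diagonal sum of \<open>tg\<close> remains.\<close>

lemma tF_stochastic:
  assumes g1: "(\<Oplus>\<^bsub>A\<^esub>x\<in>UNIV. tg x x) = \<one>\<^bsub>A\<^esub>"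
    and e1: "\<And>x x'. (\<Oplus>\<^bsub>C\<^esub>a\<in>UNIV. te (x, a) (x', a)) = (if x = x' then \<one>\<^bsub>C\<^esub> else \<zero>\<^bsub>C\<^esub>)"
  shows "stochastic_matrix TT tF"
proof -
  have Qc: "L (tg x x') (te (x, a) (x', b)) \<in> carrier DD" for x x' a b by (rule L_ops[OF tg_closed te_closed])
  have "(\<Oplus>\<^bsub>TT\<^esub>a\<in>UNIV. tF a a) = (\<Oplus>\<^bsub>DD\<^esub>a\<in>UNIV. \<Oplus>\<^bsub>DD\<^esub>x\<in>UNIV. \<Oplus>\<^bsub>DD\<^esub>x'\<in>UNIV. L (tg x x') (te (x, a) (x', a)))"
    unfolding TT_finsum[OF tF_TT] by (simp only: tF_def)
  also have "\<dots> = (\<Oplus>\<^bsub>DD\<^esub>x\<in>UNIV. \<Oplus>\<^bsub>DD\<^esub>a\<in>UNIV. \<Oplus>\<^bsub>DD\<^esub>x'\<in>UNIV. L (tg x x') (te (x, a) (x', a)))"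
    by (rule DD.M.finsum_swap[OF finite finite]) (rule DDsum[OF Qc])
  also have "\<dots> = (\<Oplus>\<^bsub>DD\<^esub>x\<in>UNIV. \<Oplus>\<^bsub>DD\<^esub>x'\<in>UNIV. \<Oplus>\<^bsub>DD\<^esub>a\<in>UNIV. L (tg x x') (te (x, a) (x', a)))"
    by (rule arg_cong[of _ _ "\<lambda>f. finsum DD f UNIV"], rule ext, rule DD.M.finsum_swap[OF finite finite]) (rule Qc)
  also have "\<dots> = (\<Oplus>\<^bsub>DD\<^esub>x\<in>UNIV. \<Oplus>\<^bsub>DD\<^esub>x'\<in>UNIV. L (tg x x') (if x = x' then \<one>\<^bsub>C\<^esub> else \<zero>\<^bsub>C\<^esub>))"
    by (simp only: L_finsum_right[OF tg_closed te_closed, symmetric] e1)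
  also have "\<dots> = (\<Oplus>\<^bsub>DD\<^esub>x\<in>UNIV. L (tg x x) \<one>\<^bsub>C\<^esub>)"
  proof (rule arg_cong[of _ _ "\<lambda>f. finsum DD f UNIV"], rule ext)
    fix x
    have "(\<Oplus>\<^bsub>DD\<^esub>x'\<in>UNIV. L (tg x x') (if x = x' then \<one>\<^bsub>C\<^esub> else \<zero>\<^bsub>C\<^esub>)) = (\<Oplus>\<^bsub>DD\<^esub>x'\<in>UNIV. if x = x' then L (tg x x') \<one>\<^bsub>C\<^esub> else \<zero>\<^bsub>DD\<^esub>)"
      by (rule arg_cong[of _ _ "\<lambda>f. finsum DD f UNIV"]) (simp add: fun_eq_iff L_zero_right[OF tg_closed])
    also have "\<dots> = L (tg x x) \<one>\<^bsub>C\<^esub>"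
      by (rule DD.M.finsum_singleton) (use L_ops[OF tg_closed C.one_closed] in auto)
    finally show "(\<Oplus>\<^bsub>DD\<^esub>x'\<in>UNIV. L (tg x x') (if x = x' then \<one>\<^bsub>C\<^esub> else \<zero>\<^bsub>C\<^esub>)) = L (tg x x) \<one>\<^bsub>C\<^esub>" .
  qed
  also have "\<dots> = L (\<Oplus>\<^bsub>A\<^esub>x\<in>UNIV. tg x x) \<one>\<^bsub>C\<^esub>" by (rule L_finsum_left[symmetric, OF C.one_closed tg_closed])
  also have "\<dots> = \<one>\<^bsub>TT\<^esub>" unfolding g1 L_one TT_simps ..
  finally show ?thesis unfolding stochastic_matrix_def using tF_positive by (intro conjI)
qed

end

section \<open>Commutativity and finite dimension of the tensor algebra\<close>

lemma TT_abelian: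
  assumes A: "abelian_alg A" and C: "abelian_alg C" shows "abelian_alg TT"
proof -
  note lo = LS_ops
  note sc = subsetD[OF span_sub]
  have 1: "U \<otimes>\<^bsub>DD\<^esub> Y = Y \<otimes>\<^bsub>DD\<^esub> U" if Y: "Y \<in> LS" and U: "U \<in> lin_span DD LS" for U Y
    using lo U
  proof (induction rule: DD.B.lin_span_induct)
    case zero
    show ?case using subsetD[OF lo Y] by simp
  next
    case (step U c s)
    obtain a c' b d where s: "s = L a c'" "Y = L b d" "a \<in> carrier A" "c' \<in> carrier C" "b \<in> carrier A" "d \<in> carrier C"
      using step.hyps(3) Y unfolding LS_def by blast
    have "a \<otimes>\<^bsub>A\<^esub> b = b \<otimes>\<^bsub>A\<^esub> a" using A[unfolded abelian_alg_def, rule_format, OF s(3,5)] .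
    moreover have "c' \<otimes>\<^bsub>C\<^esub> d = d \<otimes>\<^bsub>C\<^esub> c'" using C[unfolded abelian_alg_def, rule_format, OF s(4,6)] .
    ultimately have "s \<otimes>\<^bsub>DD\<^esub> Y = Y \<otimes>\<^bsub>DD\<^esub> s" unfolding s(1,2) using s(3-) by (simp only: L_mult)
    thus ?case
      using step.hyps(2) subsetD[OF lo step.hyps(3)] subsetD[OF lo Y] step.IH
      by (simp add: DD.l_distr DD.r_distr DD.smult_mult_left DD.smult_mult_right)
  qed
  have 2: "U \<otimes>\<^bsub>DD\<^esub> Y = Y \<otimes>\<^bsub>DD\<^esub> U" if U: "U \<in> lin_span DD LS" and Y: "Y \<in> lin_span DD LS" for U Y
    using lo Y
  proof (induction rule: DD.B.lin_span_induct)
    case zero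
    show ?case using sc[OF U] by simp
  next
    case (step Y c s)
    thus ?case using subsetD[OF lo step.hyps(3)] sc[OF U] 1[OF step.hyps(3) U]
      by (simp add: DD.l_distr DD.r_distr DD.smult_mult_left DD.smult_mult_right)
  qed
  show ?thesis unfolding abelian_alg_def TT_simps
  proof (intro ballI)
    fix U Y assume UT: "U \<in> DD.B.ncl (lin_span DD LS)" and YT: "Y \<in> DD.B.ncl (lin_span DD LS)"
    obtain u where u: "\<forall>n. u n \<in> lin_span DD LS" "DD.B.tends u U"
      using UT[THEN DD.B.ncl_iff[OF span_sub, THEN iffD1]] by (elim exE conjE)
    obtain v where v: "\<forall>n. v n \<in> lin_span DD LS" "DD.B.tends v Y"
      using YT[THEN DD.B.ncl_iff[OF span_sub, THEN iffD1]] by (elim exE conjE)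
    have eq: "(\<lambda>n. v n \<otimes>\<^bsub>DD\<^esub> u n) = (\<lambda>n. u n \<otimes>\<^bsub>DD\<^esub> v n)"
      by (rule ext) (rule 2[OF v(1)[THEN spec] u(1)[THEN spec]])
    show "U \<otimes>\<^bsub>DD\<^esub> Y = Y \<otimes>\<^bsub>DD\<^esub> U"
      by (rule DD.B.tends_unique[OF DD.B.tends_mult[OF u(2) v(2)] DD.B.tends_mult[OF v(2) u(2), unfolded eq]])
  qed
qed

text \<open>Tensors of spanning elements span all elementary tensors, and a finite dimensional span
  is already closed, so the closure in \<open>TT\<close> adds nothing.\<close>

lemma TT_finite_dim:
  assumes A: "finite_dim_alg A" and C: "finite_dim_alg C" shows "finite_dim_alg TT"
proof -
  obtain BA where BA: "finite BA" "BA \<subseteq> carrier A" "carrier A = lin_span A BA" using A unfolding finite_dim_alg_def by (elim exE conjE)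
  obtain BC where BC: "finite BC" "BC \<subseteq> carrier C" "carrier C = lin_span C BC" using C unfolding finite_dim_alg_def by (elim exE conjE)
  define B0 where "B0 = (\<lambda>(a, c). L a c) ` (BA \<times> BC)"
  have fin: "finite B0" unfolding B0_def using BA BC by simp
  have sub: "B0 \<subseteq> LS" unfolding B0_def LS_def using BA(2) BC(2) by auto
  have subD: "B0 \<subseteq> carrier DD" by (rule subset_trans[OF sub LS_ops])
  have 1: "L a c \<in> lin_span DD B0" if a: "a \<in> BA" and c: "c \<in> lin_span C BC" for a c
    using BC(2) c
  proof (induction rule: C.B.lin_span_induct)
    case zero
    show ?case unfolding L_zero_right[OF subsetD[OF BA(2) a]] by (rule DD.B.lin_span_zero)
  next
    case (step c z t)
    have ac: "a \<in> carrier A" "t \<in> carrier C" using BA BC a step.hyps by auto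
    have "L a t \<in> B0" unfolding B0_def using a step.hyps(3) by auto
    hence "L a c \<oplus>\<^bsub>DD\<^esub> z \<odot>\<^bsub>DD\<^esub> L a t \<in> lin_span DD B0" by (rule DD.B.lin_span_step[OF subD step.IH])
    thus ?case using L_add_right[OF ac(1) step.hyps(2) C.B.smult_closed'[OF ac(2)]] L_smult_right[OF ac] by (simp only:)
  qed
  have 2: "L a c \<in> lin_span DD B0" if a: "a \<in> lin_span A BA" and c: "c \<in> lin_span C BC" for a c
    using BA(2) a
  proof (induction rule: A.B.lin_span_induct)
    case zero
    show ?case unfolding L_zero_left[OF c[folded BC(3)]] by (rule DD.B.lin_span_zero)
  next
    case (step a z t)
    have t: "t \<in> carrier A" using BA step.hyps by auto
    have cc: "c \<in> carrier C" using c BC(3) by simp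
    have "L a c \<oplus>\<^bsub>DD\<^esub> z \<odot>\<^bsub>DD\<^esub> L t c \<in> lin_span DD B0"
      by (rule DD.B.lin_span_add[OF subD step.IH DD.B.lin_span_smult[OF subD 1[OF step.hyps(3) c]]])
    thus ?case using L_add_left[OF step.hyps(2) A.B.smult_closed'[OF t] cc] L_smult_left[OF t cc] by (simp only:)
  qed
  have "LS \<subseteq> lin_span DD B0" unfolding LS_def using 2 BA(3) BC(3) by auto
  hence "lin_span DD LS \<subseteq> lin_span DD B0"
    by (rule DD.B.lin_span_minimal[OF _ DD.B.lin_span_carrier[OF subD] DD.B.lin_span_zero
      DD.B.lin_span_add[OF subD] DD.B.lin_span_smult[OF subD]])
  moreover have "lin_span DD B0 \<subseteq> lin_span DD LS"
    by (rule DD.B.lin_span_minimal[OF subset_trans[OF sub DD.B.lin_span_superset[OF LS_ops]] span_sub DD.B.lin_span_zero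
      DD.B.lin_span_add[OF LS_ops] DD.B.lin_span_smult[OF LS_ops]])
  ultimately have eq: "lin_span DD LS = lin_span DD B0" by (rule subset_antisym)
  have car: "carrier TT = lin_span DD B0" unfolding TT_simps eq by (rule DD.B.lin_span_finite_closed[OF fin subD])
  have B0T: "B0 \<subseteq> carrier TT" unfolding car by (rule DD.B.lin_span_superset[OF subD])
  \<comment> \<open>Sums in \<open>TT\<close> and in \<open>DD\<close> are formed in different
    records; they agree on elements of \<open>TT\<close>.\<close>
  have "lin_span TT B0 = lin_span DD B0"
  proof -
    have "(\<Oplus>\<^bsub>TT\<^esub>i\<in>{..<n}. c i \<odot>\<^bsub>TT\<^esub> t i) = (\<Oplus>\<^bsub>DD\<^esub>i\<in>{..<n}. c i \<odot>\<^bsub>DD\<^esub> t i)" if t: "\<forall>i<n. t i \<in> B0" for n :: nat and c t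
    proof -
      have "c i \<odot>\<^bsub>TT\<^esub> t i \<in> carrier TT" if "i \<in> {..<n}" for i
        by (rule TT.B.smult_closed') (use t B0T that in auto)
      from TT_finsum[OF this] show ?thesis by (simp only: TT_simps)
    qed
    thus ?thesis unfolding lin_span_def by (intro Collect_cong) (metis (no_types, lifting))
  qed
  thus ?thesis unfolding finite_dim_alg_def using fin B0T car by (intro exI[of _ B0]) simp
qed

end

section \<open>Independence of the universe\<close>

text \<open>Codes for the elements of a dense countable *-subring, with complex scalars \<open>p + i q\<close> for
  rational \<open>p\<close> and \<open>q\<close>.\<close>

datatype cterm = CGen nat | COne | CAdd cterm cterm | CMul cterm cterm | CInv cterm | CScale rat rat cterm

instance cterm :: countable by countable_datatype

primrec ceval :: "('v, 'm) star_algebra_scheme \<Rightarrow> (nat \<Rightarrow> 'v) \<Rightarrow> cterm \<Rightarrow> 'v" where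
  "ceval B g (CGen n) = g n"
| "ceval B g COne = \<one>\<^bsub>B\<^esub>"
| "ceval B g (CAdd s t) = ceval B g s \<oplus>\<^bsub>B\<^esub> ceval B g t"
| "ceval B g (CMul s t) = ceval B g s \<otimes>\<^bsub>B\<^esub> ceval B g t"
| "ceval B g (CInv s) = invol B (ceval B g s)"
| "ceval B g (CScale p q s) = Complex (of_rat p) (of_rat q) \<odot>\<^bsub>B\<^esub> ceval B g s"

lemma rat_approx: "\<exists>p :: nat \<Rightarrow> rat. (\<lambda>n. of_rat (p n) :: real) \<longlonglongrightarrow> x"
proof -
  have "\<exists>p. x < of_rat p \<and> of_rat p < x + 1 / real (Suc n)" for n
    by (rule of_rat_dense) simp
  then obtain p where p: "\<And>n. x < of_rat (p n)" "\<And>n. of_rat (p n) < x + 1 / real (Suc n)" by metis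
  have "(\<lambda>n. x + 1 / real (Suc n)) \<longlonglongrightarrow> x + 0"
    by (intro tendsto_intros) (use LIMSEQ_inverse_real_of_nat in \<open>simp add: inverse_eq_divide\<close>)
  hence 1: "(\<lambda>n. x + 1 / real (Suc n)) \<longlonglongrightarrow> x" by simp
  have "(\<lambda>n. of_rat (p n) :: real) \<longlonglongrightarrow> x"
    by (rule tendsto_sandwich[OF always_eventually always_eventually tendsto_const 1]) (intro allI less_imp_le p)+
  thus ?thesis by blast
qed

text \<open>A sequence is coded by its graph, a set of naturals, and sets of naturals inject into
  the reals.\<close>

lemma inj_seq_real: "\<exists>f :: (nat \<Rightarrow> nat) \<Rightarrow> real. inj f"
proof -
  obtain f :: "nat set \<Rightarrow> real" where f: "inj f"
    using nat_sets_eqpoll_reals unfolding eqpoll_def by (auto simp: bij_betw_def)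
  have "inj (\<lambda>u :: nat \<Rightarrow> nat. range (\<lambda>n. prod_encode (n, u n)))"
  proof (rule injI)
    fix u v :: "nat \<Rightarrow> nat"
    assume eq: "range (\<lambda>n. prod_encode (n, u n)) = range (\<lambda>n. prod_encode (n, v n))"
    show "u = v"
    proof
      fix n
      have "prod_encode (n, u n) \<in> range (\<lambda>n. prod_encode (n, v n))" unfolding eq[symmetric] by (rule rangeI)
      then obtain m where "prod_encode (n, u n) = prod_encode (m, v m)" by (elim rangeE)
      thus "u n = v n" by auto
    qed
  qed
  from inj_compose[OF f this] show ?thesis by blast
qed

context cstar_algebra
begin

context
  fixes g :: "nat \<Rightarrow> 'a" assumes g: "\<And>n. g n \<in> carrier A"
begin

lemma ceval_closed: "ceval A g t \<in> carrier A"
  by (induction t) (simp_all add: g invol_closed)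

lemma range_sub: "range (ceval A g) \<subseteq> carrier A"
  using ceval_closed by blast

text \<open>The scalar is approximated by complex rationals, whose multiples of a coded element are
  again coded. This is the weak scalar condition of \<open>closure_cstar\<close>.\<close>

lemma ceval_smult: "c \<odot>\<^bsub>A\<^esub> ceval A g t \<in> B.ncl (range (ceval A g))"
proof -
  obtain p where p: "(\<lambda>n. of_rat (p n) :: real) \<longlonglongrightarrow> Re c" using rat_approx by blast
  obtain q where q: "(\<lambda>n. of_rat (q n) :: real) \<longlonglongrightarrow> Im c" using rat_approx by blast
  have "(\<lambda>n. Complex (of_rat (p n)) (of_rat (q n))) \<longlonglongrightarrow> Complex (Re c) (Im c)" by (intro tendsto_Complex p q)
  hence "(\<lambda>n. Complex (of_rat (p n)) (of_rat (q n))) \<longlonglongrightarrow> c" by simp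
  hence t: "B.tends (\<lambda>n. Complex (of_rat (p n)) (of_rat (q n)) \<odot>\<^bsub>A\<^esub> ceval A g t) (c \<odot>\<^bsub>A\<^esub> ceval A g t)"
    by (rule B.tends_smult_seq[OF B.tends_const[OF ceval_closed]])
  have r: "Complex (of_rat (p n)) (of_rat (q n)) \<odot>\<^bsub>A\<^esub> ceval A g t \<in> range (ceval A g)" for n
    by (rule range_eqI[of _ _ "CScale (p n) (q n) t"]) simp
  show ?thesis by (rule B.ncl_iff[OF range_sub, THEN iffD2]) (rule exI, rule conjI[OF allI[OF r] t])
qed

end

end

lemma subalg_cstar:
  fixes A :: "'a normed_star_algebra"
  assumes A: "cstar_algebra A" and g: "\<And>n. g n \<in> carrier A"
  shows "cstar_algebra (A\<lparr>carrier := norm_closure A (range (ceval A g))\<rparr>)"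
proof -
  interpret A: cstar_algebra A by fact
  note rs = A.range_sub[OF g]
  have ex: "\<exists>t. a = ceval A g t" if "a \<in> range (ceval A g)" for a using that by (elim rangeE) (rule exI)
  show ?thesis
  proof (rule A.closure_cstar[OF rs])
    show "\<one>\<^bsub>A\<^esub> \<in> norm_closure A (range (ceval A g))" unfolding A.norm_closure_eq
      by (rule subsetD[OF A.B.ncl_superset[OF rs]]) (rule range_eqI[of _ _ COne], simp)
    fix a b assume a: "a \<in> range (ceval A g)"
    obtain s where s: "a = ceval A g s" using ex[OF a] by (elim exE)
    show "invol A a \<in> range (ceval A g)" unfolding s by (rule range_eqI[of _ _ "CInv s"]) simp
    show "c \<odot>\<^bsub>A\<^esub> a \<in> norm_closure A (range (ceval A g))" for c
      unfolding s A.norm_closure_eq by (rule A.ceval_smult[OF g])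
    assume b: "b \<in> range (ceval A g)"
    obtain t where t: "b = ceval A g t" using ex[OF b] by (elim exE)
    show "a \<oplus>\<^bsub>A\<^esub> b \<in> range (ceval A g)" unfolding s t by (rule range_eqI[of _ _ "CAdd s t"]) simp
    show "a \<otimes>\<^bsub>A\<^esub> b \<in> range (ceval A g)" unfolding s t by (rule range_eqI[of _ _ "CMul s t"]) simp
  qed simp
qed

text \<open>An element of the closure is the limit of a sequence of coded elements and is determined
  by the sequence of codes. The codes are countable, so there are at most continuum many such
  elements.\<close>

lemma subalg_inj:
  fixes A :: "'a normed_star_algebra" and f :: "real \<Rightarrow> 'u"
  assumes A: "cstar_algebra A" and g: "\<And>n. g n \<in> carrier A" and f: "inj f"
  shows "\<exists>\<iota> :: 'a \<Rightarrow> 'u. inj_on \<iota> (norm_closure A (range (ceval A g)))"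
proof -
  interpret A: cstar_algebra A by fact
  note rs = A.range_sub[OF g]
  let ?S = "norm_closure A (range (ceval A g))"
  have "\<exists>u. A.B.tends (\<lambda>n. ceval A g (u n)) a" if a: "a \<in> ?S" for a
  proof -
    obtain v where v: "\<forall>n. v n \<in> range (ceval A g)" "A.B.tends v a"
      using a[unfolded A.norm_closure_eq, THEN A.B.ncl_iff[OF rs, THEN iffD1]] by (elim exE conjE)
    have "\<forall>n. \<exists>t. v n = ceval A g t"
    proof
      fix n show "\<exists>t. v n = ceval A g t" using v(1)[THEN spec, of n] by (elim rangeE) (rule exI)
    qed
    then obtain u where "\<forall>n. v n = ceval A g (u n)" by (rule choice[THEN exE])
    hence "v = (\<lambda>n. ceval A g (u n))" by (intro ext) (rule spec)
    thus ?thesis using v(2) by blast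
  qed
  hence "\<forall>a. \<exists>u. a \<in> ?S \<longrightarrow> A.B.tends (\<lambda>n. ceval A g (u n)) a" by blast
  then obtain u where u: "\<forall>a. a \<in> ?S \<longrightarrow> A.B.tends (\<lambda>n. ceval A g (u a n)) a" by (rule choice[THEN exE])
  obtain k :: "(nat \<Rightarrow> nat) \<Rightarrow> real" where k: "inj k" using inj_seq_real by (elim exE)
  have "inj_on (\<lambda>a. f (k (\<lambda>n. to_nat (u a n)))) ?S"
  proof (rule inj_onI)
    fix a b assume a: "a \<in> ?S" and b: "b \<in> ?S" and "f (k (\<lambda>n. to_nat (u a n))) = f (k (\<lambda>n. to_nat (u b n)))"
    hence "(\<lambda>n. to_nat (u a n)) = (\<lambda>n. to_nat (u b n))" using f k by (simp only: inj_eq)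
    hence "u a n = u b n" for n by (metis inj_to_nat injD)
    hence e: "(\<lambda>n. ceval A g (u a n)) = (\<lambda>n. ceval A g (u b n))" by simp
    show "a = b"
      by (rule A.B.tends_unique[OF u[rule_format, OF a] u[rule_format, OF b, folded e]])
  qed
  thus ?thesis by blast
qed

section \<open>Transport of structure along an injection\<close>

definition transp :: "('v \<Rightarrow> 'u) \<Rightarrow> 'v normed_star_algebra \<Rightarrow> 'u normed_star_algebra" where
  "transp \<iota> B = (let j = inv_into (carrier B) \<iota> in
     \<lparr>carrier = \<iota> ` carrier B, mult = (\<lambda>x y. \<iota> (j x \<otimes>\<^bsub>B\<^esub> j y)), one = \<iota> \<one>\<^bsub>B\<^esub>, zero = \<iota> \<zero>\<^bsub>B\<^esub>,
       add = (\<lambda>x y. \<iota> (j x \<oplus>\<^bsub>B\<^esub> j y)), smult = (\<lambda>c x. \<iota> (c \<odot>\<^bsub>B\<^esub> j x)),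
       invol = (\<lambda>x. \<iota> (invol B (j x))), cnorm = (\<lambda>x. cnorm B (j x))\<rparr>)"

context
  fixes \<iota> :: "'v \<Rightarrow> 'u" and B :: "'v normed_star_algebra"
  assumes B: "cstar_algebra B" and \<iota>: "inj_on \<iota> (carrier B)"
begin

interpretation B: cstar_algebra B by (rule B)

abbreviation "BT \<equiv> transp \<iota> B"

abbreviation "jj \<equiv> inv_into (carrier B) \<iota>"

lemma jj: "a \<in> carrier B \<Longrightarrow> jj (\<iota> a) = a"
  using \<iota> by (rule inv_into_f_f)

lemma transp_simps:
  "carrier BT = \<iota> ` carrier B" "one BT = \<iota> \<one>\<^bsub>B\<^esub>" "zero BT = \<iota> \<zero>\<^bsub>B\<^esub>"
  "a \<in> carrier B \<Longrightarrow> b \<in> carrier B \<Longrightarrow> \<iota> a \<otimes>\<^bsub>BT\<^esub> \<iota> b = \<iota> (a \<otimes>\<^bsub>B\<^esub> b)"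
  "a \<in> carrier B \<Longrightarrow> b \<in> carrier B \<Longrightarrow> \<iota> a \<oplus>\<^bsub>BT\<^esub> \<iota> b = \<iota> (a \<oplus>\<^bsub>B\<^esub> b)"
  "a \<in> carrier B \<Longrightarrow> c \<odot>\<^bsub>BT\<^esub> \<iota> a = \<iota> (c \<odot>\<^bsub>B\<^esub> a)"
  "a \<in> carrier B \<Longrightarrow> invol BT (\<iota> a) = \<iota> (invol B a)"
  "a \<in> carrier B \<Longrightarrow> cnorm BT (\<iota> a) = cnorm B a"
  by (simp_all add: transp_def Let_def jj)

lemma transp_eq: "a \<in> carrier B \<Longrightarrow> b \<in> carrier B \<Longrightarrow> \<iota> a = \<iota> b \<longleftrightarrow> a = b"
  using \<iota> by (rule inj_on_eq_iff)

lemma transp_cstar: "cstar_algebra BT"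
proof -
  have mod: "module complex_ring BT"
    by (rule cmoduleI) (auto simp: transp_simps B.M.a_ac B.B.smult_ldist B.B.smult_rdist B.B.smult_smult)
  then interpret sm: cmodule BT by (simp add: cmodule_def)
  have "ring BT"
    by (rule ringI[OF sm.M.abelian_group_axioms])
      (auto intro!: monoidI simp: transp_simps B.m_assoc B.l_distr B.r_distr)
  then interpret sr: ring BT .
  have minus: "\<iota> a \<ominus>\<^bsub>BT\<^esub> \<iota> b = \<iota> (a \<ominus>\<^bsub>B\<^esub> b)" if "a \<in> carrier B" "b \<in> carrier B" for a b
    using that by (simp add: sm.minus_conv B.B.minus_conv transp_simps)
  show ?thesis
  proof unfold_locales
    show "norm_complete BT (cnorm BT)"
      unfolding norm_complete_def
    proof (intro allI impI)
      fix u :: "nat \<Rightarrow> 'u" assume r: "range u \<subseteq> carrier BT"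
        and Cau: "\<forall>\<epsilon>>0. \<exists>n0. \<forall>m\<ge>n0. \<forall>n\<ge>n0. cnorm BT (u m \<ominus>\<^bsub>BT\<^esub> u n) < \<epsilon>"
      define v where "v n = jj (u n)" for n
      have uv: "u n = \<iota> (v n)" "v n \<in> carrier B" for n
      proof -
        have "u n \<in> \<iota> ` carrier B" using r unfolding transp_simps by blast
        thus "u n = \<iota> (v n)" "v n \<in> carrier B" unfolding v_def by (simp_all only: f_inv_into_f inv_into_into)
      qed
      have cm: "cnorm BT (u m \<ominus>\<^bsub>BT\<^esub> u n) = cnorm B (v m \<ominus>\<^bsub>B\<^esub> v n)" for m n
        unfolding uv(1) minus[OF uv(2) uv(2)] by (rule transp_simps(8)[OF B.M.minus_closed[OF uv(2) uv(2)]])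
      have "\<exists>a. B.B.tends v a"
        by (rule B.B.Cauchy_tends[OF uv(2)]) (rule Cau[unfolded cm, rule_format])
      then obtain a where a: "B.B.tends v a" by (elim exE)
      note ac = B.B.tendsD(2)[OF a]
      have "cnorm BT (u n \<ominus>\<^bsub>BT\<^esub> \<iota> a) = cnorm B (v n \<ominus>\<^bsub>B\<^esub> a)" for n
        unfolding uv(1) minus[OF uv(2) ac] by (rule transp_simps(8)[OF B.M.minus_closed[OF uv(2) ac]])
      hence "(\<lambda>n. cnorm BT (u n \<ominus>\<^bsub>BT\<^esub> \<iota> a)) \<longlonglongrightarrow> 0" using a unfolding B.B.tends_def by simp
      thus "\<exists>a\<in>carrier BT. (\<lambda>n. cnorm BT (u n \<ominus>\<^bsub>BT\<^esub> a)) \<longlonglongrightarrow> 0"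
        using ac unfolding transp_simps by blast
    qed
  qed (auto simp: transp_simps transp_eq B.smult_mult_left B.smult_mult_right B.invol_closed B.invol_invol B.invol_add
      B.invol_smult B.invol_mult B.cnorm_nonneg B.cnorm_eq_zero B.cnorm_smult B.cnorm_triangle B.cnorm_submult B.cstar_identity)
qed

interpretation BT: cstar_algebra BT by (rule transp_cstar)

lemma transp_finsum:
  assumes f: "\<And>i. i \<in> I \<Longrightarrow> f i \<in> carrier B"
  shows "(\<Oplus>\<^bsub>BT\<^esub>i\<in>I. \<iota> (f i)) = \<iota> (\<Oplus>\<^bsub>B\<^esub>i\<in>I. f i)"
  by (rule finsum_hom[symmetric, OF B.M.abelian_monoid_axioms BT.M.abelian_monoid_axioms]) (use f in \<open>auto simp: transp_simps\<close>)

lemma transp_tracial: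
  assumes t: "tracial_state B \<tau>" shows "tracial_state BT (\<lambda>x. \<tau> (jj x))"
proof -
  interpret t: ctrace B \<tau> by unfold_locales (rule t)
  have pos: "\<tau> (jj x) \<in> \<real>\<^sub>\<ge>\<^sub>0" if pe: "positive_elem BT x" for x
  proof -
    obtain y where y: "y \<in> carrier BT" "x = invol BT y \<otimes>\<^bsub>BT\<^esub> y"
      using pe[unfolded positive_elem_def, THEN conjunct2] by (elim bexE)
    obtain b where b: "b \<in> carrier B" "y = \<iota> b" using y(1) unfolding transp_simps by blast
    have "x = \<iota> (invol B b \<otimes>\<^bsub>B\<^esub> b)" unfolding y(2) b(2) using b(1) by (simp add: transp_simps B.invol_closed)
    hence "jj x = invol B b \<otimes>\<^bsub>B\<^esub> b" using b(1) by (simp add: jj B.invol_closed)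
    thus ?thesis using t.tr_pos[OF b(1)] by simp
  qed
  show ?thesis unfolding tracial_state_def alg_state_def
    using pos by (auto simp: transp_simps jj t.tr_add t.tr_smult t.tr_one intro: t.tr_comm)
qed

lemma transp_stochastic:
  assumes E: "stochastic_matrix B E" shows "stochastic_matrix BT (\<lambda>z z'. \<iota> (E z z'))"
proof -
  obtain b where b: "b \<in> carrier (mat_alg B)" "E = invol (mat_alg B) b \<otimes>\<^bsub>mat_alg B\<^esub> b"
    using E unfolding stochastic_matrix_def positive_elem_def by blast
  have E1: "(\<Oplus>\<^bsub>B\<^esub>z\<in>UNIV. E z z) = \<one>\<^bsub>B\<^esub>" and Ec: "E z z' \<in> carrier B" for z z'
    using E unfolding stochastic_matrix_def positive_elem_def by simp_all
  have bc: "b z z' \<in> carrier B" for z z' using b(1) by simp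
  have Eb: "E z z' = (\<Oplus>\<^bsub>B\<^esub>w\<in>UNIV. invol B (b w z) \<otimes>\<^bsub>B\<^esub> b w z')" for z z' unfolding b(2) by simp
  let ?b = "\<lambda>z z'. \<iota> (b z z')"
  have "\<iota> (E z z') = (\<Oplus>\<^bsub>BT\<^esub>w\<in>UNIV. invol BT (?b w z) \<otimes>\<^bsub>BT\<^esub> ?b w z')" for z z'
  proof -
    have "invol BT (?b w z) \<otimes>\<^bsub>BT\<^esub> ?b w z' = \<iota> (invol B (b w z) \<otimes>\<^bsub>B\<^esub> b w z')" for w
      using bc by (simp add: transp_simps B.invol_closed)
    hence "(\<Oplus>\<^bsub>BT\<^esub>w\<in>UNIV. invol BT (?b w z) \<otimes>\<^bsub>BT\<^esub> ?b w z') = (\<Oplus>\<^bsub>BT\<^esub>w\<in>UNIV. \<iota> (invol B (b w z) \<otimes>\<^bsub>B\<^esub> b w z'))" by (simp only:)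
    also have "\<dots> = \<iota> (\<Oplus>\<^bsub>B\<^esub>w\<in>UNIV. invol B (b w z) \<otimes>\<^bsub>B\<^esub> b w z')"
      by (rule transp_finsum) (use bc B.invol_closed in auto)
    finally show ?thesis unfolding Eb by (rule sym)
  qed
  hence "(\<lambda>z z'. \<iota> (E z z')) = invol (mat_alg BT) ?b \<otimes>\<^bsub>mat_alg BT\<^esub> ?b" by (simp add: fun_eq_iff)
  moreover have "?b \<in> carrier (mat_alg BT)" "(\<lambda>z z'. \<iota> (E z z')) \<in> carrier (mat_alg BT)"
    using bc Ec by (simp_all add: transp_simps)
  ultimately have "positive_elem (mat_alg BT) (\<lambda>z z'. \<iota> (E z z'))" unfolding positive_elem_def by blast
  moreover have "(\<Oplus>\<^bsub>BT\<^esub>z\<in>UNIV. \<iota> (E z z)) = \<one>\<^bsub>BT\<^esub>" using transp_finsum[of UNIV "\<lambda>z. E z z"] Ec E1 by (simp add: transp_simps)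
  ultimately show ?thesis unfolding stochastic_matrix_def by blast
qed

lemma transp_reciprocal:
  assumes E: "\<And>z z'. E z z' \<in> carrier B"
  shows "reciprocal_state BT (\<lambda>x. \<tau> (jj x)) (\<lambda>z z'. \<iota> (E z z')) = reciprocal_state B \<tau> E"
  unfolding reciprocal_state_def using E by (simp add: transp_simps jj)

lemma transp_abelian: "abelian_alg B \<Longrightarrow> abelian_alg BT"
  unfolding abelian_alg_def by (auto simp: transp_simps)

lemma transp_finite_dim: assumes "finite_dim_alg B" shows "finite_dim_alg BT"
proof -
  obtain B0 where B0: "finite B0" "B0 \<subseteq> carrier B" "carrier B = lin_span B B0"
    using assms unfolding finite_dim_alg_def by (elim exE conjE)
  have sub: "\<iota> ` B0 \<subseteq> carrier BT" unfolding transp_simps using B0(2) by (rule image_mono)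
  have "\<iota> a \<in> lin_span BT (\<iota> ` B0)" if a: "a \<in> lin_span B B0" for a
    using B0(2) a
  proof (induction rule: B.B.lin_span_induct)
    case zero
    show ?case using BT.B.lin_span_zero[of "\<iota> ` B0"] by (simp only: transp_simps)
  next
    case (step y c s)
    have s: "s \<in> carrier B" using step.hyps(3) B0(2) by (rule subsetD[rotated])
    have "\<iota> y \<oplus>\<^bsub>BT\<^esub> c \<odot>\<^bsub>BT\<^esub> \<iota> s \<in> lin_span BT (\<iota> ` B0)"
      by (rule BT.B.lin_span_step[OF sub step.IH imageI[OF step.hyps(3)]])
    thus ?case using s step.hyps(2) by (simp add: transp_simps)
  qed
  hence "carrier BT \<subseteq> lin_span BT (\<iota> ` B0)" unfolding transp_simps using B0(3) by auto
  moreover have "lin_span BT (\<iota> ` B0) \<subseteq> carrier BT" by (rule BT.B.lin_span_carrier[OF sub])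
  ultimately show ?thesis unfolding finite_dim_alg_def using B0(1) sub by (intro exI[of _ "\<iota> ` B0"]) auto
qed

end

text \<open>The generators are the entries of a square root of \<open>E\<close> and, in the finite dimensional case,
  a spanning set.\<close>

theorem reciprocal_in_universe:
  fixes B :: "'v normed_star_algebra" and E :: "'z::finite \<Rightarrow> 'z \<Rightarrow> 'v" and f :: "real \<Rightarrow> 'u"
  assumes B: "cstar_algebra B" and t: "tracial_state B \<tau>" and E: "stochastic_matrix B E" and f: "inj f"
  shows reciprocal_in_Upsilon: "reciprocal_state B \<tau> E \<in> Upsilon TYPE('u)"
    and reciprocal_in_Upsilon_q: "finite_dim_alg B \<Longrightarrow> reciprocal_state B \<tau> E \<in> Upsilon_q TYPE('u)"
    and reciprocal_in_Upsilon_loc: "abelian_alg B \<Longrightarrow> reciprocal_state B \<tau> E \<in> Upsilon_loc TYPE('u)"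
proof -
  interpret B: ctrace B \<tau> by (intro ctrace.intro ctrace_axioms.intro B t)
  obtain b where b: "b \<in> carrier (mat_alg B)" "E = invol (mat_alg B) b \<otimes>\<^bsub>mat_alg B\<^esub> b"
    using E unfolding stochastic_matrix_def positive_elem_def by blast
  have E1: "(\<Oplus>\<^bsub>B\<^esub>z\<in>UNIV. E z z) = \<one>\<^bsub>B\<^esub>" using E unfolding stochastic_matrix_def by blast
  have bc: "b z z' \<in> carrier B" for z z' using b(1) by simp
  have Eb: "E z z' = (\<Oplus>\<^bsub>B\<^esub>w\<in>UNIV. invol B (b w z) \<otimes>\<^bsub>B\<^esub> b w z')" for z z' unfolding b(2) by simp
  \<comment> \<open>S is to be a subalgebra small enough to be injected into the universe. The last
    clause makes it all of B when G spans B, which preserves finite dimension.\<close>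
  define good where "good G S \<iota> \<longleftrightarrow> cstar_algebra S \<and> inj_on \<iota> (carrier S) \<and> tracial_state S \<tau> \<and>
      stochastic_matrix S E \<and> reciprocal_state S \<tau> E = reciprocal_state B \<tau> E \<and> (\<forall>z z'. E z z' \<in> carrier S) \<and>
      (abelian_alg B \<longrightarrow> abelian_alg S) \<and> (carrier B = lin_span B G \<longrightarrow> S = B)"
    for G and S :: "'v normed_star_algebra" and \<iota> :: "'v \<Rightarrow> 'u"
  have goodD: "cstar_algebra S" "inj_on \<iota> (carrier S)" "tracial_state S \<tau>" "stochastic_matrix S E"
    "reciprocal_state S \<tau> E = reciprocal_state B \<tau> E" "E z z' \<in> carrier S" "abelian_alg B \<Longrightarrow> abelian_alg S"
    "carrier B = lin_span B G \<Longrightarrow> S = B" if "good G S \<iota>" for G S \<iota> z z'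
    using that unfolding good_def by simp_all
  have main: "\<exists>S \<iota>. good G S \<iota>"
    if G: "finite G" "G \<subseteq> carrier B" for G
  proof -
    \<comment> \<open>The entries of a root have to be included, not only those of E, since
      positivity over the subalgebra asks for a root with entries in it.\<close>
    let ?X = "range (\<lambda>(z, z'). b z z') \<union> G"
    have ne: "countable ?X" "?X \<noteq> {}" using G(1) by (auto simp: countable_finite)
    have g: "?X = range (from_nat_into ?X)" by (rule range_from_nat_into[OF ne(2,1), symmetric])
    define g where "g = from_nat_into ?X"
    note g = g[folded g_def]
    have gc: "g n \<in> carrier B" for n
    proof -
      have "g n \<in> ?X" unfolding g by (rule rangeI)
      thus ?thesis using bc G(2) by auto
    qed
    define S where "S = B\<lparr>carrier := norm_closure B (range (ceval B g))\<rparr>"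
    have S: "cstar_algebra S" unfolding S_def by (rule subalg_cstar[OF B gc])
    interpret S: cstar_algebra S by (rule S)
    have Ss: "mult S = mult B" "one S = one B" "zero S = zero B" "add S = add B" "smult S = smult B" "invol S = invol B"
      "cnorm S = cnorm B" and Sc: "carrier S = B.B.ncl (range (ceval B g))"
      by (simp_all add: S_def B.norm_closure_eq)
    obtain \<iota> :: "'v \<Rightarrow> 'u" where \<iota>: "inj_on \<iota> (carrier S)"
      using subalg_inj[OF B, of g, OF gc f] unfolding S_def by auto
    have SB: "carrier S \<subseteq> carrier B" unfolding Sc by (rule B.B.ncl_carrier)
    have gS: "x \<in> carrier S" if "x \<in> ?X" for x
    proof -
      have "x \<in> range g" using that unfolding g .
      then obtain n where "x = g n" by (elim rangeE)
      hence "x \<in> range (ceval B g)" by (intro range_eqI[of _ _ "CGen n"]) simp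
      thus ?thesis unfolding Sc by (rule subsetD[OF B.B.ncl_superset[OF B.range_sub[of g, OF gc]]])
    qed
    have bS: "b z z' \<in> carrier S" for z z' by (rule gS, rule UnI1, rule image_eqI[of _ _ "(z, z')"]) simp_all
    have fs: "finsum S h J = finsum B h J" if "\<And>j. j \<in> J \<Longrightarrow> h j \<in> carrier S" for h :: "'j \<Rightarrow> 'v" and J
      by (rule finsum_hom[where f = "\<lambda>x. x", OF S.M.abelian_monoid_axioms B.M.abelian_monoid_axioms])
        (use that SB in \<open>auto simp: Ss\<close>)
    have ESb: "E z z' = (\<Oplus>\<^bsub>S\<^esub>w\<in>UNIV. invol S (b w z) \<otimes>\<^bsub>S\<^esub> b w z')" for z z'
    proof -
      have "(\<Oplus>\<^bsub>S\<^esub>w\<in>UNIV. invol S (b w z) \<otimes>\<^bsub>S\<^esub> b w z') = (\<Oplus>\<^bsub>B\<^esub>w\<in>UNIV. invol S (b w z) \<otimes>\<^bsub>S\<^esub> b w z')"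
        by (rule fs) (rule S.m_closed[OF S.invol_closed[OF bS] bS])
      thus ?thesis unfolding Eb by (simp only: Ss)
    qed
    have ES: "E z z' \<in> carrier S" for z z' unfolding ESb
      by (intro S.M.finsum_closed) (use S.m_closed[OF S.invol_closed[OF bS] bS] in auto)
    have tS: "tracial_state S \<tau>"
    proof -
      have "positive_elem B a" if "positive_elem S a" for a
        using that SB unfolding positive_elem_def Ss by blast
      thus ?thesis using t SB unfolding tracial_state_def alg_state_def Ss by blast
    qed
    have "E = invol (mat_alg S) b \<otimes>\<^bsub>mat_alg S\<^esub> b" by (simp add: fun_eq_iff ESb)
    hence "positive_elem (mat_alg S) E" unfolding positive_elem_def using bS ES by auto
    moreover have "(\<Oplus>\<^bsub>S\<^esub>z\<in>UNIV. E z z) = \<one>\<^bsub>S\<^esub>" using fs[of UNIV "\<lambda>z. E z z"] ES E1 by (simp add: Ss)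
    ultimately have st: "stochastic_matrix S E" unfolding stochastic_matrix_def by blast
    have rc: "reciprocal_state S \<tau> E = reciprocal_state B \<tau> E" unfolding reciprocal_state_def Ss ..
    have ab: "abelian_alg S" if "abelian_alg B" using that SB unfolding abelian_alg_def Ss by blast
    have fullS: "S = B" if full: "carrier B = lin_span B G"
    proof -
      have "lin_span B G \<subseteq> carrier S"
        by (rule B.B.lin_span_minimal[OF _ SB]) (use gS S.M.zero_closed S.M.a_closed S.B.smult_closed' in \<open>auto simp: Ss\<close>)
      hence "carrier S = carrier B" using SB full by blast
      thus ?thesis unfolding S_def by simp
    qed
    show ?thesis unfolding good_def
      by (intro exI[of _ S] exI[of _ \<iota>] conjI allI impI S \<iota> tS st rc ES ab fullS)
  qed
  show "reciprocal_state B \<tau> E \<in> Upsilon TYPE('u)"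
  proof -
    obtain S \<iota> where "good {} S \<iota>" using main[OF finite.emptyI empty_subsetI] by (elim exE)
    note S = goodD[OF this]
    have eq: "reciprocal_state B \<tau> E = reciprocal_state (transp \<iota> S) (\<lambda>x. \<tau> (inv_into (carrier S) \<iota> x)) (\<lambda>z z'. \<iota> (E z z'))"
      unfolding S(5)[symmetric] by (rule transp_reciprocal[OF S(1,2,6), symmetric])
    show ?thesis unfolding Upsilon_def
      by (intro CollectI exI conjI) (rule eq, rule transp_cstar[OF S(1,2)], rule transp_tracial[OF S(1-3)],
        rule transp_stochastic[OF S(1,2,4)])
  qed
  show "reciprocal_state B \<tau> E \<in> Upsilon_loc TYPE('u)" if ab: "abelian_alg B"
  proof -
    obtain S \<iota> where "good {} S \<iota>" using main[OF finite.emptyI empty_subsetI] by (elim exE)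
    note S = goodD[OF this]
    have eq: "reciprocal_state B \<tau> E = reciprocal_state (transp \<iota> S) (\<lambda>x. \<tau> (inv_into (carrier S) \<iota> x)) (\<lambda>z z'. \<iota> (E z z'))"
      unfolding S(5)[symmetric] by (rule transp_reciprocal[OF S(1,2,6), symmetric])
    show ?thesis unfolding Upsilon_loc_def
      by (intro CollectI exI conjI) (rule eq, rule transp_cstar[OF S(1,2)], rule transp_abelian[OF S(1,2) S(7)[OF ab]], rule transp_tracial[OF S(1-3)],
        rule transp_stochastic[OF S(1,2,4)])
  qed
  show "reciprocal_state B \<tau> E \<in> Upsilon_q TYPE('u)" if fd: "finite_dim_alg B"
  proof -
    obtain G where G: "finite G" "G \<subseteq> carrier B" "carrier B = lin_span B G"
      using fd unfolding finite_dim_alg_def by (elim exE conjE)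
    obtain S \<iota> where "good G S \<iota>" using main[OF G(1,2)] by (elim exE)
    note S = goodD[OF this]
    have eq: "reciprocal_state B \<tau> E = reciprocal_state (transp \<iota> S) (\<lambda>x. \<tau> (inv_into (carrier S) \<iota> x)) (\<lambda>z z'. \<iota> (E z z'))"
      unfolding S(5)[symmetric] by (rule transp_reciprocal[OF S(1,2,6), symmetric])
    have fdS: "finite_dim_alg S" unfolding S(8)[OF G(3)] by (rule fd)
    show ?thesis unfolding Upsilon_q_def
      by (intro CollectI exI conjI) (rule eq, rule transp_cstar[OF S(1,2)], rule transp_finite_dim[OF S(1,2) fdS],
        rule transp_tracial[OF S(1-3)], rule transp_stochastic[OF S(1,2,4)])
  qed
qed

text \<open>The real multiples of the unit have different traces. Hence a single algebra over 'u
  with a trace shows that 'u has at least continuum many elements.\<close>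

lemma inj_real_of_trace:
  fixes A :: "'u normed_star_algebra"
  assumes A: "cstar_algebra A" and t: "tracial_state A \<tau>"
  shows "\<exists>f :: real \<Rightarrow> 'u. inj f"
proof -
  interpret A: ctrace A \<tau> by (intro ctrace.intro ctrace_axioms.intro A t)
  have "\<tau> (complex_of_real r \<odot>\<^bsub>A\<^esub> \<one>\<^bsub>A\<^esub>) = complex_of_real r" for r
    using A.tr_smult[OF A.one_closed] by (simp add: A.tr_one)
  hence "inj (\<lambda>r. complex_of_real r \<odot>\<^bsub>A\<^esub> \<one>\<^bsub>A\<^esub>)" by (intro injI) (metis of_real_eq_iff)
  thus ?thesis by blast
qed

section \<open>Products of adjoints\<close>

lemma fadj_minus:
  assumes H: "hfam I H" and K: "hfam I K" and f: "f \<in> ops I H K" and g: "g \<in> ops I H K"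
  shows "fadj I H K (f \<ominus>\<^bsub>op_families I H K\<^esub> g) = fadj I H K f \<ominus>\<^bsub>op_families I K H\<^esub> fadj I H K g"
proof -
  interpret M: normed_module "op_families I H K" "fnorm I H K" using ops_normed_module[OF H K] .
  interpret L: normed_module "op_families I K H" "fnorm I K H" using ops_normed_module[OF K H] .
  show ?thesis
    by (simp add: M.minus_conv[OF f g] L.minus_conv[OF fadj_closed[OF H K f] fadj_closed[OF H K g]]
      fadj_add[OF H K f M.smult_closed'[OF g]] fadj_smult[OF H K g])
qed

context
  fixes I :: "'i set" and H K L :: "'i \<Rightarrow> 'h hilbert"
  assumes H: "hfam I H" and K: "hfam I K" and L: "hfam I L"
begin

lemma opcomp_minus_left:
  assumes f: "f \<in> ops I K L" and f': "f' \<in> ops I K L" and g: "g \<in> ops I H K"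
  shows "opcomp I H f g \<ominus>\<^bsub>op_families I H L\<^esub> opcomp I H f' g = opcomp I H (f \<ominus>\<^bsub>op_families I K L\<^esub> f') g"
proof -
  interpret HL: normed_module "op_families I H L" "fnorm I H L" using ops_normed_module[OF H L] .
  interpret KL: normed_module "op_families I K L" "fnorm I K L" using ops_normed_module[OF K L] .
  note c = opcomp_closed[OF H K L _ g]
  show ?thesis
  proof (rule ops_eqI[of _ I H L])
    show "opcomp I H f g \<ominus>\<^bsub>op_families I H L\<^esub> opcomp I H f' g \<in> ops I H L"
      by (rule HL.M.minus_closed[OF c[OF f] c[OF f']])
    show "opcomp I H (f \<ominus>\<^bsub>op_families I K L\<^esub> f') g \<in> ops I H L" by (rule c[OF KL.M.minus_closed[OF f f']])
    fix i \<xi> assume i: "i \<in> I" "\<xi> \<in> carrier (H i)"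
    show "(opcomp I H f g \<ominus>\<^bsub>op_families I H L\<^esub> opcomp I H f' g) i \<xi> = opcomp I H (f \<ominus>\<^bsub>op_families I K L\<^esub> f') g i \<xi>"
      unfolding op_families_minus[OF H L c[OF f] c[OF f'] i] op_families_vals(5)[of i I \<xi> H, OF i]
        op_families_minus[OF K L f f' i(1) opsD(4)[OF g i]] ..
  qed
qed

lemma opcomp_minus_right:
  assumes f: "f \<in> ops I K L" and g: "g \<in> ops I H K" and g': "g' \<in> ops I H K"
  shows "opcomp I H f g \<ominus>\<^bsub>op_families I H L\<^esub> opcomp I H f g' = opcomp I H f (g \<ominus>\<^bsub>op_families I H K\<^esub> g')"
proof -
  interpret HL: normed_module "op_families I H L" "fnorm I H L" using ops_normed_module[OF H L] .
  interpret HK: normed_module "op_families I H K" "fnorm I H K" using ops_normed_module[OF H K] .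
  note c = opcomp_closed[OF H K L f]
  show ?thesis
  proof (rule ops_eqI[of _ I H L])
    show "opcomp I H f g \<ominus>\<^bsub>op_families I H L\<^esub> opcomp I H f g' \<in> ops I H L"
      by (rule HL.M.minus_closed[OF c[OF g] c[OF g']])
    show "opcomp I H f (g \<ominus>\<^bsub>op_families I H K\<^esub> g') \<in> ops I H L" by (rule c[OF HK.M.minus_closed[OF g g']])
    fix i \<xi> assume i: "i \<in> I" "\<xi> \<in> carrier (H i)"
    interpret Ki: hilbert_space "K i" using hfamD[OF K i(1)] .
    interpret Li: hilbert_space "L i" using hfamD[OF L i(1)] .
    note gi = opsD(4)[OF g i] opsD(4)[OF g' i]
    have "f i (g i \<xi>) \<ominus>\<^bsub>L i\<^esub> f i (g' i \<xi>) = f i (g i \<xi> \<ominus>\<^bsub>K i\<^esub> g' i \<xi>)"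
      unfolding Ki.minus_conv[OF gi] Li.minus_conv[OF opsD(4)[OF f i(1) gi(1)] opsD(4)[OF f i(1) gi(2)]]
        opsD(5)[OF f i(1) gi(1) Ki.smult_closed'[OF gi(2)]] opsD(6)[OF f i(1) gi(2)] ..
    thus "(opcomp I H f g \<ominus>\<^bsub>op_families I H L\<^esub> opcomp I H f g') i \<xi> = opcomp I H f (g \<ominus>\<^bsub>op_families I H K\<^esub> g') i \<xi>"
      unfolding op_families_minus[OF H L c[OF g] c[OF g'] i] op_families_vals(5)[of i I \<xi> H, OF i]
        op_families_minus[OF H K g g' i] .
  qed
qed

end

text \<open>Joint continuity of the product S* T. The operators run between different families, so
  this is no instance of continuity of the product in an algebra; the two factors are changed one at
  a time, and adjoints do not increase the norm.\<close>

lemma tends_adjoint_mult: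
  assumes H: "hfam I H" and K: "hfam I K"
    and s: "normed_module.tends (op_families I H K) (fnorm I H K) s S"
    and t: "normed_module.tends (op_families I H K) (fnorm I H K) t T"
  shows "normed_module.tends (op_families I H H) (fnorm I H H)
    (\<lambda>n. opcomp I H (fadj I H K (s n)) (t n)) (opcomp I H (fadj I H K S) T)"
proof -
  interpret M: normed_module "op_families I H K" "fnorm I H K" using ops_normed_module[OF H K] .
  interpret M': normed_module "op_families I K H" "fnorm I K H" using ops_normed_module[OF K H] .
  interpret D: normed_module "op_families I H H" "fnorm I H H" using ops_normed_module[OF H H] .
  note sc = M.tendsD[OF s] and tc = M.tendsD[OF t]
  note ac = fadj_closed[OF H K sc(1)] fadj_closed[OF H K sc(2)]
  note cc = opcomp_closed[OF H K H]
  let ?C = "\<lambda>a b. opcomp I H (fadj I H K a) b"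
  obtain b where b: "b > 0" "\<forall>n. fnorm I H K (t n) \<le> b" using M.tends_bounded[OF t] by (elim exE conjE)
  have sn: "(\<lambda>n. fnorm I H K (s n \<ominus>\<^bsub>op_families I H K\<^esub> S)) \<longlonglongrightarrow> 0"
    and tn: "(\<lambda>n. fnorm I H K (t n \<ominus>\<^bsub>op_families I H K\<^esub> T)) \<longlonglongrightarrow> 0"
    using s t unfolding M.tends_def by simp_all
  show ?thesis
  proof (rule D.tends_le)
    fix n
    have 1: "fnorm I H H (?C (s n) (t n) \<ominus>\<^bsub>op_families I H H\<^esub> ?C S (t n)) \<le> fnorm I H K (s n \<ominus>\<^bsub>op_families I H K\<^esub> S) * b"
    proof -
      have "fnorm I H H (?C (s n) (t n) \<ominus>\<^bsub>op_families I H H\<^esub> ?C S (t n))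
          = fnorm I H H (?C (s n \<ominus>\<^bsub>op_families I H K\<^esub> S) (t n))"
        by (simp only: opcomp_minus_left[OF H K H ac tc(1)] fadj_minus[OF H K sc])
      also have "\<dots> \<le> fnorm I K H (fadj I H K (s n \<ominus>\<^bsub>op_families I H K\<^esub> S)) * fnorm I H K (t n)"
        by (rule opcomp_norm[OF H K H fadj_closed[OF H K M.M.minus_closed[OF sc]] tc(1)])
      also have "\<dots> \<le> fnorm I H K (s n \<ominus>\<^bsub>op_families I H K\<^esub> S) * b"
        by (rule mult_mono[OF fadj_norm[OF H K M.M.minus_closed[OF sc]] b(2)[THEN spec]])
          (rule fnorm_nonneg[OF H K M.M.minus_closed[OF sc]], rule fnorm_nonneg[OF H K tc(1)])
      finally show ?thesis .
    qed
    have 2: "fnorm I H H (?C S (t n) \<ominus>\<^bsub>op_families I H H\<^esub> ?C S T) \<le> fnorm I K H (fadj I H K S) * fnorm I H K (t n \<ominus>\<^bsub>op_families I H K\<^esub> T)"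
      unfolding opcomp_minus_right[OF H K H ac(2) tc] by (rule opcomp_norm[OF H K H ac(2) M.M.minus_closed[OF tc]])
    show "fnorm I H H (?C (s n) (t n) \<ominus>\<^bsub>op_families I H H\<^esub> ?C S T) \<le>
        fnorm I H K (s n \<ominus>\<^bsub>op_families I H K\<^esub> S) * b + fnorm I K H (fadj I H K S) * fnorm I H K (t n \<ominus>\<^bsub>op_families I H K\<^esub> T)"
      by (rule order.trans[OF D.N_triangle_minus[OF cc[OF ac(1) tc(1)] cc[OF ac(2) tc(1)] cc[OF ac(2) tc(2)]] add_mono[OF 1 2]])
  next
    show "(\<lambda>n. fnorm I H K (s n \<ominus>\<^bsub>op_families I H K\<^esub> S) * b + fnorm I K H (fadj I H K S) * fnorm I H K (t n \<ominus>\<^bsub>op_families I H K\<^esub> T)) \<longlonglongrightarrow> 0"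
      using tendsto_add[OF tendsto_mult_right[OF sn, of b] tendsto_mult_left[OF tn, of "fnorm I K H (fadj I H K S)"]] by simp
  qed (rule cc[OF ac(1) tc(1)] cc[OF ac(2) tc(2)])+
qed

section \<open>The representations of the ternary ring\<close>

lemma reps_hilbert:
  assumes "r \<in> reps" shows "hilbert_space (rep_dom r)" "hilbert_space (rep_cod r)"
  using assms unfolding reps_def by auto

lemma repsD:
  assumes "r \<in> reps"
  shows "snd (snd r) a x \<in> bounded_ops (rep_dom r) (rep_cod r)"
    "\<xi> \<in> carrier (rep_dom r) \<Longrightarrow>
      (\<Oplus>\<^bsub>rep_dom r\<^esub>a\<in>UNIV. adjoint_op (rep_dom r) (rep_cod r) (snd (snd r) a x) (snd (snd r) a x' \<xi>)) =
        (if x = x' then \<xi> else \<zero>\<^bsub>rep_dom r\<^esub>)"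
  using assms unfolding reps_def by (auto split: prod.splits)

text \<open>On the one-point space every vector is 0 and all relations hold. This makes
  \<open>reps\<close> an admissible index set for \<open>hfam\<close>.\<close>

lemma reps_nonempty: "(reps :: ('h, 'x, 'a::finite) rep set) \<noteq> {}"
proof -
  define z :: 'h where "z = undefined"
  define H :: "'h hilbert" where "H = \<lparr>carrier = {z}, mult = \<lambda>_ _. z, one = z, zero = z, add = \<lambda>_ _. z, smult = \<lambda>_ _. z, hinner = \<lambda>_ _. 0\<rparr>"
  have mod: "module complex_ring H" by (rule cmoduleI) (simp_all add: H_def)
  then interpret M: cmodule H by (simp add: cmodule_def)
  have car: "carrier H = {z}" and hn: "hnorm H \<xi> = 0" for \<xi> by (simp_all add: H_def hnorm_def)
  have hs: "hilbert_space H"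
  proof unfold_locales
    show "norm_complete H (hnorm H)" unfolding norm_complete_def hn car by auto
  qed (simp_all add: H_def)
  define V where "V = (\<lambda>(a::'a) (x::'x). restrict (\<lambda>_. z) {z})"
  have V: "V a x \<in> bounded_ops H H" for a x
    unfolding bounded_ops_def car hn V_def by (auto simp: H_def)
  have ad: "adjoint_op H H (V a x) z \<in> carrier H" for a x
    using bounded_opsD(2)[OF adjoint_exists(1)[OF hs hs V]] car by simp
  have "(\<Oplus>\<^bsub>H\<^esub>a\<in>UNIV. adjoint_op H H (V a x) (V a x' \<xi>)) = z" if "\<xi> \<in> carrier H" for x x' \<xi>
  proof -
    have "(\<Oplus>\<^bsub>H\<^esub>a\<in>UNIV. adjoint_op H H (V a x) (V a x' \<xi>)) \<in> carrier H"
      by (rule M.M.finsum_closed) (use that ad in \<open>simp add: V_def car\<close>)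
    thus ?thesis by (simp add: car)
  qed
  moreover have "\<zero>\<^bsub>H\<^esub> = z" by (simp add: H_def)
  ultimately have "(H, H, V) \<in> reps" unfolding reps_def using hs V by (simp add: car)
  thus ?thesis by blast
qed

lemma hfam_dom: "hfam (reps :: ('h, 'x, 'a::finite) rep set) rep_dom"
  and hfam_cod: "hfam (reps :: ('h, 'x, 'a::finite) rep set) rep_cod"
  unfolding hfam_def using reps_nonempty reps_hilbert by auto

abbreviation RD :: "(('h, 'x, 'a::finite) rep \<Rightarrow> 'h \<Rightarrow> 'h) normed_star_algebra" where
  "RD \<equiv> op_families reps rep_dom rep_dom"

abbreviation RM :: "(('h, 'x, 'a::finite) rep \<Rightarrow> 'h \<Rightarrow> 'h) normed_star_algebra" where
  "RM \<equiv> op_families reps rep_dom rep_cod"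

text \<open>The analogue of \<open>theta_sum\<close> on terms instead of classes, which permits
  recursion over the term; the representative chosen by the quotient type is eliminated
  later.\<close>

definition theta_fam :: "('x, 'a::finite) tterm \<Rightarrow> ('h, 'x, 'a) rep \<Rightarrow> 'h \<Rightarrow> 'h" where
  "theta_fam t = (\<lambda>r\<in>reps. theta_term r t)"

definition theta_adj :: "('x, 'a::finite) tterm \<Rightarrow> ('h, 'x, 'a) rep \<Rightarrow> 'h \<Rightarrow> 'h" where
  "theta_adj t = fadj reps rep_dom rep_cod (theta_fam t)"

lemma theta_fam_simps:
  "theta_fam TZero = \<zero>\<^bsub>RM\<^esub>"
  "theta_fam (TAdd s t) = theta_fam s \<oplus>\<^bsub>RM\<^esub> theta_fam t"
  "theta_fam (TScale c s) = c \<odot>\<^bsub>RM\<^esub> theta_fam s"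
  "theta_fam (Tern s t u) = opcomp reps rep_dom (theta_fam s) (opcomp reps rep_dom (theta_adj t) (theta_fam u))"
  by (simp_all add: theta_fam_def theta_adj_def op_families_def opcomp_def fadj_def cong: restrict_cong)

text \<open>Pairing the relation for x = x' with \<xi> shows that the |V_(b,x) \<xi>|^2 sum to
  |\<xi>|^2 over b. The bound 1 is uniform in r, so each generator gives a bounded family over all
  representations.\<close>

lemma rep_contractive:
  assumes r: "r \<in> reps" and \<xi>: "\<xi> \<in> carrier (rep_dom r)"
  shows "hnorm (rep_cod r) (snd (snd r) a x \<xi>) \<le> hnorm (rep_dom r) \<xi>"
proof -
  let ?H = "rep_dom r" and ?K = "rep_cod r" and ?V = "\<lambda>a. snd (snd r) a x"
  note hs = reps_hilbert[OF r] and V = repsD(1)[OF r]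
  interpret H: hilbert_space ?H by (rule hs)
  interpret K: hilbert_space ?K by (rule hs)
  have Vc: "?V b \<xi> \<in> carrier ?K" for b by (rule bounded_opsD(2)[OF V \<xi>])
  have ac: "adjoint_op ?H ?K (?V b) (?V b \<xi>) \<in> carrier ?H" for b
    by (rule bounded_opsD(2)[OF adjoint_exists(1)[OF hs V] Vc])
  have sq: "(hnorm ?K (?V b \<xi>))\<^sup>2 = Re (hinner ?H \<xi> (adjoint_op ?H ?K (?V b) (?V b \<xi>)))" for b
    unfolding K.hnorm_sq[OF Vc] adjoint_op_inner[OF hs V \<xi> Vc] ..
  have "hinner ?H \<xi> (\<Oplus>\<^bsub>?H\<^esub>b\<in>UNIV. adjoint_op ?H ?K (?V b) (?V b \<xi>)) = (\<Sum>b\<in>UNIV. hinner ?H \<xi> (adjoint_op ?H ?K (?V b) (?V b \<xi>)))"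
    by (rule finsum_hom_sum[where f = "hinner ?H \<xi>", OF H.M.abelian_monoid_axioms H.hinner_zero_right[OF \<xi>] H.hinner_add_right[OF \<xi>] ac])
  hence "Re (hinner ?H \<xi> \<xi>) = (\<Sum>b\<in>UNIV. (hnorm ?K (?V b \<xi>))\<^sup>2)"
    using repsD(2)[OF r \<xi>, of x x] by (simp add: sq)
  hence "(hnorm ?H \<xi>)\<^sup>2 = (\<Sum>b\<in>UNIV. (hnorm ?K (?V b \<xi>))\<^sup>2)" by (simp only: H.hnorm_sq[OF \<xi>])
  moreover have "(hnorm ?K (?V a \<xi>))\<^sup>2 \<le> (\<Sum>b\<in>UNIV. (hnorm ?K (?V b \<xi>))\<^sup>2)"
    by (rule member_le_sum[where f = "\<lambda>b. (hnorm ?K (?V b \<xi>))\<^sup>2"]) auto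
  ultimately show ?thesis by (intro power2_le_imp_le[OF _ H.N_nonneg[OF \<xi>]]) simp
qed

lemma theta_gen_ops:
  fixes a :: "'a::finite" and x :: 'x
  shows "(theta_fam (Gen a x) :: ('h, 'x, 'a) rep \<Rightarrow> 'h \<Rightarrow> 'h) \<in> carrier RM" (is "?f \<in> _")
proof -
  have 1: "?f \<in> (\<Pi>\<^sub>E r\<in>reps. bounded_ops (rep_dom r) (rep_cod r))"
    unfolding theta_fam_def by (rule restrict_PiE_iff[THEN iffD2]) (simp add: repsD(1))
  have 2: "bdd_above ((\<lambda>r. op_norm (rep_dom r) (rep_cod r) (?f r)) ` reps)"
  proof (rule bdd_aboveI2)
    fix r :: "('h, 'x, 'a) rep" assume r: "r \<in> reps"
    have "op_norm (rep_dom r) (rep_cod r) (snd (snd r) a x) \<le> 1"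
      by (rule op_norm_le[OF reps_hilbert[OF r] repsD(1)[OF r]]) (simp_all add: rep_contractive[OF r])
    thus "op_norm (rep_dom r) (rep_cod r) (?f r) \<le> 1" using r by (simp add: theta_fam_def)
  qed
  show ?thesis using 1 2 by (simp add: op_families_def)
qed

lemma theta_ops: "theta_fam t \<in> carrier RM"
proof (induction t)
  case (Tern s t u)
  show ?case unfolding theta_fam_simps theta_adj_def
    by (rule opcomp_closed[OF hfam_dom hfam_dom hfam_cod Tern.IH(1)
      opcomp_closed[OF hfam_dom hfam_cod hfam_dom fadj_closed[OF hfam_dom hfam_cod Tern.IH(2)] Tern.IH(3)]])
qed (simp_all only: theta_gen_ops theta_fam_simps ops_zero[OF hfam_dom hfam_cod] ops_add[OF hfam_dom hfam_cod] ops_smult[OF hfam_dom hfam_cod])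

lemma theta_adj_ops: "theta_adj t \<in> ops reps rep_cod rep_dom"
  unfolding theta_adj_def by (rule fadj_closed[OF hfam_dom hfam_cod theta_ops])

context
  fixes r :: "('h, 'x, 'a::finite) rep"
  assumes r: "r \<in> reps"
begin

lemma theta_closed: "\<xi> \<in> carrier (rep_dom r) \<Longrightarrow> theta_fam t r \<xi> \<in> carrier (rep_cod r)"
  by (rule opsD(4)[OF theta_ops r])

lemma theta_adj_closed: "\<eta> \<in> carrier (rep_cod r) \<Longrightarrow> theta_adj t r \<eta> \<in> carrier (rep_dom r)"
  by (rule opsD(4)[OF theta_adj_ops r])

lemma theta_vals:
  assumes \<xi>: "\<xi> \<in> carrier (rep_dom r)"
  shows "theta_fam TZero r \<xi> = \<zero>\<^bsub>rep_cod r\<^esub>"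
    "theta_fam (TAdd s t) r \<xi> = theta_fam s r \<xi> \<oplus>\<^bsub>rep_cod r\<^esub> theta_fam t r \<xi>"
    "theta_fam (TScale c s) r \<xi> = c \<odot>\<^bsub>rep_cod r\<^esub> theta_fam s r \<xi>"
    "theta_fam (Tern s t u) r \<xi> = theta_fam s r (theta_adj t r (theta_fam u r \<xi>))"
  unfolding theta_fam_simps by (simp_all add: op_families_vals r \<xi>)

lemma theta_adj_vals:
  assumes \<eta>: "\<eta> \<in> carrier (rep_cod r)"
  shows "theta_adj (TAdd s t) r \<eta> = theta_adj s r \<eta> \<oplus>\<^bsub>rep_dom r\<^esub> theta_adj t r \<eta>"
    "theta_adj (TScale c s) r \<eta> = cnj c \<odot>\<^bsub>rep_dom r\<^esub> theta_adj s r \<eta>"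
    "theta_adj (Tern s t u) r \<eta> = theta_adj u r (theta_fam t r (theta_adj s r \<eta>))"
    "theta_adj (Gen a x) r \<eta> = adjoint_op (rep_dom r) (rep_cod r) (snd (snd r) a x) \<eta>"
proof -
  note HK = hfam_dom hfam_cod
  show "theta_adj (TAdd s t) r \<eta> = theta_adj s r \<eta> \<oplus>\<^bsub>rep_dom r\<^esub> theta_adj t r \<eta>"
    unfolding theta_adj_def theta_fam_simps fadj_add[OF HK theta_ops theta_ops] by (rule op_families_vals[where H = rep_cod, OF r \<eta>])
  show "theta_adj (TScale c s) r \<eta> = cnj c \<odot>\<^bsub>rep_dom r\<^esub> theta_adj s r \<eta>"
    unfolding theta_adj_def theta_fam_simps fadj_smult[OF HK theta_ops] by (rule op_families_vals[where H = rep_cod, OF r \<eta>])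
  have "(theta_adj (Tern s t u) :: ('h, 'x, 'a) rep \<Rightarrow> 'h \<Rightarrow> 'h) = opcomp reps rep_cod (opcomp reps rep_dom (theta_adj u) (theta_fam t)) (theta_adj s)"
  proof -
    have 1: "opcomp reps rep_dom (theta_adj t) (theta_fam u) \<in> carrier RD" for t u
      by (rule opcomp_closed[OF hfam_dom hfam_cod hfam_dom theta_adj_ops theta_ops])
    show ?thesis
      unfolding theta_adj_def[of "Tern s t u"] theta_fam_simps fadj_opcomp[OF hfam_dom hfam_dom hfam_cod theta_ops 1]
        fadj_opcomp[OF hfam_dom hfam_cod hfam_dom theta_adj_ops theta_ops]
        theta_adj_def[symmetric] unfolding theta_adj_def[of t] fadj_fadj[OF HK theta_ops] ..
  qed
  thus "theta_adj (Tern s t u) r \<eta> = theta_adj u r (theta_fam t r (theta_adj s r \<eta>))"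
    by (simp add: op_families_vals[where H = rep_cod, OF r \<eta>] op_families_vals[where H = rep_dom, OF r theta_adj_closed[OF \<eta>]])
  show "theta_adj (Gen a x) r \<eta> = adjoint_op (rep_dom r) (rep_cod r) (snd (snd r) a x) \<eta>"
    by (simp add: theta_adj_def fadj_def r theta_fam_def)
qed

lemma theta_lin:
  assumes \<xi>: "\<xi> \<in> carrier (rep_dom r)"
  shows "\<xi>' \<in> carrier (rep_dom r) \<Longrightarrow> theta_fam t r (\<xi> \<oplus>\<^bsub>rep_dom r\<^esub> \<xi>') = theta_fam t r \<xi> \<oplus>\<^bsub>rep_cod r\<^esub> theta_fam t r \<xi>'"
    "theta_fam t r (c \<odot>\<^bsub>rep_dom r\<^esub> \<xi>) = c \<odot>\<^bsub>rep_cod r\<^esub> theta_fam t r \<xi>"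
  by (rule opsD(5)[OF theta_ops r \<xi>], assumption) (rule opsD(6)[OF theta_ops r \<xi>])

lemma theta_adj_lin:
  assumes \<eta>: "\<eta> \<in> carrier (rep_cod r)"
  shows "\<eta>' \<in> carrier (rep_cod r) \<Longrightarrow> theta_adj t r (\<eta> \<oplus>\<^bsub>rep_cod r\<^esub> \<eta>') = theta_adj t r \<eta> \<oplus>\<^bsub>rep_dom r\<^esub> theta_adj t r \<eta>'"
    "theta_adj t r (c \<odot>\<^bsub>rep_cod r\<^esub> \<eta>) = c \<odot>\<^bsub>rep_dom r\<^esub> theta_adj t r \<eta>"
  by (rule opsD(5)[OF theta_adj_ops r \<eta>], assumption) (rule opsD(6)[OF theta_adj_ops r \<eta>])

lemma theta_zero: "theta_fam t r \<zero>\<^bsub>rep_dom r\<^esub> = \<zero>\<^bsub>rep_cod r\<^esub>"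
proof -
  interpret H: hilbert_space "rep_dom r" by (rule reps_hilbert[OF r])
  interpret K: hilbert_space "rep_cod r" by (rule reps_hilbert[OF r])
  have "theta_fam t r (0 \<odot>\<^bsub>rep_dom r\<^esub> \<zero>\<^bsub>rep_dom r\<^esub>) = 0 \<odot>\<^bsub>rep_cod r\<^esub> theta_fam t r \<zero>\<^bsub>rep_dom r\<^esub>"
    by (rule theta_lin(2)[OF H.M.zero_closed])
  thus ?thesis by (simp add: theta_closed)
qed

lemma theta_tsum:
  assumes \<xi>: "\<xi> \<in> carrier (rep_dom r)"
  shows "distinct as \<Longrightarrow> theta_fam (tsum (map g as)) r \<xi> = (\<Oplus>\<^bsub>rep_cod r\<^esub>a\<in>set as. theta_fam (g a) r \<xi>)"
proof (induction as)
  case Nil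
  interpret K: hilbert_space "rep_cod r" by (rule reps_hilbert[OF r])
  show ?case by (simp add: tsum_def theta_vals[OF \<xi>])
next
  case (Cons a as)
  interpret K: hilbert_space "rep_cod r" by (rule reps_hilbert[OF r])
  have "theta_fam (tsum (map g (a # as))) r \<xi> = theta_fam (g a) r \<xi> \<oplus>\<^bsub>rep_cod r\<^esub> theta_fam (tsum (map g as)) r \<xi>"
    by (simp add: tsum_def theta_vals[OF \<xi>])
  thus ?case using Cons theta_closed[OF \<xi>] by (simp add: K.M.finsum_insert Pi_def)
qed

lemma theta_relation:
  assumes \<xi>: "\<xi> \<in> carrier (rep_dom r)"
  shows "(\<Oplus>\<^bsub>rep_dom r\<^esub>a\<in>UNIV. theta_adj (Gen a x) r (theta_fam (Gen a x') r \<xi>)) = (if x = x' then \<xi> else \<zero>\<^bsub>rep_dom r\<^esub>)"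
proof -
  have "theta_adj (Gen a x) r (theta_fam (Gen a x') r \<xi>) =
      adjoint_op (rep_dom r) (rep_cod r) (snd (snd r) a x) (snd (snd r) a x' \<xi>)" for a
    unfolding theta_adj_vals(4)[OF theta_closed[OF \<xi>]] by (simp add: theta_fam_def r)
  thus ?thesis using repsD(2)[OF r \<xi>] by (simp only:)
qed

text \<open>The outer operator is pulled out of the sum by linearity, which leaves the isometry
  relation inside.\<close>

lemma teq_theta_at:
  assumes \<xi>: "\<xi> \<in> carrier (rep_dom r)" and as: "distinct as" "set as = UNIV"
  shows "theta_fam (tsum (map (\<lambda>a. Tern (Gen a'' x'') (Gen a x) (Gen a x')) as)) r \<xi> =
    theta_fam (if x = x' then Gen a'' x'' else TZero) r \<xi>"
proof -
  interpret H: hilbert_space "rep_dom r" by (rule reps_hilbert[OF r])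
  interpret K: hilbert_space "rep_cod r" by (rule reps_hilbert[OF r])
  have "theta_fam (tsum (map (\<lambda>a. Tern (Gen a'' x'') (Gen a x) (Gen a x')) as)) r \<xi> =
      (\<Oplus>\<^bsub>rep_cod r\<^esub>a\<in>UNIV. theta_fam (Gen a'' x'') r (theta_adj (Gen a x) r (theta_fam (Gen a x') r \<xi>)))"
    unfolding theta_tsum[OF \<xi> as(1)] as(2) by (simp only: theta_vals(4)[OF \<xi>])
  also have "\<dots> = theta_fam (Gen a'' x'') r (\<Oplus>\<^bsub>rep_dom r\<^esub>a\<in>UNIV. theta_adj (Gen a x) r (theta_fam (Gen a x') r \<xi>))"
    by (rule finsum_hom[where f = "theta_fam (Gen a'' x'') r", symmetric, OF H.M.abelian_monoid_axioms K.M.abelian_monoid_axioms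
      theta_closed theta_zero theta_lin(1) theta_adj_closed[OF theta_closed[OF \<xi>]]])
  also have "\<dots> = theta_fam (if x = x' then Gen a'' x'' else TZero) r \<xi>"
    unfolding theta_relation[OF \<xi>] by (simp add: theta_zero theta_vals[OF \<xi>])
  finally show ?thesis .
qed

end

lemma theta_eqI:
  fixes s t :: "('x, 'a::finite) tterm"
  assumes "\<And>(r :: ('h, 'x, 'a) rep) \<xi>. r \<in> reps \<Longrightarrow> \<xi> \<in> carrier (rep_dom r) \<Longrightarrow> theta_fam s r \<xi> = theta_fam t r \<xi>"
  shows "(theta_fam s :: ('h, 'x, 'a) rep \<Rightarrow> 'h \<Rightarrow> 'h) = theta_fam t"
  by (rule ops_eqI[OF theta_ops theta_ops]) (rule assms)

text \<open>Induction over the congruence. The vector space axioms hold in the normed module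
  \<open>RM\<close>; the ternary ones are checked at vectors, where the ternary product is S T*
  U.\<close>

lemma teq_theta:
  fixes s t :: "('x, 'a::finite) tterm"
  assumes st: "teq s t"
  shows "(theta_fam s :: ('h, 'x, 'a) rep \<Rightarrow> 'h \<Rightarrow> 'h) = theta_fam t"
proof -
  interpret M: normed_module "RM :: (('h, 'x, 'a) rep \<Rightarrow> 'h \<Rightarrow> 'h) normed_star_algebra" "fnorm reps rep_dom rep_cod"
    using ops_normed_module[OF hfam_dom hfam_cod] .
  show ?thesis using st
proof (induction rule: teq.induct)
  case tern_add1
  show ?case by (rule theta_eqI) (simp add: theta_vals theta_adj_vals theta_closed theta_adj_closed theta_lin theta_adj_lin)
next
  case tern_add2
  show ?case by (rule theta_eqI) (simp add: theta_vals theta_adj_vals theta_closed theta_adj_closed theta_lin theta_adj_lin)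
next
  case tern_add3
  show ?case by (rule theta_eqI) (simp add: theta_vals theta_adj_vals theta_closed theta_adj_closed theta_lin theta_adj_lin)
next
  case tern_scale1
  show ?case by (rule theta_eqI) (simp add: theta_vals theta_adj_vals theta_closed theta_adj_closed theta_lin theta_adj_lin)
next
  case tern_scale2
  show ?case by (rule theta_eqI) (simp add: theta_vals theta_adj_vals theta_closed theta_adj_closed theta_lin theta_adj_lin)
next
  case tern_scale3
  show ?case by (rule theta_eqI) (simp add: theta_vals theta_adj_vals theta_closed theta_adj_closed theta_lin theta_adj_lin)
next
  case tern_assoc1
  show ?case by (rule theta_eqI) (simp add: theta_vals theta_adj_vals theta_closed theta_adj_closed theta_lin theta_adj_lin)
next
  case tern_assoc2
  show ?case by (rule theta_eqI) (simp add: theta_vals theta_adj_vals theta_closed theta_adj_closed theta_lin theta_adj_lin)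
next
  case (add_assoc s t u)
  show ?case by (simp add: theta_fam_simps M.M.a_assoc theta_ops)
next
  case (add_comm s t)
  show ?case by (simp add: theta_fam_simps M.M.a_comm theta_ops)
next
  case (add_zero s)
  show ?case by (simp add: theta_fam_simps theta_ops)
next
  case (add_neg s)
  show ?case by (simp add: theta_fam_simps M.smult_neg M.M.r_neg theta_ops)
next
  case (scale_add c s t)
  show ?case by (simp add: theta_fam_simps M.smult_rdist theta_ops)
next
  case (add_scale c d s)
  show ?case by (simp add: theta_fam_simps M.smult_ldist theta_ops)
next
  case (scale_scale c d s)
  show ?case by (simp add: theta_fam_simps M.smult_smult theta_ops)
next
  case (scale_one s)
  show ?case by (simp add: theta_fam_simps theta_ops)
next
  case (relation as a'' x'' x x')
  show ?case by (rule theta_eqI) (rule teq_theta_at[OF _ _ relation])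
qed (simp_all add: theta_fam_simps theta_adj_def)
qed

section \<open>The algebra of the universal representation\<close>

definition theta_prod :: "('x, 'a::finite) tterm \<Rightarrow> ('x, 'a) tterm \<Rightarrow> ('h, 'x, 'a) rep \<Rightarrow> 'h \<Rightarrow> 'h" where
  "theta_prod s t = opcomp reps rep_dom (theta_adj s) (theta_fam t)"

lemma theta_prod_ops: "theta_prod s t \<in> carrier RD"
  unfolding theta_prod_def by (rule opcomp_closed[OF hfam_dom hfam_cod hfam_dom theta_adj_ops theta_ops])

lemma theta_prod_val:
  "r \<in> reps \<Longrightarrow> \<xi> \<in> carrier (rep_dom r) \<Longrightarrow> theta_prod s t r \<xi> = theta_adj s r (theta_fam t r \<xi>)"
  unfolding theta_prod_def by (rule op_families_vals)

text \<open>The identity (S* T) (U* V) = S* (T U* V): the ternary product absorbs the second factor,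
  so the elements S* T are closed under multiplication before any span is taken.\<close>

lemma theta_prod_mult:
  fixes s t u v :: "('x, 'a::finite) tterm"
  shows "opcomp reps rep_dom (theta_prod s t) (theta_prod u v) = (theta_prod s (Tern t u v) :: ('h, 'x, 'a) rep \<Rightarrow> 'h \<Rightarrow> 'h)"
proof (rule ops_eqI[OF opcomp_closed[OF hfam_dom hfam_dom hfam_dom theta_prod_ops theta_prod_ops] theta_prod_ops])
  fix r :: "('h, 'x, 'a) rep" and \<xi> assume r: "r \<in> reps" "\<xi> \<in> carrier (rep_dom r)"
  show "opcomp reps rep_dom (theta_prod s t) (theta_prod u v) r \<xi> = theta_prod s (Tern t u v) r \<xi>"
    unfolding op_families_vals(5)[of r reps \<xi> rep_dom, OF r]
    using r by (simp add: theta_prod_val theta_vals theta_closed theta_adj_closed)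
qed

lemma theta_prod_adj: "fadj reps rep_dom rep_dom (theta_prod s t) = theta_prod t s"
  unfolding theta_prod_def fadj_opcomp[OF hfam_dom hfam_cod hfam_dom theta_adj_ops theta_ops]
  unfolding theta_adj_def fadj_fadj[OF hfam_dom hfam_cod theta_ops] ..

lemma theta_sum_eq: "theta_sum u = theta_fam (rep_ternary_V0 u)"
  unfolding theta_sum_def theta_def theta_fam_def ..

lemma theta_sum_abs: "theta_sum (abs_ternary_V0 t) = theta_fam t"
  unfolding theta_sum_eq by (rule teq_theta) (rule Quotient3_rep_abs[OF Quotient3_ternary_V0 teq_refl])

text \<open>Passing from terms to classes loses nothing, because a term and the chosen
  representative of its class act equally.\<close>

lemma range_theta_sum: "range theta_sum = range theta_fam"
proof
  show "range theta_sum \<subseteq> range theta_fam" by (auto simp: theta_sum_eq)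
  show "range theta_fam \<subseteq> range theta_sum" using theta_sum_abs by (metis image_subsetI rangeI)
qed

lemma e_elem_eq: "e_elem x x' a a' = theta_prod (Gen a x) (Gen a' x')"
proof -
  have "tro_product S T = opcomp reps rep_dom (fadj reps rep_dom rep_cod S) T" for S T
    by (simp add: tro_product_def opcomp_def fadj_def cong: restrict_cong)
  thus ?thesis unfolding e_elem_def gen_v.abs_eq theta_sum_abs by (simp only: theta_prod_def theta_adj_def)
qed

text \<open>The parameter only fixes the type variables.\<close>

context
  fixes universe :: "('h \<times> 'x \<times> 'a::finite) itself"
begin

abbreviation "P0 \<equiv> range (\<lambda>(s :: ('x, 'a) tterm, t). theta_prod s t :: ('h, 'x, 'a) rep \<Rightarrow> 'h \<Rightarrow> 'h)"

interpretation RD: cstar_algebra "RD :: (('h, 'x, 'a) rep \<Rightarrow> 'h \<Rightarrow> 'h) normed_star_algebra"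
  by (rule ops_cstar[OF hfam_dom])

interpretation RM: normed_module "RM :: (('h, 'x, 'a) rep \<Rightarrow> 'h \<Rightarrow> 'h) normed_star_algebra" "fnorm reps rep_dom rep_cod"
  by (rule ops_normed_module[OF hfam_dom hfam_cod])

lemma P0_carrier: "P0 \<subseteq> carrier RD"
  using theta_prod_ops by auto

lemma P0I: "theta_prod s t \<in> P0"
  by (rule range_eqI[of _ _ "(s, t)"]) simp

lemma P0E: assumes "p \<in> P0" obtains s t where "p = theta_prod s t"
proof -
  obtain st where "p = (case st of (s, t) \<Rightarrow> theta_prod s t)" using assms by (elim rangeE)
  thus ?thesis using that by (cases st) simp
qed

text \<open>The isometry relation written in the algebra. For x = x' it places the unit in the span
  of the products, and it is also the stochasticity condition for the elements
  \<open>e_elem x x' a a\<close>.\<close>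

lemma P0_sum: "(\<Oplus>\<^bsub>RD\<^esub>a\<in>UNIV. theta_prod (Gen a x) (Gen a x')) = (if x = x' then \<one>\<^bsub>RD\<^esub> else \<zero>\<^bsub>RD\<^esub> :: ('h, 'x, 'a) rep \<Rightarrow> 'h \<Rightarrow> 'h)"
  (is "?l = ?r")
proof (rule ops_eqI[of _ reps rep_dom rep_dom])
  show "?l \<in> carrier RD" by (rule RD.M.finsum_closed) (use theta_prod_ops in auto)
  show "?r \<in> carrier RD" by simp
  fix r :: "('h, 'x, 'a) rep" and \<xi> assume r: "r \<in> reps" "\<xi> \<in> carrier (rep_dom r)"
  have "?l r \<xi> = (\<Oplus>\<^bsub>rep_dom r\<^esub>a\<in>UNIV. theta_prod (Gen a x) (Gen a x') r \<xi>)"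
    by (rule op_families_finsum[OF hfam_dom hfam_dom theta_prod_ops r])
  also have "\<dots> = (if x = x' then \<xi> else \<zero>\<^bsub>rep_dom r\<^esub>)"
    by (simp only: theta_prod_val[OF r] theta_relation[OF r])
  also have "\<dots> = ?r r \<xi>" by (simp add: op_families_vals[of r reps \<xi> rep_dom, OF r])
  finally show "?l r \<xi> = ?r r \<xi>" .
qed

lemma P0_cstar: "cstar_algebra (RD\<lparr>carrier := norm_closure RD (lin_span RD P0)\<rparr>)"
proof (rule RD.span_closure_cstar[OF P0_carrier])
  show "a \<otimes>\<^bsub>RD\<^esub> b \<in> P0" if ab: "a \<in> P0" "b \<in> P0" for a b
  proof -
    obtain s t u v where "a = theta_prod s t" "b = theta_prod u v" using ab by (elim P0E)
    thus ?thesis unfolding op_families_mult by (simp only: theta_prod_mult P0I)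
  qed
  show "invol RD a \<in> P0" if a: "a \<in> P0" for a
  proof -
    obtain s t where "a = theta_prod s t" using a by (elim P0E)
    thus ?thesis unfolding op_families_invol by (simp only: theta_prod_adj P0I)
  qed
  have span: "(\<Oplus>\<^bsub>RD\<^esub>a\<in>UNIV. theta_prod (Gen a x) (Gen a x)) \<in> lin_span RD P0" for x
    by (rule RD.B.lin_span_finsum[OF P0_carrier]) (rule subsetD[OF RD.B.lin_span_superset[OF P0_carrier] P0I])
  \<comment> \<open>Any x will do; \<open>undefined\<close> supplies one because types are
    nonempty.\<close>
  show "\<one>\<^bsub>RD\<^esub> \<in> lin_span RD P0" using span[of undefined] unfolding P0_sum by simp
qed

text \<open>The definition multiplies limits, then takes the span and closes again. By
  \<open>tends_adjoint_mult\<close> a product of limits is a limit of products of terms, so one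
  closure after forming the products of terms suffices.\<close>

lemma C_alg_eq: "(C_alg :: (('h, 'x, 'a) rep \<Rightarrow> 'h \<Rightarrow> 'h) normed_star_algebra) = RD\<lparr>carrier := norm_closure RD (lin_span RD P0)\<rparr>"
proof -
  let ?V = "V_tro :: (('h, 'x, 'a) rep \<Rightarrow> 'h \<Rightarrow> 'h) set"
  let ?P = "{tro_product S T | S T. S \<in> ?V \<and> T \<in> ?V}"
  let ?Q = "lin_span RD P0"
  interpret Q: cstar_algebra "RD\<lparr>carrier := norm_closure RD ?Q\<rparr>" by (rule P0_cstar)
  have Vn: "?V = RM.ncl (range theta_fam)"
    unfolding V_tro_def norm_closure_def RM.ncl_def range_theta_sum ..
  have tp: "tro_product S T = opcomp reps rep_dom (fadj reps rep_dom rep_cod S) T" for S T :: "('h, 'x, 'a) rep \<Rightarrow> 'h \<Rightarrow> 'h"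
    by (simp add: tro_product_def opcomp_def fadj_def cong: restrict_cong)
  have rt: "range theta_fam \<subseteq> carrier RM" using theta_ops by auto
  have Qc: "?Q \<subseteq> carrier RD" by (rule RD.B.lin_span_carrier[OF P0_carrier])
  have lim: "\<exists>s. RM.tends (\<lambda>n. theta_fam (s n)) S" if S: "S \<in> ?V" for S
  proof -
    obtain u where u: "\<forall>n. u n \<in> range theta_fam" "RM.tends u S"
      using S[unfolded Vn, THEN RM.ncl_iff[OF rt, THEN iffD1]] by (elim exE conjE)
    have "\<forall>n. \<exists>t. u n = theta_fam t"
    proof
      fix n show "\<exists>t. u n = theta_fam t" using u(1)[THEN spec, of n] by (elim rangeE) (rule exI)
    qed
    then obtain s where s: "\<forall>n. u n = theta_fam (s n)" by (rule choice[THEN exE])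
    have "u = (\<lambda>n. theta_fam (s n))" by (rule ext) (rule s[THEN spec])
    with u(2) have "RM.tends (\<lambda>n. theta_fam (s n)) S" by (simp only:)
    thus ?thesis by (rule exI[of _ s])
  qed
  have PQ: "?P \<subseteq> RD.B.ncl ?Q"
  proof
    fix p assume "p \<in> ?P"
    then obtain S T where p: "p = tro_product S T" "S \<in> ?V" "T \<in> ?V" by (elim CollectE exE conjE)
    obtain s where s: "RM.tends (\<lambda>n. theta_fam (s n)) S" using lim[OF p(2)] by (elim exE)
    obtain t where t: "RM.tends (\<lambda>n. theta_fam (t n)) T" using lim[OF p(3)] by (elim exE)
    have t: "RD.B.tends (\<lambda>n. theta_prod (s n) (t n)) p"
      unfolding p(1) tp theta_prod_def theta_adj_def by (rule tends_adjoint_mult[OF hfam_dom hfam_cod s t])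
    show "p \<in> RD.B.ncl ?Q"
      by (rule RD.B.ncl_iff[OF Qc, THEN iffD2])
        (rule exI, rule conjI[OF allI t], rule subsetD[OF RD.B.lin_span_superset[OF P0_carrier] P0I])
  qed
  have PC: "?P \<subseteq> carrier RD" by (rule subset_trans[OF PQ RD.B.ncl_carrier])
  have "lin_span RD ?P \<subseteq> RD.B.ncl ?Q"
  proof (rule RD.B.lin_span_minimal[OF PQ RD.B.ncl_carrier])
    show "\<zero>\<^bsub>RD\<^esub> \<in> RD.B.ncl ?Q" using Q.M.zero_closed by (simp add: RD.norm_closure_eq)
    show "a \<oplus>\<^bsub>RD\<^esub> b \<in> RD.B.ncl ?Q" if "a \<in> RD.B.ncl ?Q" "b \<in> RD.B.ncl ?Q" for a b
      using Q.M.a_closed[of a b] that by (simp add: RD.norm_closure_eq)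
    show "c \<odot>\<^bsub>RD\<^esub> a \<in> RD.B.ncl ?Q" if "a \<in> RD.B.ncl ?Q" for c a
      using Q.B.smult_closed'[of a c] that by (simp add: RD.norm_closure_eq)
  qed
  hence le: "RD.B.ncl (lin_span RD ?P) \<subseteq> RD.B.ncl ?Q"
  proof (intro subsetI)
    fix a assume sub: "lin_span RD ?P \<subseteq> RD.B.ncl ?Q" and a: "a \<in> RD.B.ncl (lin_span RD ?P)"
    obtain u where u: "\<forall>n. u n \<in> lin_span RD ?P" "RD.B.tends u a"
      using a[THEN RD.B.ncl_iff[OF RD.B.lin_span_carrier[OF PC], THEN iffD1]] by (elim exE conjE)
    show "a \<in> RD.B.ncl ?Q" by (rule RD.B.ncl_closed[OF Qc subsetD[OF sub u(1)[THEN spec]] u(2)])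
  qed
  have "P0 \<subseteq> ?P"
  proof
    fix p assume "p \<in> P0"
    then obtain s t where p: "p = theta_prod s t" by (elim P0E)
    have "theta_fam s \<in> ?V" for s unfolding Vn by (rule subsetD[OF RM.ncl_superset[OF rt] rangeI])
    moreover have "p = tro_product (theta_fam s) (theta_fam t)" unfolding p tp theta_prod_def theta_adj_def ..
    ultimately show "p \<in> ?P" by (intro CollectI exI conjI)
  qed
  hence "?Q \<subseteq> lin_span RD ?P"
    by (rule RD.B.lin_span_minimal[OF subset_trans[OF _ RD.B.lin_span_superset[OF PC]] RD.B.lin_span_carrier[OF PC]
      RD.B.lin_span_zero RD.B.lin_span_add[OF PC] RD.B.lin_span_smult[OF PC]])
  hence "RD.B.ncl ?Q \<subseteq> RD.B.ncl (lin_span RD ?P)" unfolding RD.B.ncl_def by blast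
  with le have "RD.B.ncl (lin_span RD ?P) = RD.B.ncl ?Q" by (rule subset_antisym)
  thus ?thesis unfolding C_alg_def Let_def RD.norm_closure_eq by (simp only:)
qed

lemma C_alg_cstar: "cstar_algebra (C_alg :: (('h, 'x, 'a) rep \<Rightarrow> 'h \<Rightarrow> 'h) normed_star_algebra)"
  unfolding C_alg_eq by (rule P0_cstar)

interpretation C: cstar_algebra "C_alg :: (('h, 'x, 'a) rep \<Rightarrow> 'h \<Rightarrow> 'h) normed_star_algebra"
  by (rule C_alg_cstar)

lemma C_alg_sub: "carrier (C_alg :: (('h, 'x, 'a) rep \<Rightarrow> 'h \<Rightarrow> 'h) normed_star_algebra) \<subseteq> carrier RD"
  unfolding C_alg_eq RD.norm_closure_eq using RD.B.ncl_carrier by simp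

lemma theta_prod_C: "theta_prod s t \<in> carrier (C_alg :: (('h, 'x, 'a) rep \<Rightarrow> 'h \<Rightarrow> 'h) normed_star_algebra)"
proof -
  have "theta_prod s t \<in> RD.B.ncl (lin_span RD P0)"
    by (rule subsetD[OF RD.B.ncl_superset[OF RD.B.lin_span_carrier[OF P0_carrier]]])
      (rule subsetD[OF RD.B.lin_span_superset[OF P0_carrier] P0I])
  thus ?thesis unfolding C_alg_eq RD.norm_closure_eq by simp
qed

lemma e_elem_C: "e_elem x x' a a' \<in> carrier (C_alg :: (('h, 'x, 'a) rep \<Rightarrow> 'h \<Rightarrow> 'h) normed_star_algebra)"
  unfolding e_elem_eq by (rule theta_prod_C)

lemma e_elem_sum: "(\<Oplus>\<^bsub>C_alg\<^esub>a\<in>UNIV. e_elem x x' a a) =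
    (if x = x' then \<one>\<^bsub>C_alg\<^esub> else \<zero>\<^bsub>C_alg\<^esub> :: ('h, 'x, 'a) rep \<Rightarrow> 'h \<Rightarrow> 'h)"
proof -
  have "(\<Oplus>\<^bsub>C_alg\<^esub>a\<in>UNIV. e_elem x x' a a) = (\<Oplus>\<^bsub>RD\<^esub>a\<in>UNIV. e_elem x x' a a :: ('h, 'x, 'a) rep \<Rightarrow> 'h \<Rightarrow> 'h)"
    by (rule finsum_hom[where f = "\<lambda>x. x", OF C.M.abelian_monoid_axioms RD.M.abelian_monoid_axioms subsetD[OF C_alg_sub] _ _ e_elem_C])
      (simp_all add: C_alg_eq)
  thus ?thesis unfolding e_elem_eq P0_sum by (simp add: C_alg_eq)
qed

end

text \<open>The generators map the domain of a representation to its codomain, so the factorisation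
  e = v* v does not take place in \<open>C_alg\<close>. With a single Gram factor per column,
  \<open>gram_positive\<close> yields a root with entries in \<open>C_alg\<close>.\<close>

lemma e_elem_gram:
  "\<exists>s :: 'x::finite \<times> 'a::finite \<Rightarrow> 'x \<times> 'a \<Rightarrow> ('h, 'x, 'a) rep \<Rightarrow> 'h \<Rightarrow> 'h.
    (\<forall>k m. s k m \<in> carrier C_alg) \<and> (\<forall>m n. e_elem (fst m) (fst n) (snd m) (snd n) =
      (\<Oplus>\<^bsub>C_alg\<^esub>k\<in>UNIV. invol C_alg (s k m) \<otimes>\<^bsub>C_alg\<^esub> s k n))"
proof -
  let ?C = "C_alg :: (('h, 'x, 'a) rep \<Rightarrow> 'h \<Rightarrow> 'h) normed_star_algebra"
  let ?F = "\<lambda>m n. e_elem (fst m) (fst n) (snd m) (snd n) :: ('h, 'x, 'a) rep \<Rightarrow> 'h \<Rightarrow> 'h"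
  have "positive_elem (mat_alg ?C) ?F"
  proof (rule gram_positive[where N = "{()}" and G = "\<lambda>_ m. theta_fam (Gen (snd m) (fst m))", OF hfam_dom hfam_cod _ C_alg_sub C_alg_cstar])
    show "?C = RD\<lparr>carrier := carrier ?C\<rparr>" by (simp add: C_alg_eq)
    show "?F m n \<in> carrier ?C" for m n by (rule e_elem_C)
    show "theta_fam (Gen (snd m) (fst m)) \<in> ops reps rep_dom rep_cod" for m :: "'x \<times> 'a" by (rule theta_ops)
    show "invol ?C (?F m n) = ?F n m" for m n
      unfolding e_elem_eq by (simp add: C_alg_eq op_families_invol theta_prod_adj)
    fix r :: "('h, 'x, 'a) rep" and m n \<xi> assume r: "r \<in> reps" "\<xi> \<in> carrier (rep_dom r)"
    interpret H: hilbert_space "rep_dom r" by (rule reps_hilbert[OF r(1)])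
    show "?F m n r \<xi> = (\<Oplus>\<^bsub>rep_dom r\<^esub>_\<in>{()}. fadj reps rep_dom rep_cod (theta_fam (Gen (snd m) (fst m))) r
        (theta_fam (Gen (snd n) (fst n)) r \<xi>))"
      unfolding e_elem_eq theta_prod_val[OF r] theta_adj_def[symmetric]
      using theta_adj_closed[OF r(1) theta_closed[OF r]] by (simp add: H.M.finsum_insert)
  qed simp
  then obtain b where b: "b \<in> carrier (mat_alg ?C)" "?F = invol (mat_alg ?C) b \<otimes>\<^bsub>mat_alg ?C\<^esub> b"
    unfolding positive_elem_def by blast
  have bF: "?F m n = (\<Oplus>\<^bsub>?C\<^esub>k\<in>UNIV. invol ?C (b k m) \<otimes>\<^bsub>?C\<^esub> b k n)" for m n
    using fun_cong[OF fun_cong[OF b(2)], of m n] by simp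
  have bc: "b k m \<in> carrier ?C" for k m using b(1)[unfolded mat_alg_simps mem_Collect_eq, rule_format] .
  show ?thesis by (rule exI[of _ b]) (rule conjI, intro allI bc, intro allI bF)
qed

section \<open>Reciprocal states under tracial correlations\<close>

text \<open>C is any algebra with elements satisfying the relations of the e_(x,x',a,b). In part (i)
  it is \<open>C_alg\<close>; in parts (ii) and (iii) it is the target of the homomorphism, so that
  finite dimension or commutativity is available in both legs.\<close>

lemma reciprocal_image:
  fixes A :: "'u normed_star_algebra" and E :: "'x::finite \<Rightarrow> 'x \<Rightarrow> 'u"
    and C :: "'c normed_star_algebra" and e :: "'x \<Rightarrow> 'x \<Rightarrow> 'a::finite \<Rightarrow> 'a \<Rightarrow> 'c"
    and s :: "'x \<times> 'a \<Rightarrow> 'x \<times> 'a \<Rightarrow> 'c"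
  assumes A: "cstar_algebra A" "tracial_state A \<tau>" and E: "stochastic_matrix A E"
    and C: "cstar_algebra C" "tracial_state C \<sigma>"
    and s: "\<And>k m. s k m \<in> carrier C"
    and es: "\<And>m n. e (fst m) (fst n) (snd m) (snd n) = (\<Oplus>\<^bsub>C\<^esub>k\<in>UNIV. invol C (s k m) \<otimes>\<^bsub>C\<^esub> s k n)"
    and e1: "\<And>x x'. (\<Oplus>\<^bsub>C\<^esub>a\<in>UNIV. e x x' a a) = (if x = x' then \<one>\<^bsub>C\<^esub> else \<zero>\<^bsub>C\<^esub>)"
    and G: "\<And>p q. G $ p $ q = (\<Sum>x\<in>UNIV. \<Sum>x'\<in>UNIV. \<Sum>y\<in>UNIV. \<Sum>y'\<in>UNIV.
      reciprocal_state A \<tau> E $ (x, y) $ (x', y') * \<sigma> (e x x' (fst p) (fst q) \<otimes>\<^bsub>C\<^esub> e y' y (snd q) (snd p)))"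
  shows image_Upsilon: "G \<in> Upsilon TYPE('u)"
    and image_Upsilon_q: "finite_dim_alg A \<Longrightarrow> finite_dim_alg C \<Longrightarrow> G \<in> Upsilon_q TYPE('u)"
    and image_Upsilon_loc: "abelian_alg A \<Longrightarrow> abelian_alg C \<Longrightarrow> G \<in> Upsilon_loc TYPE('u)"
proof -
  interpret T: two_traces A \<tau> C \<sigma>
    by (intro two_traces.intro ctrace.intro ctrace_axioms.intro A C)
  obtain f :: "real \<Rightarrow> 'u" where f: "inj f" using inj_real_of_trace[OF A] by (elim exE)
  obtain h where h0: "h \<in> carrier (mat_alg A)" "E = invol (mat_alg A) h \<otimes>\<^bsub>mat_alg A\<^esub> h"
    using E unfolding stochastic_matrix_def positive_elem_def by blast
  have E1: "(\<Oplus>\<^bsub>A\<^esub>x\<in>UNIV. E x x) = \<one>\<^bsub>A\<^esub>" using E unfolding stochastic_matrix_def by (elim conjE)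
  have h: "h w x \<in> carrier A" for w x using h0(1) by simp
  have tg: "T.tg h x x' = E x x'" for x x' unfolding T.tg_def[OF h s] h0(2) by simp
  have te: "T.te s (x, a) (x', b) = e x x' a b" for x x' a b
    unfolding T.te_def[OF h s] es[of "(x, a)" "(x', b)", symmetric] by simp
  have st: "stochastic_matrix T.TT (T.tF TYPE('x) h s)"
    by (rule T.tF_stochastic[OF h s]) (simp_all only: tg te E1 e1)
  have GF: "G = reciprocal_state T.TT T.\<phi> (T.tF TYPE('x) h s)"
  proof (intro vec_eq_iff[THEN iffD2] allI)
    fix p q
    let ?t = "\<lambda>x x' y y'. \<tau> (E x x' \<otimes>\<^bsub>A\<^esub> E y y') * \<sigma> (e x x' (fst p) (fst q) \<otimes>\<^bsub>C\<^esub> e y y' (snd q) (snd p))"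
    have "G $ p $ q = (\<Sum>x\<in>UNIV. \<Sum>x'\<in>UNIV. \<Sum>y\<in>UNIV. \<Sum>y'\<in>UNIV. ?t x x' y' y)"
      unfolding G reciprocal_state_def by simp
    \<comment> \<open>The second factors in \<omega> and in \<Gamma> both carry reversed indices;
      exchanging y and y' brings them into the order of \<open>tF_trace\<close>.\<close>
    also have "\<dots> = (\<Sum>x\<in>UNIV. \<Sum>x'\<in>UNIV. \<Sum>y\<in>UNIV. \<Sum>y'\<in>UNIV. ?t x x' y y')"
      by (intro sum.cong refl sum.swap)
    also have "\<dots> = T.\<phi> (T.tF TYPE('x) h s (fst p) (fst q) \<otimes>\<^bsub>T.DD\<^esub> T.tF TYPE('x) h s (snd q) (snd p))"
      unfolding T.tF_trace[OF h s] tg te ..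
    also have "\<dots> = reciprocal_state T.TT T.\<phi> (T.tF TYPE('x) h s) $ p $ q"
      unfolding reciprocal_state_def by simp
    finally show "G $ p $ q = reciprocal_state T.TT T.\<phi> (T.tF TYPE('x) h s) $ p $ q" .
  qed
  note rc = T.TT_cstar T.TT_trace st f
  show "G \<in> Upsilon TYPE('u)" unfolding GF by (rule reciprocal_in_Upsilon[OF rc])
  show "G \<in> Upsilon_q TYPE('u)" if "finite_dim_alg A" "finite_dim_alg C"
    unfolding GF by (rule reciprocal_in_Upsilon_q[OF rc T.TT_finite_dim[OF that]])
  show "G \<in> Upsilon_loc TYPE('u)" if "abelian_alg A" "abelian_alg C"
    unfolding GF by (rule reciprocal_in_Upsilon_loc[OF rc T.TT_abelian[OF that]])
qed

lemma abelian_trace: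
  assumes "abelian_alg B" "alg_state B \<tau>"
  shows "tracial_state B \<tau>"
  using assms unfolding abelian_alg_def tracial_state_def by simp

text \<open>A unital star homomorphism carries the root, the sum relation and the products of
  \<open>C_alg\<close> into B, which provides what \<open>reciprocal_image\<close> asks of its
  second algebra.\<close>

lemma e_elem_hom_gram:
  fixes \<pi> :: "(('h, 'x::finite, 'a::finite) rep \<Rightarrow> 'h \<Rightarrow> 'h) \<Rightarrow> 'b" and B :: "'b normed_star_algebra"
  assumes B: "cstar_algebra B" and \<pi>: "star_hom C_alg B \<pi>"
  shows hom_gram: "\<exists>s. (\<forall>k m. s k m \<in> carrier B) \<and> (\<forall>m n. \<pi> (e_elem (fst m) (fst n) (snd m) (snd n)) =
      (\<Oplus>\<^bsub>B\<^esub>k\<in>UNIV. invol B (s k m) \<otimes>\<^bsub>B\<^esub> s (k :: 'x \<times> 'a) n))"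
    and hom_sum: "(\<Oplus>\<^bsub>B\<^esub>a\<in>UNIV. \<pi> (e_elem x x' a a)) = (if x = x' then \<one>\<^bsub>B\<^esub> else \<zero>\<^bsub>B\<^esub>)"
    and hom_mult: "\<pi> (e_elem x x' a a' \<otimes>\<^bsub>C_alg\<^esub> e_elem y y' b b') = \<pi> (e_elem x x' a a') \<otimes>\<^bsub>B\<^esub> \<pi> (e_elem y y' b b')"
proof -
  let ?C = "C_alg :: (('h, 'x, 'a) rep \<Rightarrow> 'h \<Rightarrow> 'h) normed_star_algebra"
  interpret C: cstar_algebra ?C by (rule C_alg_cstar)
  interpret B: cstar_algebra B by (rule B)
  have hom: "\<pi> \<in> ring_hom ?C B" and sm: "\<And>c a. a \<in> carrier ?C \<Longrightarrow> \<pi> (c \<odot>\<^bsub>?C\<^esub> a) = c \<odot>\<^bsub>B\<^esub> \<pi> a"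
    and inv: "\<And>a. a \<in> carrier ?C \<Longrightarrow> \<pi> (invol ?C a) = invol B (\<pi> a)"
    using \<pi> unfolding star_hom_def by simp_all
  have cl: "\<pi> a \<in> carrier B" if "a \<in> carrier ?C" for a by (rule ring_hom_closed[OF hom that])
  have zero: "\<pi> \<zero>\<^bsub>?C\<^esub> = \<zero>\<^bsub>B\<^esub>"
    using sm[OF C.M.zero_closed, of 0] C.B.smult_0[OF C.M.zero_closed] B.B.smult_0[OF cl[OF C.M.zero_closed]] by simp
  have fs: "\<pi> (\<Oplus>\<^bsub>?C\<^esub>i\<in>I. f i) = (\<Oplus>\<^bsub>B\<^esub>i\<in>I. \<pi> (f i))" if "\<And>i. i \<in> I \<Longrightarrow> f i \<in> carrier ?C" for f :: "'j \<Rightarrow> _" and I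
    by (rule finsum_hom[OF C.M.abelian_monoid_axioms B.M.abelian_monoid_axioms cl zero ring_hom_add[OF hom] that])
  obtain s :: "'x \<times> 'a \<Rightarrow> 'x \<times> 'a \<Rightarrow> ('h, 'x, 'a) rep \<Rightarrow> 'h \<Rightarrow> 'h" where
    s: "\<forall>k m. s k m \<in> carrier ?C" and es: "\<forall>m n. e_elem (fst m) (fst n) (snd m) (snd n) =
      (\<Oplus>\<^bsub>?C\<^esub>k\<in>UNIV. invol ?C (s k m) \<otimes>\<^bsub>?C\<^esub> s k n)"
    using e_elem_gram by (elim exE conjE)
  note s = s[rule_format]
  show "\<exists>s. (\<forall>k m. s k m \<in> carrier B) \<and> (\<forall>m n. \<pi> (e_elem (fst m) (fst n) (snd m) (snd n)) =
      (\<Oplus>\<^bsub>B\<^esub>k\<in>UNIV. invol B (s k m) \<otimes>\<^bsub>B\<^esub> s (k :: 'x \<times> 'a) n))"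
  proof (intro exI[of _ "\<lambda>k m. \<pi> (s k m)"] conjI allI)
    show "\<pi> (s k m) \<in> carrier B" for k m by (rule cl[OF s])
    fix m n :: "'x \<times> 'a"
    have "\<pi> (e_elem (fst m) (fst n) (snd m) (snd n)) = (\<Oplus>\<^bsub>B\<^esub>k\<in>UNIV. \<pi> (invol ?C (s k m) \<otimes>\<^bsub>?C\<^esub> s k n))"
      unfolding es[rule_format] by (rule fs[OF C.m_closed[OF C.invol_closed[OF s] s]])
    thus "\<pi> (e_elem (fst m) (fst n) (snd m) (snd n)) = (\<Oplus>\<^bsub>B\<^esub>k\<in>UNIV. invol B (\<pi> (s k m)) \<otimes>\<^bsub>B\<^esub> \<pi> (s k n))"
      by (simp only: ring_hom_mult[OF hom C.invol_closed[OF s] s] inv[OF s])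
  qed
  show "(\<Oplus>\<^bsub>B\<^esub>a\<in>UNIV. \<pi> (e_elem x x' a a)) = (if x = x' then \<one>\<^bsub>B\<^esub> else \<zero>\<^bsub>B\<^esub>)"
    unfolding fs[OF e_elem_C, symmetric] e_elem_sum by (simp add: zero ring_hom_one[OF hom])
  show "\<pi> (e_elem x x' a a' \<otimes>\<^bsub>?C\<^esub> e_elem y y' b b') = \<pi> (e_elem x x' a a') \<otimes>\<^bsub>B\<^esub> \<pi> (e_elem y y' b b')"
    by (rule ring_hom_mult[OF hom e_elem_C e_elem_C])
qed

theorem theorem9p12:
  fixes \<Gamma> :: "complex^('x::finite \<times> 'x)^('x \<times> 'x) \<Rightarrow> complex^('a::finite \<times> 'a)^('a \<times> 'a)"
  assumes "QNS \<Gamma>"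
  shows "(tracial_corr TYPE('h) \<Gamma> \<longrightarrow> \<Gamma> ` Upsilon TYPE('u) \<subseteq> Upsilon TYPE('u)) \<and>
    (quantum_tracial_corr TYPE('h) TYPE('b) \<Gamma> \<longrightarrow> \<Gamma> ` Upsilon_q TYPE('u) \<subseteq> Upsilon_q TYPE('u)) \<and>
    (locally_tracial_corr TYPE('h) TYPE('b) \<Gamma> \<longrightarrow> \<Gamma> ` Upsilon_loc TYPE('u) \<subseteq> Upsilon_loc TYPE('u))"
proof (intro conjI impI image_subsetI)
  fix M :: "complex^('x \<times> 'x)^('x \<times> 'x)"
  assume "tracial_corr TYPE('h) \<Gamma>" and "M \<in> Upsilon TYPE('u)"
  then obtain \<sigma> :: "(('h, 'x, 'a) rep \<Rightarrow> 'h \<Rightarrow> 'h) \<Rightarrow> complex" and A :: "'u normed_star_algebra" and \<tau> E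
    where \<sigma>: "tracial_state C_alg \<sigma>" "\<Gamma> = Gamma_of \<sigma>"
      and A: "cstar_algebra A" "tracial_state A \<tau>" "stochastic_matrix A E" and M: "M = reciprocal_state A \<tau> E"
    unfolding tracial_corr_def Upsilon_def by (elim exE conjE CollectE)
  obtain s :: "'x \<times> 'a \<Rightarrow> 'x \<times> 'a \<Rightarrow> ('h, 'x, 'a) rep \<Rightarrow> 'h \<Rightarrow> 'h" where
    s: "\<forall>k m. s k m \<in> carrier C_alg" and es: "\<forall>m n. e_elem (fst m) (fst n) (snd m) (snd n) =
      (\<Oplus>\<^bsub>C_alg\<^esub>k\<in>UNIV. invol C_alg (s k m) \<otimes>\<^bsub>C_alg\<^esub> s k n)"
    using e_elem_gram by (elim exE conjE)
  show "\<Gamma> M \<in> Upsilon TYPE('u)"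
    by (rule image_Upsilon[OF A C_alg_cstar \<sigma>(1) s[rule_format] es[rule_format] e_elem_sum])
      (simp add: M \<sigma>(2) Gamma_of_def)
next
  fix M :: "complex^('x \<times> 'x)^('x \<times> 'x)"
  assume "quantum_tracial_corr TYPE('h) TYPE('b) \<Gamma>" and "M \<in> Upsilon_q TYPE('u)"
  then obtain B :: "'b normed_star_algebra" and \<sigma> and \<pi> :: "(('h, 'x, 'a) rep \<Rightarrow> 'h \<Rightarrow> 'h) \<Rightarrow> 'b"
    and A :: "'u normed_star_algebra" and \<tau> E
    where B: "cstar_algebra B" "finite_dim_alg B" "tracial_state B \<sigma>" "star_hom C_alg B \<pi>" "\<Gamma> = Gamma_of (\<sigma> \<circ> \<pi>)"
      and A: "cstar_algebra A" "tracial_state A \<tau>" "stochastic_matrix A E" "finite_dim_alg A" and M: "M = reciprocal_state A \<tau> E"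
    unfolding quantum_tracial_corr_def Upsilon_q_def by (elim exE conjE CollectE)
  note \<pi> = B(1,4)
  obtain s where s: "\<forall>k m. s k m \<in> carrier B" and es: "\<forall>m n. \<pi> (e_elem (fst m) (fst n) (snd m) (snd n)) =
      (\<Oplus>\<^bsub>B\<^esub>k\<in>UNIV. invol B (s k m) \<otimes>\<^bsub>B\<^esub> s (k :: 'x \<times> 'a) n)"
    using hom_gram[OF \<pi>] by (elim exE conjE)
  \<comment> \<open>The second leg is B instead of \<open>C_alg\<close>: its finite dimension
    together with that of A passes to the tensor algebra.\<close>
  show "\<Gamma> M \<in> Upsilon_q TYPE('u)"
    by (rule image_Upsilon_q[where e = "\<lambda>x x' a a'. \<pi> (e_elem x x' a a')",
        OF A(1-3) B(1,3) s[rule_format] es[rule_format] hom_sum[OF \<pi>] _ A(4) B(2)])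
      (simp add: M B(5) Gamma_of_def hom_mult[OF \<pi>])
next
  fix M :: "complex^('x \<times> 'x)^('x \<times> 'x)"
  assume "locally_tracial_corr TYPE('h) TYPE('b) \<Gamma>" and "M \<in> Upsilon_loc TYPE('u)"
  then obtain B :: "'b normed_star_algebra" and \<sigma> and \<pi> :: "(('h, 'x, 'a) rep \<Rightarrow> 'h \<Rightarrow> 'h) \<Rightarrow> 'b"
    and A :: "'u normed_star_algebra" and \<tau> E
    where B: "cstar_algebra B" "abelian_alg B" "alg_state B \<sigma>" "star_hom C_alg B \<pi>" "\<Gamma> = Gamma_of (\<sigma> \<circ> \<pi>)"
      and A: "cstar_algebra A" "tracial_state A \<tau>" "stochastic_matrix A E" "abelian_alg A" and M: "M = reciprocal_state A \<tau> E"
    unfolding locally_tracial_corr_def Upsilon_loc_def by (elim exE conjE CollectE)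
  note \<pi> = B(1,4)
  obtain s where s: "\<forall>k m. s k m \<in> carrier B" and es: "\<forall>m n. \<pi> (e_elem (fst m) (fst n) (snd m) (snd n)) =
      (\<Oplus>\<^bsub>B\<^esub>k\<in>UNIV. invol B (s k m) \<otimes>\<^bsub>B\<^esub> s (k :: 'x \<times> 'a) n)"
    using hom_gram[OF \<pi>] by (elim exE conjE)
  \<comment> \<open>Here the functional on B is only given as a state; commutativity of B makes it a
    trace.\<close>
  show "\<Gamma> M \<in> Upsilon_loc TYPE('u)"
    by (rule image_Upsilon_loc[where e = "\<lambda>x x' a a'. \<pi> (e_elem x x' a a')",
        OF A(1-3) B(1) abelian_trace[OF B(2,3)] s[rule_format] es[rule_format] hom_sum[OF \<pi>] _ A(4) B(2)])
      (simp add: M B(5) Gamma_of_def hom_mult[OF \<pi>])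
qed

end
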